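(* Let $(\mathcal{T},\mathcal{G},\mathcal{A})$ be a regularity structure. Let $\gamma>0$, $p\in[1,\infty)$, $\alpha:=\min\mathcal{A}<0$, $r>|\alpha|$ and let $(\Pi,\Gamma)$ be a model. There exists a unique continuous linear map $\mathcal{R}:\mathcal{D}^{\gamma,p}\to\mathcal{E}^{\alpha,p}$ such that $$\Big\|\sup_{\eta\in\mathcal{B}^r}\big|\langle\mathcal{R}f-\Pi_{t,x}f(t,x),\eta^\lambda_{t,x}\rangle\big|\Big\|_{L^p_{x_0,1}}\lesssim\lambda^\gamma\,C_{t,x_0,\lambda}(\Pi,f),$$ uniformly over all $\lambda\in(0,1]$, all $(t,x_0)\in\mathbb{R}^{d+1}$, all $f\in\mathcal{D}^{\gamma,p}$ and all admissible models $(\Pi,\Gamma)$. Here the proportionality constant can be given by $$C_{t,x_0,\lambda}(\Pi,f)=\sum_{2^{-n}\le\lambda}\Big(\frac{2^{-n}}{\lambda}\Big)^{\gamma\wedge(r+\alpha)}\|\Pi\|_{B^n_{\lambda,t,x_0}}\big(1+\|\Gamma\|_{B^n_{\lambda,t,x_0}}\big)\|f\|_{B^n_{\lambda,t,x_0}},$$ with $B^n_{\lambda,t,x_0}=[t-2\lambda^2,\,t+\lambda^2-2^{-2n}]\times B(x_0,3)$. If $(\bar\Pi,\bar\Gamma)$ is a second model for $\mathcal{T}$ and $\bar{\mathcal{R}}$ is its associated reconstruction operator, then $$\Big\|\sup_{\eta\in\mathcal{B}^r}\big|\langle\mathcal{R}f-\bar{\mathcal{R}}\bar f-\Pi_{t,x}f(t,x)+\bar\Pi_{t,x}\bar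 f(t,x),\eta^\lambda_{t,x}\rangle\big|\Big\|_{L^p_{x_0,1}}\lesssim\lambda^\gamma\,C_{t,x_0,\lambda}(\Pi,\bar\Pi,f,\bar f),$$ uniformly over all $\lambda\in(0,1]$, all $f\in\mathcal{D}^{\gamma,p}$, all $\bar f\in\bar{\mathcal{D}}^{\gamma,p}$, all $(t,x_0)\in\mathbb{R}^{d+1}$ and all admissible models $(\Pi,\Gamma)$, $(\bar\Pi,\bar\Gamma)$. Here $C_{t,x_0,\lambda}(\Pi,\bar\Pi,f,\bar f)$ is obtained from the formula for $C_{t,x_0,\lambda}(\Pi,f)$ by replacing $\|\Pi\|_{B^n}(1+\|\Gamma\|_{B^n})\|f\|_{B^n}$ (with $B^n=B^n_{\lambda,t,x_0}$) by $$\|\Pi\|_{B^n}(1+\|\Gamma\|_{B^n})\|f;\bar f\|_{B^n}+\big(\|\Pi-\bar\Pi\|_{B^n}(1+\|\Gamma\|_{B^n})+\|\bar\Pi\|_{B^n}\|\Gamma-\bar\Gamma\|_{B^n}\big)\|\bar f\|_{B^n}.$$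
   Context: Notation. Work on $\mathbb{R}^{d+1}$ (one time, $d$ space variables) with parabolic scaling $\mathfrak{s}=(2,1,\dots,1)$, $|\mathfrak{s}|=d+2$, $\|(t,x)\|_{\mathfrak{s}}=\max(\sqrt{|t|},|x_1|,\dots,|x_d|)$, $|k|=2k_0+k_1+\dots+k_d$ for $k\in\mathbb{N}^{d+1}$. $\mathcal{C}^r$ is the space of functions on $\mathbb{R}^{d+1}$ with $D^kf$ continuous for all $|k|\le r$; $\mathcal{B}^r$ is the set of elements of $\mathcal{C}^r$ supported in the unit parabolic ball with $\mathcal{C}^r$-norm at most $1$. $\eta^\lambda_{t,x}(s,y)=\lambda^{-|\mathfrak{s}|}\eta(\lambda^{-2}(s-t),\lambda^{-1}(y-x))$. $B(x,\lambda)$ is the ball in $\mathbb{R}^d$ of centre $x$ and radius $\lambda$. $\|g\|_{L^p_{x_0,1}}=(\int_{B(x_0,1)}|g(x)|^pdx)^{1/p}$ (the integration variable is $x$). Regularity structure: a graded vector space $\mathcal{T}=\bigoplus_{\zeta\in\mathcal{A}}\mathcal{T}_\zeta$ (normed components), $\mathcal{A}\subset\mathbb{R}$ locally finite and bounded below, and a group $\mathcal{G}$ of continuous linear maps of $\mathcal{T}$ with $\Gamma\tau-\tau\in\mathcal{T}_{<\beta}:=\bigoplus_{\zeta<\beta}\mathcal{T}_\zeta$ for all $\tau\in\mathcal{T}_\beta$, $\beta\in\mathcal{A}$. $\mathcal{Q}_\zeta$ is the projection on $\mathcal{T}_\zeta$ and $|a|_\zeta$ the norm of $\mathcal{Q}_\zeta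 a$. Model: a pair $(\Pi,\Gamma)$, where $z\mapsto\Pi_z$ takes values in linear maps from $\mathcal{T}$ to distributions on $\mathbb{R}^{d+1}$, $(z,z')\mapsto\Gamma_{z,z'}\in\mathcal{G}$, $\Pi_z\Gamma_{z,z'}=\Pi_{z'}$, and $$\|\Pi\|_z:=\sup_{\eta\in\mathcal{B}^r}\sup_{\lambda\in(0,1]}\sup_{\zeta\in\mathcal{A}}\sup_{\tau\in\mathcal{T}_\zeta}\frac{|(\Pi_z\tau)(\eta^\lambda_z)|}{|\tau|_\zeta\lambda^\zeta},\qquad\|\Gamma\|_{z,z'}:=\sup_{\beta\le\zeta}\sup_{\tau\in\mathcal{T}_\zeta}\frac{|\Gamma_{z,z'}\tau|_\beta}{|\tau|_\zeta\|z-z'\|_{\mathfrak{s}}^{\zeta-\beta}}$$ are bounded locally uniformly (over $z$, resp. over $z,z'$ with $\|z-z'\|_{\mathfrak{s}}\le1$). For $B\subset\mathbb{R}^{d+1}$: $\|\Pi\|_B=\sup_{z\in B}\|\Pi\|_z$, $\|\Gamma\|_B=\sup_{z,z'\in B}\|\Gamma\|_{z,z'}$; $\|\Pi-\bar\Pi\|_B$, $\|\Gamma-\bar\Gamma\|_B$ are defined by the same formulas for the differences. The model is admissible if moreover, whenever the symbols in question belong to $\mathcal{T}$, $(\Pi_zX^k)(z')=(z'-z)^k$ for polynomial symbols $X^k$ and, for the abstract integration map $\mathcal{I}$ (increasing homogeneity by 2), $(\Pi_z\mathcal{I}\tau)(z')=\langle\Pi_z\tau,P_+(z'-\cdot)\rangle-\sum_{|k|<|\mathcal{I}\tau|}\frac{(z'-z)^k}{k!}\langle\Pi_z\tau,D^kP_+(z-\cdot)\rangle$,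 where $|\mathcal{I}\tau|$ is the homogeneity of $\mathcal{I}\tau$. Here the heat kernel $P$ of $\mathbb{R}^d$ is decomposed (once and for all) on $\mathbb{R}^{d+1}\setminus\{0\}$ as $P=P_++P_-$, $P_+=\sum_{n\ge0}P_n$, with $P_-,P_n$ smooth, $P_0$ supported in the unit ball, $P_n(t,x)=2^{nd}P_0(2^{2n}t,2^nx)$, $\int P_n(z)z^kdz=0$ for $|k|\le r$; pairings with $D^kP_+$ mean the sum over $n$ of the pairings with $D^kP_n$. Write $\Gamma^t_{x,y}=\Gamma_{(t,x),(t,y)}$ and $\Gamma^x_{t,s}=\Gamma_{(t,x),(s,x)}$. $\mathcal{E}^{\alpha,p}$ ($\alpha<0$): distributions $f$ on $\mathbb{R}^{d+1}$ with $\|f\|_{\alpha,p}=\sup_{\lambda\in(0,1]}\sup_{t\in\mathbb{R}}\big\|\sup_{\eta\in\mathcal{B}^r}\lambda^{-\alpha}|\langle f,\eta^\lambda_{t,x}\rangle|\big\|_{L^p(\mathbb{R}^d,dx)}<\infty$. $\mathcal{D}^{\gamma,p}$ (relative to $(\Pi,\Gamma)$): maps $f:\mathbb{R}^{d+1}\to\mathcal{T}_{<\gamma}$ for which $$\big\||f(t,x)|_\zeta\big\|_{L^p(dx)}+\Big\|\int_{B(x,\lambda)}\frac{|f(t,y)-\Gamma^t_{y,x}f(t,x)|_\zeta}{\lambda^{\gamma-\zeta}}\lambda^{-d}dy\Big\|_{L^p(dx)}+\Big\|\frac{|f(t,x)-\Gamma^x_{t,t-\lambda^2}f(t-\lambda^2,x)|_\zeta}{\lambda^{\gamma-\zeta}}\Big\|_{L^p(dx)}$$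 is bounded uniformly over $t\in\mathbb{R}$, $\zeta\in\mathcal{A}$, $\lambda\in(0,2]$; the supremum is the norm. For $B=[s,t]\times B(x_0,L)$, $\|f\|_B$ is the supremum of the terms in this norm with all time indices restricted to $[s,t]$ and the $L^p(\mathbb{R}^d)$-norms replaced by $L^p$-norms on $B(x_0,L)$. $\bar{\mathcal{D}}^{\gamma,p}$ is the corresponding space for $(\bar\Pi,\bar\Gamma)$. For $f\in\mathcal{D}^{\gamma,p}$, $\bar f\in\bar{\mathcal{D}}^{\gamma,p}$, $\|f;\bar f\|_{\gamma,p}$ is defined by the same expression with $f(t,x)$ replaced by $f(t,x)-\bar f(t,x)$ in the first term, $f(t,y)-\Gamma^t_{y,x}f(t,x)$ replaced by $f(t,y)-\bar f(t,y)-\Gamma^t_{y,x}f(t,x)+\bar\Gamma^t_{y,x}\bar f(t,x)$, and $f(t,x)-\Gamma^x_{t,t-\lambda^2}f(t-\lambda^2,x)$ replaced by $f(t,x)-\bar f(t,x)-\Gamma^x_{t,t-\lambda^2}f(t-\lambda^2,x)+\bar\Gamma^x_{t,t-\lambda^2}\bar f(t-\lambda^2,x)$; $\|f;\bar f\|_B$ is its localised version as for $\|f\|_B$.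
   Formalization: R maps into E^{α,p} localised to bounded sets, and into the global space when the model bounds are uniform (false for merely local bounds); models satisfy the cocycle identity for Γ and have ‖Π‖, ‖Γ‖ finite on every bounded set. *)

theory Defs
  imports "HOL-Analysis.Analysis"
begin

section \<open>Parabolic space-time\<close>

text \<open>A space-time point is a pair of a time and a vector of \<open>real ^ 'd\<close>, with \<open>d = CARD('d)\<close>.
  Coordinates are indexed by \<open>'d option\<close>: \<open>None\<close> is time and \<open>Some i\<close> the \<open>i\<close>-th space
  direction, so that a multi-index is a function \<open>'d option \<Rightarrow> nat\<close>.\<close>

type_synonym 'd pt = "real \<times> (real ^ 'd)"
type_synonym 'd midx = "'d option \<Rightarrow> nat"
type_synonym 'd func = "'d pt \<Rightarrow> real"

definition pnorm :: "'d::finite pt \<Rightarrow> real" where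
  "pnorm z = max (sqrt \<bar>fst z\<bar>) (infnorm (snd z))"

text \<open>Balls of \<open>\<real>\<^sup>d\<close> are those of the norm that \<^const>\<open>pnorm\<close> induces on the space variables.\<close>

definition sball :: "real ^ 'd::finite \<Rightarrow> real \<Rightarrow> (real ^ 'd) set" where
  "sball x \<rho> = {y. infnorm (y - x) < \<rho>}"

fun coord :: "'d::finite pt \<Rightarrow> 'd option \<Rightarrow> real" where
  "coord z None = fst z"
| "coord z (Some i) = snd z $ i"

fun unit_vec :: "'d::finite option \<Rightarrow> 'd pt" where
  "unit_vec None = (1, 0)"
| "unit_vec (Some i) = (0, axis i 1)"

definition mdeg :: "'d::finite midx \<Rightarrow> real" where
  "mdeg k = 2 * real (k None) + (\<Sum>i\<in>UNIV. real (k (Some i)))"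

definition mpow :: "'d::finite pt \<Rightarrow> 'd midx \<Rightarrow> real" where
  "mpow z k = (\<Prod>j\<in>UNIV. coord z j ^ k j)"

definition mfact :: "'d::finite midx \<Rightarrow> real" where
  "mfact k = (\<Prod>j\<in>UNIV. fact (k j))"

section \<open>Test functions and distributions\<close>

text \<open>\<open>D k\<close> is the iterated partial derivative of \<open>f\<close> of multi-index \<open>k\<close>, for all
  \<open>k\<close> of parabolic degree at most \<open>r\<close> (for such \<open>k\<close> it is determined by \<open>f\<close>).\<close>

definition derivs :: "real \<Rightarrow> 'd::finite func \<Rightarrow> ('d midx \<Rightarrow> 'd func) \<Rightarrow> bool" where
  "derivs r f D \<longleftrightarrow> D (\<lambda>_. 0) = f \<and>
     (\<forall>k. mdeg k \<le> r \<longrightarrow> continuous_on UNIV (D k)) \<and>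
     (\<forall>k j. mdeg (k(j := Suc (k j))) \<le> r \<longrightarrow>
        (\<forall>z. ((\<lambda>s. D k (z + s *\<^sub>R unit_vec j)) has_real_derivative D (k(j := Suc (k j))) z) (at 0)))"

definition Cr :: "real \<Rightarrow> 'd::finite func set" where
  "Cr r = {f. \<exists>D. derivs r f D}"

definition pd :: "'d::finite midx \<Rightarrow> 'd func \<Rightarrow> 'd func" where
  "pd k f = (SOME D. derivs (mdeg k) f D) k"

definition Cr_norm :: "real \<Rightarrow> 'd::finite func \<Rightarrow> ennreal" where
  "Cr_norm r f = (SUP k\<in>{k. mdeg k \<le> r}. SUP z. ennreal \<bar>pd k f z\<bar>)"

definition vanishes_off :: "real \<Rightarrow> 'd::finite func \<Rightarrow> bool" where
  "vanishes_off \<rho> f \<longleftrightarrow> (\<forall>z. \<rho> < pnorm z \<longrightarrow> f z = 0)"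

definition Br :: "real \<Rightarrow> 'd::finite func set" where
  "Br r = {\<eta> \<in> Cr r. vanishes_off 1 \<eta> \<and> Cr_norm r \<eta> \<le> 1}"

definition tests :: "real \<Rightarrow> 'd::finite func set" where
  "tests r = {\<phi> \<in> Cr r. \<exists>\<rho>. vanishes_off \<rho> \<phi>}"

definition rescale :: "'d::finite func \<Rightarrow> real \<Rightarrow> 'd pt \<Rightarrow> 'd func" where
  "rescale \<eta> l z = (\<lambda>w. (1 / l) ^ (CARD('d) + 2) *
      \<eta> ((fst w - fst z) / l\<^sup>2, (1 / l) *\<^sub>R (snd w - snd z)))"

text \<open>Distributions have to be paired with the elements of \<^const>\<open>Br\<close>, which are only of class
  \<^const>\<open>Cr\<close>. They are therefore the distributions of order \<open>r\<close>, identified with their unique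
  continuous extension from the smooth test functions to \<^const>\<open>tests\<close>. The value \<open>0\<close> off
  \<^const>\<open>tests\<close> makes equality of distributions the equality of HOL functions.\<close>

type_synonym 'd dist = "'d func \<Rightarrow> real"

definition distributions :: "real \<Rightarrow> 'd::finite dist set" where
  "distributions r = {\<xi>.
     (\<forall>\<phi>\<in>tests r. \<forall>\<psi>\<in>tests r. \<xi> (\<lambda>z. \<phi> z + \<psi> z) = \<xi> \<phi> + \<xi> \<psi>) \<and>
     (\<forall>c. \<forall>\<phi>\<in>tests r. \<xi> (\<lambda>z. c * \<phi> z) = c * \<xi> \<phi>) \<and>
     (\<forall>\<rho>. \<exists>K::real. \<forall>\<phi>\<in>tests r. vanishes_off \<rho> \<phi> \<longrightarrow> ennreal \<bar>\<xi> \<phi>\<bar> \<le> ennreal K * Cr_norm r \<phi>) \<and>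
     (\<forall>\<phi>. \<phi> \<notin> tests r \<longrightarrow> \<xi> \<phi> = 0)}"

section \<open>Norms of Lebesgue type\<close>

definition epowr :: "ennreal \<Rightarrow> real \<Rightarrow> ennreal" where
  "epowr x a = (if x = top then top else ennreal (enn2real x powr a))"

definition Lp :: "real \<Rightarrow> (real ^ 'd::finite) set \<Rightarrow> (real ^ 'd \<Rightarrow> ennreal) \<Rightarrow> ennreal" where
  "Lp p U g = epowr (\<integral>\<^sup>+x\<in>U. epowr (g x) p \<partial>lebesgue) (1 / p)"

text \<open>The norm is localised to times in \<open>J\<close> and space points in \<open>U\<close>.\<close>

definition E_norm :: "real \<Rightarrow> real \<Rightarrow> real \<Rightarrow> real set \<Rightarrow> (real ^ 'd::finite) set \<Rightarrow> 'd dist \<Rightarrow> ennreal" where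
  "E_norm r \<alpha> p J U \<xi> = (SUP l\<in>{0<..1}. SUP t\<in>J.
     Lp p U (\<lambda>x. SUP \<eta>\<in>Br r. ennreal (l powr (- \<alpha>) * \<bar>\<xi> (rescale \<eta> l (t, x))\<bar>)))"

section \<open>Regularity structures\<close>

text \<open>The graded space is the whole type \<open>'t\<close>. \<open>part S \<zeta>\<close> is the component of homogeneity \<open>\<zeta>\<close>,
  which is \<open>{0}\<close> for \<open>\<zeta>\<close> outside \<open>levels S\<close>, and \<open>cnorm S \<zeta>\<close> is its norm, meaningful only there.\<close>

record 't regstruct =
  levels :: "real set"
  part :: "real \<Rightarrow> 't set"
  cnorm :: "real \<Rightarrow> 't \<Rightarrow> real"
  grp :: "('t \<Rightarrow> 't) set"

definition decomposition :: "'t::real_vector regstruct \<Rightarrow> 't \<Rightarrow> (real \<Rightarrow> 't) \<Rightarrow> bool" where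
  "decomposition S \<tau> c \<longleftrightarrow> (\<forall>\<zeta>. c \<zeta> \<in> part S \<zeta>) \<and> finite {\<zeta>. c \<zeta> \<noteq> 0} \<and>
     \<tau> = (\<Sum>\<zeta>\<in>{\<zeta>. c \<zeta> \<noteq> 0}. c \<zeta>)"

definition proj :: "'t::real_vector regstruct \<Rightarrow> real \<Rightarrow> 't \<Rightarrow> 't" where
  "proj S \<zeta> \<tau> = (THE c. decomposition S \<tau> c) \<zeta>"

definition hnorm :: "'t::real_vector regstruct \<Rightarrow> real \<Rightarrow> 't \<Rightarrow> real" where
  "hnorm S \<zeta> \<tau> = cnorm S \<zeta> (proj S \<zeta> \<tau>)"

definition below :: "'t::real_vector regstruct \<Rightarrow> real \<Rightarrow> 't set" where
  "below S \<beta> = {\<tau>. \<forall>\<zeta>\<ge>\<beta>. proj S \<zeta> \<tau> = 0}"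

definition norm_on :: "'t::real_vector set \<Rightarrow> ('t \<Rightarrow> real) \<Rightarrow> bool" where
  "norm_on V N \<longleftrightarrow> (\<forall>a\<in>V. 0 \<le> N a \<and> (N a = 0 \<longleftrightarrow> a = 0)) \<and>
     (\<forall>a\<in>V. \<forall>c. N (c *\<^sub>R a) = \<bar>c\<bar> * N a) \<and> (\<forall>a\<in>V. \<forall>b\<in>V. N (a + b) \<le> N a + N b)"

text \<open>The elements of the group are triangular, so their continuity for the direct sum topology
  is the boundedness of each of their blocks from \<open>part S \<zeta>\<close> to \<open>part S \<beta>\<close>.\<close>

definition regularity_structure :: "'t::real_vector regstruct \<Rightarrow> bool" where
  "regularity_structure S \<longleftrightarrow>
     (\<forall>a b. finite (levels S \<inter> {a..b})) \<and> bdd_below (levels S) \<and>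
     (\<forall>\<zeta>. subspace (part S \<zeta>) \<and> norm_on (part S \<zeta>) (cnorm S \<zeta>)) \<and>
     (\<forall>\<zeta>. \<zeta> \<notin> levels S \<longrightarrow> part S \<zeta> = {0}) \<and>
     (\<forall>\<tau>. \<exists>!c. decomposition S \<tau> c) \<and>
     id \<in> grp S \<and> (\<forall>g\<in>grp S. \<forall>h\<in>grp S. g \<circ> h \<in> grp S) \<and>
     (\<forall>g\<in>grp S. \<exists>h\<in>grp S. g \<circ> h = id \<and> h \<circ> g = id) \<and>
     (\<forall>g\<in>grp S. linear g \<and>
        (\<forall>\<zeta> \<beta>. \<exists>K. \<forall>\<tau>\<in>part S \<zeta>. hnorm S \<beta> (g \<tau>) \<le> K * cnorm S \<zeta> \<tau>) \<and>
        (\<forall>\<beta>\<in>levels S. \<forall>\<tau>\<in>part S \<beta>. g \<tau> - \<tau> \<in> below S \<beta>))"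

text \<open>The distinguished symbols, each of which may be absent: \<open>Xsym Y k\<close> is the polynomial
  symbol of multi-index \<open>k\<close>, if the structure contains it, and \<open>intdom Y \<zeta>\<close> the subspace of those
  elements of homogeneity \<open>\<zeta>\<close> whose image under the abstract integration map belongs to it.\<close>

record ('d, 't) symbols =
  Xsym :: "'d midx \<Rightarrow> 't option"
  intdom :: "real \<Rightarrow> 't set"
  intmap :: "'t \<Rightarrow> 't"

definition symbols_of :: "'t::real_vector regstruct \<Rightarrow> ('d::finite, 't) symbols \<Rightarrow> bool" where
  "symbols_of S Y \<longleftrightarrow>
     (\<forall>k \<tau>. Xsym Y k = Some \<tau> \<longrightarrow> \<tau> \<in> part S (mdeg k)) \<and>
     (\<forall>\<zeta>. subspace (intdom Y \<zeta>) \<and> intdom Y \<zeta> \<subseteq> part S \<zeta> \<and>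
        (\<forall>a\<in>intdom Y \<zeta>. intmap Y a \<in> part S (\<zeta> + 2)) \<and>
        (\<forall>a\<in>intdom Y \<zeta>. \<forall>b\<in>intdom Y \<zeta>. intmap Y (a + b) = intmap Y a + intmap Y b) \<and>
        (\<forall>a\<in>intdom Y \<zeta>. \<forall>c. intmap Y (c *\<^sub>R a) = c *\<^sub>R intmap Y a))"

section \<open>Models\<close>

record ('d, 't) model =
  mPi :: "'d pt \<Rightarrow> 't \<Rightarrow> 'd dist"
  mGam :: "'d pt \<Rightarrow> 'd pt \<Rightarrow> 't \<Rightarrow> 't"

text \<open>The quotients are taken in \<^typ>\<open>ennreal\<close>, where \<open>0 / 0 = 0\<close> and \<open>c / 0 = \<infinity>\<close> for
  \<open>c \<noteq> 0\<close>. The power of the distance is \<open>1\<close> when the exponent is \<open>0\<close>, also for coinciding points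
  (where \<^const>\<open>powr\<close> would give \<open>0\<close>).\<close>

definition Pi_norm :: "'t::real_vector regstruct \<Rightarrow> real \<Rightarrow> ('d::finite pt \<Rightarrow> 't \<Rightarrow> 'd dist) \<Rightarrow> 'd pt set \<Rightarrow> ennreal" where
  "Pi_norm S r F B = (SUP z\<in>B. SUP \<eta>\<in>Br r. SUP l\<in>{0<..1}. SUP \<zeta>\<in>levels S. SUP \<tau>\<in>part S \<zeta>.
     ennreal \<bar>F z \<tau> (rescale \<eta> l z)\<bar> / ennreal (cnorm S \<zeta> \<tau> * l powr \<zeta>))"

definition Gam_norm_at :: "'t::real_vector regstruct \<Rightarrow> ('d::finite pt \<Rightarrow> 'd pt \<Rightarrow> 't \<Rightarrow> 't) \<Rightarrow> 'd pt \<Rightarrow> 'd pt \<Rightarrow> ennreal" where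
  "Gam_norm_at S G z z' = (SUP \<zeta>\<in>levels S. SUP \<beta>\<in>levels S \<inter> {..\<zeta>}. SUP \<tau>\<in>part S \<zeta>.
     ennreal (hnorm S \<beta> (G z z' \<tau>)) /
     ennreal (cnorm S \<zeta> \<tau> * (if \<zeta> = \<beta> then 1 else pnorm (z - z') powr (\<zeta> - \<beta>))))"

definition Gam_norm :: "'t::real_vector regstruct \<Rightarrow> ('d::finite pt \<Rightarrow> 'd pt \<Rightarrow> 't \<Rightarrow> 't) \<Rightarrow> 'd pt set \<Rightarrow> ennreal" where
  "Gam_norm S G B = (SUP z\<in>B. SUP z'\<in>B. Gam_norm_at S G z z')"

text \<open>Local boundedness is finiteness of both norms on every bounded set, in particular on the
  sets in the reconstruction bound. For a finite set of levels this follows, by the cocycle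
  identity, from local bounds over pairs of points at distance at most \<open>1\<close>, but not for an
  infinite one, since the supremum in \<^const>\<open>Gam_norm_at\<close> is over all levels.\<close>

definition is_model :: "'t::real_vector regstruct \<Rightarrow> real \<Rightarrow> ('d::finite, 't) model \<Rightarrow> bool" where
  "is_model S r M \<longleftrightarrow>
     (\<forall>z \<tau>. mPi M z \<tau> \<in> distributions r) \<and> (\<forall>z \<phi>. linear (\<lambda>\<tau>. mPi M z \<tau> \<phi>)) \<and>
     (\<forall>z z'. mGam M z z' \<in> grp S) \<and>
     (\<forall>z z' \<tau>. mPi M z (mGam M z z' \<tau>) = mPi M z' \<tau>) \<and>
     (\<forall>z z' z''. mGam M z z' \<circ> mGam M z' z'' = mGam M z z'') \<and>
     (\<forall>B. bounded B \<longrightarrow> Pi_norm S r (mPi M) B < top \<and> Gam_norm S (mGam M) B < top)"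

definition unif_bounded_model :: "'t::real_vector regstruct \<Rightarrow> real \<Rightarrow> ('d::finite, 't) model \<Rightarrow> bool" where
  "unif_bounded_model S r M \<longleftrightarrow> Pi_norm S r (mPi M) UNIV < top \<and>
     (SUP z. SUP z'\<in>{z'. pnorm (z - z') \<le> 1}. Gam_norm_at S (mGam M) z z') < top"

section \<open>Admissible models\<close>

definition heat_kernel :: "'d::finite func" where
  "heat_kernel z = (if fst z > 0
     then (4 * pi * fst z) powr (- real CARD('d) / 2) * exp (- (norm (snd z))\<^sup>2 / (4 * fst z)) else 0)"

definition dyadic :: "'d::finite func \<Rightarrow> nat \<Rightarrow> 'd func" where
  "dyadic P0 n = (\<lambda>z. 2 ^ (n * CARD('d)) * P0 (2 ^ (2 * n) * fst z, 2 ^ n *\<^sub>R snd z))"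

definition heat_kernel_decomposition :: "real \<Rightarrow> 'd::finite func \<Rightarrow> 'd func \<Rightarrow> bool" where
  "heat_kernel_decomposition r P0 Pminus \<longleftrightarrow>
     (\<forall>m. P0 \<in> Cr m) \<and> (\<forall>m. Pminus \<in> Cr m) \<and> vanishes_off 1 P0 \<and>
     (\<forall>z. z \<noteq> 0 \<longrightarrow> (\<lambda>n. dyadic P0 n z) sums (heat_kernel z - Pminus z)) \<and>
     (\<forall>n k. mdeg k \<le> r \<longrightarrow> (\<integral>z. dyadic P0 n z * mpow z k \<partial>lborel) = 0)"

text \<open>Both identities are between distributions, hence tested against \<open>\<phi>\<close>.\<close>

definition admissible :: "'t::real_vector regstruct \<Rightarrow> ('d::finite, 't) symbols \<Rightarrow> real \<Rightarrow> 'd func \<Rightarrow> ('d, 't) model \<Rightarrow> bool" where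
  "admissible S Y r P0 M \<longleftrightarrow> is_model S r M \<and>
     (\<forall>k \<tau>. Xsym Y k = Some \<tau> \<longrightarrow>
        (\<forall>z. \<forall>\<phi>\<in>tests r. mPi M z \<tau> \<phi> = (\<integral>z'. mpow (z' - z) k * \<phi> z' \<partial>lborel))) \<and>
     (\<forall>\<zeta>. \<forall>\<tau>\<in>intdom Y \<zeta>. \<forall>z. \<forall>\<phi>\<in>tests r.
        mPi M z (intmap Y \<tau>) \<phi> =
          (\<Sum>n. \<integral>z'. mPi M z \<tau> (\<lambda>w. dyadic P0 n (z' - w)) * \<phi> z' \<partial>lborel) -
          (\<Sum>k\<in>{k. mdeg k < \<zeta> + 2}. (\<integral>z'. mpow (z' - z) k / mfact k * \<phi> z' \<partial>lborel) *
             (\<Sum>n. mPi M z \<tau> (\<lambda>w. pd k (dyadic P0 n) (z - w)))))"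

section \<open>Modelled distributions\<close>

text \<open>Bochner measurability for the component of homogeneity \<open>\<zeta>\<close>.\<close>

definition strongly_measurable :: "'t::real_vector regstruct \<Rightarrow> real \<Rightarrow> (real ^ 'd::finite \<Rightarrow> 't) \<Rightarrow> bool" where
  "strongly_measurable S \<zeta> g \<longleftrightarrow> (\<exists>s::nat \<Rightarrow> real ^ 'd \<Rightarrow> 't.
     (\<forall>n. finite (range (s n)) \<and> range (s n) \<subseteq> part S \<zeta> \<and> (\<forall>v. s n -` {v} \<in> sets lebesgue)) \<and>
     (AE x in lebesgue. (\<lambda>n. cnorm S \<zeta> (s n x - proj S \<zeta> (g x))) \<longlonglongrightarrow> 0))"

text \<open>The common expression behind the norms of modelled distributions, with \<open>v\<close>, \<open>sp\<close> and \<open>tm\<close>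
  the values, space increments and time increments, times restricted to \<open>J\<close>, and space norms
  taken on \<open>U\<close>.\<close>

definition D_expr :: "'t::real_vector regstruct \<Rightarrow> real \<Rightarrow> real \<Rightarrow>
    (real \<Rightarrow> real ^ 'd::finite \<Rightarrow> 't) \<Rightarrow> (real \<Rightarrow> real ^ 'd \<Rightarrow> real ^ 'd \<Rightarrow> 't) \<Rightarrow>
    (real \<Rightarrow> real \<Rightarrow> real ^ 'd \<Rightarrow> 't) \<Rightarrow> real set \<Rightarrow> (real ^ 'd) set \<Rightarrow> ennreal" where
  "D_expr S \<gamma> p v sp tm J U = (SUP t\<in>J. SUP \<zeta>\<in>levels S. SUP l\<in>{0<..2}.
     Lp p U (\<lambda>x. ennreal (hnorm S \<zeta> (v t x))) +
     Lp p U (\<lambda>x. \<integral>\<^sup>+y\<in>sball x l.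
        ennreal (hnorm S \<zeta> (sp t y x) / l powr (\<gamma> - \<zeta>) * (1 / l) ^ CARD('d)) \<partial>lebesgue) +
     (if t - l\<^sup>2 \<in> J
      then Lp p U (\<lambda>x. ennreal (hnorm S \<zeta> (tm t (t - l\<^sup>2) x) / l powr (\<gamma> - \<zeta>))) else 0))"

definition D_norm :: "'t::real_vector regstruct \<Rightarrow> real \<Rightarrow> real \<Rightarrow> ('d::finite, 't) model \<Rightarrow>
    real set \<Rightarrow> (real ^ 'd) set \<Rightarrow> ('d pt \<Rightarrow> 't) \<Rightarrow> ennreal" where
  "D_norm S \<gamma> p M J U f = D_expr S \<gamma> p
     (\<lambda>t x. f (t, x))
     (\<lambda>t y x. f (t, y) - mGam M (t, y) (t, x) (f (t, x)))
     (\<lambda>t s x. f (t, x) - mGam M (t, x) (s, x) (f (s, x))) J U"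

definition D_dist :: "'t::real_vector regstruct \<Rightarrow> real \<Rightarrow> real \<Rightarrow> ('d::finite, 't) model \<Rightarrow> ('d, 't) model \<Rightarrow>
    real set \<Rightarrow> (real ^ 'd) set \<Rightarrow> ('d pt \<Rightarrow> 't) \<Rightarrow> ('d pt \<Rightarrow> 't) \<Rightarrow> ennreal" where
  "D_dist S \<gamma> p M M' J U f f' = D_expr S \<gamma> p
     (\<lambda>t x. f (t, x) - f' (t, x))
     (\<lambda>t y x. f (t, y) - f' (t, y) - mGam M (t, y) (t, x) (f (t, x)) + mGam M' (t, y) (t, x) (f' (t, x)))
     (\<lambda>t s x. f (t, x) - f' (t, x) - mGam M (t, x) (s, x) (f (s, x)) + mGam M' (t, x) (s, x) (f' (s, x))) J U"

definition D_space :: "'t::real_vector regstruct \<Rightarrow> real \<Rightarrow> real \<Rightarrow> ('d::finite, 't) model \<Rightarrow> ('d pt \<Rightarrow> 't) set" where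
  "D_space S \<gamma> p M = {f. (\<forall>z. f z \<in> below S \<gamma>) \<and>
     (\<forall>t. \<forall>\<zeta>\<in>levels S. strongly_measurable S \<zeta> (\<lambda>x. f (t, x))) \<and> D_norm S \<gamma> p M UNIV UNIV f < top}"

section \<open>Reconstruction\<close>

text \<open>The sum over dyadic scales, for a weight \<open>w\<close> of the time interval and the space ball whose
  product is \<open>B\<close>.\<close>

definition scale_sum :: "real \<Rightarrow> real \<Rightarrow> real \<Rightarrow> (real set \<Rightarrow> (real ^ 'd::finite) set \<Rightarrow> ennreal) \<Rightarrow>
    real \<Rightarrow> real ^ 'd \<Rightarrow> real \<Rightarrow> ennreal" where
  "scale_sum r \<gamma> \<alpha> w t x0 l = (\<Sum>n::nat. if (1 / 2) ^ n \<le> l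
     then ennreal (((1 / 2) ^ n / l) powr (min \<gamma> (r + \<alpha>))) *
       w {t - 2 * l\<^sup>2 .. t + l\<^sup>2 - (1 / 2) ^ (2 * n)} (sball x0 3)
     else 0)"

definition recon_const :: "'t::real_vector regstruct \<Rightarrow> real \<Rightarrow> real \<Rightarrow> real \<Rightarrow> real \<Rightarrow> ('d::finite, 't) model \<Rightarrow>
    ('d pt \<Rightarrow> 't) \<Rightarrow> real \<Rightarrow> real ^ 'd \<Rightarrow> real \<Rightarrow> ennreal" where
  "recon_const S r \<gamma> p \<alpha> M f = scale_sum r \<gamma> \<alpha> (\<lambda>J U.
     Pi_norm S r (mPi M) (J \<times> U) * (1 + Gam_norm S (mGam M) (J \<times> U)) * D_norm S \<gamma> p M J U f)"

definition recon_diff_const :: "'t::real_vector regstruct \<Rightarrow> real \<Rightarrow> real \<Rightarrow> real \<Rightarrow> real \<Rightarrow>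
    ('d::finite, 't) model \<Rightarrow> ('d, 't) model \<Rightarrow> ('d pt \<Rightarrow> 't) \<Rightarrow> ('d pt \<Rightarrow> 't) \<Rightarrow>
    real \<Rightarrow> real ^ 'd \<Rightarrow> real \<Rightarrow> ennreal" where
  "recon_diff_const S r \<gamma> p \<alpha> M M' f f' = scale_sum r \<gamma> \<alpha> (\<lambda>J U.
     Pi_norm S r (mPi M) (J \<times> U) * (1 + Gam_norm S (mGam M) (J \<times> U)) * D_dist S \<gamma> p M M' J U f f' +
     (Pi_norm S r (\<lambda>z \<tau> \<phi>. mPi M z \<tau> \<phi> - mPi M' z \<tau> \<phi>) (J \<times> U) * (1 + Gam_norm S (mGam M) (J \<times> U)) +
      Pi_norm S r (mPi M') (J \<times> U) * Gam_norm S (\<lambda>z z' \<tau>. mGam M z z' \<tau> - mGam M' z z' \<tau>) (J \<times> U)) *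
     D_norm S \<gamma> p M' J U f')"

definition recon_bound :: "'t::real_vector regstruct \<Rightarrow> real \<Rightarrow> real \<Rightarrow> real \<Rightarrow> real \<Rightarrow> ('d::finite, 't) model \<Rightarrow>
    (('d pt \<Rightarrow> 't) \<Rightarrow> 'd dist) \<Rightarrow> real \<Rightarrow> bool" where
  "recon_bound S r \<gamma> p \<alpha> M R C \<longleftrightarrow>
     (\<forall>f\<in>D_space S \<gamma> p M. \<forall>l\<in>{0<..1}. \<forall>t x0.
        Lp p (sball x0 1) (\<lambda>x. SUP \<eta>\<in>Br r. ennreal
          \<bar>R f (rescale \<eta> l (t, x)) - mPi M (t, x) (f (t, x)) (rescale \<eta> l (t, x))\<bar>)
        \<le> ennreal (C * l powr \<gamma>) * recon_const S r \<gamma> p \<alpha> M f t x0 l)"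

definition recon_diff_bound :: "'t::real_vector regstruct \<Rightarrow> real \<Rightarrow> real \<Rightarrow> real \<Rightarrow> real \<Rightarrow>
    ('d::finite, 't) model \<Rightarrow> ('d, 't) model \<Rightarrow>
    (('d pt \<Rightarrow> 't) \<Rightarrow> 'd dist) \<Rightarrow> (('d pt \<Rightarrow> 't) \<Rightarrow> 'd dist) \<Rightarrow> real \<Rightarrow> bool" where
  "recon_diff_bound S r \<gamma> p \<alpha> M M' R R' C \<longleftrightarrow>
     (\<forall>f\<in>D_space S \<gamma> p M. \<forall>f'\<in>D_space S \<gamma> p M'. \<forall>l\<in>{0<..1}. \<forall>t x0.
        Lp p (sball x0 1) (\<lambda>x. SUP \<eta>\<in>Br r. ennreal
          \<bar>R f (rescale \<eta> l (t, x)) - R' f' (rescale \<eta> l (t, x))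
            - mPi M (t, x) (f (t, x)) (rescale \<eta> l (t, x))
            + mPi M' (t, x) (f' (t, x)) (rescale \<eta> l (t, x))\<bar>)
        \<le> ennreal (C * l powr \<gamma>) * recon_diff_const S r \<gamma> p \<alpha> M M' f f' t x0 l)"

text \<open>\<open>R\<close> is a continuous linear map from \<open>X\<close>, normed by \<open>nX\<close>, to the distributions for which
  \<open>nY\<close> is finite.\<close>

definition continuous_linear_map :: "real \<Rightarrow> ('d::finite pt \<Rightarrow> 't::real_vector) set \<Rightarrow>
    (('d pt \<Rightarrow> 't) \<Rightarrow> ennreal) \<Rightarrow> ('d dist \<Rightarrow> ennreal) \<Rightarrow> (('d pt \<Rightarrow> 't) \<Rightarrow> 'd dist) \<Rightarrow> bool" where
  "continuous_linear_map r X nX nY R \<longleftrightarrow>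
     (\<forall>f\<in>X. R f \<in> distributions r \<and> nY (R f) < top) \<and>
     (\<forall>f\<in>X. \<forall>g\<in>X. R (\<lambda>z. f z + g z) = (\<lambda>\<phi>. R f \<phi> + R g \<phi>)) \<and>
     (\<forall>f\<in>X. \<forall>c. R (\<lambda>z. c *\<^sub>R f z) = (\<lambda>\<phi>. c * R f \<phi>)) \<and>
     (\<forall>f\<in>X. \<forall>\<epsilon>>0. \<exists>\<delta>>0. \<forall>g\<in>X. nX (\<lambda>z. g z - f z) < ennreal \<delta> \<longrightarrow>
        nY (\<lambda>\<phi>. R g \<phi> - R f \<phi>) < ennreal \<epsilon>)"

text \<open>Modelled distributions carry no weight at infinity, so a model whose norms are only
  locally bounded reconstructs into the localised spaces (for instance, a growing continuous
  function as noise, multiplied by an integrable function, need not be integrable). The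
  global target space is reached as soon as the bounds on the model are uniform.\<close>

definition reconstruction :: "'t::real_vector regstruct \<Rightarrow> real \<Rightarrow> real \<Rightarrow> real \<Rightarrow> real \<Rightarrow> ('d::finite, 't) model \<Rightarrow>
    (('d pt \<Rightarrow> 't) \<Rightarrow> 'd dist) \<Rightarrow> bool" where
  "reconstruction S r \<gamma> p \<alpha> M R \<longleftrightarrow>
     (\<forall>\<rho>>0. continuous_linear_map r (D_space S \<gamma> p M) (D_norm S \<gamma> p M UNIV UNIV)
        (E_norm r \<alpha> p {-\<rho>..\<rho>} (sball 0 \<rho>)) R) \<and>
     (unif_bounded_model S r M \<longrightarrow>
        continuous_linear_map r (D_space S \<gamma> p M) (D_norm S \<gamma> p M UNIV UNIV) (E_norm r \<alpha> p UNIV UNIV) R) \<and>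
     (\<exists>C. recon_bound S r \<gamma> p \<alpha> M R C)"

end

theory Submission
  imports Defs
begin

text \<open>Let \<open>G\<^sub>z = \<Pi>\<^sub>z f(z)\<close>, or the difference of two such germs, and let \<open>\<chi>\<^sub>m\<^sub>,\<^sub>k\<close> be a smooth partition of unity at the
  parabolic scale \<open>2\<^sup>-\<^sup>m\<close>. The operator \<open>\<R>\<close> is the limit of \<open>L\<^sub>m \<phi> = \<Sum>\<^sub>k avg\<^sub>y G(t\<^sub>k, y)(\<chi>\<^sub>m\<^sub>,\<^sub>k \<phi>)\<close>, where \<open>y\<close> runs through a cell
  near the support of \<open>\<chi>\<^sub>m\<^sub>,\<^sub>k\<close> and \<open>t\<^sub>k\<close> lies in its past; averaging is what makes only the \<open>L\<^sup>p\<close> norms in space matter. Expanding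
  both levels in both partitions, \<open>L\<^sub>m\<^sub>+\<^sub>1 - L\<^sub>m\<close> becomes a sum of terms \<open>(G(s, w) - G(s', y))(\<chi> \<chi>' \<eta>)\<close> whose test functions
  live at scale \<open>2\<^sup>-\<^sup>m\<close>. Such a difference is a space increment at time \<open>s\<close> followed by a time increment at \<open>y\<close>, and testing
  each at its own base point bounds it by \<open>2\<^sup>-\<^sup>m\<^sup>\<gamma>\<close> times the norms of the model and of \<open>f\<close>, with no norm of \<open>\<Gamma>\<close>. The first level that sees the test
  function is compared with \<open>G(t, x)\<close> in the same way. A distribution satisfying the reconstruction bound differs from
  \<open>L\<^sub>m\<close> by quantities tending to \<open>0\<close>, whence uniqueness. The bound for one model is that for two with \<open>f' = 0\<close>.\<close>


text \<open>The bound sees f only up to the time \<open>t + \<epsilon>\<^sup>2\<close> minus a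
  squared scale, which fixes the base times: a partition function of level m that meets the test
  function has its time centre at most one \<open>(dl m)\<^sup>2\<close> beyond
  \<open>t + \<epsilon>\<^sup>2\<close>, and \<open>bt\<close> steps back by two. Times are summed,
  not averaged. Their number grows like \<open>(\<epsilon> / dl m)\<^sup>2\<close>, and the time
  volume \<open>(dl m)\<^sup>2\<close> in the size of the test functions compensates this exactly,
  so that a level difference keeps the full power \<gamma> of the scale. The second obstacle is
  measurability. The nonnegative integral of a nonmeasurable function is a lower integral, monotone
  but not subadditive. Suprema over \<open>Br r\<close> are therefore handled by monotonicity alone,
  while sums, products with constants and Fubini are applied to measurable majorants, or to
  measurable minorants in the uniqueness argument. Finally, the increments are small only in a
  Lebesgue norm, whereas the limit has to exist for each single test function. One base point at
  which a majorant is finite serves for all test functions supported near it.\<close>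

lemma sigma_finite_lebesgue: "sigma_finite_measure (lebesgue :: 'a::euclidean_space measure)"
proof
  obtain A :: "'a set set" where A: "countable A" "A \<subseteq> sets lborel" "\<Union>A = space lborel" "\<forall>a\<in>A. emeasure lborel a \<noteq> \<infinity>"
    using lborel.sigma_finite_countable by blast
  then show "\<exists>A::'a set set. countable A \<and> A \<subseteq> sets lebesgue \<and> \<Union>A = space lebesgue \<and> (\<forall>a\<in>A. emeasure lebesgue a \<noteq> \<infinity>)"
    by (intro exI[of _ A]) auto
qed

interpretation leb: sigma_finite_measure "lebesgue :: 'a::euclidean_space measure"
  by (rule sigma_finite_lebesgue)

interpretation leb_pair: pair_sigma_finite "lebesgue :: 'a::euclidean_space measure" "lebesgue :: 'b::euclidean_space measure"
  by (simp add: pair_sigma_finite_def sigma_finite_lebesgue)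

section \<open>Norms of Lebesgue type\<close>

lemma epowr_top [simp]: "epowr top a = top"
  by (simp add: epowr_def)

lemma epowr_ennreal [simp]: "0 \<le> x \<Longrightarrow> epowr (ennreal x) a = ennreal (x powr a)"
  by (simp add: epowr_def)

lemma epowr_0 [simp]: "epowr 0 a = 0"
  by (simp add: epowr_def)

lemma epowr_mono: "0 \<le> a \<Longrightarrow> x \<le> y \<Longrightarrow> epowr x a \<le> epowr y a"
  by (cases x; cases y) (auto simp: epowr_def top_unique intro!: ennreal_leI powr_mono2)

lemma epowr_mult: "0 < a \<Longrightarrow> epowr (x * y) a = epowr x a * epowr y a"
proof (cases x; cases y)
  fix r s :: real assume "0 \<le> r" "x = ennreal r" "0 \<le> s" "y = ennreal s" "0 < a"
  then show ?thesis by (simp flip: ennreal_mult add: powr_mult)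
next
  fix r assume "0 \<le> r" "x = ennreal r" "y = top" "0 < a"
  then show ?thesis by (cases "r = 0") (auto simp: ennreal_mult_top)
next
  fix r assume "0 \<le> r" "y = ennreal r" "x = top" "0 < a"
  then show ?thesis by (cases "r = 0") (auto simp: ennreal_top_mult)
qed (auto simp: ennreal_top_mult)

lemma epowr_inverse [simp]: "0 < a \<Longrightarrow> epowr (epowr x a) (1 / a) = x" "0 < a \<Longrightarrow> epowr (epowr x (1 / a)) a = x"
  by (cases x; simp add: powr_powr)+

text \<open>The power with positive exponent is an increasing bijection of the extended half-line
  whose inverse is the power \<open>1 / a\<close>; such a map commutes with every supremum.\<close>

lemma epowr_SUP:
  assumes "0 < a"
  shows "epowr (SUP i\<in>I. f i) a = (SUP i\<in>I. epowr (f i) a)"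
proof (rule antisym)
  let ?s = "SUP i\<in>I. epowr (f i) a"
  have "f i \<le> epowr ?s (1 / a)" if "i \<in> I" for i
    using epowr_mono[OF _ SUP_upper[of i I "\<lambda>i. epowr (f i) a"], of "1 / a"] that assms by simp
  then have "(SUP i\<in>I. f i) \<le> epowr ?s (1 / a)" by (rule SUP_least)
  from epowr_mono[OF _ this, of a] show "epowr (SUP i\<in>I. f i) a \<le> ?s" using assms by simp
qed (use assms in \<open>auto intro!: SUP_least epowr_mono SUP_upper\<close>)

lemma borel_measurable_epowr [measurable]:
  assumes [measurable]: "f \<in> borel_measurable M"
  shows "(\<lambda>x. epowr (f x) a) \<in> borel_measurable M"
  unfolding epowr_def by measurable

text \<open>No measurability is asked for, in contrast to \<open>Lp_cmult\<close>,
  \<open>Lp_add\<close> and \<open>Lp_sum\<close>. This is the way in which suprema over test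
  functions, and increments that are measurable only off a null set, enter an estimate.\<close>

lemma Lp_mono:
  assumes "0 < p" "\<And>x. x \<in> U \<Longrightarrow> f x \<le> g x" "U \<subseteq> V"
  shows "Lp p U f \<le> Lp p V g"
  unfolding Lp_def using assms
  by (intro epowr_mono nn_integral_mono) (auto intro!: mult_mono epowr_mono simp: indicator_def)

lemma epowr_Lp: "0 < p \<Longrightarrow> epowr (Lp p U f) p = (\<integral>\<^sup>+x\<in>U. epowr (f x) p \<partial>lebesgue)"
  by (simp add: Lp_def)

lemma epowr_le_iff: "0 < a \<Longrightarrow> epowr x a \<le> epowr y a \<longleftrightarrow> x \<le> y"
  using epowr_mono[of a x y] epowr_mono[of "1/a" "epowr x a" "epowr y a"] by auto

lemma Lp_leI:
  "0 < p \<Longrightarrow> (\<integral>\<^sup>+x\<in>U. epowr (f x) p \<partial>lebesgue) \<le> epowr c p \<Longrightarrow> Lp p U f \<le> c"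
  using epowr_le_iff[of p "Lp p U f" c] by (simp add: epowr_Lp)

lemma Lp_cong_AE:
  assumes "AE x in lebesgue. x \<in> U \<longrightarrow> f x = g x"
  shows "Lp p U f = Lp p U g"
  unfolding Lp_def by (intro arg_cong[where f="\<lambda>x. epowr x (1/p)"] nn_integral_cong_AE)
    (use assms in \<open>auto elim!: eventually_mono simp: indicator_def\<close>)

lemma Lp_cmult:
  assumes "0 < p" and [measurable]: "f \<in> borel_measurable lebesgue" "U \<in> sets lebesgue"
  shows "Lp p U (\<lambda>x. c * f x) = c * Lp p U f"
proof -
  have "(\<integral>\<^sup>+x\<in>U. epowr (c * f x) p \<partial>lebesgue) = epowr c p * (\<integral>\<^sup>+x\<in>U. epowr (f x) p \<partial>lebesgue)"
    using assms by (subst nn_integral_cmult[symmetric]) (auto simp: epowr_mult mult.assoc)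
  then show ?thesis
    using assms by (simp add: Lp_def epowr_mult)
qed

text \<open>Convexity of the power p at the points \<open>u / A\<close> and \<open>v / B\<close>,
  with weights \<open>A / (A + B)\<close> and \<open>B / (A + B)\<close>. With A and B close to two
  norms, its integral is Minkowski's inequality.\<close>

lemma powr_convex_ineq:
  fixes u v A B p :: real
  assumes "1 \<le> p" "0 < A" "0 < B" "0 \<le> u" "0 \<le> v"
  shows "(u + v) powr p \<le> (A + B) powr p * (A / (A + B) * (u powr p / A powr p) + B / (A + B) * (v powr p / B powr p))"
proof -
  have conv: "((1 - s) * x + s * y) powr p \<le> (1 - s) * x powr p + s * y powr p"
    if "0 \<le> x" "0 \<le> y" "0 < s" "s < 1" for x y s :: real
  proof (cases "x = 0 \<or> y = 0")
    case True
    \<comment> \<open>On the unit interval the power p lies below the identity, which settles the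
      case where one of the two points is 0.\<close>
    have *: "s powr p \<le> s" "(1 - s) powr p \<le> 1 - s"
      using that assms powr_mono'[of 1 p s] powr_mono'[of 1 p "1 - s"] by auto
    show ?thesis using True *[THEN mult_right_mono, of "y powr p"] *[THEN mult_right_mono, of "x powr p"] that assms
      by (auto simp: powr_mult)
  next
    case False
    then show ?thesis
      using convex_onD[OF powr_convex[OF assms(1)], of s x y] that by simp
  qed
  let ?s = "B / (A + B)"
  have s: "0 < ?s" "?s < 1" "1 - ?s = A / (A + B)" using assms by (auto simp: field_simps)
  have e: "(1 - ?s) * (u / A) + ?s * (v / B) = (u + v) / (A + B)"
    using assms unfolding s(3) by (simp add: add_divide_distrib)
  have "((u + v) / (A + B)) powr p \<le> A / (A + B) * (u / A) powr p + ?s * (v / B) powr p"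
    using conv[of "u/A" "v/B" ?s] s(1,2) assms unfolding e unfolding s(3) by simp
  then have "(A + B) powr p * ((u + v) / (A + B)) powr p \<le> (A + B) powr p * (A / (A + B) * (u / A) powr p + ?s * (v / B) powr p)"
    by (intro mult_left_mono) auto
  moreover have "(A + B) powr p * ((u + v) / (A + B)) powr p = (u + v) powr p"
    using assms by (simp add: powr_divide)
  ultimately show ?thesis using assms by (simp add: powr_divide)
qed

lemma Lp_add:
  assumes p: "1 \<le> p" and [measurable]: "f \<in> borel_measurable lebesgue" "g \<in> borel_measurable lebesgue" "U \<in> sets lebesgue"
  shows "Lp p U (\<lambda>x. f x + g x) \<le> Lp p U f + Lp p U g"
proof (cases "Lp p U f = top \<or> Lp p U g = top")
  case False
  then obtain a b where a: "Lp p U f = ennreal a" "0 \<le> a" and b: "Lp p U g = ennreal b" "0 \<le> b"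
    by (metis ennreal_cases)
  have p0: "0 < p" using p by simp
  have "Lp p U (\<lambda>x. f x + g x) \<le> ennreal (a + b + e)" if "0 < e" for e :: real
  proof -
    \<comment> \<open>The halves of e keep A and B positive even if a norm is 0;
      \<open>ennreal_le_epsilon\<close> removes e at the end.\<close>
    define A B where "A = a + e / 2" and "B = b + e / 2"
    have AB: "0 < A" "0 < B" "a \<le> A" "b \<le> B" using a b that by (auto simp: A_def B_def)
    have pt: "epowr (f x + g x) p \<le> ennreal ((A + B) powr p * (A / (A + B)) / A powr p) * epowr (f x) p
       + ennreal ((A + B) powr p * (B / (A + B)) / B powr p) * epowr (g x) p" for x
    proof (cases "f x"; cases "g x")
      fix u v assume "f x = ennreal u" "g x = ennreal v" "0 \<le> u" "0 \<le> v"
      then show ?thesis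
        using powr_convex_ineq[OF p AB(1,2), of u v] AB
        by (simp flip: ennreal_plus ennreal_mult add: algebra_simps)
    qed (use AB in \<open>auto simp: ennreal_mult_top\<close>)
    have "(\<integral>\<^sup>+x\<in>U. epowr (f x + g x) p \<partial>lebesgue) \<le>
      (\<integral>\<^sup>+x\<in>U. (ennreal ((A + B) powr p * (A / (A + B)) / A powr p) * epowr (f x) p
       + ennreal ((A + B) powr p * (B / (A + B)) / B powr p) * epowr (g x) p) \<partial>lebesgue)"
      by (intro nn_integral_mono mult_right_mono pt) auto
    also have "\<dots> = (\<integral>\<^sup>+x. ennreal ((A + B) powr p * (A / (A + B)) / A powr p) * (epowr (f x) p * indicator U x)
       + ennreal ((A + B) powr p * (B / (A + B)) / B powr p) * (epowr (g x) p * indicator U x) \<partial>lebesgue)"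
      by (intro nn_integral_cong) (simp add: algebra_simps)
    also have "\<dots> = ennreal ((A + B) powr p * (A / (A + B)) / A powr p) * epowr (Lp p U f) p +
       ennreal ((A + B) powr p * (B / (A + B)) / B powr p) * epowr (Lp p U g) p"
      by (simp add: nn_integral_add nn_integral_cmult epowr_Lp p0)
    also have "\<dots> \<le> ennreal ((A + B) powr p * (A / (A + B)) / A powr p) * ennreal (A powr p) +
       ennreal ((A + B) powr p * (B / (A + B)) / B powr p) * ennreal (B powr p)"
      unfolding a b using AB a b p0 by (intro add_mono mult_left_mono) (auto intro!: ennreal_leI powr_mono2)
    also have "\<dots> = ennreal ((A + B) powr p * (A / (A + B)) + (A + B) powr p * (B / (A + B)))"
      using AB by (simp flip: ennreal_mult ennreal_plus)
    also have "(A + B) powr p * (A / (A + B)) + (A + B) powr p * (B / (A + B)) = (A + B) powr p"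
      using AB by (simp flip: distrib_left add_divide_distrib)
    finally have "Lp p U (\<lambda>x. f x + g x) \<le> ennreal (A + B)"
      using AB p0 by (intro Lp_leI) (auto simp del: ennreal_plus)
    then show ?thesis by (simp add: A_def B_def algebra_simps)
  qed
  with a(2) b(2) show ?thesis
    unfolding a(1) b(1) by (rule_tac ennreal_le_epsilon) (auto simp flip: ennreal_plus simp: add.assoc)
qed auto

lemma Lp_0 [simp]: "Lp p U (\<lambda>x. 0) = 0"
  by (simp add: Lp_def)

lemma Lp_sum:
  assumes p: "1 \<le> p" and "finite I" "\<And>i. i \<in> I \<Longrightarrow> f i \<in> borel_measurable lebesgue" "U \<in> sets lebesgue"
  shows "Lp p U (\<lambda>x. \<Sum>i\<in>I. f i x) \<le> (\<Sum>i\<in>I. Lp p U (f i))"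
  using assms(2,3)
proof (induction I rule: finite_induct)
  case (insert i I)
  have "Lp p U (\<lambda>x. f i x + (\<Sum>i\<in>I. f i x)) \<le> Lp p U (f i) + Lp p U (\<lambda>x. \<Sum>i\<in>I. f i x)"
    using insert assms by (intro Lp_add) auto
  also have "\<dots> \<le> Lp p U (f i) + (\<Sum>i\<in>I. Lp p U (f i))"
    using insert by (intro add_left_mono) auto
  finally show ?case using insert by simp
qed simp

text \<open>The partial sums increase, so monotone convergence carries the finite triangle
  inequality to the series; \<open>epowr_SUP\<close> moves the power through the supremum.\<close>

lemma Lp_suminf:
  fixes f :: "nat \<Rightarrow> (real ^ 'd::finite) \<Rightarrow> ennreal"
  assumes p: "1 \<le> p" and [measurable]: "\<And>i. f i \<in> borel_measurable lebesgue" "U \<in> sets lebesgue"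
  shows "Lp p U (\<lambda>x. \<Sum>i. f i x) \<le> (\<Sum>i. Lp p U (f i))"
proof (rule Lp_leI)
  have p0: "0 < p" using p by simp
  let ?S = "\<lambda>n x. \<Sum>i<n. f i x"
  have inc: "incseq (\<lambda>n x. epowr (?S n x) p * indicator U x)"
    using p0 by (auto simp: incseq_def le_fun_def intro!: mult_right_mono epowr_mono sum_mono2)
  have "(\<integral>\<^sup>+x\<in>U. epowr (\<Sum>i. f i x) p \<partial>lebesgue) = (\<integral>\<^sup>+x. (SUP n. epowr (?S n x) p * indicator U x) \<partial>lebesgue)"
    by (simp add: suminf_eq_SUP epowr_SUP[OF p0] SUP_mult_right_ennreal)
  also have "\<dots> = (SUP n. \<integral>\<^sup>+x. epowr (?S n x) p * indicator U x \<partial>lebesgue)"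
    by (intro nn_integral_monotone_convergence_SUP inc) auto
  also have "\<dots> = (SUP n. epowr (Lp p U (?S n)) p)"
    by (simp add: epowr_Lp p0)
  also have "\<dots> \<le> epowr (\<Sum>i. Lp p U (f i)) p"
  proof (intro SUP_least epowr_mono)
    fix n
    show "Lp p U (?S n) \<le> (\<Sum>i. Lp p U (f i))"
      using Lp_sum[OF p, of "{..<n}" f U] sum_le_suminf[of "\<lambda>i. Lp p U (f i)" "{..<n}"] by (auto intro: order_trans)
  qed (use p0 in auto)
  finally show "(\<integral>\<^sup>+x\<in>U. epowr (\<Sum>i. f i x) p \<partial>lebesgue) \<le> epowr (\<Sum>i. Lp p U (f i)) p" .
qed (use p in auto)

text \<open>Hoelder's inequality up to the factor 2, without conjugate exponents: where f exceeds a
  threshold c, \<open>u = u powr (1 - p) * u powr p\<close> is at most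
  \<open>c powr (1 - p) * u powr p\<close>. The choice \<open>c = A * v powr (- 1 / p)\<close> makes
  both contributions equal, whence the 2. Only an upper bound v of the volume enters.\<close>

lemma nn_integral_le_Lp:
  assumes p: "1 \<le> p" and [measurable]: "f \<in> borel_measurable lebesgue" "U \<in> sets lebesgue"
    and v: "emeasure lebesgue U \<le> ennreal v" "0 < v"
  shows "(\<integral>\<^sup>+x\<in>U. f x \<partial>lebesgue) \<le> ennreal (2 * v powr (1 - 1 / p)) * Lp p U f"
proof (cases "Lp p U f")
  case (real a)
  have "(\<integral>\<^sup>+x\<in>U. f x \<partial>lebesgue) \<le> ennreal (2 * v powr (1 - 1 / p) * (a + e))" if "0 < e" for e
  proof -
    define A where "A = a + e"
    have A: "0 < A" "a \<le> A" using real that by (auto simp: A_def)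
    define c where "c = A * v powr (- 1 / p)"
    have c: "0 < c" using A v by (simp add: c_def)
    have pt: "f x \<le> ennreal c + ennreal (c powr (1 - p)) * epowr (f x) p" for x
    proof (cases "f x")
      case (real u)
      have "u \<le> c + c powr (1 - p) * u powr p"
      proof (cases "u \<le> c")
        case False
        have "u = u powr (1 - p) * u powr p"
          using False c by (simp flip: powr_add)
        also have "\<dots> \<le> c powr (1 - p) * u powr p"
          using False c p by (intro mult_right_mono powr_mono2') auto
        finally show ?thesis using c by simp
      qed (simp add: add_increasing2)
      then show ?thesis using real c by (simp flip: ennreal_plus ennreal_mult)
    qed (use c in \<open>simp add: ennreal_mult_top\<close>)
    have "(\<integral>\<^sup>+x\<in>U. f x \<partial>lebesgue) \<le> (\<integral>\<^sup>+x\<in>U. (ennreal c + ennreal (c powr (1 - p)) * epowr (f x) p) \<partial>lebesgue)"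
      by (intro nn_integral_mono mult_right_mono pt) auto
    also have "\<dots> = (\<integral>\<^sup>+x. ennreal c * indicator U x + ennreal (c powr (1 - p)) * (epowr (f x) p * indicator U x) \<partial>lebesgue)"
      by (intro nn_integral_cong) (simp add: algebra_simps)
    also have "\<dots> = ennreal c * emeasure lebesgue U + ennreal (c powr (1 - p)) * epowr (Lp p U f) p"
      using p by (simp add: nn_integral_add nn_integral_cmult epowr_Lp)
    also have "\<dots> \<le> ennreal c * ennreal v + ennreal (c powr (1 - p)) * ennreal (A powr p)"
      unfolding real using v A real p by (intro add_mono mult_left_mono) (auto intro!: ennreal_leI powr_mono2)
    also have "\<dots> = ennreal (c * v + c powr (1 - p) * A powr p)"
      using c v by (simp flip: ennreal_plus ennreal_mult)
    also have "c * v = A * v powr (1 - 1 / p)"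
      using v by (simp add: c_def powr_diff powr_minus_divide)
    also have "c powr (1 - p) * A powr p = A * v powr (1 - 1 / p)"
    proof -
      have "c powr (1 - p) = A powr (1 - p) * v powr (1 - 1 / p)"
        using A v p by (simp add: c_def powr_mult powr_powr) (simp add: diff_divide_distrib)
      moreover have "A powr (1 - p) * A powr p = A" using A by (simp flip: powr_add)
      ultimately show ?thesis by (simp add: ac_simps)
    qed
    finally show ?thesis by (simp add: A_def algebra_simps)
  qed
  note * = this
  have "(\<integral>\<^sup>+x\<in>U. f x \<partial>lebesgue) \<le> ennreal (2 * v powr (1 - 1 / p) * a) + ennreal e" if "0 < e" for e
  proof -
    define k where "k = 2 * v powr (1 - 1 / p)"
    have k: "0 < k" using v by (simp add: k_def)
    show ?thesis using *[of "e / k"] k that real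
      by (simp flip: k_def ennreal_plus add: distrib_left)
  qed
  then have "(\<integral>\<^sup>+x\<in>U. f x \<partial>lebesgue) \<le> ennreal (2 * v powr (1 - 1 / p) * a)"
    by (rule ennreal_le_epsilon)
  then show ?thesis using real by (simp add: ennreal_mult')
qed (use v in \<open>simp add: ennreal_mult_top\<close>)

section \<open>Balls of the space variables and averages over them\<close>

lemma sball_box: "sball x l = box (x - (\<chi> i. l)) (x + (\<chi> i. l))"
proof -
  have "infnorm (y - x) < l \<longleftrightarrow> (\<forall>i. \<bar>(y - x) $ i\<bar> < l)" for y
  proof -
    have e: "{\<bar>(y - x) $ i\<bar> |i. i \<in> UNIV} = range (\<lambda>i. \<bar>(y - x) $ i\<bar>)" by auto
    show ?thesis unfolding infnorm_cart e by (subst cSup_eq_Max) auto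
  qed
  then show ?thesis by (auto simp: sball_def mem_box_cart abs_less_iff algebra_simps)
qed

lemma sets_sball [measurable, simp]: "sball x l \<in> sets lebesgue" "sball x l \<in> sets borel"
  by (simp_all add: sball_box)

lemma emeasure_sball:
  fixes x :: "real ^ 'd::finite"
  assumes "0 \<le> l"
  shows "emeasure lebesgue (sball x l) = ennreal ((2 * l) ^ CARD('d))"
proof -
  have "emeasure lborel (sball x l) = ennreal (\<Prod>b\<in>Basis. (x + (\<chi> i. l) - (x - (\<chi> i. l))) \<bullet> b)"
    unfolding sball_box
    by (intro emeasure_lborel_box) (use assms in \<open>auto simp: Basis_vec_def inner_axis\<close>)
  also have "(\<Prod>b\<in>Basis. (x + (\<chi> i. l) - (x - (\<chi> i. l))) \<bullet> b) = (\<Prod>b\<in>(Basis::(real^'d) set). 2 * l)"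
    by (intro prod.cong) (auto simp: Basis_vec_def inner_axis)
  also have "\<dots> = (2 * l) ^ CARD('d)" by simp
  finally show ?thesis by simp
qed

lemma sball_commute: "y \<in> sball x l \<longleftrightarrow> x \<in> sball y l"
  by (simp add: sball_def infnorm_sub)

text \<open>The product sigma-algebra of the two completed measures contains the Borel sets of the
  product space, so continuous functions of two space points are measurable for it.\<close>

lemma measurable_lebesgue_pair_borel:
  "(\<lambda>z. z) \<in> (lebesgue :: 'a::euclidean_space measure) \<Otimes>\<^sub>M (lebesgue :: 'b::euclidean_space measure) \<rightarrow>\<^sub>M borel"
proof -
  have [measurable]: "(\<lambda>x::'c::euclidean_space. x) \<in> lebesgue \<rightarrow>\<^sub>M borel"
    by (simp add: measurable_def)
  have "(\<lambda>z. (fst z, snd z)) \<in> (lebesgue :: 'a measure) \<Otimes>\<^sub>M (lebesgue :: 'b measure) \<rightarrow>\<^sub>M borel \<Otimes>\<^sub>M borel"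
    by (intro measurable_Pair) (auto intro: measurable_compose[OF measurable_fst] measurable_compose[OF measurable_snd])
  then show ?thesis by (simp add: borel_prod)
qed

lemma pred_sball [measurable]: "Measurable.pred (lebesgue \<Otimes>\<^sub>M lebesgue) (\<lambda>z. snd z \<in> sball (fst z) l)"
proof -
  have "(\<lambda>z::(real^'a) \<times> (real^'a). infnorm (snd z - fst z)) \<in> borel_measurable borel"
    by (intro borel_measurable_continuous_onI continuous_intros)
  from measurable_compose[OF measurable_lebesgue_pair_borel this]
  show ?thesis unfolding sball_def by simp
qed

lemma measurable_sball_integral [measurable]:
  assumes [measurable]: "(\<lambda>(x, y). h x y) \<in> borel_measurable (lebesgue \<Otimes>\<^sub>M lebesgue)"
  shows "(\<lambda>x. \<integral>\<^sup>+y\<in>sball x l. h x y \<partial>lebesgue) \<in> borel_measurable lebesgue"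
proof -
  have "(\<lambda>z. (case z of (x, y) \<Rightarrow> h x y) * indicator {z. snd z \<in> sball (fst z) l} z) \<in> borel_measurable (lebesgue \<Otimes>\<^sub>M lebesgue)"
    by measurable
  then have "(\<lambda>(x, y). h x y * indicator (sball x l) y) \<in> borel_measurable (lebesgue \<Otimes>\<^sub>M lebesgue)"
    by (rule measurable_cong[THEN iffD1, rotated]) (auto simp: indicator_def)
  then show ?thesis by (intro leb.borel_measurable_nn_integral)
qed

lemma measurable_snd_lebesgue:
  assumes "h \<in> borel_measurable lebesgue"
  shows "(\<lambda>(x, y). h y) \<in> borel_measurable (lebesgue \<Otimes>\<^sub>M lebesgue)"
  using assms by measurable

text \<open>Hoelder on each ball bounds the power p of the average by the integral of the power p.
  Fubini then exchanges the integrals, because \<open>y \<in> sball x l\<close> is symmetric in x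
  and y. Averaging thus costs the volume of a ball and an enlargement of U to V.\<close>

lemma Lp_moving_average:
  fixes h :: "real ^ 'd::finite \<Rightarrow> ennreal"
  assumes p: "1 \<le> p" and h [measurable]: "h \<in> borel_measurable lebesgue" and [measurable]: "U \<in> sets lebesgue" "V \<in> sets lebesgue"
    and l: "0 < l" and UV: "\<And>x. x \<in> U \<Longrightarrow> sball x l \<subseteq> V"
  shows "Lp p U (\<lambda>x. \<integral>\<^sup>+y\<in>sball x l. h y \<partial>lebesgue) \<le> ennreal (2 * (2 * l) ^ CARD('d)) * Lp p V h"
proof (rule Lp_leI)
  have p0: "0 < p" using p by simp
  define v where "v = (2 * l) ^ CARD('d)"
  have v: "0 < v" using l by (simp add: v_def)
  have em: "emeasure lebesgue (sball x l) = ennreal v" for x :: "real ^ 'd"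
    using emeasure_sball[of l x] l by (simp add: v_def)
  have 1: "epowr (\<integral>\<^sup>+y\<in>sball x l. h y \<partial>lebesgue) p \<le> ennreal (2 powr p * v powr (p - 1)) * (\<integral>\<^sup>+y\<in>sball x l. epowr (h y) p \<partial>lebesgue)" for x
  proof -
    have "epowr (\<integral>\<^sup>+y\<in>sball x l. h y \<partial>lebesgue) p \<le> epowr (ennreal (2 * v powr (1 - 1 / p)) * Lp p (sball x l) h) p"
      using em v p0 by (intro epowr_mono nn_integral_le_Lp[OF p]) auto
    also have "\<dots> = ennreal ((2 * v powr (1 - 1 / p)) powr p) * (\<integral>\<^sup>+y\<in>sball x l. epowr (h y) p \<partial>lebesgue)"
      using p0 v by (simp add: epowr_mult epowr_Lp)
    also have "(2 * v powr (1 - 1 / p)) powr p = 2 powr p * v powr (p - 1)"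
      using v p0 by (simp add: powr_mult powr_powr left_diff_distrib)
    finally show ?thesis .
  qed
  have "(\<integral>\<^sup>+x\<in>U. epowr (\<integral>\<^sup>+y\<in>sball x l. h y \<partial>lebesgue) p \<partial>lebesgue)
    \<le> (\<integral>\<^sup>+x\<in>U. (ennreal (2 powr p * v powr (p - 1)) * (\<integral>\<^sup>+y\<in>sball x l. epowr (h y) p \<partial>lebesgue)) \<partial>lebesgue)"
    by (intro nn_integral_mono mult_right_mono 1) auto
  also have "\<dots> = ennreal (2 powr p * v powr (p - 1)) * (\<integral>\<^sup>+x\<in>U. (\<integral>\<^sup>+y\<in>sball x l. epowr (h y) p \<partial>lebesgue) \<partial>lebesgue)"
    by (subst nn_integral_cmult[symmetric]) (auto simp: mult.assoc intro!: borel_measurable_times measurable_sball_integral)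
  also have "(\<integral>\<^sup>+x\<in>U. (\<integral>\<^sup>+y\<in>sball x l. epowr (h y) p \<partial>lebesgue) \<partial>lebesgue)
    \<le> (\<integral>\<^sup>+x. (\<integral>\<^sup>+y. epowr (h y) p * indicator V y * indicator (sball x l) y \<partial>lebesgue) \<partial>lebesgue)"
  proof (intro nn_integral_mono)
    fix x
    show "(\<integral>\<^sup>+y\<in>sball x l. epowr (h y) p \<partial>lebesgue) * indicator U x \<le> (\<integral>\<^sup>+y. epowr (h y) p * indicator V y * indicator (sball x l) y \<partial>lebesgue)"
      using UV[of x] by (cases "x \<in> U") (auto simp: indicator_def intro!: nn_integral_mono)
  qed
  also have "\<dots> = (\<integral>\<^sup>+y. (\<integral>\<^sup>+x. epowr (h y) p * indicator V y * indicator (sball x l) y \<partial>lebesgue) \<partial>lebesgue)"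
  proof (rule leb_pair.Fubini'[symmetric])
    have "(\<lambda>z. epowr (h (snd z)) p * indicator V (snd z) * indicator {z. snd z \<in> sball (fst z) l} z) \<in> borel_measurable (lebesgue \<Otimes>\<^sub>M lebesgue)"
      by measurable
    then show "(\<lambda>(x, y). epowr (h y) p * indicator V y * indicator (sball x l) y) \<in> borel_measurable (lebesgue \<Otimes>\<^sub>M lebesgue)"
      by (rule measurable_cong[THEN iffD1, rotated]) (auto simp: indicator_def)
  qed
  also have "\<dots> = (\<integral>\<^sup>+y. ennreal v * (epowr (h y) p * indicator V y) \<partial>lebesgue)"
  proof (intro nn_integral_cong)
    fix y
    have "(\<integral>\<^sup>+x. epowr (h y) p * indicator V y * indicator (sball x l) y \<partial>lebesgue) = (\<integral>\<^sup>+x. epowr (h y) p * indicator V y * indicator (sball y l) x \<partial>lebesgue)"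
      by (intro nn_integral_cong) (auto simp: indicator_def sball_commute[of y])
    also have "\<dots> = epowr (h y) p * indicator V y * ennreal v"
      by (subst nn_integral_cmult) (auto simp: em)
    finally show "(\<integral>\<^sup>+x. epowr (h y) p * indicator V y * indicator (sball x l) y \<partial>lebesgue) = ennreal v * (epowr (h y) p * indicator V y)"
      by (simp add: mult.commute)
  qed
  also have "\<dots> = ennreal v * epowr (Lp p V h) p"
    by (simp add: nn_integral_cmult epowr_Lp p0)
  also have "ennreal (2 powr p * v powr (p - 1)) * (ennreal v * epowr (Lp p V h) p) = epowr (ennreal (2 * v) * Lp p V h) p"
  proof -
    have "v powr (p - 1) * v = v powr p" using v powr_add[of v "p - 1" 1] by simp
    then have "ennreal (2 powr p * v powr (p - 1)) * (ennreal v * epowr (Lp p V h) p) = ennreal (2 powr p * v powr p) * epowr (Lp p V h) p"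
      using v by (simp flip: ennreal_mult mult.assoc) (simp add: mult.assoc)
    also have "\<dots> = epowr (ennreal (2 * v) * Lp p V h) p"
      using v by (subst epowr_mult[OF p0], subst epowr_ennreal) (auto simp: powr_mult)
    finally show ?thesis .
  qed
  finally show "(\<integral>\<^sup>+x\<in>U. epowr (\<integral>\<^sup>+y\<in>sball x l. h y \<partial>lebesgue) p \<partial>lebesgue) \<le> epowr (ennreal (2 * (2 * l) ^ CARD('d)) * Lp p V h) p"
    by (simp add: v_def mult_left_mono)
qed (use p in auto)


section \<open>Test functions\<close>

definition sdeg :: "'d option \<Rightarrow> real" where
  "sdeg j = (case j of None \<Rightarrow> 2 | Some i \<Rightarrow> 1)"

lemma mdeg_eq_sum: "mdeg k = (\<Sum>j\<in>UNIV. sdeg j * real (k j))"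
  unfolding mdeg_def by (simp add: UNIV_option_conv sum.reindex sdeg_def)

lemma sdeg_ge_1: "1 \<le> sdeg j"
  by (simp add: sdeg_def split: option.split)

lemma sdeg_nonneg [simp]: "0 \<le> sdeg j"
  using sdeg_ge_1[of j] by simp

lemma mdeg_nonneg [simp]: "0 \<le> mdeg k"
  by (simp add: mdeg_def sum_nonneg)

lemma mdeg_0 [simp]: "mdeg (\<lambda>_. 0) = 0"
  by (simp add: mdeg_def)

lemma mdeg_Suc: "mdeg (k(j := Suc (k j))) = mdeg k + sdeg j"
proof -
  have "mdeg (k(j := Suc (k j))) = (\<Sum>i\<in>UNIV. sdeg i * real (k i) + (if i = j then sdeg i else 0))"
    unfolding mdeg_eq_sum by (intro sum.cong) (auto simp: algebra_simps)
  then show ?thesis by (simp add: sum.distrib mdeg_eq_sum)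
qed

lemma mdeg_mono: "i \<le> k \<Longrightarrow> mdeg i \<le> mdeg k"
  unfolding mdeg_eq_sum by (intro sum_mono mult_left_mono) (auto simp: le_fun_def)

lemma mdeg_diff: "i \<le> k \<Longrightarrow> mdeg (\<lambda>j. k j - i j) = mdeg k - mdeg i"
  unfolding mdeg_eq_sum by (simp add: le_fun_def of_nat_diff right_diff_distrib flip: sum_subtractf)

lemma component_le_mdeg: "real (k j) \<le> mdeg k"
proof -
  have "real (k j) \<le> sdeg j * real (k j)" using mult_right_mono[OF sdeg_ge_1, of "real (k j)"] by simp
  also have "\<dots> \<le> mdeg k" unfolding mdeg_eq_sum
    by (intro member_le_sum) auto
  finally show ?thesis .
qed

lemma finite_mdeg: "finite {k :: 'd::finite midx. mdeg k \<le> r}"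
proof (rule finite_subset)
  show "{k :: 'd midx. mdeg k \<le> r} \<subseteq> {k. \<forall>j. (j \<in> UNIV \<longrightarrow> k j \<in> {..nat \<lceil>r\<rceil>}) \<and> (j \<notin> UNIV \<longrightarrow> k j = 0)}"
  proof safe
    fix k :: "'d midx" and j assume "mdeg k \<le> r"
    then have "real (k j) \<le> real (nat \<lceil>r\<rceil>)"
      using component_le_mdeg[of k j] real_nat_ceiling_ge[of r] by linarith
    then show "k j \<le> nat \<lceil>r\<rceil>" by simp
  qed auto
qed (intro finite_set_of_finite_funs; simp)

lemma finite_atMost_midx: "finite {..k :: 'd::finite midx}"
  by (rule finite_subset[OF _ finite_mdeg[of "mdeg k"]]) (auto intro: mdeg_mono)

lemma midx_induct [case_names zero Suc]:
  fixes k :: "'d::finite midx"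
  assumes "P (\<lambda>_. 0)" "\<And>k j. P k \<Longrightarrow> P (k(j := Suc (k j)))"
  shows "P k"
proof (induction "\<Sum>j\<in>UNIV. k j" arbitrary: k)
  case 0
  then have "k = (\<lambda>_. 0)" by auto
  then show ?case using assms(1) by simp
next
  case (Suc n)
  then obtain j where j: "k j \<noteq> 0" by (metis nat.distinct(1) sum.neutral)
  define k' where "k' = k(j := k j - 1)"
  have k: "k = k'(j := Suc (k' j))" using j by (auto simp: k'_def)
  have "(\<Sum>j\<in>UNIV. k j) = Suc (\<Sum>j\<in>UNIV. k' j)"
  proof -
    have "(\<Sum>i\<in>UNIV. k i) = (\<Sum>i\<in>UNIV. k' i + (if i = j then 1 else 0))"
      by (intro sum.cong) (auto simp: k)
    then show ?thesis by (simp add: sum.distrib)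
  qed
  with Suc have "P k'" by simp
  then show ?case using assms(2) k by metis
qed

lemma derivs_mono: "derivs r f D \<Longrightarrow> s \<le> r \<Longrightarrow> derivs s f D"
  unfolding derivs_def by (meson order_trans)

lemma derivs_unique:
  assumes "derivs r f D" "derivs r f D'" "mdeg k \<le> r"
  shows "D k = D' k"
  using assms(3)
proof (induction k rule: midx_induct)
  case (Suc k j)
  have "mdeg k \<le> r" using Suc.prems(1)[unfolded mdeg_Suc] sdeg_ge_1[of j] by linarith
  then have IH: "D k = D' k" by (rule Suc.IH)
  have "((\<lambda>s. D k (z + s *\<^sub>R unit_vec j)) has_real_derivative D (k(j := Suc (k j))) z) (at 0)"
    "((\<lambda>s. D' k (z + s *\<^sub>R unit_vec j)) has_real_derivative D' (k(j := Suc (k j))) z) (at 0)" for z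
    using assms Suc.prems unfolding derivs_def by blast+
  then show ?case unfolding IH by (intro ext) (rule DERIV_unique)
qed (use assms in \<open>auto simp: derivs_def\<close>)

lemma pd_eq:
  assumes "derivs r f D" "mdeg k \<le> r"
  shows "pd k f = D k"
proof -
  have 1: "derivs (mdeg k) f D" using assms by (rule derivs_mono)
  then have "derivs (mdeg k) f (SOME D. derivs (mdeg k) f D)" by (rule someI[of "derivs (mdeg k) f"])
  from derivs_unique[OF this 1] show ?thesis by (simp add: pd_def)
qed

text \<open>Serves to show that all derivatives of a test function vanish off its support, so that
  their bounds on a compact set are global.\<close>

lemma derivs_zero_on_open:
  assumes D: "derivs r f D" and V: "open V" "\<And>z. z \<in> V \<Longrightarrow> f z = 0" and "mdeg k \<le> r" "z \<in> V"
  shows "D k z = 0"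
  using assms(4,5)
proof (induction k arbitrary: z rule: midx_induct)
  case (Suc k j)
  have "mdeg k \<le> r" using Suc.prems(1)[unfolded mdeg_Suc] sdeg_ge_1[of j] by linarith
  with Suc have IH: "\<And>z. z \<in> V \<Longrightarrow> D k z = 0" by blast
  have "((\<lambda>s. D k (z + s *\<^sub>R unit_vec j)) has_real_derivative D (k(j := Suc (k j))) z) (at 0)"
    using D Suc.prems unfolding derivs_def by blast
  moreover have "((\<lambda>s. D k (z + s *\<^sub>R unit_vec j)) has_real_derivative 0) (at 0)"
  proof -
    have "((\<lambda>s::real. z + s *\<^sub>R unit_vec j) \<longlongrightarrow> z + 0 *\<^sub>R unit_vec j) (nhds 0)"
      by (intro tendsto_intros) (simp add: filterlim_ident)
    then have "\<forall>\<^sub>F s in nhds 0. z + s *\<^sub>R unit_vec j \<in> V"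
      using V(1) Suc.prems(2) by (auto dest!: topological_tendstoD)
    then have "\<forall>\<^sub>F s in nhds 0. D k (z + s *\<^sub>R unit_vec j) = 0"
      by (rule eventually_mono) (rule IH)
    then show ?thesis by (subst DERIV_cong_ev[where g="\<lambda>_. 0", OF refl _ refl]) auto
  qed
  ultimately show ?case by (rule DERIV_unique)
qed (use D V in \<open>auto simp: derivs_def\<close>)

text \<open>Chain rule for the parabolic dilation: a step in the direction j becomes
  \<open>a powr sdeg j\<close> times as long, and these factors multiply up to
  \<open>a powr mdeg k\<close>.\<close>

lemma derivs_affine:
  fixes f :: "'d::finite func"
  assumes D: "derivs r f D" and a: "0 < a"
  shows "derivs r (\<lambda>w. c * f (a\<^sup>2 * fst w + t, a *\<^sub>R snd w + x))
     (\<lambda>k w. c * a powr mdeg k * D k (a\<^sup>2 * fst w + t, a *\<^sub>R snd w + x))"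
proof -
  let ?T = "\<lambda>w::'d pt. (a\<^sup>2 * fst w + t, a *\<^sub>R snd w + x)"
  have T: "?T (w + s *\<^sub>R unit_vec j) = ?T w + (a powr sdeg j * s) *\<^sub>R unit_vec j" for w s j
    using a by (cases j) (auto simp: sdeg_def algebra_simps powr_numeral)
  have "((\<lambda>s. c * a powr mdeg k * D k (?T (z + s *\<^sub>R unit_vec j))) has_real_derivative
      c * a powr mdeg (k(j := Suc (k j))) * D (k(j := Suc (k j))) (?T z)) (at 0)"
    if "mdeg (k(j := Suc (k j))) \<le> r" for k j z
  proof -
    have "((\<lambda>s. D k (?T z + s *\<^sub>R unit_vec j)) has_real_derivative D (k(j := Suc (k j))) (?T z)) (at 0)"
      using D that unfolding derivs_def by blast
    then have "((\<lambda>s. D k (?T z + s *\<^sub>R unit_vec j)) has_real_derivative D (k(j := Suc (k j))) (?T z)) (at (a powr sdeg j * 0))"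
      by simp
    then have "((\<lambda>s. D k (?T z + (a powr sdeg j * s) *\<^sub>R unit_vec j)) has_real_derivative D (k(j := Suc (k j))) (?T z) * a powr sdeg j) (at 0)"
      by (rule DERIV_chain2) (auto intro!: derivative_eq_intros)
    then have "((\<lambda>s. c * a powr mdeg k * D k (?T z + (a powr sdeg j * s) *\<^sub>R unit_vec j)) has_real_derivative (c * a powr mdeg k) * (D (k(j := Suc (k j))) (?T z) * a powr sdeg j)) (at 0)"
      by (rule DERIV_cmult)
    then show ?thesis unfolding T mdeg_Suc by (simp add: powr_add mult_ac)
  qed
  moreover have "continuous_on UNIV (\<lambda>w. c * a powr mdeg k * D k (?T w))" if "mdeg k \<le> r" for k
  proof -
    have "continuous_on UNIV (D k)" using D that by (simp add: derivs_def)
    then have "continuous_on UNIV (\<lambda>w. D k (?T w))"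
      by (rule continuous_on_compose2) (auto intro!: continuous_intros)
    then show ?thesis by (intro continuous_intros)
  qed
  ultimately show ?thesis using D a unfolding derivs_def by auto
qed

text \<open>Leibniz' rule for multi-indices. A derivative in the direction j raises the order of one
  of the two factors, and Pascal's rule in the coordinate j recombines the two sums.\<close>

lemma derivs_mult:
  fixes f g :: "'d::finite func"
  assumes F: "derivs r f F" and G: "derivs r g G"
  shows "derivs r (\<lambda>z. f z * g z)
    (\<lambda>k z. \<Sum>i\<in>{..k}. real (\<Prod>j\<in>UNIV. k j choose i j) * (F i z * G (\<lambda>j. k j - i j) z))"
  unfolding derivs_def
proof (intro conjI allI impI)
  have "{..\<lambda>_::'d option. 0::nat} = {\<lambda>_. 0}" by (auto simp: le_fun_def)
  then show "(\<lambda>z. \<Sum>i\<in>{..\<lambda>_. 0}. real (\<Prod>j\<in>UNIV. 0 choose i j) * (F i z * G (\<lambda>j. 0 - i j) z)) = (\<lambda>z. f z * g z)"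
    using F G by (simp add: derivs_def)
next
  fix k :: "'d midx" assume k: "mdeg k \<le> r"
  have "continuous_on UNIV (F i)" "continuous_on UNIV (G (\<lambda>j. k j - i j))" if "i \<le> k" for i
  proof -
    have "mdeg i \<le> r" "mdeg (\<lambda>j. k j - i j) \<le> r"
      using k mdeg_mono[OF that] mdeg_diff[OF that] mdeg_nonneg[of i] by linarith+
    then show "continuous_on UNIV (F i)" "continuous_on UNIV (G (\<lambda>j. k j - i j))"
      using F G unfolding derivs_def by blast+
  qed
  then show "continuous_on UNIV (\<lambda>z. \<Sum>i\<in>{..k}. real (\<Prod>j\<in>UNIV. k j choose i j) * (F i z * G (\<lambda>j. k j - i j) z))"
    by (intro continuous_intros) auto
next
  fix k :: "'d midx" and j z assume k': "mdeg (k(j := Suc (k j))) \<le> r"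
  define k' where "k' = k(j := Suc (k j))"
  let ?b = "\<lambda>k i. real (\<Prod>j\<in>UNIV. (k j :: nat) choose i j)"
  define A where "A i = F i z * G (\<lambda>j. k' j - i j) z" for i
  have d: "((\<lambda>s. F i (z + s *\<^sub>R unit_vec j) * G (\<lambda>j. k j - i j) (z + s *\<^sub>R unit_vec j)) has_real_derivative
      A (i(j := Suc (i j))) + A i) (at 0)" if "i \<le> k" for i
  proof -
    have ik: "\<And>l. i l \<le> k l" using that by (simp add: le_fun_def)
    have m: "mdeg (i(j := Suc (i j))) \<le> r"
      using mdeg_mono[OF that] k' by (simp add: mdeg_Suc)
    have e: "(\<lambda>l. k l - i l)(j := Suc (k j - i j)) = (\<lambda>l. k' l - i l)"
      using ik by (auto simp: k'_def Suc_diff_le)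
    have e2: "(\<lambda>l. k l - i l) = (\<lambda>l. k' l - (i(j := Suc (i j))) l)"
      by (auto simp: k'_def)
    have m2: "mdeg ((\<lambda>l. k l - i l)(j := Suc ((\<lambda>l. k l - i l) j))) \<le> r"
      using mdeg_Suc[of "\<lambda>l. k l - i l" j] mdeg_Suc[of k j] mdeg_diff[OF that] mdeg_nonneg[of i] k' by linarith
    have "((\<lambda>s. F i (z + s *\<^sub>R unit_vec j)) has_real_derivative F (i(j := Suc (i j))) z) (at 0)"
      using F m unfolding derivs_def by blast
    moreover have "((\<lambda>s. G (\<lambda>l. k l - i l) (z + s *\<^sub>R unit_vec j)) has_real_derivative G ((\<lambda>l. k l - i l)(j := Suc ((\<lambda>l. k l - i l) j))) z) (at 0)"
      using G m2 unfolding derivs_def by blast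
    ultimately have "((\<lambda>s. F i (z + s *\<^sub>R unit_vec j) * G (\<lambda>l. k l - i l) (z + s *\<^sub>R unit_vec j)) has_real_derivative
      F (i(j := Suc (i j))) z * G (\<lambda>l. k l - i l) (z + 0 *\<^sub>R unit_vec j) + G ((\<lambda>l. k l - i l)(j := Suc ((\<lambda>l. k l - i l) j))) z * F i (z + 0 *\<^sub>R unit_vec j)) (at 0)"
      by (rule DERIV_mult)
    then show ?thesis unfolding A_def e2[symmetric] by (simp add: e mult.commute)
  qed
  have "((\<lambda>s. \<Sum>i\<in>{..k}. ?b k i * (F i (z + s *\<^sub>R unit_vec j) * G (\<lambda>j. k j - i j) (z + s *\<^sub>R unit_vec j))) has_real_derivative
    (\<Sum>i\<in>{..k}. ?b k i * (A (i(j := Suc (i j))) + A i))) (at 0)"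
    by (intro DERIV_sum DERIV_cmult d) auto
  also have "(\<Sum>i\<in>{..k}. ?b k i * (A (i(j := Suc (i j))) + A i)) = (\<Sum>i\<in>{..k'}. ?b k' i * A i)"
  proof -
    have kk': "k \<le> k'" by (auto simp: k'_def le_fun_def)
    \<comment> \<open>Only the factor of the coordinate j differs between k and k'. If
      \<open>i j = 0\<close>, both its binomials are 1 and there is no second summand.\<close>
    have pascal: "?b k' i = ?b k i + (if i j = 0 then 0 else ?b k (i(j := i j - 1)))" for i
    proof -
      have s: "?b q i = real (q j choose i j) * (\<Prod>l\<in>UNIV - {j}. real (q l choose i l))" for q i :: "'d midx"
        by (subst prod.remove[of UNIV j]) auto
      have r: "(\<Prod>l\<in>UNIV - {j}. real (k' l choose i l)) = (\<Prod>l\<in>UNIV - {j}. real (k l choose i l))"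
         "(\<Prod>l\<in>UNIV - {j}. real (k l choose (i(j := i j - 1)) l)) = (\<Prod>l\<in>UNIV - {j}. real (k l choose i l))"
        by (intro prod.cong; auto simp: k'_def)+
      show ?thesis unfolding s r
        by (cases "i j") (auto simp: k'_def algebra_simps)
    qed
    \<comment> \<open>An index with a component above that of k has a vanishing binomial factor, so
      the first sum shrinks from \<open>{..k'}\<close> to \<open>{..k}\<close>.\<close>
    have z: "?b k i = 0" if "i \<in> {..k'} - {..k}" for i
    proof -
      have "\<not> i \<le> k" using that by simp
      then obtain l where "k l < i l" unfolding le_fun_def not_all not_le by blast
      then have "(k l choose i l) = 0" by (rule binomial_eq_0)
      then show ?thesis by (auto simp: prod_zero_iff)
    qed
    have "(\<Sum>i\<in>{..k'}. ?b k' i * A i) = (\<Sum>i\<in>{..k'}. ?b k i * A i) + (\<Sum>i\<in>{..k'}. (if i j = 0 then 0 else ?b k (i(j := i j - 1))) * A i)"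
      unfolding pascal by (simp add: distrib_right sum.distrib)
    also have "(\<Sum>i\<in>{..k'}. ?b k i * A i) = (\<Sum>i\<in>{..k}. ?b k i * A i)"
      using kk' z by (intro sum.mono_neutral_right finite_atMost_midx) auto
    also have "(\<Sum>i\<in>{..k'}. (if i j = 0 then 0 else ?b k (i(j := i j - 1))) * A i) = (\<Sum>i\<in>{i\<in>{..k'}. i j \<noteq> 0}. ?b k (i(j := i j - 1)) * A i)"
      by (intro sum.mono_neutral_cong_right finite_atMost_midx) auto
    also have "\<dots> = (\<Sum>i\<in>{..k}. ?b k i * A (i(j := Suc (i j))))"
    proof (rule sum.reindex_bij_witness[where i="\<lambda>i. i(j := Suc (i j))" and j="\<lambda>i. i(j := i j - 1)"])
      fix i assume "i \<in> {i \<in> {..k'}. i j \<noteq> 0}"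
      then have i: "\<And>l. i l \<le> k' l" "i j \<noteq> 0" by (auto simp: le_fun_def)
      have "(i(j := i j - 1)) l \<le> k l" for l
        using i(1)[of l] i(2) by (cases "l = j") (simp_all add: k'_def)
      then show "i(j := i j - 1) \<in> {..k}" by (auto simp: le_fun_def)
    qed (auto simp: k'_def le_fun_def)
    finally show ?thesis by (simp add: distrib_left sum.distrib)
  qed
  finally show "((\<lambda>s. \<Sum>i\<in>{..k}. ?b k i * (F i (z + s *\<^sub>R unit_vec j) * G (\<lambda>j. k j - i j) (z + s *\<^sub>R unit_vec j))) has_real_derivative
      (\<Sum>i\<in>{..k(j := Suc (k j))}. ?b (k(j := Suc (k j))) i * (F i z * G (\<lambda>l. (k(j := Suc (k j))) l - i l) z))) (at 0)"
    unfolding A_def k'_def .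
qed

lemma derivs_add: "derivs r f F \<Longrightarrow> derivs r g G \<Longrightarrow> derivs r (\<lambda>z. f z + g z) (\<lambda>k z. F k z + G k z)"
  unfolding derivs_def by (auto intro!: continuous_intros DERIV_add)

lemma derivs_0: "derivs r (\<lambda>z. 0) (\<lambda>k z. 0)"
  unfolding derivs_def by auto

text \<open>Up to the amplitude \<open>A\<close>, the derivatives are those of a fixed function rescaled to the parabolic scale \<open>\<mu>\<close>.\<close>

definition sized :: "real \<Rightarrow> real \<Rightarrow> real \<Rightarrow> 'd::finite func \<Rightarrow> bool" where
  "sized r A \<mu> f \<longleftrightarrow> (\<exists>D. derivs r f D \<and> (\<forall>k z. mdeg k \<le> r \<longrightarrow> \<bar>D k z\<bar> \<le> A * (1 / \<mu>) powr mdeg k))"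

text \<open>In each term of Leibniz' rule the degrees of the two factors add up to that of k, so the
  power of \<mu> is the same throughout. C dominates the sums of binomial coefficients over the
  finitely many k of degree at most r; its summand 1 keeps it positive.\<close>

lemma sized_mult:
  "\<exists>C>0. \<forall>(f::'d::finite func) g A B \<mu>. 0 \<le> A \<longrightarrow> 0 \<le> B \<longrightarrow> 0 < \<mu> \<longrightarrow> sized r A \<mu> f \<longrightarrow> sized r B \<mu> g \<longrightarrow>
     sized r (C * A * B) \<mu> (\<lambda>z. f z * g z)"
proof -
  define b where "b k i = real (\<Prod>j\<in>UNIV. (k j :: nat) choose i j)" for k i :: "'d midx"
  have b0: "0 \<le> b k i" for k i by (simp add: b_def prod_nonneg)
  define C where "C = 1 + (\<Sum>k\<in>{k. mdeg k \<le> r}. \<Sum>i\<in>{..k}. b k i)"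
  have "0 < C" unfolding C_def by (intro add_pos_nonneg sum_nonneg b0) auto
  moreover have "sized r (C * A * B) \<mu> (\<lambda>z. f z * g z)"
    if AB: "0 \<le> A" "0 \<le> B" "0 < \<mu>" "sized r A \<mu> f" "sized r B \<mu> g" for f g :: "'d func" and A B \<mu>
  proof -
    obtain F where F: "derivs r f F" "\<And>k z. mdeg k \<le> r \<Longrightarrow> \<bar>F k z\<bar> \<le> A * (1 / \<mu>) powr mdeg k"
      using AB unfolding sized_def by blast
    obtain G where G: "derivs r g G" "\<And>k z. mdeg k \<le> r \<Longrightarrow> \<bar>G k z\<bar> \<le> B * (1 / \<mu>) powr mdeg k"
      using AB unfolding sized_def by blast
    have "\<bar>\<Sum>i\<in>{..k}. b k i * (F i z * G (\<lambda>j. k j - i j) z)\<bar> \<le> C * A * B * (1 / \<mu>) powr mdeg k" if k: "mdeg k \<le> r" for k z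
    proof -
      have "\<bar>\<Sum>i\<in>{..k}. b k i * (F i z * G (\<lambda>j. k j - i j) z)\<bar> \<le> (\<Sum>i\<in>{..k}. b k i * (A * B * (1 / \<mu>) powr mdeg k))"
      proof (rule sum_abs[THEN order_trans], rule sum_mono)
        fix i assume i: "i \<in> {..k}"
        then have m: "mdeg i \<le> mdeg k" "mdeg (\<lambda>j. k j - i j) = mdeg k - mdeg i" by (auto intro: mdeg_mono mdeg_diff)
        have "\<bar>F i z\<bar> * \<bar>G (\<lambda>j. k j - i j) z\<bar> \<le> (A * (1 / \<mu>) powr mdeg i) * (B * (1 / \<mu>) powr mdeg (\<lambda>j. k j - i j))"
          using m k AB mdeg_nonneg[of i] by (intro mult_mono F(2) G(2)) (auto simp del: mdeg_nonneg)
        also have "\<dots> = A * B * (1 / \<mu>) powr mdeg k"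
          using AB by (simp add: m(2) powr_diff)
        finally show "\<bar>b k i * (F i z * G (\<lambda>j. k j - i j) z)\<bar> \<le> b k i * (A * B * (1 / \<mu>) powr mdeg k)"
          using b0 by (simp add: abs_mult mult_left_mono)
      qed
      also have "\<dots> = (\<Sum>i\<in>{..k}. b k i) * (A * B * (1 / \<mu>) powr mdeg k)"
        by (simp add: sum_distrib_right)
      also have "\<dots> \<le> C * (A * B * (1 / \<mu>) powr mdeg k)"
      proof (rule mult_right_mono)
        have "(\<Sum>i\<in>{..k}. b k i) \<le> (\<Sum>k\<in>{k. mdeg k \<le> r}. \<Sum>i\<in>{..k}. b k i)"
          using k by (intro member_le_sum[of k _ "\<lambda>k. \<Sum>i\<in>{..k}. b k i"] sum_nonneg b0 finite_mdeg) auto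
        then show "(\<Sum>i\<in>{..k}. b k i) \<le> C" by (simp add: C_def)
      qed (use AB in auto)
      finally show ?thesis by (simp add: mult.assoc)
    qed
    then show ?thesis
      using derivs_mult[OF F(1) G(1)] unfolding sized_def b_def by blast
  qed
  ultimately show ?thesis by blast
qed

lemma sized_scale_down:
  assumes "sized r A l f" "0 < \<mu>" "\<mu> \<le> l" "0 \<le> A"
  shows "sized r A \<mu> f"
proof -
  have "A * (1 / l) powr mdeg k \<le> A * (1 / \<mu>) powr mdeg k" for k :: "'a midx"
    using assms by (intro mult_left_mono powr_mono2) (auto intro!: divide_left_mono)
  then show ?thesis using assms(1) unfolding sized_def by (meson order_trans)
qed

text \<open>A derivative of degree at most r loses at most r powers of the ratio c of the two
  scales. In the other direction, \<open>sized_scale_down\<close>, nothing is lost.\<close>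

lemma sized_scale_up:
  assumes "sized r A \<mu> f" "0 < \<mu>" "\<mu> \<le> l" "l \<le> c * \<mu>" "0 \<le> A"
  shows "sized r (A * c powr r) l f"
proof -
  have "1 * \<mu> \<le> c * \<mu>" using assms by linarith
  then have c: "1 \<le> c" using assms(2) by (simp only: mult_le_cancel_right_pos)
  have "A * (1 / \<mu>) powr mdeg k \<le> A * c powr r * (1 / l) powr mdeg k" if "mdeg k \<le> r" for k :: "'a midx"
  proof -
    have "(1 / \<mu>) powr mdeg k \<le> (c * (1 / l)) powr mdeg k"
      using assms by (intro powr_mono2) (auto simp: field_simps)
    also have "\<dots> = c powr mdeg k * (1 / l) powr mdeg k"
      using assms c by (simp add: powr_mult powr_divide)
    also have "\<dots> \<le> c powr r * (1 / l) powr mdeg k"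
      using c that by (intro mult_right_mono powr_mono) auto
    finally show ?thesis using assms(5) by (simp add: mult.assoc mult_left_mono)
  qed
  then show ?thesis using assms(1) unfolding sized_def by (meson order_trans)
qed

lemma sized_mono: "sized r A \<mu> f \<Longrightarrow> A \<le> B \<Longrightarrow> sized r B \<mu> f"
  unfolding sized_def by (meson mult_right_mono order_trans powr_ge_zero)

lemma sized_Cr: "sized r A \<mu> f \<Longrightarrow> f \<in> Cr r"
  unfolding sized_def Cr_def by blast

lemma pnorm_le_iff: "0 \<le> \<rho> \<Longrightarrow> pnorm z \<le> \<rho> \<longleftrightarrow> \<bar>fst z\<bar> \<le> \<rho>\<^sup>2 \<and> infnorm (snd z) \<le> \<rho>"
  by (auto simp: pnorm_def real_sqrt_le_iff sqrt_le_D real_le_lsqrt)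

lemma continuous_on_pnorm: "continuous_on UNIV (pnorm :: 'd::finite pt \<Rightarrow> real)"
proof -
  have "continuous_on UNIV (\<lambda>z::'d pt. max (sqrt \<bar>fst z\<bar>) (infnorm (snd z)))"
    by (intro continuous_intros)
  then show ?thesis by (simp add: pnorm_def[abs_def])
qed

lemma Cr_norm_le_iff:
  assumes D: "derivs r f D" and "0 \<le> A"
  shows "Cr_norm r f \<le> ennreal A \<longleftrightarrow> (\<forall>k z. mdeg k \<le> r \<longrightarrow> \<bar>D k z\<bar> \<le> A)"
  unfolding Cr_norm_def SUP_le_iff using assms pd_eq[OF D] by auto

text \<open>Each derivative is continuous, hence bounded on a compact parabolic ball, and it
  vanishes outside. Finitely many derivatives are involved, so the sum of their bounds controls the
  norm.\<close>

lemma testsD: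
  fixes \<phi> :: "'d::finite func"
  assumes "\<phi> \<in> tests r"
  shows "Cr_norm r \<phi> < top" "sized r (enn2real (Cr_norm r \<phi>)) 1 \<phi>"
proof -
  obtain D \<rho> where D: "derivs r \<phi> D" and "vanishes_off \<rho> \<phi>"
    using assms by (auto simp: tests_def Cr_def)
  then have z: "\<phi> z = 0" if "\<rho> < pnorm z" for z using that unfolding vanishes_off_def by blast
  \<comment> \<open>\<open>vanishes_off\<close> also admits negative radii, whereas
    \<open>pnorm_le_iff\<close> requires a nonnegative one.\<close>
  define R where "R = max 0 \<rho>"
  have compact: "compact {z :: 'd pt. pnorm z \<le> R}"
  proof (rule compact_eq_bounded_closed[THEN iffD2], intro conjI)
    show "closed {z :: 'd pt. pnorm z \<le> R}"
      by (intro closed_Collect_le continuous_on_pnorm continuous_intros)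
    have "{z :: 'd pt. pnorm z \<le> R} \<subseteq> {-(R\<^sup>2)..R\<^sup>2} \<times> cball 0 (sqrt (DIM(real^'d)) * R)"
    proof safe
      fix t and x :: "real^'d" assume "pnorm (t, x) \<le> R"
      then have *: "\<bar>t\<bar> \<le> R\<^sup>2" "infnorm x \<le> R" by (auto simp: pnorm_le_iff R_def)
      then show "t \<in> {-(R\<^sup>2)..R\<^sup>2}" by auto
      have "norm x \<le> sqrt (DIM(real^'d)) * infnorm x" by (rule norm_le_infnorm)
      also have "\<dots> \<le> sqrt (DIM(real^'d)) * R" using * by (intro mult_left_mono) auto
      finally show "x \<in> cball 0 (sqrt (DIM(real^'d)) * R)" by simp
    qed
    then show "bounded {z :: 'd pt. pnorm z \<le> R}"
      by (rule bounded_subset[rotated]) (intro bounded_Times bounded_closed_interval bounded_cball)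
  qed
  have "\<exists>B. \<forall>z. \<bar>D k z\<bar> \<le> B" if k: "mdeg k \<le> r" for k
  proof -
    have "compact (D k ` {z. pnorm z \<le> R})"
      using D k compact by (intro compact_continuous_image) (auto simp: derivs_def intro: continuous_on_subset)
    then have "bounded (D k ` {z. pnorm z \<le> R})" by (rule compact_imp_bounded)
    then obtain B where "\<forall>x\<in>D k ` {z. pnorm z \<le> R}. norm x \<le> B" unfolding bounded_iff by blast
    then have B: "\<And>z. pnorm z \<le> R \<Longrightarrow> \<bar>D k z\<bar> \<le> B" by (metis image_eqI mem_Collect_eq real_norm_def)
    have "open {z. R < pnorm (z::'d pt)}"
      by (intro open_Collect_less continuous_on_pnorm continuous_intros)
    then have Z: "D k z = 0" if "R < pnorm z" for z
      by (rule derivs_zero_on_open[OF D]) (use that k z in \<open>auto simp: R_def\<close>)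
    have "\<bar>D k z\<bar> \<le> max 0 B" for z
      using B[of z] Z[of z] by (cases "pnorm z \<le> R") (simp_all add: not_le le_max_iff_disj)
    then show ?thesis by blast
  qed
  then obtain B where B: "\<And>k z. mdeg k \<le> r \<Longrightarrow> \<bar>D k z\<bar> \<le> B k" by metis
  have "\<bar>D k z\<bar> \<le> (\<Sum>k\<in>{k. mdeg k \<le> r}. \<bar>B k\<bar>)" if "mdeg k \<le> r" for k z
  proof -
    have "\<bar>D k z\<bar> \<le> \<bar>B k\<bar>" using B[OF that, of z] by simp
    also have "\<dots> \<le> (\<Sum>k\<in>{k. mdeg k \<le> r}. \<bar>B k\<bar>)"
      using that by (intro member_le_sum[of k _ "\<lambda>k. \<bar>B k\<bar>"] finite_mdeg) auto
    finally show ?thesis .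
  qed
  then have "Cr_norm r \<phi> \<le> ennreal (\<Sum>k\<in>{k. mdeg k \<le> r}. \<bar>B k\<bar>)"
    by (subst Cr_norm_le_iff[OF D]) (auto intro: sum_nonneg)
  then show fin: "Cr_norm r \<phi> < top" by (rule le_less_trans) simp
  then have "Cr_norm r \<phi> = ennreal (enn2real (Cr_norm r \<phi>))" by simp
  then have "\<bar>D k z\<bar> \<le> enn2real (Cr_norm r \<phi>)" if "mdeg k \<le> r" for k z
    using Cr_norm_le_iff[OF D, of "enn2real (Cr_norm r \<phi>)"] that by (metis enn2real_nonneg order_refl)
  then show "sized r (enn2real (Cr_norm r \<phi>)) 1 \<phi>"
    using D unfolding sized_def by auto
qed

lemma rescale_affine:
  fixes \<eta> :: "'d::finite func"
  assumes "0 < l"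
  shows "rescale \<eta> l z = (\<lambda>w. (1 / l) ^ (CARD('d) + 2) * \<eta> ((1 / l)\<^sup>2 * fst w + - (fst z / l\<^sup>2), (1 / l) *\<^sub>R snd w + - ((1 / l) *\<^sub>R snd z)))"
  unfolding rescale_def by (simp add: diff_divide_distrib power_divide algebra_simps)

lemma Br_tests: "\<eta> \<in> Br r \<Longrightarrow> \<eta> \<in> tests r"
  by (auto simp: Br_def tests_def)

lemma sized_rescale:
  fixes \<eta> :: "'d::finite func"
  assumes "sized r A 1 \<eta>" "0 < l"
  shows "sized r ((1 / l) ^ (CARD('d) + 2) * A) l (rescale \<eta> l z)"
proof -
  obtain D where D: "derivs r \<eta> D" "\<And>k z. mdeg k \<le> r \<Longrightarrow> \<bar>D k z\<bar> \<le> A"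
    using assms unfolding sized_def by auto
  have "\<bar>(1 / l) ^ (CARD('d) + 2) * (1 / l) powr mdeg k * D k u\<bar> \<le> (1 / l) ^ (CARD('d) + 2) * A * (1 / l) powr mdeg k"
    if "mdeg k \<le> r" for k u
  proof -
    have "\<bar>(1 / l) ^ (CARD('d) + 2) * (1 / l) powr mdeg k * D k u\<bar> = (1 / l) ^ (CARD('d) + 2) * (1 / l) powr mdeg k * \<bar>D k u\<bar>"
      using assms(2) by (simp add: abs_mult)
    also have "\<dots> \<le> (1 / l) ^ (CARD('d) + 2) * (1 / l) powr mdeg k * A"
      using D(2)[OF that, of u] assms(2) by (intro mult_left_mono) auto
    finally show ?thesis by (simp only: mult_ac)
  qed
  moreover have "derivs r (rescale \<eta> l z) (\<lambda>k w. (1 / l) ^ (CARD('d) + 2) * (1 / l) powr mdeg k * D k ((1 / l)\<^sup>2 * fst w + - (fst z / l\<^sup>2), (1 / l) *\<^sub>R snd w + - ((1 / l) *\<^sub>R snd z)))"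
    unfolding rescale_affine[OF assms(2)] by (rule derivs_affine[OF D(1)]) (use assms in simp)
  ultimately show ?thesis unfolding sized_def by blast
qed

lemma Br_sized: "\<eta> \<in> Br r \<Longrightarrow> sized r 1 1 \<eta>"
  using testsD[OF Br_tests, of \<eta> r] sized_mono[of r "enn2real (Cr_norm r \<eta>)" 1 \<eta> 1]
  by (auto simp: Br_def enn2real_leI)

lemma rescale_support:
  assumes "vanishes_off 1 \<eta>" "0 < l" "rescale \<eta> l z w \<noteq> 0"
  shows "\<bar>fst w - fst z\<bar> \<le> l\<^sup>2" "infnorm (snd w - snd z) \<le> l"
proof -
  have "pnorm ((fst w - fst z) / l\<^sup>2, (1 / l) *\<^sub>R (snd w - snd z)) \<le> 1"
    using assms by (force simp: vanishes_off_def rescale_def)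
  then have "\<bar>(fst w - fst z) / l\<^sup>2\<bar> \<le> 1" "infnorm ((1 / l) *\<^sub>R (snd w - snd z)) \<le> 1"
    by (simp_all only: pnorm_le_iff[of 1] fst_conv snd_conv) auto
  then show "\<bar>fst w - fst z\<bar> \<le> l\<^sup>2" "infnorm (snd w - snd z) \<le> l"
    using assms(2) by (simp_all only: infnorm_mul abs_divide) (auto simp: field_simps)
qed

lemma bounded_support_vanishes:
  assumes "\<And>w. \<phi> w \<noteq> 0 \<Longrightarrow> \<bar>fst w - fst z\<bar> \<le> l\<^sup>2 \<and> infnorm (snd w - snd z) \<le> l" "0 \<le> l"
  shows "vanishes_off (sqrt (l\<^sup>2 + \<bar>fst z\<bar>) + l + infnorm (snd z)) \<phi>"
  unfolding vanishes_off_def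
proof (intro allI impI, rule ccontr)
  fix w assume w: "sqrt (l\<^sup>2 + \<bar>fst z\<bar>) + l + infnorm (snd z) < pnorm w" "\<phi> w \<noteq> 0"
  have "\<bar>fst w\<bar> \<le> l\<^sup>2 + \<bar>fst z\<bar>" using assms(1)[OF w(2)] by auto
  then have "sqrt \<bar>fst w\<bar> \<le> sqrt (l\<^sup>2 + \<bar>fst z\<bar>)" by simp
  moreover have "infnorm (snd w) \<le> l + infnorm (snd z)"
    using infnorm_triangle[of "snd w - snd z" "snd z"] assms(1)[OF w(2)] by auto
  moreover have "0 \<le> sqrt (l\<^sup>2 + \<bar>fst z\<bar>)" by simp
  ultimately show False using w(1) assms(2) infnorm_pos_le[of "snd z"] unfolding pnorm_def less_max_iff_disj
    by (elim disjE) linarith+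
qed

lemma tests_rescale:
  assumes "\<eta> \<in> Br r" "0 < l"
  shows "rescale \<eta> l z \<in> tests r"
proof -
  have "rescale \<eta> l z \<in> Cr r" using sized_rescale[OF Br_sized] assms by (blast intro: sized_Cr)
  moreover have "vanishes_off (sqrt (l\<^sup>2 + \<bar>fst z\<bar>) + l + infnorm (snd z)) (rescale \<eta> l z)"
    by (rule bounded_support_vanishes) (use assms rescale_support[of \<eta> l z] in \<open>auto simp: Br_def\<close>)
  ultimately show ?thesis by (auto simp: tests_def)
qed

text \<open>Inverse to \<open>sized_rescale\<close>, and the bridge to all hypotheses stated for
  \<open>Br r\<close>: a function of size A supported within \<mu> of z is a multiple of a rescaled
  element of \<open>Br r\<close>. The base point z may be any point that close to the support. The
  factor is the amplitude times the parabolic volume, because \<open>rescale\<close> preserves the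
  integral.\<close>

lemma sized_imp_rescale:
  fixes \<phi> :: "'d::finite func"
  assumes "sized r A \<mu> \<phi>" "0 < A" "0 < \<mu>"
    and supp: "\<And>w. \<phi> w \<noteq> 0 \<Longrightarrow> \<bar>fst w - fst z\<bar> \<le> \<mu>\<^sup>2 \<and> infnorm (snd w - snd z) \<le> \<mu>"
  obtains \<eta> where "\<eta> \<in> Br r" "\<phi> = (\<lambda>w. (A * \<mu> ^ (CARD('d) + 2)) * rescale \<eta> \<mu> z w)"
proof
  define \<eta> where "\<eta> = (\<lambda>u. (1 / A) * \<phi> (\<mu>\<^sup>2 * fst u + fst z, \<mu> *\<^sub>R snd u + snd z))"
  obtain D where D: "derivs r \<phi> D" "\<And>k z. mdeg k \<le> r \<Longrightarrow> \<bar>D k z\<bar> \<le> A * (1 / \<mu>) powr mdeg k"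
    using assms unfolding sized_def by auto
  have d: "derivs r \<eta> (\<lambda>k w. (1 / A) * \<mu> powr mdeg k * D k (\<mu>\<^sup>2 * fst w + fst z, \<mu> *\<^sub>R snd w + snd z))"
    unfolding \<eta>_def using D(1) assms(3) by (rule derivs_affine)
  have "\<bar>(1 / A) * \<mu> powr mdeg k * D k u\<bar> \<le> 1" if "mdeg k \<le> r" for k u
  proof -
    have "\<bar>(1 / A) * \<mu> powr mdeg k * D k u\<bar> \<le> (1 / A) * \<mu> powr mdeg k * (A * (1 / \<mu>) powr mdeg k)"
      unfolding abs_mult using assms D(2)[OF that, of u] by (intro mult_mono) auto
    also have "\<dots> = 1" using assms by (simp add: powr_divide)
    finally show ?thesis .
  qed
  then have "Cr_norm r \<eta> \<le> ennreal 1" by (subst Cr_norm_le_iff[OF d]) auto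
  moreover have "vanishes_off 1 \<eta>"
    unfolding vanishes_off_def
  proof (intro allI impI, rule ccontr)
    fix u :: "'d pt" assume u: "1 < pnorm u" "\<eta> u \<noteq> 0"
    then have "\<phi> (\<mu>\<^sup>2 * fst u + fst z, \<mu> *\<^sub>R snd u + snd z) \<noteq> 0" by (simp add: \<eta>_def)
    from supp[OF this] have "pnorm u \<le> 1"
      using assms(3) by (simp add: pnorm_le_iff infnorm_mul abs_mult)
    with u show False by simp
  qed
  ultimately show "\<eta> \<in> Br r" using d by (auto simp: Br_def Cr_def)
  have "(1 / \<mu>) ^ (CARD('d) + 2) * \<mu> ^ (CARD('d) + 2) = 1"
    using assms by (simp add: power_one_over)
  then have "(A * \<mu> ^ (CARD('d) + 2)) * ((1 / \<mu>) ^ (CARD('d) + 2) * ((1 / A) * x)) = x" for x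
  proof -
    have "(A * \<mu> ^ (CARD('d) + 2)) * ((1 / \<mu>) ^ (CARD('d) + 2) * ((1 / A) * x)) = ((1 / \<mu>) ^ (CARD('d) + 2) * \<mu> ^ (CARD('d) + 2)) * (A * (1 / A) * x)"
      by (simp only: mult_ac)
    then show ?thesis
      unfolding \<open>(1 / \<mu>) ^ (CARD('d) + 2) * \<mu> ^ (CARD('d) + 2) = 1\<close> using assms(2) by simp
  qed
  moreover have "(\<mu>\<^sup>2 * ((fst w - fst z) / \<mu>\<^sup>2) + fst z, \<mu> *\<^sub>R (1 / \<mu>) *\<^sub>R (snd w - snd z) + snd z) = w" for w
    using assms(3) by (simp add: prod_eq_iff)
  ultimately show "\<phi> = (\<lambda>w. (A * \<mu> ^ (CARD('d) + 2)) * rescale \<eta> \<mu> z w)"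
    unfolding rescale_def \<eta>_def fst_conv snd_conv by simp
qed

lemma tests_add: "\<phi> \<in> tests r \<Longrightarrow> \<psi> \<in> tests r \<Longrightarrow> (\<lambda>z. \<phi> z + \<psi> z) \<in> tests r"
proof -
  assume "\<phi> \<in> tests r" "\<psi> \<in> tests r"
  then obtain D D' \<rho> \<rho>' where "derivs r \<phi> D" "derivs r \<psi> D'" "vanishes_off \<rho> \<phi>" "vanishes_off \<rho>' \<psi>"
    by (auto simp: tests_def Cr_def)
  then have "derivs r (\<lambda>z. \<phi> z + \<psi> z) (\<lambda>k z. D k z + D' k z)" "vanishes_off (max \<rho> \<rho>') (\<lambda>z. \<phi> z + \<psi> z)"
    by (auto intro: derivs_add simp: vanishes_off_def)
  then show ?thesis by (auto simp: tests_def Cr_def)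
qed

lemma vanishes_off_mult: "vanishes_off \<rho> \<phi> \<Longrightarrow> vanishes_off \<rho> (\<lambda>z. f z * \<phi> z)"
  by (simp add: vanishes_off_def)

lemma tests_mult: "f \<in> Cr r \<Longrightarrow> \<phi> \<in> tests r \<Longrightarrow> (\<lambda>z. f z * \<phi> z) \<in> tests r"
  using derivs_mult[of r f _ \<phi>] by (auto simp: tests_def Cr_def intro: vanishes_off_mult)

lemma tests_cmult: "\<phi> \<in> tests r \<Longrightarrow> (\<lambda>z. c * \<phi> z) \<in> tests r"
  using derivs_affine[of r \<phi> _ 1 c 0 0] by (auto simp: tests_def Cr_def intro: vanishes_off_mult)

lemma tests_0: "(\<lambda>z. 0) \<in> tests r"
  using derivs_0 by (auto simp: tests_def Cr_def vanishes_off_def)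

lemma tests_sum: "(\<And>i. i \<in> I \<Longrightarrow> f i \<in> tests r) \<Longrightarrow> (\<lambda>z. \<Sum>i\<in>I. f i z) \<in> tests r"
  by (induction I rule: infinite_finite_induct) (auto intro: tests_add tests_0)

lemma distribution_add: "\<xi> \<in> distributions r \<Longrightarrow> \<phi> \<in> tests r \<Longrightarrow> \<psi> \<in> tests r \<Longrightarrow> \<xi> (\<lambda>z. \<phi> z + \<psi> z) = \<xi> \<phi> + \<xi> \<psi>"
  by (simp add: distributions_def)

lemma distribution_cmult: "\<xi> \<in> distributions r \<Longrightarrow> \<phi> \<in> tests r \<Longrightarrow> \<xi> (\<lambda>z. c * \<phi> z) = c * \<xi> \<phi>"
  by (simp add: distributions_def)

lemma distribution_0: "\<xi> \<in> distributions r \<Longrightarrow> \<xi> (\<lambda>z. 0) = 0"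
  using distribution_cmult[OF _ tests_0, of \<xi> r 0] by simp

lemma distribution_sum:
  "\<xi> \<in> distributions r \<Longrightarrow> (\<And>i. i \<in> I \<Longrightarrow> f i \<in> tests r) \<Longrightarrow> \<xi> (\<lambda>z. \<Sum>i\<in>I. f i z) = (\<Sum>i\<in>I. \<xi> (f i))"
proof (induction I rule: infinite_finite_induct)
  case (insert x F)
  then have "\<xi> (\<lambda>z. f x z + (\<Sum>i\<in>F. f i z)) = \<xi> (f x) + \<xi> (\<lambda>z. \<Sum>i\<in>F. f i z)"
    by (intro distribution_add tests_sum) auto
  then show ?case using insert by simp
qed (auto simp: distribution_0)

lemma distribution_bound:
  "\<xi> \<in> distributions r \<Longrightarrow> \<exists>K. \<forall>\<phi>\<in>tests r. vanishes_off \<rho> \<phi> \<longrightarrow> ennreal \<bar>\<xi> \<phi>\<bar> \<le> ennreal K * Cr_norm r \<phi>"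
  by (simp add: distributions_def)

lemma distribution_lincomb:
  assumes "\<xi> \<in> distributions r" "\<zeta> \<in> distributions r"
  shows "(\<lambda>\<phi>. a * \<xi> \<phi> + b * \<zeta> \<phi>) \<in> distributions r"
proof -
  have "\<exists>K. \<forall>\<phi>\<in>tests r. vanishes_off \<rho> \<phi> \<longrightarrow> ennreal \<bar>a * \<xi> \<phi> + b * \<zeta> \<phi>\<bar> \<le> ennreal K * Cr_norm r \<phi>" for \<rho>
  proof -
    obtain K where K: "\<And>\<phi>. \<phi> \<in> tests r \<Longrightarrow> vanishes_off \<rho> \<phi> \<Longrightarrow> ennreal \<bar>\<xi> \<phi>\<bar> \<le> ennreal K * Cr_norm r \<phi>"
      using distribution_bound[OF assms(1), of \<rho>] by blast
    obtain K' where K': "\<And>\<phi>. \<phi> \<in> tests r \<Longrightarrow> vanishes_off \<rho> \<phi> \<Longrightarrow> ennreal \<bar>\<zeta> \<phi>\<bar> \<le> ennreal K' * Cr_norm r \<phi>"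
      using distribution_bound[OF assms(2), of \<rho>] by blast
    have "ennreal \<bar>a * \<xi> \<phi> + b * \<zeta> \<phi>\<bar> \<le> ennreal (\<bar>a\<bar> * \<bar>K\<bar> + \<bar>b\<bar> * \<bar>K'\<bar>) * Cr_norm r \<phi>" if "\<phi> \<in> tests r" "vanishes_off \<rho> \<phi>" for \<phi>
    proof -
      have "ennreal \<bar>a * \<xi> \<phi> + b * \<zeta> \<phi>\<bar> \<le> ennreal (\<bar>a\<bar> * \<bar>\<xi> \<phi>\<bar> + \<bar>b\<bar> * \<bar>\<zeta> \<phi>\<bar>)"
        by (intro ennreal_leI) (simp add: abs_triangle_ineq flip: abs_mult)
      also have "\<dots> = ennreal \<bar>a\<bar> * ennreal \<bar>\<xi> \<phi>\<bar> + ennreal \<bar>b\<bar> * ennreal \<bar>\<zeta> \<phi>\<bar>"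
        by (simp add: ennreal_mult)
      also have "\<dots> \<le> ennreal \<bar>a\<bar> * (ennreal K * Cr_norm r \<phi>) + ennreal \<bar>b\<bar> * (ennreal K' * Cr_norm r \<phi>)"
        using K K' that by (intro add_mono mult_left_mono) auto
      also have "\<dots> \<le> ennreal \<bar>a\<bar> * (ennreal \<bar>K\<bar> * Cr_norm r \<phi>) + ennreal \<bar>b\<bar> * (ennreal \<bar>K'\<bar> * Cr_norm r \<phi>)"
        by (intro add_mono mult_left_mono mult_right_mono ennreal_leI) auto
      finally show ?thesis by (simp add: distrib_right ennreal_mult mult.assoc)
    qed
    then show ?thesis by blast
  qed
  then show ?thesis using assms unfolding distributions_def by (auto simp: algebra_simps)
qed

section \<open>A dyadic smooth partition of unity\<close>

text \<open>The counterpart of \<open>derivs\<close> in one variable. Finitely many derivatives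
  suffice, since r is fixed; this permits bump functions built by repeated integration of a
  piecewise linear one.\<close>

definition deriv_chain :: "nat \<Rightarrow> (real \<Rightarrow> real) \<Rightarrow> (nat \<Rightarrow> real \<Rightarrow> real) \<Rightarrow> bool" where
  "deriv_chain N f D \<longleftrightarrow> D 0 = f \<and> (\<forall>i\<le>N. continuous_on UNIV (D i)) \<and>
     (\<forall>i<N. \<forall>x. (D i has_real_derivative D (Suc i) x) (at x))"

lemma deriv_chain_affine:
  assumes "deriv_chain N f D"
  shows "deriv_chain N (\<lambda>x. f (a * x + b)) (\<lambda>i x. a ^ i * D i (a * x + b))"
  unfolding deriv_chain_def
proof (intro conjI allI impI)
  show "(\<lambda>x. a ^ 0 * D 0 (a * x + b)) = (\<lambda>x. f (a * x + b))"
    using assms by (simp add: deriv_chain_def)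
next
  fix i assume "i \<le> N"
  then have "continuous_on UNIV (D i)" using assms by (simp add: deriv_chain_def)
  then have "continuous_on UNIV (\<lambda>x. D i (a * x + b))"
    by (rule continuous_on_compose2) (auto intro!: continuous_intros)
  then show "continuous_on UNIV (\<lambda>x. a ^ i * D i (a * x + b))" by (intro continuous_intros)
next
  fix i x assume "i < N"
  then have "(D i has_real_derivative D (Suc i) (a * x + b)) (at (a * x + b))"
    using assms by (simp add: deriv_chain_def)
  then have "((\<lambda>x. D i (a * x + b)) has_real_derivative D (Suc i) (a * x + b) * a) (at x)"
    by (rule DERIV_chain2) (auto intro!: derivative_eq_intros)
  then have "((\<lambda>x. a ^ i * D i (a * x + b)) has_real_derivative a ^ i * (D (Suc i) (a * x + b) * a)) (at x)"
    by (rule DERIV_cmult)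
  then show "((\<lambda>x. a ^ i * D i (a * x + b)) has_real_derivative a ^ Suc i * D (Suc i) (a * x + b)) (at x)"
    by (simp add: mult_ac)
qed

lemma deriv_chain_diff:
  "deriv_chain N f D \<Longrightarrow> deriv_chain N g E \<Longrightarrow> deriv_chain N (\<lambda>x. f x - g x) (\<lambda>i x. D i x - E i x)"
  unfolding deriv_chain_def by (auto intro!: continuous_intros DERIV_diff)

text \<open>Averaging over unit intervals gains one derivative.\<close>

lemma smooth_step:
  "\<exists>S D. deriv_chain N S D \<and> (\<forall>x\<le>0. S x = 0) \<and> (\<forall>x\<ge>real N + 1. S x = (1::real))"
proof (induction N)
  case 0
  have "deriv_chain 0 (\<lambda>x::real. max 0 (min 1 x)) (\<lambda>_ x. max 0 (min 1 x))"
    unfolding deriv_chain_def by (auto intro!: continuous_intros)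
  then show ?case by (intro exI[of _ "\<lambda>x::real. max 0 (min 1 x)"]) auto
next
  case (Suc N)
  then obtain S D where S: "deriv_chain N S D" "\<And>x. x \<le> 0 \<Longrightarrow> S x = 0" "\<And>x. real N + 1 \<le> x \<Longrightarrow> S x = 1"
    by auto
  have "D 0 = S" "continuous_on UNIV (D 0)" using S(1) unfolding deriv_chain_def by auto
  then have cont: "continuous_on UNIV S" by simp
  then have "isCont S x" for x by (simp add: continuous_on_eq_continuous_at)
  then obtain F where F: "\<And>x. (F has_real_derivative S x) (at x)"
    using einterval_antiderivative[of "-\<infinity>" "\<infinity>" S]
    by (auto simp: has_real_derivative_iff_has_vector_derivative)
  \<comment> \<open>The average of S over a unit interval is a value of S inside it. The value 0
    thus persists on the left, and the value 1 from one unit further to the right.\<close>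
  have mvt: "\<exists>y. x - 1 < y \<and> y < x \<and> F x - F (x - 1) = S y" for x
    using MVT2[of "x - 1" x F S] F by auto
  have "deriv_chain (Suc N) (\<lambda>x. F x - F (x - 1)) (\<lambda>i x. case i of 0 \<Rightarrow> F x - F (x - 1) | Suc i \<Rightarrow> D i x - D i (x - 1))"
    unfolding deriv_chain_def
  proof (intro conjI allI impI)
    have dF: "((\<lambda>x. F x - F (x - 1)) has_real_derivative S x - S (x - 1)) (at x)" for x
    proof -
      have "((\<lambda>x. F (x - 1)) has_real_derivative S (x - 1) * 1) (at x)"
        by (rule DERIV_chain2[OF F]) (auto intro!: derivative_eq_intros)
      then show ?thesis using DERIV_diff[OF F[of x]] by auto
    qed
    fix i
    show "continuous_on UNIV (\<lambda>x. case i of 0 \<Rightarrow> F x - F (x - 1) | Suc i \<Rightarrow> D i x - D i (x - 1))" if "i \<le> Suc N"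
    proof (cases i)
      case 0
      then show ?thesis using DERIV_continuous_on[OF DERIV_subset[OF dF subset_UNIV]] by simp
    next
      case (Suc i')
      then have "continuous_on UNIV (D i')" using S(1) that by (simp add: deriv_chain_def)
      moreover from this have "continuous_on UNIV (\<lambda>x. D i' (x - 1))"
        by (rule continuous_on_compose2) (auto intro!: continuous_intros)
      ultimately show ?thesis using Suc by (auto intro: continuous_on_diff)
    qed
    fix x
    show "((\<lambda>x. case i of 0 \<Rightarrow> F x - F (x - 1) | Suc i \<Rightarrow> D i x - D i (x - 1)) has_real_derivative
      (case Suc i of 0 \<Rightarrow> F x - F (x - 1) | Suc i \<Rightarrow> D i x - D i (x - 1))) (at x)" if "i < Suc N"
    proof (cases i)
      case 0
      then show ?thesis using dF S(1) by (simp add: deriv_chain_def)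
    next
      case (Suc i')
      then have d: "(D i' has_real_derivative D (Suc i') x) (at x)" for x
        using S(1) that by (simp add: deriv_chain_def)
      have "((\<lambda>x. D i' (x - 1)) has_real_derivative D (Suc i') (x - 1) * 1) (at x)"
        by (rule DERIV_chain2[OF d]) (auto intro!: derivative_eq_intros)
      then show ?thesis using DERIV_diff[OF d] Suc by auto
    qed
  qed auto
  moreover have "F x - F (x - 1) = 0" if "x \<le> 0" for x
    using mvt[of x] S(2) that by force
  moreover have "F x - F (x - 1) = 1" if "real (Suc N) + 1 \<le> x" for x
    using mvt[of x] S(3) that by force
  ultimately show ?case by blast
qed

text \<open>At each x at most the two integer translates with indices
  \<open>\<lfloor>x\<rfloor>\<close> and \<open>\<lfloor>x\<rfloor> + 1\<close> are nonzero. The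
  last clause, taken at the fractional part, says that they add up to 1.\<close>

definition is_bump :: "nat \<Rightarrow> (real \<Rightarrow> real) \<Rightarrow> bool" where
  "is_bump N b \<longleftrightarrow> (\<exists>D. deriv_chain N b D) \<and> (\<forall>x. 1 \<le> \<bar>x\<bar> \<longrightarrow> b x = 0) \<and>
     (\<forall>u. 0 \<le> u \<and> u < 1 \<longrightarrow> b u + b (u - 1) = 1)"

text \<open>A difference of two consecutive translates of a smooth step: the sum
  \<open>b u + b (u - 1)\<close> telescopes to \<open>T (u + 1) - T (u - 1) = 1\<close>. The
  dilation by \<open>N + 1\<close> squeezes the transition of the step into the unit
  interval.\<close>

lemma ex_bump: "\<exists>b. is_bump N b"
proof -
  obtain S D where S: "deriv_chain N S D" "\<And>x. x \<le> 0 \<Longrightarrow> S x = 0" "\<And>x. real N + 1 \<le> x \<Longrightarrow> S x = (1::real)"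
    using smooth_step by metis
  define T where "T x = S ((real N + 1) * x)" for x
  have T: "T x = 0" if "x \<le> 0" for x
    unfolding T_def by (rule S(2)) (use that in \<open>simp add: mult_nonneg_nonpos\<close>)
  have T1: "T x = 1" if "1 \<le> x" for x
    unfolding T_def by (rule S(3)) (use mult_left_mono[OF that, of "real N + 1"] in simp)
  have "deriv_chain N (\<lambda>x. S ((real N + 1) * x + (real N + 1)) - S ((real N + 1) * x + 0))
     (\<lambda>i x. (real N + 1) ^ i * D i ((real N + 1) * x + (real N + 1)) - (real N + 1) ^ i * D i ((real N + 1) * x + 0))"
    by (intro deriv_chain_diff deriv_chain_affine S)
  then have "\<exists>D. deriv_chain N (\<lambda>x. T (x + 1) - T x) D"
    unfolding T_def by (auto simp: algebra_simps)
  moreover have "T (x + 1) - T x = 0" if "1 \<le> \<bar>x\<bar>" for x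
    using T[of x] T[of "x + 1"] T1[of x] T1[of "x + 1"] that by (cases "0 \<le> x") auto
  moreover have "T (u + 1) - T u + (T (u - 1 + 1) - T (u - 1)) = 1" if "0 \<le> u" "u < 1" for u
    using T[of "u - 1"] T1[of "u + 1"] that by simp
  ultimately have "is_bump N (\<lambda>x. T (x + 1) - T x)" unfolding is_bump_def by blast
  then show ?thesis by blast
qed

definition bump :: "real \<Rightarrow> real \<Rightarrow> real" where
  "bump r = (SOME b. is_bump (nat \<lceil>r\<rceil>) b)"

lemma is_bump: "is_bump (nat \<lceil>r\<rceil>) (bump r)"
  unfolding bump_def by (rule someI_ex[OF ex_bump])

lemma bump_sum:
  assumes "finite A" "{\<lfloor>x\<rfloor>, \<lfloor>x\<rfloor> + 1} \<subseteq> A"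
  shows "(\<Sum>j\<in>A. bump r (x - of_int j)) = 1"
proof -
  have "bump r (x - of_int j) = 0" if "j \<notin> {\<lfloor>x\<rfloor>, \<lfloor>x\<rfloor> + 1}" for j
  proof -
    have "j + 1 \<le> \<lfloor>x\<rfloor> \<or> \<lfloor>x\<rfloor> + 2 \<le> j" using that by auto
    then have "1 \<le> \<bar>x - of_int j\<bar>" by linarith
    then show ?thesis using is_bump by (simp add: is_bump_def)
  qed
  then have "(\<Sum>j\<in>A. bump r (x - of_int j)) = (\<Sum>j\<in>{\<lfloor>x\<rfloor>, \<lfloor>x\<rfloor> + 1}. bump r (x - of_int j))"
    using assms by (intro sum.mono_neutral_right) auto
  also have "\<dots> = bump r (frac x) + bump r (frac x - 1)"
    by (simp add: frac_def algebra_simps)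
  also have "\<dots> = 1"
    using is_bump[of r] frac_ge_0[of x] frac_lt_1[of x] unfolding is_bump_def by blast
  finally show ?thesis .
qed

lemma bump_nonzero: "bump r (x - of_int j) \<noteq> 0 \<Longrightarrow> j \<in> {\<lfloor>x\<rfloor>, \<lfloor>x\<rfloor> + 1}"
proof (rule ccontr)
  assume a: "bump r (x - of_int j) \<noteq> 0" "j \<notin> {\<lfloor>x\<rfloor>, \<lfloor>x\<rfloor> + 1}"
  then have "j + 1 \<le> \<lfloor>x\<rfloor> \<or> \<lfloor>x\<rfloor> + 2 \<le> j" by auto
  then have "1 \<le> \<bar>x - of_int j\<bar>" by linarith
  then show False using is_bump a(1) by (simp add: is_bump_def)
qed

lemma coord_add: "coord (z + s *\<^sub>R unit_vec i) j = coord z j + (if i = j then s else 0)"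
  by (cases i; cases j) (auto simp: axis_def)

lemma continuous_on_coord: "continuous_on UNIV (\<lambda>z. coord z j)"
  by (cases j) (auto intro!: continuous_intros)

text \<open>Only the pure derivatives in the coordinate j survive, and their order
  \<open>k j\<close> is at most \<open>mdeg k\<close>, so N derivatives with
  \<open>r \<le> N\<close> suffice.\<close>

lemma Cr_coord:
  assumes g: "deriv_chain N g G" and N: "r \<le> real N"
  shows "(\<lambda>z::'d::finite pt. g (coord z j)) \<in> Cr r"
proof -
  define D where "D k z = (if \<forall>i. i \<noteq> j \<longrightarrow> k i = 0 then G (k j) (coord z j) else 0)" for k :: "'d midx" and z
  have kN: "k j \<le> N" if "mdeg k \<le> r" for k :: "'d midx"
    using component_le_mdeg[of k j] that N by linarith
  have D1: "D k = (\<lambda>z. G (k j) (coord z j))" if "\<forall>i. i \<noteq> j \<longrightarrow> k i = 0" for k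
    unfolding D_def by (intro ext if_P that)
  have D0: "D k = (\<lambda>z. 0)" if "\<not> (\<forall>i. i \<noteq> j \<longrightarrow> k i = 0)" for k
    unfolding D_def by (intro ext if_not_P that)
  have "derivs r (\<lambda>z. g (coord z j)) D"
    unfolding derivs_def
  proof (intro conjI allI impI)
    show "D (\<lambda>_. 0) = (\<lambda>z. g (coord z j))" using g by (auto simp: D_def deriv_chain_def)
    fix k :: "'d midx"
    show "continuous_on UNIV (D k)" if "mdeg k \<le> r"
    proof -
      have "continuous_on UNIV (G (k j))" using g kN[OF that] by (simp add: deriv_chain_def)
      then have "continuous_on UNIV (\<lambda>z. G (k j) (coord z j))"
        by (rule continuous_on_compose2) (auto intro: continuous_on_coord)
      then show ?thesis using D0[of k] D1[of k] by (cases "\<forall>i. i \<noteq> j \<longrightarrow> k i = 0") auto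
    qed
    fix i z assume m: "mdeg (k(i := Suc (k i))) \<le> r"
    show "((\<lambda>s. D k (z + s *\<^sub>R unit_vec i)) has_real_derivative D (k(i := Suc (k i))) z) (at 0)"
    proof (cases "\<forall>l. l \<noteq> j \<longrightarrow> k l = 0")
      case True
      note z = this
      show ?thesis
      proof (cases "i = j")
        case ij: True
        have "k j < N" using kN[OF m] ij by simp
        then have "(G (k j) has_real_derivative G (Suc (k j)) (coord z j)) (at (coord z j + 0))"
          using g by (simp add: deriv_chain_def)
        then have "((\<lambda>s. G (k j) (coord z j + s)) has_real_derivative G (Suc (k j)) (coord z j) * 1) (at 0)"
          by (rule DERIV_chain2) (auto intro!: derivative_eq_intros)
        moreover have "\<forall>l. l \<noteq> j \<longrightarrow> (k(i := Suc (k i))) l = 0" using z ij by auto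
        ultimately show ?thesis using ij D1[OF z] D1[of "k(i := Suc (k i))"] by (simp add: coord_add)
      next
        case False
        then have "\<not> (\<forall>l. l \<noteq> j \<longrightarrow> (k(i := Suc (k i))) l = 0)" by auto
        from D0[OF this] show ?thesis using D1[OF z] False by (simp only: coord_add if_False DERIV_const add_0_right)
      qed
    next
      case False
      then have "\<not> (\<forall>l. l \<noteq> j \<longrightarrow> (k(i := Suc (k i))) l = 0)" by auto
      from D0[OF this] D0[OF False] show ?thesis by (simp only: DERIV_const)
    qed
  qed
  then show ?thesis by (auto simp: Cr_def)
qed

lemma Cr_mult: "f \<in> Cr r \<Longrightarrow> g \<in> Cr r \<Longrightarrow> (\<lambda>z. f z * g z) \<in> Cr r"
  using derivs_mult by (auto simp: Cr_def) blast

lemma Cr_prod: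
  fixes f :: "'i \<Rightarrow> 'a::finite func"
  shows "(\<And>i. i \<in> I \<Longrightarrow> f i \<in> Cr r) \<Longrightarrow> (\<lambda>z. \<Prod>i\<in>I. f i z) \<in> Cr r"
proof (induction I rule: infinite_finite_induct)
  have "derivs r (\<lambda>z::'a pt. 1) (\<lambda>k z. if k = (\<lambda>_. 0) then 1 else 0)"
    unfolding derivs_def by (auto simp: fun_eq_iff fun_upd_def intro!: continuous_intros)
  then have "(\<lambda>z::'a pt. 1) \<in> Cr r" by (auto simp: Cr_def)
  then show "(\<lambda>z. \<Prod>i\<in>{}. f i z) \<in> Cr r" and "\<And>A. infinite A \<Longrightarrow> (\<lambda>z. \<Prod>i\<in>A. f i z) \<in> Cr r" by simp_all
qed (auto intro: Cr_mult)

lemma infnorm_vec: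
  fixes y :: "real ^ 'd::finite"
  shows "infnorm y < l \<longleftrightarrow> (\<forall>i. \<bar>y $ i\<bar> < l)" "infnorm y \<le> l \<longleftrightarrow> (\<forall>i. \<bar>y $ i\<bar> \<le> l)"
proof -
  have e: "{\<bar>y $ i\<bar> |i. i \<in> UNIV} = range (\<lambda>i. \<bar>y $ i\<bar>)" by auto
  show "infnorm y < l \<longleftrightarrow> (\<forall>i. \<bar>y $ i\<bar> < l)" "infnorm y \<le> l \<longleftrightarrow> (\<forall>i. \<bar>y $ i\<bar> \<le> l)"
    unfolding infnorm_cart e by (subst cSup_eq_Max; auto)+
qed

definition bump_func :: "real \<Rightarrow> 'd::finite func" where
  "bump_func r z = bump r (fst z) * (\<Prod>i\<in>UNIV. bump r (snd z $ i))"

lemma bump_func_tests: "(bump_func r :: 'a::finite func) \<in> tests r"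
proof -
  obtain D where D: "deriv_chain (nat \<lceil>r\<rceil>) (bump r) D" using is_bump[of r] by (auto simp: is_bump_def)
  have r: "r \<le> real (nat \<lceil>r\<rceil>)" by (rule real_nat_ceiling_ge)
  have "(\<lambda>z::'a pt. bump r (coord z None) * (\<Prod>i\<in>UNIV. bump r (coord z (Some i)))) \<in> Cr r"
    by (intro Cr_mult Cr_prod Cr_coord[OF D r])
  then have "(bump_func r :: 'a func) \<in> Cr r" by (simp add: bump_func_def[abs_def])
  moreover have "vanishes_off 1 (bump_func r :: 'a func)"
    unfolding vanishes_off_def
  proof (intro allI impI, rule ccontr)
    fix z :: "'a pt" assume z: "1 < pnorm z" "bump_func r z \<noteq> 0"
    then have "bump r (fst z) \<noteq> 0" "\<And>i. bump r (snd z $ i) \<noteq> 0" by (auto simp: bump_func_def)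
    then have "\<bar>fst z\<bar> < 1" "\<And>i. \<bar>snd z $ i\<bar> < 1"
      using is_bump[of r] by (force simp: is_bump_def not_less)+
    then have "pnorm z \<le> 1" by (auto simp: pnorm_le_iff infnorm_vec intro: less_imp_le)
    with z show False by simp
  qed
  ultimately show ?thesis by (auto simp: tests_def)
qed

definition dl :: "nat \<Rightarrow> real" where "dl m = (1 / 2) ^ m"

lemma dl_pos [simp]: "0 < dl m" by (simp add: dl_def)
lemma dl_le_1 [simp]: "dl m \<le> 1" by (simp add: dl_def power_le_one)
lemma dl_Suc: "dl (Suc m) = dl m / 2" by (simp add: dl_def)
lemma dl_square: "(dl m)\<^sup>2 = (1 / 2) ^ (2 * m)" by (simp add: dl_def power_mult mult.commute flip: power_mult)
lemma dl_nonneg [simp]: "0 \<le> dl m" and dl_nz [simp]: "dl m \<noteq> 0" by (simp_all add: dl_def)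

type_synonym 'd idx = "int \<times> ('d \<Rightarrow> int)"

definition corner :: "nat \<Rightarrow> ('d::finite \<Rightarrow> int) \<Rightarrow> real ^ 'd" where
  "corner m \<kappa> = (\<chi> i. dl m * of_int (\<kappa> i))"

definition pu :: "real \<Rightarrow> nat \<Rightarrow> 'd::finite idx \<Rightarrow> 'd func" where
  "pu r m k z = bump_func r ((1 / dl m)\<^sup>2 * fst z + - of_int (fst k), (1 / dl m) *\<^sub>R snd z + - (\<chi> i. of_int (snd k i)))"

lemma pu_eq: "pu r m k z = bump r (fst z / (dl m)\<^sup>2 - of_int (fst k)) * (\<Prod>i\<in>UNIV. bump r (snd z $ i / dl m - of_int (snd k i)))"
  by (simp add: pu_def bump_func_def power_divide)

text \<open>All partition functions are parabolic dilations and translates of the single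
  \<open>bump_func r\<close>, hence one constant serves every level and every index.\<close>

lemma pu_sized: "\<exists>C>0. \<forall>m (k::'d::finite idx). sized r C (dl m) (pu r m k)"
proof -
  obtain A where "sized r A 1 (bump_func r :: 'd func)" using testsD[OF bump_func_tests] by blast
  then obtain D where D: "derivs r (bump_func r :: 'd func) D" "\<And>k z. mdeg k \<le> r \<Longrightarrow> \<bar>D k z\<bar> \<le> A"
    unfolding sized_def by auto
  have "sized r (\<bar>A\<bar> + 1) (dl m) (pu r m k)" for m and k :: "'d idx"
  proof -
    have "derivs r (\<lambda>w. 1 * bump_func r ((1 / dl m)\<^sup>2 * fst w + - of_int (fst k), (1 / dl m) *\<^sub>R snd w + - (\<chi> i. of_int (snd k i))))
      (\<lambda>q w. 1 * (1 / dl m) powr mdeg q * D q ((1 / dl m)\<^sup>2 * fst w + - of_int (fst k), (1 / dl m) *\<^sub>R snd w + - (\<chi> i. of_int (snd k i))))"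
      by (rule derivs_affine[OF D(1)]) simp
    moreover have "\<bar>1 * (1 / dl m) powr mdeg q * D q z\<bar> \<le> (\<bar>A\<bar> + 1) * (1 / dl m) powr mdeg q" if "mdeg q \<le> r" for q z
    proof -
      have "\<bar>D q z\<bar> \<le> \<bar>A\<bar> + 1" using D(2)[OF that, of z] by linarith
      then have "(1 / dl m) powr mdeg q * \<bar>D q z\<bar> \<le> (1 / dl m) powr mdeg q * (\<bar>A\<bar> + 1)" by (intro mult_left_mono) auto
      then show ?thesis by (simp add: abs_mult mult.commute)
    qed
    ultimately show ?thesis unfolding sized_def pu_def[abs_def] by (auto simp only: mult_1)
  qed
  then show ?thesis by (intro exI[of _ "\<bar>A\<bar> + 1"]) auto
qed

lemma pu_Cr: "pu r m k \<in> Cr r"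
  using pu_sized[of r] sized_Cr by blast

lemma pu_support:
  assumes "pu r m k z \<noteq> 0"
  shows "\<bar>fst z - (dl m)\<^sup>2 * of_int (fst k)\<bar> \<le> (dl m)\<^sup>2" "infnorm (snd z - corner m (snd k)) \<le> dl m"
proof -
  have b: "\<bar>x\<bar> < 1" if "bump r x \<noteq> 0" for x
    using that is_bump[of r] by (force simp: is_bump_def not_less)
  have "\<bar>fst z / (dl m)\<^sup>2 - of_int (fst k)\<bar> < 1" "\<And>i. \<bar>snd z $ i / dl m - of_int (snd k i)\<bar> < 1"
    using assms by (auto simp: pu_eq intro!: b)
  then have 1: "(dl m)\<^sup>2 * \<bar>fst z / (dl m)\<^sup>2 - of_int (fst k)\<bar> \<le> (dl m)\<^sup>2 * 1"
    "\<And>i. dl m * \<bar>snd z $ i / dl m - of_int (snd k i)\<bar> \<le> dl m * 1"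
    by (intro mult_left_mono; simp add: less_imp_le)+
  have "(dl m)\<^sup>2 * \<bar>fst z / (dl m)\<^sup>2 - of_int (fst k)\<bar> = \<bar>(dl m)\<^sup>2 * (fst z / (dl m)\<^sup>2 - of_int (fst k))\<bar>"
    "\<And>i. dl m * \<bar>snd z $ i / dl m - of_int (snd k i)\<bar> = \<bar>dl m * (snd z $ i / dl m - of_int (snd k i))\<bar>"
    by (simp_all add: abs_mult)
  with 1 show "\<bar>fst z - (dl m)\<^sup>2 * of_int (fst k)\<bar> \<le> (dl m)\<^sup>2" "infnorm (snd z - corner m (snd k)) \<le> dl m"
    by (simp_all add: infnorm_vec corner_def right_diff_distrib)
qed

text \<open>K may be replaced by the product box of the two nearest integers in each coordinate,
  over which the sum of products factors into one-dimensional sums, each equal to 1.\<close>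

lemma pu_sum:
  assumes "finite K" "\<And>k. pu r m k z \<noteq> 0 \<Longrightarrow> k \<in> K"
  shows "(\<Sum>k\<in>K. pu r m k (z::'d::finite pt)) = 1"
proof -
  define A where "A i = {\<lfloor>snd z $ i / dl m\<rfloor>, \<lfloor>snd z $ i / dl m\<rfloor> + 1}" for i
  define A0 where "A0 = {\<lfloor>fst z / (dl m)\<^sup>2\<rfloor>, \<lfloor>fst z / (dl m)\<^sup>2\<rfloor> + 1}"
  define K0 where "K0 = A0 \<times> PiE UNIV A"
  have fin: "finite K0" by (auto simp: K0_def A0_def A_def intro!: finite_PiE)
  have nz: "k \<in> K0" if "pu r m k z \<noteq> 0" for k
  proof -
    have "fst k \<in> A0" "\<And>i. snd k i \<in> A i"
      using that unfolding A0_def A_def by (intro bump_nonzero[of r]; auto simp: pu_eq)+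
    then show ?thesis by (cases k) (auto simp: K0_def PiE_UNIV_domain)
  qed
  have "(\<Sum>k\<in>K. pu r m k z) = (\<Sum>k\<in>K \<union> K0. pu r m k z)"
    using assms fin by (intro sum.mono_neutral_left) auto
  also have "\<dots> = (\<Sum>k\<in>K0. pu r m k z)"
    using assms fin nz by (intro sum.mono_neutral_right) auto
  also have "\<dots> = (\<Sum>j\<in>A0. \<Sum>\<kappa>\<in>PiE UNIV A. bump r (fst z / (dl m)\<^sup>2 - of_int j) * (\<Prod>i\<in>UNIV. bump r (snd z $ i / dl m - of_int (\<kappa> i))))"
    unfolding K0_def sum.cartesian_product by (intro sum.cong) (auto simp: pu_eq)
  also have "\<dots> = (\<Sum>j\<in>A0. bump r (fst z / (dl m)\<^sup>2 - of_int j)) * (\<Sum>\<kappa>\<in>PiE UNIV A. (\<Prod>i\<in>UNIV. bump r (snd z $ i / dl m - of_int (\<kappa> i))))"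
    by (simp add: sum_product)
  also have "(\<Sum>\<kappa>\<in>PiE UNIV A. (\<Prod>i\<in>UNIV. bump r (snd z $ i / dl m - of_int (\<kappa> i)))) = (\<Prod>i\<in>UNIV. \<Sum>j\<in>A i. bump r (snd z $ i / dl m - of_int j))"
    by (rule prod_sum_PiE[symmetric]) (auto simp: A_def)
  also have "\<dots> = 1"
    by (intro prod.neutral ballI bump_sum) (auto simp: A_def)
  also have "(\<Sum>j\<in>A0. bump r (fst z / (dl m)\<^sup>2 - of_int j)) = 1"
    by (rule bump_sum) (auto simp: A0_def)
  finally show ?thesis by simp
qed

definition supp_idx :: "real \<Rightarrow> nat \<Rightarrow> 'd::finite func \<Rightarrow> 'd idx set" where
  "supp_idx r m \<phi> = {k. \<exists>z. pu r m k z * \<phi> z \<noteq> 0}"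

lemma finite_near_idx:
  assumes \<rho>: "0 \<le> \<rho>"
  shows "finite {k :: 'd::finite idx. \<exists>z. pnorm z \<le> \<rho> \<and> pu r m k z \<noteq> 0}"
proof -
  let ?K = "{k :: 'd idx. \<exists>z. pnorm z \<le> \<rho> \<and> pu r m k z \<noteq> 0}"
  define M :: int where "M = \<lceil>\<rho>\<^sup>2 / (dl m)\<^sup>2\<rceil> + \<lceil>\<rho> / dl m\<rceil> + 1"
  have "?K \<subseteq> {-M..M} \<times> {\<kappa>. \<forall>i. (i \<in> UNIV \<longrightarrow> \<kappa> i \<in> {-M..M}) \<and> (i \<notin> UNIV \<longrightarrow> \<kappa> i = 0)}"
  proof
    fix k assume "k \<in> ?K"
    then obtain w where w: "pu r m k w \<noteq> 0" "pnorm w \<le> \<rho>" by blast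
    have "\<bar>fst w\<bar> \<le> \<rho>\<^sup>2" "infnorm (snd w) \<le> \<rho>" using w(2) \<rho> by (auto simp: pnorm_le_iff)
    then have n: "\<bar>fst w\<bar> \<le> \<rho>\<^sup>2" "\<And>i. \<bar>snd w $ i\<bar> \<le> \<rho>" by (auto simp: infnorm_vec)
    have *: "\<bar>j\<bar> \<le> \<lceil>b\<rceil> + 1" if "j \<in> {\<lfloor>x\<rfloor>, \<lfloor>x\<rfloor> + 1}" "\<bar>x\<bar> \<le> b" for j and x b :: real
      using that by (auto; linarith)
    have k1: "\<bar>fst k\<bar> \<le> \<lceil>\<rho>\<^sup>2 / (dl m)\<^sup>2\<rceil> + 1"
      by (rule *[OF bump_nonzero[of r "fst w / (dl m)\<^sup>2"]]) (use w n in \<open>auto simp: pu_eq divide_right_mono\<close>)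
    have k2: "\<bar>snd k i\<bar> \<le> \<lceil>\<rho> / dl m\<rceil> + 1" for i
      by (rule *[OF bump_nonzero[of r "snd w $ i / dl m"]]) (use w n in \<open>auto simp: pu_eq divide_right_mono\<close>)
    have k3: "0 \<le> \<lceil>\<rho>\<^sup>2 / (dl m)\<^sup>2\<rceil>" "0 \<le> \<lceil>\<rho> / dl m\<rceil>" 
    proof -
      have "0 \<le> \<rho>\<^sup>2 / (dl m)\<^sup>2" "0 \<le> \<rho> / dl m" using \<rho> by auto
      then show "0 \<le> \<lceil>\<rho>\<^sup>2 / (dl m)\<^sup>2\<rceil>" "0 \<le> \<lceil>\<rho> / dl m\<rceil>" by linarith+
    qed
    have "\<bar>fst k\<bar> \<le> M" using k1 k3 unfolding M_def by linarith
    moreover have "\<bar>snd k i\<bar> \<le> M" for i using k2[of i] k3 unfolding M_def by linarith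
    ultimately
    show "k \<in> {-M..M} \<times> {\<kappa>. \<forall>i. (i \<in> UNIV \<longrightarrow> \<kappa> i \<in> {-M..M}) \<and> (i \<notin> UNIV \<longrightarrow> \<kappa> i = 0)}"
      by (cases k) (auto simp: abs_le_iff minus_le_iff)
  qed
  then show ?thesis
    by (rule finite_subset) (intro finite_cartesian_product finite_set_of_finite_funs; simp)
qed

lemma supp_idx_near:
  assumes "vanishes_off \<rho> \<phi>"
  shows "supp_idx r m \<phi> \<subseteq> {k. \<exists>z. pnorm z \<le> max 0 \<rho> \<and> pu r m k z \<noteq> 0}"
proof
  fix k assume "k \<in> supp_idx r m \<phi>"
  then obtain z where "pu r m k z * \<phi> z \<noteq> 0" unfolding supp_idx_def by blast
  then have z: "pu r m k z \<noteq> 0" "\<phi> z \<noteq> 0" by auto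
  then have "\<not> \<rho> < pnorm z" using assms unfolding vanishes_off_def by blast
  with z show "k \<in> {k. \<exists>z. pnorm z \<le> max 0 \<rho> \<and> pu r m k z \<noteq> 0}"
    by (intro CollectI exI[of _ z]) auto
qed

lemma finite_supp_idx: "\<phi> \<in> tests r \<Longrightarrow> finite (supp_idx r m \<phi>)"
  using finite_subset[OF supp_idx_near finite_near_idx] by (auto simp: tests_def)

lemma pu_decompose:
  assumes "finite K" "supp_idx r m \<phi> \<subseteq> K"
  shows "\<phi> = (\<lambda>z. \<Sum>k\<in>K. pu r m k z * \<phi> z)"
proof
  fix z
  show "\<phi> z = (\<Sum>k\<in>K. pu r m k z * \<phi> z)"
  proof (cases "\<phi> z = 0")
    case False
    then have "(\<Sum>k\<in>K. pu r m k z) = 1"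
    proof (intro pu_sum)
      fix k assume "pu r m k z \<noteq> 0"
      with False have "k \<in> supp_idx r m \<phi>" unfolding supp_idx_def mem_Collect_eq by (intro exI[of _ z]) simp
      then show "k \<in> K" using assms by blast
    qed (use assms in auto)
    then show ?thesis by (simp flip: sum_distrib_right)
  qed simp
qed

text \<open>Half-open cubes: a point lies in no two cells of a level, which is why sums of integrals
  over cells are dominated by one integral over space.\<close>

definition cell :: "nat \<Rightarrow> ('d::finite \<Rightarrow> int) \<Rightarrow> (real ^ 'd) set" where
  "cell m \<kappa> = {x. \<forall>i. \<kappa> i = \<lfloor>x $ i / dl m\<rfloor>}"

lemma cell_unique: "x \<in> cell m \<kappa> \<Longrightarrow> x \<in> cell m \<kappa>' \<Longrightarrow> \<kappa> = \<kappa>'"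
  by (auto simp: cell_def)

lemma cell_bounds: "x \<in> cell m \<kappa> \<longleftrightarrow> (\<forall>i. dl m * of_int (\<kappa> i) \<le> x $ i \<and> x $ i < dl m * (of_int (\<kappa> i) + 1))"
proof -
  have "\<kappa> i = \<lfloor>x $ i / dl m\<rfloor> \<longleftrightarrow> dl m * of_int (\<kappa> i) \<le> x $ i \<and> x $ i < dl m * (of_int (\<kappa> i) + 1)" for i
    unfolding eq_commute[of "\<kappa> i"] floor_eq_iff by (simp add: pos_le_divide_eq pos_divide_less_eq mult.commute)
  then show ?thesis by (simp add: cell_def)
qed

lemma cell_corner: "x \<in> cell m \<kappa> \<Longrightarrow> infnorm (x - corner m \<kappa>) \<le> dl m"
  by (auto simp: cell_bounds infnorm_vec corner_def abs_le_iff algebra_simps) (smt (verit) dl_pos)+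

lemma sets_cell [measurable, simp]: "cell m \<kappa> \<in> sets lebesgue"
proof -
  have "cell m \<kappa> = (\<Inter>i\<in>UNIV. {x. dl m * of_int (\<kappa> i) \<le> x $ i} \<inter> {x. x $ i < dl m * (of_int (\<kappa> i) + 1)})"
    by (auto simp: cell_bounds)
  also have "\<dots> \<in> sets borel"
    by (intro sets.finite_INT sets.Int borel_closed borel_open closed_Collect_le open_Collect_less) (auto intro!: continuous_intros)
  finally show ?thesis by simp
qed

lemma emeasure_cell: "emeasure lebesgue (cell m \<kappa> :: (real^'d::finite) set) = ennreal (dl m ^ CARD('d))"
proof -
  let ?a = "corner m \<kappa> :: real^'d" and ?b = "corner m \<kappa> + (\<chi> i. dl m) :: real^'d"
  have p: "emeasure lborel (box ?a ?b) = ennreal (\<Prod>b\<in>Basis. (?b - ?a) \<bullet> b)"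
    by (intro emeasure_lborel_box) (auto simp: Basis_vec_def inner_axis)
  have q: "emeasure lborel (cbox ?a ?b) = ennreal (\<Prod>b\<in>Basis. (?b - ?a) \<bullet> b)"
    by (intro emeasure_lborel_cbox) (auto simp: Basis_vec_def inner_axis)
  have e: "(\<Prod>b\<in>Basis. (?b - ?a) \<bullet> b) = (\<Prod>b\<in>(Basis::(real^'d) set). dl m)"
    by (intro prod.cong) (auto simp: Basis_vec_def inner_axis)
  have "box ?a ?b \<subseteq> cell m \<kappa>" "cell m \<kappa> \<subseteq> cbox ?a ?b"
    by (auto simp: cell_bounds mem_box_cart corner_def algebra_simps less_imp_le)
  then have "emeasure lebesgue (box ?a ?b) \<le> emeasure lebesgue (cell m \<kappa>)" "emeasure lebesgue (cell m \<kappa>) \<le> emeasure lebesgue (cbox ?a ?b)"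
    by (intro emeasure_mono; simp)+
  moreover have "emeasure lebesgue (box ?a ?b) = ennreal (dl m ^ CARD('d))" "emeasure lebesgue (cbox ?a ?b) = ennreal (dl m ^ CARD('d))"
    using p q unfolding e by simp_all
  ultimately show ?thesis by (metis antisym)
qed

lemma sum_cells_le:
  fixes g :: "real ^ 'd::finite \<Rightarrow> ennreal"
  assumes "finite A" and [measurable]: "g \<in> borel_measurable lebesgue"
  shows "(\<Sum>\<kappa>\<in>A. \<integral>\<^sup>+x\<in>cell m \<kappa>. g x \<partial>lebesgue) \<le> (\<integral>\<^sup>+x. g x \<partial>lebesgue)"
proof -
  have "(\<Sum>\<kappa>\<in>A. \<integral>\<^sup>+x\<in>cell m \<kappa>. g x \<partial>lebesgue) = (\<integral>\<^sup>+x. (\<Sum>\<kappa>\<in>A. g x * indicator (cell m \<kappa>) x) \<partial>lebesgue)"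
    by (intro nn_integral_sum[symmetric]) auto
  also have "\<dots> \<le> (\<integral>\<^sup>+x. g x \<partial>lebesgue)"
  proof (intro nn_integral_mono)
    fix x
    show "(\<Sum>\<kappa>\<in>A. g x * indicator (cell m \<kappa>) x) \<le> g x"
    proof (cases "\<exists>\<kappa>\<in>A. x \<in> cell m \<kappa>")
      case True
      then obtain \<kappa> where k: "\<kappa> \<in> A" "x \<in> cell m \<kappa>" by blast
      have "(\<Sum>\<kappa>\<in>A. g x * indicator (cell m \<kappa>) x) = (\<Sum>\<kappa>'\<in>{\<kappa>}. g x * indicator (cell m \<kappa>') x)"
      proof (intro sum.mono_neutral_right ballI)
        fix \<kappa>' assume "\<kappa>' \<in> A - {\<kappa>}"
        then have "x \<notin> cell m \<kappa>'" using cell_unique[OF k(2)] by blast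
        then show "g x * indicator (cell m \<kappa>') x = 0" by simp
      qed (use k assms in auto)
      then show ?thesis using k by simp
    qed (auto simp: indicator_def intro!: sum_nonneg)
  qed
  finally show ?thesis .
qed


section \<open>Reconstruction of coherent germs\<close>

text \<open>Integrability in space, for a fixed time and a fixed test function, is what makes cell
  averages meaningful and additive. Nothing is asked of the dependence on time.\<close>

definition germ :: "real \<Rightarrow> ('d::finite pt \<Rightarrow> 'd dist) \<Rightarrow> bool" where
  "germ r G \<longleftrightarrow> (\<forall>z. G z \<in> distributions r) \<and>
     (\<forall>s. \<forall>\<psi>\<in>tests r. \<forall>\<rho>. set_integrable lebesgue (sball 0 \<rho>) (\<lambda>y. G (s, y) \<psi>))"

text \<open>The base points of the level \<open>m\<close> lie in the past of the support of the partition functions.\<close>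

definition bt :: "nat \<Rightarrow> int \<Rightarrow> real" where
  "bt m j = (dl m)\<^sup>2 * (of_int j - 2)"

definition cavg :: "nat \<Rightarrow> ('d::finite \<Rightarrow> int) \<Rightarrow> (real ^ 'd \<Rightarrow> real) \<Rightarrow> real" where
  "cavg m \<kappa> g = (1 / dl m) ^ CARD('d) * (LINT y:cell m \<kappa>|lebesgue. g y)"

definition lvl :: "real \<Rightarrow> ('d::finite pt \<Rightarrow> 'd dist) \<Rightarrow> nat \<Rightarrow> 'd dist" where
  "lvl r G m \<phi> = (\<Sum>k\<in>supp_idx r m \<phi>. cavg m (snd k) (\<lambda>y. G (bt m (fst k), y) (\<lambda>z. pu r m k z * \<phi> z)))"

text \<open>\<open>HS\<close> and \<open>HT\<close> are measurable majorants of the space and time increments, the suprema over \<^term>\<open>Br r\<close>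
  not being known to be measurable. Increments are tested at the point (for \<open>HT\<close>, at the later time) at which the
  value of a modelled distribution is compared with the transported one.\<close>

definition coherent_with ::
  "real \<Rightarrow> real \<Rightarrow> real \<Rightarrow> ('d::finite pt \<Rightarrow> 'd dist) \<Rightarrow> real set \<Rightarrow> (real ^ 'd) set \<Rightarrow> ennreal \<Rightarrow>
    (real \<Rightarrow> real \<Rightarrow> real ^ 'd \<Rightarrow> real ^ 'd \<Rightarrow> ennreal) \<Rightarrow> (real \<Rightarrow> real \<Rightarrow> real \<Rightarrow> real ^ 'd \<Rightarrow> ennreal) \<Rightarrow> bool" where
  "coherent_with r \<gamma> p G J U N HS HT \<longleftrightarrow>
    (\<forall>\<mu> s. (\<lambda>(y, w). HS \<mu> s y w) \<in> borel_measurable (lebesgue \<Otimes>\<^sub>M lebesgue)) \<and>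
    (\<forall>\<mu> s s'. HT \<mu> s s' \<in> borel_measurable lebesgue) \<and>
    (\<forall>\<mu>\<in>{0<..1}. \<forall>s\<in>J.
      (\<forall>w\<in>U. \<forall>y. \<forall>\<eta>\<in>Br r. ennreal \<bar>G (s, w) (rescale \<eta> \<mu> (s, w)) - G (s, y) (rescale \<eta> \<mu> (s, w))\<bar> \<le> HS \<mu> s y w) \<and>
      Lp p U (\<lambda>y. \<integral>\<^sup>+w\<in>sball y (2 * \<mu>). HS \<mu> s y w \<partial>lebesgue) \<le> N * ennreal (\<mu> powr \<gamma> * \<mu> ^ CARD('d)) \<and>
      (\<forall>s'\<in>J. \<bar>s - s'\<bar> \<le> 2 * \<mu>\<^sup>2 \<longrightarrow>
        (\<forall>y\<in>U. \<forall>\<eta>\<in>Br r. ennreal \<bar>G (s, y) (rescale \<eta> \<mu> (max s s', y)) - G (s', y) (rescale \<eta> \<mu> (max s s', y))\<bar> \<le> HT \<mu> s s' y) \<and>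
        Lp p U (HT \<mu> s s') \<le> N * ennreal (\<mu> powr \<gamma>)))"

definition coherent :: "real \<Rightarrow> real \<Rightarrow> real \<Rightarrow> ('d::finite pt \<Rightarrow> 'd dist) \<Rightarrow> real set \<Rightarrow> (real ^ 'd) set \<Rightarrow> ennreal \<Rightarrow> bool" where
  "coherent r \<gamma> p G J U N \<longleftrightarrow> (\<exists>HS HT. coherent_with r \<gamma> p G J U N HS HT)"

lemma coherent_mono: "coherent r \<gamma> p G J U N \<Longrightarrow> J' \<subseteq> J \<Longrightarrow> coherent r \<gamma> p G J' U N"
proof -
  assume "coherent r \<gamma> p G J U N" and sub: "J' \<subseteq> J"
  then obtain HS HT where "coherent_with r \<gamma> p G J U N HS HT" unfolding coherent_def by blast
  with sub have "coherent_with r \<gamma> p G J' U N HS HT"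
    unfolding coherent_with_def by (elim conjE, intro conjI ballI) (assumption | blast)+
  then show ?thesis unfolding coherent_def by blast
qed

lemma germ_dist: "germ r G \<Longrightarrow> G z \<in> distributions r"
  unfolding germ_def by blast

lemma measure_cell: "measure lebesgue (cell m \<kappa> :: (real^'d::finite) set) = dl m ^ CARD('d)"
  by (rule measure_eq_emeasure_eq_ennreal) (simp_all only: emeasure_cell zero_le_power dl_nonneg)

lemma germ_integrable_cell:
  assumes "germ r G" "\<psi> \<in> tests r"
  shows "set_integrable lebesgue (cell m \<kappa>) (\<lambda>y. G (s, y) \<psi>)"
proof (rule set_integrable_subset)
  let ?\<rho> = "infnorm (corner m \<kappa>) + dl m + 1"
  show "set_integrable lebesgue (sball 0 ?\<rho>) (\<lambda>y. G (s, y) \<psi>)" using assms by (simp add: germ_def)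
  show "cell m \<kappa> \<subseteq> sball 0 ?\<rho>"
  proof
    fix x assume "x \<in> cell m \<kappa>"
    then have "infnorm (x - corner m \<kappa>) \<le> dl m" by (rule cell_corner)
    then have "infnorm x < ?\<rho>" using infnorm_triangle[of "x - corner m \<kappa>" "corner m \<kappa>"] by auto
    then show "x \<in> sball 0 ?\<rho>" by (simp add: sball_def)
  qed
qed simp

lemma set_integrable_const_cell: "set_integrable lebesgue (cell m \<kappa>) (\<lambda>_. b :: real)"
proof -
  have "emeasure lebesgue (cell m \<kappa>) < \<infinity>" by (simp only: emeasure_cell) simp
  then show ?thesis unfolding set_integrable_def by (intro integrable_scaleR_left integrable_real_indicator) auto
qed

lemma cavg_const: "cavg m \<kappa> (\<lambda>_. b) = b"
proof -
  have "(LINT y:cell m \<kappa>|lebesgue. b) = measure lebesgue (cell m \<kappa>) * b"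
    unfolding set_lebesgue_integral_def by simp
  then show ?thesis by (simp add: cavg_def measure_cell power_one_over)
qed

lemma cavg_sum:
  assumes "\<And>i. i \<in> I \<Longrightarrow> set_integrable lebesgue (cell m \<kappa>) (f i)"
  shows "cavg m \<kappa> (\<lambda>y. \<Sum>i\<in>I. f i y) = (\<Sum>i\<in>I. cavg m \<kappa> (f i))"
proof (cases "finite I")
  case True
  then have "(LINT y:cell m \<kappa>|lebesgue. \<Sum>i\<in>I. f i y) = (\<Sum>i\<in>I. LINT y:cell m \<kappa>|lebesgue. f i y)"
    using assms unfolding set_lebesgue_integral_def set_integrable_def scaleR_sum_right
    by (intro Bochner_Integration.integral_sum)
  then show ?thesis by (simp add: cavg_def sum_distrib_left)
qed (simp add: cavg_const)

lemma cavg_diff_const: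
  fixes \<kappa> :: "'d::finite \<Rightarrow> int"
  assumes a: "set_integrable lebesgue (cell m \<kappa>) a"
  shows "ennreal \<bar>cavg m \<kappa> a - b\<bar> \<le> ennreal ((1 / dl m) ^ CARD('d)) * (\<integral>\<^sup>+y\<in>cell m \<kappa>. ennreal \<bar>a y - b\<bar> \<partial>lebesgue)"
proof -
  have i: "set_integrable lebesgue (cell m \<kappa>) (\<lambda>y. a y - b)"
    using a set_integrable_const_cell by (rule set_integral_diff)
  have "cavg m \<kappa> a - b = cavg m \<kappa> a - cavg m \<kappa> (\<lambda>_. b)" by (simp add: cavg_const)
  also have "\<dots> = cavg m \<kappa> (\<lambda>y. a y - b)"
    unfolding cavg_def using set_integral_diff(2)[OF a set_integrable_const_cell] by (simp add: right_diff_distrib)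
  finally have "ennreal \<bar>cavg m \<kappa> a - b\<bar> = ennreal ((1 / dl m) ^ CARD('d)) * ennreal (norm (LINT y:cell m \<kappa>|lebesgue. a y - b))"
    by (simp add: cavg_def abs_mult ennreal_mult)
  also have "ennreal (norm (LINT y:cell m \<kappa>|lebesgue. a y - b)) \<le> (\<integral>\<^sup>+y. ennreal (norm (indicator (cell m \<kappa>) y *\<^sub>R (a y - b))) \<partial>lebesgue)"
    using i unfolding set_lebesgue_integral_def set_integrable_def by (rule integral_norm_bound_ennreal)
  also have "\<dots> = (\<integral>\<^sup>+y\<in>cell m \<kappa>. ennreal \<bar>a y - b\<bar> \<partial>lebesgue)"
    by (intro nn_integral_cong) (auto simp: indicator_def)
  finally show ?thesis by (simp add: mult_left_mono)
qed

lemma cavg_diff: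
  fixes \<kappa> \<kappa>' :: "'d::finite \<Rightarrow> int"
  assumes a: "set_integrable lebesgue (cell m' \<kappa>') a" and b: "set_integrable lebesgue (cell m \<kappa>) b"
  shows "ennreal \<bar>cavg m' \<kappa>' a - cavg m \<kappa> b\<bar> \<le> ennreal ((1 / dl m) ^ CARD('d)) *
    (\<integral>\<^sup>+y\<in>cell m \<kappa>. ennreal ((1 / dl m') ^ CARD('d)) * (\<integral>\<^sup>+w\<in>cell m' \<kappa>'. ennreal \<bar>a w - b y\<bar> \<partial>lebesgue) \<partial>lebesgue)"
proof -
  have "ennreal \<bar>cavg m' \<kappa>' a - cavg m \<kappa> b\<bar> = ennreal \<bar>cavg m \<kappa> b - cavg m' \<kappa>' a\<bar>" by (simp add: abs_minus_commute)
  also have "\<dots> \<le> ennreal ((1 / dl m) ^ CARD('d)) * (\<integral>\<^sup>+y\<in>cell m \<kappa>. ennreal \<bar>b y - cavg m' \<kappa>' a\<bar> \<partial>lebesgue)"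
    by (rule cavg_diff_const[OF b])
  also have "\<dots> \<le> ennreal ((1 / dl m) ^ CARD('d)) * (\<integral>\<^sup>+y\<in>cell m \<kappa>. ennreal ((1 / dl m') ^ CARD('d)) * (\<integral>\<^sup>+w\<in>cell m' \<kappa>'. ennreal \<bar>a w - b y\<bar> \<partial>lebesgue) \<partial>lebesgue)"
    using cavg_diff_const[OF a] by (intro mult_left_mono nn_integral_mono mult_right_mono) (auto simp: abs_minus_commute[of "b _"])
  finally show ?thesis .
qed

text \<open>An index outside \<open>supp_idx\<close> pairs the germ with the zero function. Hence
  different test functions can be summed over a common index set, and index sets can be enlarged to
  products.\<close>

lemma lvl_eq:
  assumes "germ r G" "finite K" "supp_idx r m \<phi> \<subseteq> K"
  shows "lvl r G m \<phi> = (\<Sum>k\<in>K. cavg m (snd k) (\<lambda>y. G (bt m (fst k), y) (\<lambda>z. pu r m k z * \<phi> z)))"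
  unfolding lvl_def
proof (rule sum.mono_neutral_left[OF assms(2,3)], intro ballI)
  fix k assume "k \<in> K - supp_idx r m \<phi>"
  then have "\<And>z. pu r m k z * \<phi> z = 0" unfolding supp_idx_def by blast
  then have "(\<lambda>z. pu r m k z * \<phi> z) = (\<lambda>z. 0)" by (rule ext)
  then show "cavg m (snd k) (\<lambda>y. G (bt m (fst k), y) (\<lambda>z. pu r m k z * \<phi> z)) = 0"
    using distribution_0[OF germ_dist[OF assms(1)]] by (simp only: cavg_const)
qed

lemma pu_tests: "\<phi> \<in> tests r \<Longrightarrow> (\<lambda>z. pu r m k z * \<phi> z) \<in> tests r"
  by (intro tests_mult pu_Cr)

text \<open>Inserting the partition of another level writes both levels as sums over the same pairs
  of indices with the same products of partition functions, so that they can be subtracted term by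
  term.\<close>

lemma lvl_refine:
  assumes G: "germ r G" and \<phi>: "\<phi> \<in> tests r" and K: "finite K" "supp_idx r m \<phi> \<subseteq> K" and L: "finite L" "supp_idx r m' \<phi> \<subseteq> L"
  shows "lvl r G m \<phi> = (\<Sum>k\<in>K. \<Sum>l\<in>L. cavg m (snd k) (\<lambda>y. G (bt m (fst k), y) (\<lambda>z. pu r m k z * (pu r m' l z * \<phi> z))))"
proof -
  have "cavg m (snd k) (\<lambda>y. G (bt m (fst k), y) (\<lambda>z. pu r m k z * \<phi> z)) =
    (\<Sum>l\<in>L. cavg m (snd k) (\<lambda>y. G (bt m (fst k), y) (\<lambda>z. pu r m k z * (pu r m' l z * \<phi> z))))" for k
  proof -
    have "(\<lambda>z. pu r m k z * \<phi> z) = (\<lambda>z. pu r m k z * (\<Sum>l\<in>L. pu r m' l z * \<phi> z))"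
      using pu_decompose[OF L] by (simp add: fun_eq_iff)
    also have "\<dots> = (\<lambda>z. \<Sum>l\<in>L. pu r m k z * (pu r m' l z * \<phi> z))" by (simp add: sum_distrib_left)
    finally have e: "(\<lambda>z. pu r m k z * \<phi> z) = (\<lambda>z. \<Sum>l\<in>L. pu r m k z * (pu r m' l z * \<phi> z))" .
    have t: "(\<lambda>z. pu r m k z * (pu r m' l z * \<phi> z)) \<in> tests r" for l by (intro pu_tests \<phi>)
    show ?thesis
      unfolding e distribution_sum[OF germ_dist[OF G] t] by (intro cavg_sum germ_integrable_cell[OF G] t)
  qed
  then show ?thesis unfolding lvl_eq[OF G K] by simp
qed

lemma lvl_add_test:
  assumes G: "germ r G" and "\<phi> \<in> tests r" "\<psi> \<in> tests r"
  shows "lvl r G m (\<lambda>z. \<phi> z + \<psi> z) = lvl r G m \<phi> + lvl r G m \<psi>"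
proof -
  define K where "K = supp_idx r m \<phi> \<union> supp_idx r m \<psi> \<union> supp_idx r m (\<lambda>z. \<phi> z + \<psi> z)"
  have K: "finite K" unfolding K_def using assms tests_add by (intro finite_UnI finite_supp_idx) blast+
  have e: "(\<lambda>z. pu r m k z * (\<phi> z + \<psi> z)) = (\<lambda>z. pu r m k z * \<phi> z + pu r m k z * \<psi> z)" for k
    by (simp add: distrib_left)
  have "cavg m (snd k) (\<lambda>y. G (bt m (fst k), y) (\<lambda>z. pu r m k z * (\<phi> z + \<psi> z))) =
    cavg m (snd k) (\<lambda>y. G (bt m (fst k), y) (\<lambda>z. pu r m k z * \<phi> z)) + cavg m (snd k) (\<lambda>y. G (bt m (fst k), y) (\<lambda>z. pu r m k z * \<psi> z))" for k
    unfolding e distribution_add[OF germ_dist[OF G] pu_tests[OF assms(2)] pu_tests[OF assms(3)]] cavg_def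
    using set_integral_add(2)[OF germ_integrable_cell[OF G pu_tests[OF assms(2)]] germ_integrable_cell[OF G pu_tests[OF assms(3)]]]
    by (simp add: distrib_left)
  then show ?thesis
    using lvl_eq[OF G K, of m] by (simp add: K_def sum.distrib Un_upper1 Un_upper2 le_supI1)
qed

lemma lvl_cmult_test:
  assumes G: "germ r G" and "\<phi> \<in> tests r"
  shows "lvl r G m (\<lambda>z. c * \<phi> z) = c * lvl r G m \<phi>"
proof -
  have s: "supp_idx r m (\<lambda>z. c * \<phi> z) \<subseteq> supp_idx r m \<phi>" unfolding supp_idx_def by (intro Collect_mono) auto
  have e: "(\<lambda>z. pu r m k z * (c * \<phi> z)) = (\<lambda>z. c * (pu r m k z * \<phi> z))" for k by (simp add: mult_ac)
  show ?thesis
    unfolding lvl_eq[OF G finite_supp_idx[OF assms(2)] s] e distribution_cmult[OF germ_dist[OF G] pu_tests[OF assms(2)]]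
    unfolding lvl_def by (simp add: cavg_def sum_distrib_left mult_ac)
qed

section \<open>Comparison of consecutive levels, and of the first level with the germ at the base
  point\<close>

lemma ennreal_abs_scale: "0 \<le> c \<Longrightarrow> ennreal \<bar>c * a - c * b\<bar> = ennreal c * ennreal \<bar>a - b\<bar>"
  by (simp add: abs_mult ennreal_mult flip: right_diff_distrib)

text \<open>The path from (s, w) to (s', y) passes through (s, y). The support of \<psi> lies within
  the scale \<mu> of all these points, so the same \<psi> is a multiple of a rescaled test function
  both about (s, w), for the space increment, and about \<open>(max s s', y)\<close>, for the time
  increment.\<close>

lemma coherent_pointwise:
  fixes G :: "'d::finite pt \<Rightarrow> 'd dist"
  assumes coh: "coherent_with r \<gamma> p G J U N HS HT" and G: "germ r G"
    and \<psi>: "sized r A \<mu> \<psi>" "0 < A" "0 < \<mu>" "\<mu> \<le> 1"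
    and pts: "s \<in> J" "s' \<in> J" "\<bar>s - s'\<bar> \<le> 2 * \<mu>\<^sup>2" "w \<in> U" "y \<in> U"
    and supp: "\<And>z. \<psi> z \<noteq> 0 \<Longrightarrow> \<bar>fst z - s\<bar> \<le> \<mu>\<^sup>2 \<and> \<bar>fst z - s'\<bar> \<le> \<mu>\<^sup>2 \<and> infnorm (snd z - w) \<le> \<mu> \<and> infnorm (snd z - y) \<le> \<mu>"
  shows "ennreal \<bar>G (s, w) \<psi> - G (s', y) \<psi>\<bar> \<le> ennreal (A * \<mu> ^ (CARD('d) + 2)) * (HS \<mu> s y w + HT \<mu> s s' y)"
proof -
  let ?c = "A * \<mu> ^ (CARD('d) + 2)"
  have c: "0 \<le> ?c" using \<psi> by simp
  obtain \<eta> where \<eta>: "\<eta> \<in> Br r" "\<psi> = (\<lambda>z. ?c * rescale \<eta> \<mu> (s, w) z)"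
    using sized_imp_rescale[OF \<psi>(1-3), of "(s, w)"] supp by auto
  obtain \<eta>' where \<eta>': "\<eta>' \<in> Br r" "\<psi> = (\<lambda>z. ?c * rescale \<eta>' \<mu> (max s s', y) z)"
  proof (rule sized_imp_rescale[OF \<psi>(1-3), of "(max s s', y)"])
    fix z assume "\<psi> z \<noteq> 0"
    from supp[OF this] show "\<bar>fst z - fst (max s s', y)\<bar> \<le> \<mu>\<^sup>2 \<and> infnorm (snd z - snd (max s s', y)) \<le> \<mu>"
      by (auto simp: max_def)
  qed
  have 1: "G z \<psi> = ?c * G z (rescale \<eta> \<mu> (s, w))" "G z \<psi> = ?c * G z (rescale \<eta>' \<mu> (max s s', y))" for z
    using distribution_cmult[OF germ_dist[OF G] tests_rescale[OF \<eta>(1) \<psi>(3)]]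
      distribution_cmult[OF germ_dist[OF G] tests_rescale[OF \<eta>'(1) \<psi>(3)]] \<eta>(2) \<eta>'(2) by metis+
  have "ennreal \<bar>G (s, w) \<psi> - G (s, y) \<psi>\<bar> = ennreal ?c * ennreal \<bar>G (s, w) (rescale \<eta> \<mu> (s, w)) - G (s, y) (rescale \<eta> \<mu> (s, w))\<bar>"
    unfolding 1(1) using c by (rule ennreal_abs_scale)
  also have "\<dots> \<le> ennreal ?c * HS \<mu> s y w"
    using coh \<eta>(1) pts \<psi> unfolding coherent_with_def by (intro mult_left_mono) auto
  finally have a: "ennreal \<bar>G (s, w) \<psi> - G (s, y) \<psi>\<bar> \<le> ennreal ?c * HS \<mu> s y w" .
  have "ennreal \<bar>G (s, y) \<psi> - G (s', y) \<psi>\<bar> = ennreal ?c * ennreal \<bar>G (s, y) (rescale \<eta>' \<mu> (max s s', y)) - G (s', y) (rescale \<eta>' \<mu> (max s s', y))\<bar>"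
    unfolding 1(2) using c by (rule ennreal_abs_scale)
  also have "\<dots> \<le> ennreal ?c * HT \<mu> s s' y"
    using coh \<eta>'(1) pts \<psi> unfolding coherent_with_def by (intro mult_left_mono) auto
  finally have b: "ennreal \<bar>G (s, y) \<psi> - G (s', y) \<psi>\<bar> \<le> ennreal ?c * HT \<mu> s s' y" .
  have "ennreal \<bar>G (s, w) \<psi> - G (s', y) \<psi>\<bar> \<le> ennreal (\<bar>G (s, w) \<psi> - G (s, y) \<psi>\<bar> + \<bar>G (s, y) \<psi> - G (s', y) \<psi>\<bar>)"
    by (intro ennreal_leI) simp
  also have "\<dots> \<le> ennreal ?c * HS \<mu> s y w + ennreal ?c * HT \<mu> s s' y"
    using add_mono[OF a b] by simp
  finally show ?thesis by (simp add: distrib_left)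
qed

lemma double_cells_le:
  fixes P :: "real ^ 'd::finite \<Rightarrow> real ^ 'd \<Rightarrow> ennreal"
  assumes "finite A" "finite B" and P: "(\<lambda>(y, w). P y w) \<in> borel_measurable (lebesgue \<Otimes>\<^sub>M lebesgue)"
  shows "(\<Sum>\<kappa>\<in>A. \<Sum>\<kappa>'\<in>B. \<integral>\<^sup>+y\<in>cell m \<kappa>. (\<integral>\<^sup>+w\<in>cell m' \<kappa>'. P y w \<partial>lebesgue) \<partial>lebesgue) \<le> (\<integral>\<^sup>+y. \<integral>\<^sup>+w. P y w \<partial>lebesgue \<partial>lebesgue)"
proof -
  have [measurable]: "(\<lambda>z. P (fst z) (snd z)) \<in> borel_measurable (lebesgue \<Otimes>\<^sub>M lebesgue)"
    using P by (simp add: case_prod_beta')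
  have m1 [measurable]: "(\<lambda>y. \<integral>\<^sup>+w\<in>cell m' \<kappa>'. P y w \<partial>lebesgue) \<in> borel_measurable lebesgue" for \<kappa>'
    by (rule leb.borel_measurable_nn_integral) (simp add: case_prod_beta')
  have m2 [measurable]: "(\<lambda>y. \<integral>\<^sup>+w. P y w \<partial>lebesgue) \<in> borel_measurable lebesgue"
    by (rule leb.borel_measurable_nn_integral) (rule P)
  have m3: "(\<lambda>w. P y w) \<in> borel_measurable lebesgue" for y
    using measurable_Pair2[OF P, of y] by simp
  have "(\<Sum>\<kappa>'\<in>B. \<integral>\<^sup>+y\<in>cell m \<kappa>. (\<integral>\<^sup>+w\<in>cell m' \<kappa>'. P y w \<partial>lebesgue) \<partial>lebesgue) \<le> (\<integral>\<^sup>+y\<in>cell m \<kappa>. (\<integral>\<^sup>+w. P y w \<partial>lebesgue) \<partial>lebesgue)" for \<kappa>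
  proof -
    have "(\<Sum>\<kappa>'\<in>B. \<integral>\<^sup>+y\<in>cell m \<kappa>. (\<integral>\<^sup>+w\<in>cell m' \<kappa>'. P y w \<partial>lebesgue) \<partial>lebesgue) = (\<integral>\<^sup>+y\<in>cell m \<kappa>. (\<Sum>\<kappa>'\<in>B. \<integral>\<^sup>+w\<in>cell m' \<kappa>'. P y w \<partial>lebesgue) \<partial>lebesgue)"
      by (subst nn_integral_sum[symmetric]) (auto simp: sum_distrib_right)
    also have "\<dots> \<le> (\<integral>\<^sup>+y\<in>cell m \<kappa>. (\<integral>\<^sup>+w. P y w \<partial>lebesgue) \<partial>lebesgue)"
      using sum_cells_le[OF assms(2) m3] by (intro nn_integral_mono mult_right_mono) auto
    finally show ?thesis .
  qed
  then have "(\<Sum>\<kappa>\<in>A. \<Sum>\<kappa>'\<in>B. \<integral>\<^sup>+y\<in>cell m \<kappa>. (\<integral>\<^sup>+w\<in>cell m' \<kappa>'. P y w \<partial>lebesgue) \<partial>lebesgue) \<le> (\<Sum>\<kappa>\<in>A. \<integral>\<^sup>+y\<in>cell m \<kappa>. (\<integral>\<^sup>+w. P y w \<partial>lebesgue) \<partial>lebesgue)"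
    by (rule sum_mono)
  also have "\<dots> \<le> (\<integral>\<^sup>+y. \<integral>\<^sup>+w. P y w \<partial>lebesgue \<partial>lebesgue)"
    by (rule sum_cells_le[OF assms(1) m2])
  finally show ?thesis .
qed

lemma card_int_interval: "finite {j::int. \<bar>u - of_int j\<bar> \<le> a}" "0 \<le> a \<Longrightarrow> real (card {j::int. \<bar>u - of_int j\<bar> \<le> a}) \<le> 2 * a + 1"
proof -
  have e: "{j::int. \<bar>u - of_int j\<bar> \<le> a} = {\<lceil>u - a\<rceil>..\<lfloor>u + a\<rfloor>}"
    by (auto simp: abs_le_iff ceiling_le_iff le_floor_iff)
  show "finite {j::int. \<bar>u - of_int j\<bar> \<le> a}" unfolding e by simp
  show "real (card {j::int. \<bar>u - of_int j\<bar> \<le> a}) \<le> 2 * a + 1" if "0 \<le> a"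
    unfolding e using that by (simp add: nat_add_distrib) linarith
qed

text \<open>The time steps of the levels m and \<open>Suc m\<close> have the ratio 4. Overlapping
  supports force \<open>D * i\<close> and \<open>D / 4 * j\<close> within \<open>D + D / 4\<close>
  of each other, D being \<open>(dl m)\<^sup>2\<close>, which is the bound 5.\<close>

definition time_pairs :: "real \<Rightarrow> real \<Rightarrow> nat \<Rightarrow> real set \<Rightarrow> (int \<times> int) set" where
  "time_pairs t l m J = {(i, j). \<bar>t / (dl m)\<^sup>2 - of_int i\<bar> \<le> l\<^sup>2 / (dl m)\<^sup>2 + 1 \<and> \<bar>4 * i - j\<bar> \<le> 5 \<and> bt m i \<in> J \<and> bt (Suc m) j \<in> J}"

text \<open>For each i there are at most 11 indices j, and at most \<open>2 * X + 3\<close> indices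
  i occur. As X is at least 16, \<open>2 * X + 3 \<le> 3 * X\<close>, and 33 results.\<close>

lemma time_pairs_card:
  assumes "dl m \<le> l / 4"
  shows "finite (time_pairs t l m J)" "real (card (time_pairs t l m J)) \<le> 33 * (l\<^sup>2 / (dl m)\<^sup>2)"
proof -
  define X where "X = l\<^sup>2 / (dl m)\<^sup>2"
  have "16 * (dl m)\<^sup>2 \<le> l\<^sup>2" using power_mono[OF assms, of 2] by (simp add: power_divide)
  then have X: "16 \<le> X" by (simp add: X_def le_divide_eq)
  let ?A = "{i::int. \<bar>t / (dl m)\<^sup>2 - of_int i\<bar> \<le> X + 1}"
  let ?S = "SIGMA i:?A. {4 * i - 5..4 * i + 5}"
  have sub: "time_pairs t l m J \<subseteq> ?S" by (auto simp: time_pairs_def X_def)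
  have fin: "finite ?S" using card_int_interval(1) by auto
  then show "finite (time_pairs t l m J)" using sub by (rule rev_finite_subset)
  have "card (time_pairs t l m J) \<le> card ?S" using fin sub by (rule card_mono)
  also have "card ?S = 11 * card ?A" using card_int_interval(1) by simp
  finally have "real (card (time_pairs t l m J)) \<le> 11 * real (card ?A)" by linarith
  moreover have "real (card ?A) \<le> 2 * (X + 1) + 1" by (rule card_int_interval(2)) (use X in simp)
  moreover have "a \<le> 11 * b \<Longrightarrow> b \<le> 2 * (X + 1) + 1 \<Longrightarrow> a \<le> 33 * X" for a b :: real
    using X by (smt (verit))
  ultimately show "real (card (time_pairs t l m J)) \<le> 33 * (l\<^sup>2 / (dl m)\<^sup>2)" unfolding X_def by blast
qed

lemma infnorm_tri: "infnorm (a - b) \<le> infnorm (c - a) + infnorm (c - b)"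
  using infnorm_triangle[of "a - c" "c - b"] infnorm_sub[of a c] by simp


lemma iterated_le:
  fixes H :: "'a::euclidean_space \<Rightarrow> 'b::euclidean_space \<Rightarrow> ennreal"
  assumes H: "(\<lambda>(y, w). H y w) \<in> borel_measurable (lebesgue \<Otimes>\<^sub>M lebesgue)"
    and [measurable]: "A \<in> sets lebesgue" "B \<in> sets lebesgue"
    and X: "\<And>y w. y \<in> A \<Longrightarrow> w \<in> B \<Longrightarrow> X y w \<le> q * H y w"
  shows "c * (\<integral>\<^sup>+y\<in>A. c' * (\<integral>\<^sup>+w\<in>B. X y w \<partial>lebesgue) \<partial>lebesgue) \<le> (\<integral>\<^sup>+y\<in>A. (\<integral>\<^sup>+w\<in>B. c * (c' * q) * H y w \<partial>lebesgue) \<partial>lebesgue)"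
proof -
  have [measurable]: "(\<lambda>z. H (fst z) (snd z)) \<in> borel_measurable (lebesgue \<Otimes>\<^sub>M lebesgue)"
    using H by (simp add: case_prod_beta')
  have m2 [measurable]: "(\<lambda>y. \<integral>\<^sup>+w\<in>B. H y w \<partial>lebesgue) \<in> borel_measurable lebesgue"
    by (rule leb.borel_measurable_nn_integral) (simp add: case_prod_beta')
  have m3 [measurable]: "(\<lambda>w. H y w) \<in> borel_measurable lebesgue" for y
    using measurable_Pair2[OF H, of y] by simp
  have pull: "(\<integral>\<^sup>+w\<in>B. k * H y w \<partial>lebesgue) = k * (\<integral>\<^sup>+w\<in>B. H y w \<partial>lebesgue)" for k y
    by (subst nn_integral_cmult[symmetric]) (auto simp: mult.assoc)
  have "c * (\<integral>\<^sup>+y\<in>A. c' * (\<integral>\<^sup>+w\<in>B. X y w \<partial>lebesgue) \<partial>lebesgue) \<le> c * (\<integral>\<^sup>+y\<in>A. c' * (\<integral>\<^sup>+w\<in>B. q * H y w \<partial>lebesgue) \<partial>lebesgue)"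
  proof (intro mult_left_mono nn_integral_mono)
    fix y
    show "c' * (\<integral>\<^sup>+w\<in>B. X y w \<partial>lebesgue) * indicator A y \<le> c' * (\<integral>\<^sup>+w\<in>B. q * H y w \<partial>lebesgue) * indicator A y"
      by (cases "y \<in> A") (auto intro!: mult_left_mono nn_integral_mono X simp: indicator_def)
  qed auto
  also have "\<dots> = (\<integral>\<^sup>+y. c * (c' * (q * (\<integral>\<^sup>+w\<in>B. H y w \<partial>lebesgue)) * indicator A y) \<partial>lebesgue)"
    unfolding pull by (subst nn_integral_cmult) auto
  also have "\<dots> = (\<integral>\<^sup>+y\<in>A. (\<integral>\<^sup>+w\<in>B. c * (c' * q) * H y w \<partial>lebesgue) \<partial>lebesgue)"
    unfolding pull by (simp add: mult.assoc)
  finally show ?thesis .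
qed

lemma bt_diff: "bt (Suc m) j - bt m i = (dl m)\<^sup>2 * (of_int (j - 4 * i) + 6) / 4"
  by (simp add: bt_def dl_Suc power_divide field_simps)

text \<open>At the comparison scale \<open>\<mu> = 2 * dl m\<close>, the right-hand side is the
  largest time gap \<open>2 * \<mu>\<^sup>2\<close> about which \<open>coherent_with\<close> says
  anything.\<close>

lemma bt_diff_le:
  assumes "\<bar>4 * i - j\<bar> \<le> 5"
  shows "\<bar>bt (Suc m) j - bt m i\<bar> \<le> 2 * (2 * dl m)\<^sup>2"
proof -
  have "\<bar>real_of_int (j - 4 * i) + 6\<bar> \<le> 32" using assms by linarith
  then have "(dl m)\<^sup>2 * \<bar>real_of_int (j - 4 * i) + 6\<bar> \<le> (dl m)\<^sup>2 * 32" by (intro mult_left_mono) auto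
  then show ?thesis unfolding bt_diff by (simp add: abs_mult power_mult_distrib)
qed

text \<open>A point of the support of the product of the partition functions with a rescaled test function
  localises the cells and the base times.\<close>

lemma overlap:
  fixes k l :: "'d::finite idx"
  assumes \<eta>: "\<eta> \<in> Br r" and l: "0 < \<epsilon>" "dl m \<le> \<epsilon> / 4"
    and J: "{t - 2 * \<epsilon>\<^sup>2..t + \<epsilon>\<^sup>2 - (dl (Suc m))\<^sup>2} \<subseteq> J"
    and yw: "y \<in> cell m (snd k)" "w \<in> cell (Suc m) (snd l)"
    and z: "pu r m k z * (pu r (Suc m) l z * rescale \<eta> \<epsilon> (t, x) z) \<noteq> 0"
  shows "(fst k, fst l) \<in> time_pairs t \<epsilon> m J" "y \<in> sball x (2 * \<epsilon>)" "w \<in> sball x (2 * \<epsilon>)" "w \<in> sball y (4 * dl m)"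
    "\<bar>fst z - bt (Suc m) (fst l)\<bar> \<le> (2 * dl m)\<^sup>2" "\<bar>fst z - bt m (fst k)\<bar> \<le> (2 * dl m)\<^sup>2"
    "infnorm (snd z - w) \<le> 2 * dl m" "infnorm (snd z - y) \<le> 2 * dl m"
proof -
  define D where "D = (dl m)\<^sup>2"
  have D: "0 < D" by (simp add: D_def)
  have D': "(dl (Suc m))\<^sup>2 = D / 4" by (simp add: D_def dl_Suc power_divide)
  have lD: "16 * D \<le> \<epsilon>\<^sup>2" using power_mono[OF l(2), of 2] by (simp add: power_divide D_def)
  have zk: "\<bar>fst z - D * of_int (fst k)\<bar> \<le> D" "infnorm (snd z - corner m (snd k)) \<le> dl m"
    using z pu_support[of r m k z] by (auto simp: D_def)
  have zl: "\<bar>fst z - D / 4 * of_int (fst l)\<bar> \<le> D / 4" "infnorm (snd z - corner (Suc m) (snd l)) \<le> dl m / 2"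
    using z pu_support[of r "Suc m" l z] unfolding D' by (auto simp: dl_Suc)
  have zx: "\<bar>fst z - t\<bar> \<le> \<epsilon>\<^sup>2" "infnorm (snd z - x) \<le> \<epsilon>"
    using z \<eta> l rescale_support[of \<eta> \<epsilon> "(t, x)" z] by (auto simp: Br_def)
  have yk: "infnorm (y - corner m (snd k)) \<le> dl m" and wl: "infnorm (w - corner (Suc m) (snd l)) \<le> dl m / 2"
    using cell_corner[OF yw(1)] cell_corner[OF yw(2)] by (auto simp: dl_Suc)
  have zy: "infnorm (snd z - y) \<le> 2 * dl m"
    using infnorm_tri[of "snd z" y "corner m (snd k)"] infnorm_sub[of "snd z"] infnorm_sub[of y] yk zk by (smt (verit))
  have zw: "infnorm (snd z - w) \<le> dl m"
    using infnorm_tri[of "snd z" w "corner (Suc m) (snd l)"] infnorm_sub[of "snd z"] infnorm_sub[of w] wl zl by (smt (verit) field_sum_of_halves)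
  show "infnorm (snd z - y) \<le> 2 * dl m" by (rule zy)
  show "infnorm (snd z - w) \<le> 2 * dl m" using zw dl_pos[of m] by linarith
  have "infnorm (y - x) \<le> 2 * dl m + \<epsilon>" using infnorm_tri[of y x "snd z"] zy zx by linarith
  then show "y \<in> sball x (2 * \<epsilon>)" using l by (simp add: sball_def)
  have "infnorm (w - x) \<le> dl m + \<epsilon>" using infnorm_tri[of w x "snd z"] zw zx by linarith
  then show "w \<in> sball x (2 * \<epsilon>)" using l by (simp add: sball_def)
  have "infnorm (w - y) \<le> 3 * dl m" using infnorm_tri[of w y "snd z"] zw zy by linarith
  then show "w \<in> sball y (4 * dl m)" using dl_pos[of m] unfolding sball_def mem_Collect_eq by linarith
  have bk: "bt m (fst k) = D * of_int (fst k) - 2 * D" by (simp add: bt_def D_def algebra_simps)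
  have bl: "bt (Suc m) (fst l) = D / 4 * of_int (fst l) - D / 2" by (simp add: bt_def D' algebra_simps)
  have D4: "(2 * dl m)\<^sup>2 = 4 * D" by (simp add: power_mult_distrib D_def)
  show "\<bar>fst z - bt (Suc m) (fst l)\<bar> \<le> (2 * dl m)\<^sup>2" unfolding D4 bl using zl(1) D by linarith
  show "\<bar>fst z - bt m (fst k)\<bar> \<le> (2 * dl m)\<^sup>2" unfolding D4 bk using zk(1) D by linarith
  \<comment> \<open>The support of a partition function reaches one squared scale to either side of
    its centre, and \<open>bt\<close> lies two squared scales before the centre. The latest base
    time is thus one squared scale before \<open>t + \<epsilon>\<^sup>2\<close>; for the finer level
    this is exactly the right end \<open>t + \<epsilon>\<^sup>2 - D / 4\<close>. The earliest one is
    \<open>t - \<epsilon>\<^sup>2 - 3 * D\<close>, within the left end because of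
    \<open>16 * D \<le> \<epsilon>\<^sup>2\<close>.\<close>
  have "bt m (fst k) \<in> {t - 2 * \<epsilon>\<^sup>2..t + \<epsilon>\<^sup>2 - D / 4}" unfolding bk atLeastAtMost_iff using zk(1) zx(1) lD D by (intro conjI; linarith)
  moreover have "bt (Suc m) (fst l) \<in> {t - 2 * \<epsilon>\<^sup>2..t + \<epsilon>\<^sup>2 - D / 4}" unfolding bl atLeastAtMost_iff using zl(1) zx(1) lD D by (intro conjI; linarith)
  moreover have "\<bar>t / D - of_int (fst k)\<bar> \<le> \<epsilon>\<^sup>2 / D + 1"
  proof -
    have "\<bar>t - D * of_int (fst k)\<bar> / D \<le> (\<epsilon>\<^sup>2 + D) / D"
      using zk(1) zx(1) D by (intro divide_right_mono) auto
    moreover have "\<bar>t - D * of_int (fst k)\<bar> / D = \<bar>t / D - of_int (fst k)\<bar>"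
    proof -
      have "(t - D * of_int (fst k)) / D = t / D - of_int (fst k)" using D by (simp add: diff_divide_distrib)
      then show ?thesis using D by (metis abs_divide abs_of_pos)
    qed
    ultimately show ?thesis using D by (simp add: add_divide_distrib)
  qed
  moreover have "\<bar>4 * fst k - fst l\<bar> \<le> 5"
  proof -
    have "\<bar>D * (4 * of_int (fst k) - of_int (fst l))\<bar> \<le> D * 5"
    proof -
      have "\<bar>4 * (D * of_int (fst k)) - D * of_int (fst l)\<bar> \<le> D * 5"
        using zk(1) zl(1) by linarith
      then show ?thesis by (simp only: right_diff_distrib mult.left_commute[of D 4])
    qed
    then have "\<bar>4 * of_int (fst k) - of_int (fst l)\<bar> \<le> (5::real)"
      using D by (simp add: abs_mult)
    then show ?thesis by linarith
  qed
  ultimately show "(fst k, fst l) \<in> time_pairs t \<epsilon> m J"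
    using J unfolding D' time_pairs_def D_def by auto
qed

lemma sum_quad:
  "(\<Sum>k\<in>A \<times> K. \<Sum>l\<in>B \<times> L. f (fst k) (snd k) (fst l) (snd l)) = (\<Sum>i\<in>A. \<Sum>j\<in>B. \<Sum>\<kappa>\<in>K. \<Sum>\<kappa>'\<in>L. f i \<kappa> j \<kappa>')"
proof -
  have "(\<Sum>k\<in>A \<times> K. \<Sum>l\<in>B \<times> L. f (fst k) (snd k) (fst l) (snd l)) = (\<Sum>i\<in>A. \<Sum>\<kappa>\<in>K. \<Sum>j\<in>B. \<Sum>\<kappa>'\<in>L. f i \<kappa> j \<kappa>')"
    by (simp only: sum.cartesian_product[of _ K A] sum.cartesian_product[of _ L B] case_prod_beta')
  also have "\<dots> = (\<Sum>i\<in>A. \<Sum>j\<in>B. \<Sum>\<kappa>\<in>K. \<Sum>\<kappa>'\<in>L. f i \<kappa> j \<kappa>')"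
    by (intro sum.cong refl sum.swap)
  finally show ?thesis .
qed

text \<open>By \<open>lvl_refine\<close> the difference is a sum, over pairs of indices, of
  differences of two cell averages with one test function, and \<open>coherent_pointwise\<close>
  bounds each. Disjointness of the cells merges the sums over space indices into one double
  integral, so only pairs of times remain. In the weight,
  \<open>(1 / \<epsilon>) ^ (CARD('d) + 2)\<close> is the height of the test function,
  \<open>(dl m)\<^sup>2\<close> a time volume and \<open>(1 / dl m) ^ CARD('d)\<close> the
  normalisation of one cell; that of the other cell cancels against a space volume.\<close>

lemma level_diff_pointwise:
  "\<exists>C>0. \<forall>(G :: 'd::finite pt \<Rightarrow> 'd dist) \<gamma> p J U N HS HT t \<epsilon> m x \<eta>.
    germ r G \<longrightarrow> coherent_with r \<gamma> p G J U N HS HT \<longrightarrow> 0 < \<epsilon> \<longrightarrow> \<epsilon> \<le> 1 \<longrightarrow> dl m \<le> \<epsilon> / 4 \<longrightarrow>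
    {t - 2 * \<epsilon>\<^sup>2..t + \<epsilon>\<^sup>2 - (dl (Suc m))\<^sup>2} \<subseteq> J \<longrightarrow> sball x 2 \<subseteq> U \<longrightarrow> \<eta> \<in> Br r \<longrightarrow>
    ennreal \<bar>lvl r G (Suc m) (rescale \<eta> \<epsilon> (t, x)) - lvl r G m (rescale \<eta> \<epsilon> (t, x))\<bar> \<le>
    (\<Sum>(i, j)\<in>time_pairs t \<epsilon> m J. \<integral>\<^sup>+y\<in>sball x (2 * \<epsilon>). (\<integral>\<^sup>+w\<in>sball y (4 * dl m).
       ennreal (C * ((1 / \<epsilon>) ^ (CARD('d) + 2) * ((1 / dl m) ^ CARD('d) * (dl m)\<^sup>2))) *
       (HS (2 * dl m) (bt (Suc m) j) y w + HT (2 * dl m) (bt (Suc m) j) (bt m i) y) \<partial>lebesgue) \<partial>lebesgue)"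
proof -
  obtain Cp where Cp: "0 < Cp" "\<And>m (k::'d idx). sized r Cp (dl m) (pu r m k)" using pu_sized by blast
  obtain Cm where Cm: "0 < Cm" "\<And>(f::'d func) g A B \<mu>. 0 \<le> A \<Longrightarrow> 0 \<le> B \<Longrightarrow> 0 < \<mu> \<Longrightarrow> sized r A \<mu> f \<Longrightarrow> sized r B \<mu> g \<Longrightarrow>
     sized r (Cm * A * B) \<mu> (\<lambda>z. f z * g z)" using sized_mult by blast
  \<comment> \<open>One Leibniz constant for each of the two products. The partition functions are
    brought from the scales \<open>dl m\<close> and \<open>dl m / 2\<close> to
    \<open>2 * dl m\<close>, which costs \<open>2 powr r\<close> and \<open>4 powr r\<close>; the
    test function comes down from \<epsilon> at no cost.\<close>
  define c1 where "c1 = Cm * (Cp * 2 powr r) * (Cm * (Cp * 4 powr r))"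
  have c1: "0 < c1" using Cp(1) Cm(1) by (simp add: c1_def)
  define C where "C = c1 * (2 ^ CARD('d) * 2 ^ (CARD('d) + 2))"
  have C: "0 < C" using c1 by (simp add: C_def)
  show ?thesis
  proof (intro exI[of _ C] conjI C allI impI)
    fix G :: "'d pt \<Rightarrow> 'd dist" and \<gamma> p J U N HS HT t \<epsilon> m and x :: "real ^ 'd" and \<eta> :: "'d func"
    assume G: "germ r G" and coh: "coherent_with r \<gamma> p G J U N HS HT" and l: "0 < \<epsilon>" "\<epsilon> \<le> 1" "dl m \<le> \<epsilon> / 4"
      and J: "{t - 2 * \<epsilon>\<^sup>2..t + \<epsilon>\<^sup>2 - (dl (Suc m))\<^sup>2} \<subseteq> J" and U: "sball x 2 \<subseteq> U" and \<eta>: "\<eta> \<in> Br r"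
    define \<phi> where "\<phi> = rescale \<eta> \<epsilon> (t, x)"
    \<comment> \<open>Twice the scale, since a point of a cell and a point of the support of the
      partition function may both be \<open>dl m\<close> away from the corner, on opposite
      sides.\<close>
    define \<mu> where "\<mu> = 2 * dl m"
    define A0 where "A0 = (1 / \<epsilon>) ^ (CARD('d) + 2)"
    define q where "q = c1 * A0 * \<mu> ^ (CARD('d) + 2)"
    have A0: "0 < A0" unfolding A0_def by (rule zero_less_power) (use l in simp)
    have \<mu>: "0 < \<mu>" "\<mu> \<le> 1" "\<mu> \<le> \<epsilon>" using l dl_pos[of m] unfolding \<mu>_def by linarith+
    have q: "0 < q" unfolding q_def by (intro mult_pos_pos zero_less_power c1 A0 \<mu>)
    have \<phi>: "\<phi> \<in> tests r" unfolding \<phi>_def by (rule tests_rescale[OF \<eta> l(1)])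
    have s\<phi>: "sized r A0 \<mu> \<phi>"
    proof (rule sized_scale_down[OF _ \<mu>(1,3)])
      show "sized r A0 \<epsilon> \<phi>"
        using sized_rescale[OF Br_sized[OF \<eta>] l(1), of "(t, x)"] by (simp only: \<phi>_def A0_def mult_1_right)
    qed (use A0 in simp)
    define \<psi> where "\<psi> k l = (\<lambda>z. pu r m k z * (pu r (Suc m) l z * \<phi> z))" for k l :: "'d idx"
    have s\<psi>: "sized r (c1 * A0) \<mu> (\<psi> k l)" for k l
    proof -
      have "sized r (Cp * 4 powr r) \<mu> (pu r (Suc m) l)" "sized r (Cp * 2 powr r) \<mu> (pu r m k)"
        using Cp(1) \<mu> by (intro sized_scale_up[OF Cp(2)]; simp add: \<mu>_def dl_Suc)+
      then have "sized r (Cm * (Cp * 2 powr r) * (Cm * (Cp * 4 powr r) * A0)) \<mu> (\<psi> k l)"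
        unfolding \<psi>_def using Cp(1) Cm(1) A0 \<mu> s\<phi> by (intro Cm(2)) auto
      then show ?thesis by (simp add: c1_def mult_ac)
    qed
    have t\<psi>: "\<psi> k l \<in> tests r" for k l unfolding \<psi>_def by (intro pu_tests \<phi>)
    define IA KA IB KB where "IA = fst ` supp_idx r m \<phi>" and "KA = snd ` supp_idx r m \<phi>"
      and "IB = fst ` supp_idx r (Suc m) \<phi>" and "KB = snd ` supp_idx r (Suc m) \<phi>"
    have fin: "finite IA" "finite KA" "finite IB" "finite KB"
      unfolding IA_def KA_def IB_def KB_def using finite_supp_idx[OF \<phi>] by auto
    have sub: "supp_idx r m \<phi> \<subseteq> IA \<times> KA" "supp_idx r (Suc m) \<phi> \<subseteq> IB \<times> KB"
      unfolding IA_def KA_def IB_def KB_def by force+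
    have fin2: "finite (IA \<times> KA)" "finite (IB \<times> KB)" using fin by auto
    let ?T = "time_pairs t \<epsilon> m J"
    define H where "H i j y w = HS \<mu> (bt (Suc m) j) y w + HT \<mu> (bt (Suc m) j) (bt m i) y" for i j y w
    define Q where "Q = (1 / dl m) ^ CARD('d) * ((1 / dl (Suc m)) ^ CARD('d) * q)"
    have Q: "Q = C * (A0 * ((1 / dl m) ^ CARD('d) * (dl m)\<^sup>2))"
    proof -
      have "(1 / dl (Suc m)) ^ CARD('d) * \<mu> ^ (CARD('d) + 2) = ((1 / dl (Suc m)) * \<mu>) ^ CARD('d) * \<mu>\<^sup>2"
        by (simp only: power_add power_mult_distrib mult.assoc)
      also have "(1 / dl (Suc m)) * \<mu> = 4" by (simp add: \<mu>_def dl_Suc)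
      also have "(4::real) ^ CARD('d) = 2 ^ CARD('d) * 2 ^ CARD('d)" by (simp flip: power_mult_distrib)
      finally have "(1 / dl (Suc m)) ^ CARD('d) * \<mu> ^ (CARD('d) + 2) = 2 ^ CARD('d) * 2 ^ (CARD('d) + 2) * (dl m)\<^sup>2"
        by (simp add: \<mu>_def power_mult_distrib power_add)
      then show ?thesis unfolding Q_def q_def C_def by (simp only: mult_ac)
    qed
    have mH: "(\<lambda>(y, w). H i j y w) \<in> borel_measurable (lebesgue \<Otimes>\<^sub>M lebesgue)" for i j
    proof -
      have [measurable]: "(\<lambda>z. HS \<mu> s (fst z) (snd z)) \<in> borel_measurable (lebesgue \<Otimes>\<^sub>M lebesgue)" "HT \<mu> s s' \<in> borel_measurable lebesgue" for s s'
        using coh by (simp_all add: coherent_with_def case_prod_beta')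
      show ?thesis unfolding H_def case_prod_beta' by measurable
    qed
    define P where "P i j y w = ennreal Q * H i j y w * indicator (sball y (4 * dl m)) w * indicator (sball x (2 * \<epsilon>)) y" for i j y w
    have mP: "(\<lambda>(y, w). P i j y w) \<in> borel_measurable (lebesgue \<Otimes>\<^sub>M lebesgue)" for i j
    proof -
      have [measurable]: "(\<lambda>z. H i j (fst z) (snd z)) \<in> borel_measurable (lebesgue \<Otimes>\<^sub>M lebesgue)"
        using mH by (simp add: case_prod_beta')
      have "(\<lambda>z. ennreal Q * H i j (fst z) (snd z) * indicator {z. snd z \<in> sball (fst z) (4 * dl m)} z * indicator (sball x (2 * \<epsilon>)) (fst z)) \<in> borel_measurable (lebesgue \<Otimes>\<^sub>M lebesgue)"
        by measurable
      then show ?thesis unfolding P_def by (rule measurable_cong[THEN iffD1, rotated]) (auto simp: indicator_def)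
    qed
    define a where "a k l = cavg (Suc m) (snd l) (\<lambda>w. G (bt (Suc m) (fst l), w) (\<psi> k l))" for k l
    define b where "b k l = cavg m (snd k) (\<lambda>y. G (bt m (fst k), y) (\<psi> k l))" for k l
    \<comment> \<open>If the product of the test functions vanishes identically, both averages are
      0. Otherwise one point of its support places the times in \<open>time_pairs\<close> and the
      cells in the two balls.\<close>
    have kl_bound: "ennreal \<bar>a k l - b k l\<bar> \<le> (if (fst k, fst l) \<in> ?T then
        \<integral>\<^sup>+y\<in>cell m (snd k). (\<integral>\<^sup>+w\<in>cell (Suc m) (snd l). P (fst k) (fst l) y w \<partial>lebesgue) \<partial>lebesgue else 0)" for k l
    proof (cases "\<exists>z. \<psi> k l z \<noteq> 0")
      case False
      then have "\<psi> k l = (\<lambda>z. 0)" by auto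
      then have "a k l = 0" "b k l = 0" using distribution_0[OF germ_dist[OF G]] by (simp_all only: a_def b_def cavg_const)
      then show ?thesis by simp
    next
      case True
      then obtain z0 where z0: "\<psi> k l z0 \<noteq> 0" by blast
      note ov = overlap[OF \<eta> l(1,3) J _ _ z0[unfolded \<psi>_def \<phi>_def]]
      have yw: "\<exists>y. y \<in> cell m \<kappa>" for m and \<kappa> :: "'d \<Rightarrow> int"
        by (rule exI[of _ "corner m \<kappa>"]) (auto simp: cell_bounds corner_def)
      have T: "(fst k, fst l) \<in> ?T" using ov(1) yw by blast
      then have bts: "bt m (fst k) \<in> J" "bt (Suc m) (fst l) \<in> J" "\<bar>bt (Suc m) (fst l) - bt m (fst k)\<bar> \<le> 2 * \<mu>\<^sup>2"
        using bt_diff_le[of "fst k" "fst l" m] by (auto simp: time_pairs_def \<mu>_def)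
      have pt: "ennreal \<bar>G (bt (Suc m) (fst l), w) (\<psi> k l) - G (bt m (fst k), y) (\<psi> k l)\<bar> \<le> ennreal q * H (fst k) (fst l) y w"
        and in_balls: "y \<in> sball x (2 * \<epsilon>)" "w \<in> sball y (4 * dl m)"
        if yw: "y \<in> cell m (snd k)" "w \<in> cell (Suc m) (snd l)" for y w
      proof -
        have "sball x (2 * \<epsilon>) \<subseteq> U" using U l by (auto simp: sball_def)
        then have "w \<in> U" "y \<in> U" using ov[OF yw] by auto
        then show "ennreal \<bar>G (bt (Suc m) (fst l), w) (\<psi> k l) - G (bt m (fst k), y) (\<psi> k l)\<bar> \<le> ennreal q * H (fst k) (fst l) y w"
          unfolding q_def H_def using c1 A0 \<mu> bts
        proof (intro coherent_pointwise[OF coh G s\<psi>])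
          fix z assume "\<psi> k l z \<noteq> 0"
          from overlap[OF \<eta> l(1,3) J yw this[unfolded \<psi>_def \<phi>_def]]
          show "\<bar>fst z - bt (Suc m) (fst l)\<bar> \<le> \<mu>\<^sup>2 \<and> \<bar>fst z - bt m (fst k)\<bar> \<le> \<mu>\<^sup>2 \<and> infnorm (snd z - w) \<le> \<mu> \<and> infnorm (snd z - y) \<le> \<mu>"
            unfolding \<mu>_def by blast
        qed auto
        show "y \<in> sball x (2 * \<epsilon>)" "w \<in> sball y (4 * dl m)" using ov[OF yw] by auto
      qed
      have "ennreal \<bar>a k l - b k l\<bar> \<le> ennreal ((1 / dl m) ^ CARD('d)) *
        (\<integral>\<^sup>+y\<in>cell m (snd k). ennreal ((1 / dl (Suc m)) ^ CARD('d)) * (\<integral>\<^sup>+w\<in>cell (Suc m) (snd l). ennreal \<bar>G (bt (Suc m) (fst l), w) (\<psi> k l) - G (bt m (fst k), y) (\<psi> k l)\<bar> \<partial>lebesgue) \<partial>lebesgue)"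
        unfolding a_def b_def by (intro cavg_diff germ_integrable_cell[OF G] t\<psi>)
      also have "\<dots> \<le> (\<integral>\<^sup>+y\<in>cell m (snd k). (\<integral>\<^sup>+w\<in>cell (Suc m) (snd l).
          ennreal ((1 / dl m) ^ CARD('d)) * (ennreal ((1 / dl (Suc m)) ^ CARD('d)) * ennreal q) * H (fst k) (fst l) y w \<partial>lebesgue) \<partial>lebesgue)"
        by (intro iterated_le mH pt) auto
      also have "ennreal ((1 / dl m) ^ CARD('d)) * (ennreal ((1 / dl (Suc m)) ^ CARD('d)) * ennreal q) = ennreal Q"
        unfolding Q_def using q by (simp add: ennreal_mult)
      also have "(\<integral>\<^sup>+y\<in>cell m (snd k). (\<integral>\<^sup>+w\<in>cell (Suc m) (snd l). ennreal Q * H (fst k) (fst l) y w \<partial>lebesgue) \<partial>lebesgue)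
        = (\<integral>\<^sup>+y\<in>cell m (snd k). (\<integral>\<^sup>+w\<in>cell (Suc m) (snd l). P (fst k) (fst l) y w \<partial>lebesgue) \<partial>lebesgue)"
      proof (intro nn_integral_cong)
        fix y
        show "(\<integral>\<^sup>+w\<in>cell (Suc m) (snd l). ennreal Q * H (fst k) (fst l) y w \<partial>lebesgue) * indicator (cell m (snd k)) y =
          (\<integral>\<^sup>+w\<in>cell (Suc m) (snd l). P (fst k) (fst l) y w \<partial>lebesgue) * indicator (cell m (snd k)) y"
        proof (cases "y \<in> cell m (snd k)")
          case True
          \<comment> \<open>\<open>overlap\<close> localises pairs of cell points, so some point of
            the other cell is required before anything is known about y.\<close>
          obtain w0 where "w0 \<in> cell (Suc m) (snd l)" using yw by blast
          with True have "y \<in> sball x (2 * \<epsilon>)" using in_balls(1) by blast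
          then show ?thesis using True in_balls(2) by (auto simp: P_def indicator_def intro!: nn_integral_cong)
        qed simp
      qed
      finally show ?thesis using T by simp
    qed
    have "lvl r G m \<phi> = (\<Sum>k\<in>IA \<times> KA. \<Sum>l\<in>IB \<times> KB. b k l)"
      using lvl_refine[OF G \<phi> fin2(1) sub(1) fin2(2) sub(2)] by (simp only: b_def \<psi>_def)
    moreover have "lvl r G (Suc m) \<phi> = (\<Sum>k\<in>IA \<times> KA. \<Sum>l\<in>IB \<times> KB. a k l)"
      using lvl_refine[OF G \<phi> fin2(2) sub(2) fin2(1) sub(1)]
      by (subst sum.swap) (simp only: a_def \<psi>_def mult.left_commute)
    ultimately have "ennreal \<bar>lvl r G (Suc m) \<phi> - lvl r G m \<phi>\<bar> = ennreal \<bar>\<Sum>k\<in>IA \<times> KA. \<Sum>l\<in>IB \<times> KB. a k l - b k l\<bar>"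
      by (simp only: sum_subtractf)
    also have "\<dots> \<le> ennreal (\<Sum>k\<in>IA \<times> KA. \<Sum>l\<in>IB \<times> KB. \<bar>a k l - b k l\<bar>)"
      by (intro ennreal_leI order_trans[OF sum_abs] sum_mono sum_abs)
    also have "\<dots> = (\<Sum>k\<in>IA \<times> KA. \<Sum>l\<in>IB \<times> KB. ennreal \<bar>a k l - b k l\<bar>)"
      by (subst sum_ennreal[symmetric]) (auto intro!: sum_nonneg sum.cong simp: sum_ennreal)
    also have "\<dots> \<le> (\<Sum>k\<in>IA \<times> KA. \<Sum>l\<in>IB \<times> KB. (if (fst k, fst l) \<in> ?T then
        \<integral>\<^sup>+y\<in>cell m (snd k). (\<integral>\<^sup>+w\<in>cell (Suc m) (snd l). P (fst k) (fst l) y w \<partial>lebesgue) \<partial>lebesgue else 0))"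
      by (intro sum_mono kl_bound)
    also have "\<dots> = (\<Sum>i\<in>IA. \<Sum>j\<in>IB. \<Sum>\<kappa>\<in>KA. \<Sum>\<kappa>'\<in>KB. (if (i, j) \<in> ?T then
        \<integral>\<^sup>+y\<in>cell m \<kappa>. (\<integral>\<^sup>+w\<in>cell (Suc m) \<kappa>'. P i j y w \<partial>lebesgue) \<partial>lebesgue else 0))"
      by (rule sum_quad)
    also have "\<dots> \<le> (\<Sum>i\<in>IA. \<Sum>j\<in>IB. (if (i, j) \<in> ?T then \<integral>\<^sup>+y. \<integral>\<^sup>+w. P i j y w \<partial>lebesgue \<partial>lebesgue else 0))"
      by (intro sum_mono) (use double_cells_le[OF fin(2,4) mP] in auto)
    also have "\<dots> = (\<Sum>ij\<in>IA \<times> IB. (if ij \<in> ?T then \<integral>\<^sup>+y. \<integral>\<^sup>+w. P (fst ij) (snd ij) y w \<partial>lebesgue \<partial>lebesgue else 0))"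
      by (simp add: sum.cartesian_product case_prod_beta')
    also have "\<dots> = (\<Sum>ij\<in>(IA \<times> IB) \<inter> ?T. \<integral>\<^sup>+y. \<integral>\<^sup>+w. P (fst ij) (snd ij) y w \<partial>lebesgue \<partial>lebesgue)"
      using fin by (simp add: sum.inter_restrict)
    also have "\<dots> \<le> (\<Sum>ij\<in>?T. \<integral>\<^sup>+y. \<integral>\<^sup>+w. P (fst ij) (snd ij) y w \<partial>lebesgue \<partial>lebesgue)"
      using time_pairs_card(1)[OF l(3)] by (intro sum_mono2) auto
    also have "\<dots> = (\<Sum>(i, j)\<in>?T. \<integral>\<^sup>+y\<in>sball x (2 * \<epsilon>). (\<integral>\<^sup>+w\<in>sball y (4 * dl m). ennreal Q * H i j y w \<partial>lebesgue) \<partial>lebesgue)"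
    proof (unfold case_prod_beta', intro sum.cong refl nn_integral_cong)
      fix ij y
      show "(\<integral>\<^sup>+w. P (fst ij) (snd ij) y w \<partial>lebesgue) = (\<integral>\<^sup>+w\<in>sball y (4 * dl m). ennreal Q * H (fst ij) (snd ij) y w \<partial>lebesgue) * indicator (sball x (2 * \<epsilon>)) y"
        by (cases "y \<in> sball x (2 * \<epsilon>)") (auto simp: P_def)
    qed
    finally show "ennreal \<bar>lvl r G (Suc m) (rescale \<eta> \<epsilon> (t, x)) - lvl r G m (rescale \<eta> \<epsilon> (t, x))\<bar> \<le>
      (\<Sum>(i, j)\<in>time_pairs t \<epsilon> m J. \<integral>\<^sup>+y\<in>sball x (2 * \<epsilon>). (\<integral>\<^sup>+w\<in>sball y (4 * dl m).
       ennreal (C * ((1 / \<epsilon>) ^ (CARD('d) + 2) * ((1 / dl m) ^ CARD('d) * (dl m)\<^sup>2))) *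
       (HS (2 * dl m) (bt (Suc m) j) y w + HT (2 * dl m) (bt (Suc m) j) (bt m i) y) \<partial>lebesgue) \<partial>lebesgue)"
      unfolding \<phi>_def[symmetric] Q H_def A0_def \<mu>_def .
  qed
qed


lemma coherent_withD:
  fixes G :: "'d::finite pt \<Rightarrow> 'd dist"
  assumes "coherent_with r \<gamma> p G J U N HS HT"
  shows "(\<lambda>(y, w). HS \<mu> s y w) \<in> borel_measurable (lebesgue \<Otimes>\<^sub>M lebesgue)" "HT \<mu> s s' \<in> borel_measurable lebesgue"
    "0 < \<mu> \<Longrightarrow> \<mu> \<le> 1 \<Longrightarrow> s \<in> J \<Longrightarrow> Lp p U (\<lambda>y. \<integral>\<^sup>+w\<in>sball y (2 * \<mu>). HS \<mu> s y w \<partial>lebesgue) \<le> N * ennreal (\<mu> powr \<gamma> * \<mu> ^ CARD('d))"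
    "0 < \<mu> \<Longrightarrow> \<mu> \<le> 1 \<Longrightarrow> s \<in> J \<Longrightarrow> s' \<in> J \<Longrightarrow> \<bar>s - s'\<bar> \<le> 2 * \<mu>\<^sup>2 \<Longrightarrow> Lp p U (HT \<mu> s s') \<le> N * ennreal (\<mu> powr \<gamma>)"
  using assms unfolding coherent_with_def by auto

text \<open>The time increment is constant in w; integrated over the ball it picks up the volume
  \<open>(4 * \<mu>) ^ CARD('d)\<close>, which is the origin of \<open>4 ^ CARD('d)\<close>.\<close>

lemma Lp_increments:
  fixes G :: "'d::finite pt \<Rightarrow> 'd dist"
  assumes p: "1 \<le> p" and coh: "coherent_with r \<gamma> p G J U N HS HT" and [measurable]: "U \<in> sets lebesgue"
    and \<mu>: "0 < \<mu>" "\<mu> \<le> 1" and s: "s \<in> J" "s' \<in> J" "\<bar>s - s'\<bar> \<le> 2 * \<mu>\<^sup>2" and Q: "0 \<le> Q"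
  shows "(\<lambda>y. \<integral>\<^sup>+w\<in>sball y (2 * \<mu>). ennreal Q * (HS \<mu> s y w + HT \<mu> s s' y) \<partial>lebesgue) \<in> borel_measurable lebesgue"
    "Lp p U (\<lambda>y. \<integral>\<^sup>+w\<in>sball y (2 * \<mu>). ennreal Q * (HS \<mu> s y w + HT \<mu> s s' y) \<partial>lebesgue) \<le>
      ennreal (Q * ((1 + 4 ^ CARD('d)) * (\<mu> powr \<gamma> * \<mu> ^ CARD('d)))) * N"
proof -
  note m1 [measurable] = coherent_withD(1)[OF coh, of \<mu> s]
  note m2 [measurable] = coherent_withD(2)[OF coh, of \<mu> s s']
  have m3 [measurable]: "(\<lambda>w. HS \<mu> s y w) \<in> borel_measurable lebesgue" for y
    using measurable_Pair2[OF m1, of y] by simp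
  have m4 [measurable]: "(\<lambda>y. \<integral>\<^sup>+w\<in>sball y (2 * \<mu>). HS \<mu> s y w \<partial>lebesgue) \<in> borel_measurable lebesgue"
    by (rule measurable_sball_integral[OF m1])
  define v where "v = (4 * \<mu>) ^ CARD('d)"
  have v: "0 \<le> v" "v = 4 ^ CARD('d) * \<mu> ^ CARD('d)" using \<mu> by (auto simp: v_def power_mult_distrib)
  have em: "emeasure lebesgue (sball y (2 * \<mu>)) = ennreal v" for y :: "real ^ 'd"
    using emeasure_sball[of "2 * \<mu>" y] \<mu> by (simp add: v_def)
  have e: "(\<integral>\<^sup>+w\<in>sball y (2 * \<mu>). ennreal Q * (HS \<mu> s y w + HT \<mu> s s' y) \<partial>lebesgue) =
     ennreal Q * ((\<integral>\<^sup>+w\<in>sball y (2 * \<mu>). HS \<mu> s y w \<partial>lebesgue) + ennreal v * HT \<mu> s s' y)" for y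
  proof -
    have "(\<integral>\<^sup>+w\<in>sball y (2 * \<mu>). ennreal Q * (HS \<mu> s y w + HT \<mu> s s' y) \<partial>lebesgue) =
      (\<integral>\<^sup>+w. ennreal Q * (HS \<mu> s y w * indicator (sball y (2 * \<mu>)) w + HT \<mu> s s' y * indicator (sball y (2 * \<mu>)) w) \<partial>lebesgue)"
      by (intro nn_integral_cong) (simp add: algebra_simps)
    also have "\<dots> = ennreal Q * ((\<integral>\<^sup>+w\<in>sball y (2 * \<mu>). HS \<mu> s y w \<partial>lebesgue) + HT \<mu> s s' y * emeasure lebesgue (sball y (2 * \<mu>)))"
      by (subst nn_integral_cmult, measurable, subst nn_integral_add, measurable, subst nn_integral_cmult_indicator) auto
    finally show ?thesis unfolding em by (simp add: mult.commute)
  qed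
  show "(\<lambda>y. \<integral>\<^sup>+w\<in>sball y (2 * \<mu>). ennreal Q * (HS \<mu> s y w + HT \<mu> s s' y) \<partial>lebesgue) \<in> borel_measurable lebesgue"
    unfolding e by measurable
  have "Lp p U (\<lambda>y. \<integral>\<^sup>+w\<in>sball y (2 * \<mu>). ennreal Q * (HS \<mu> s y w + HT \<mu> s s' y) \<partial>lebesgue) =
    ennreal Q * Lp p U (\<lambda>y. (\<integral>\<^sup>+w\<in>sball y (2 * \<mu>). HS \<mu> s y w \<partial>lebesgue) + ennreal v * HT \<mu> s s' y)"
    unfolding e using p by (intro Lp_cmult) auto
  also have "\<dots> \<le> ennreal Q * (Lp p U (\<lambda>y. \<integral>\<^sup>+w\<in>sball y (2 * \<mu>). HS \<mu> s y w \<partial>lebesgue) + Lp p U (\<lambda>y. ennreal v * HT \<mu> s s' y))"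
    by (intro mult_left_mono Lp_add p) auto
  also have "Lp p U (\<lambda>y. ennreal v * HT \<mu> s s' y) = ennreal v * Lp p U (HT \<mu> s s')"
    using p by (intro Lp_cmult) auto
  also have "ennreal Q * (Lp p U (\<lambda>y. \<integral>\<^sup>+w\<in>sball y (2 * \<mu>). HS \<mu> s y w \<partial>lebesgue) + ennreal v * Lp p U (HT \<mu> s s')) \<le>
    ennreal Q * (N * ennreal (\<mu> powr \<gamma> * \<mu> ^ CARD('d)) + ennreal v * (N * ennreal (\<mu> powr \<gamma>)))"
    by (intro mult_left_mono add_mono coherent_withD(3,4)[OF coh] \<mu> s) auto
  also have "\<dots> = (ennreal Q * (ennreal (\<mu> powr \<gamma> * \<mu> ^ CARD('d)) + ennreal v * ennreal (\<mu> powr \<gamma>))) * N"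
    by (simp add: algebra_simps)
  also have "ennreal Q * (ennreal (\<mu> powr \<gamma> * \<mu> ^ CARD('d)) + ennreal v * ennreal (\<mu> powr \<gamma>)) = ennreal (Q * (\<mu> powr \<gamma> * \<mu> ^ CARD('d) + v * \<mu> powr \<gamma>))"
    using Q v \<mu> by (simp flip: ennreal_mult ennreal_plus)
  also have "\<mu> powr \<gamma> * \<mu> ^ CARD('d) + v * \<mu> powr \<gamma> = (1 + 4 ^ CARD('d)) * (\<mu> powr \<gamma> * \<mu> ^ CARD('d))"
    unfolding v(2) by (simp add: algebra_simps)
  finally show "Lp p U (\<lambda>y. \<integral>\<^sup>+w\<in>sball y (2 * \<mu>). ennreal Q * (HS \<mu> s y w + HT \<mu> s s' y) \<partial>lebesgue) \<le>
      ennreal (Q * ((1 + 4 ^ CARD('d)) * (\<mu> powr \<gamma> * \<mu> ^ CARD('d)))) * N" .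
qed

lemma sum_const_ennreal_le:
  assumes "finite T" "\<And>i. i \<in> T \<Longrightarrow> f i \<le> ennreal a * N" "0 \<le> a" "real (card T) \<le> c"
  shows "(\<Sum>i\<in>T. f i) \<le> ennreal (c * a) * N"
proof -
  have "(\<Sum>i\<in>T. f i) \<le> of_nat (card T) * (ennreal a * N)" by (intro sum_bounded_above assms(2))
  also have "\<dots> \<le> ennreal c * (ennreal a * N)"
    using assms(4) by (intro mult_right_mono) (auto simp flip: ennreal_of_nat_eq_real_of_nat intro: ennreal_leI)
  finally show ?thesis using assms(3,4) by (simp add: ennreal_mult mult.assoc)
qed

text \<open>The norm of the previous pointwise bound. The number of time pairs cancels the time
  volumes, the ball of radius \<open>2 * \<epsilon>\<close> in \<open>Lp_moving_average\<close>
  cancels the height of the test function in space, and the integral of the increments cancels the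
  cell normalisation. What is left is \<open>dl m powr \<gamma>\<close>.\<close>

lemma level_diff:
  assumes p: "1 \<le> p"
  shows "\<exists>C>0. \<forall>(G :: 'd::finite pt \<Rightarrow> 'd dist) J U U1 N t \<epsilon> m.
    germ r G \<longrightarrow> coherent r \<gamma> p G J U N \<longrightarrow> 0 < \<epsilon> \<longrightarrow> \<epsilon> \<le> 1 \<longrightarrow> dl m \<le> \<epsilon> / 4 \<longrightarrow>
    {t - 2 * \<epsilon>\<^sup>2..t + \<epsilon>\<^sup>2 - (dl (Suc m))\<^sup>2} \<subseteq> J \<longrightarrow> U \<in> sets lebesgue \<longrightarrow> U1 \<in> sets lebesgue \<longrightarrow> (\<forall>x\<in>U1. sball x 2 \<subseteq> U) \<longrightarrow>
    (\<exists>B\<in>borel_measurable lebesgue. (\<forall>x\<in>U1. \<forall>\<eta>\<in>Br r.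
        ennreal \<bar>lvl r G (Suc m) (rescale \<eta> \<epsilon> (t, x)) - lvl r G m (rescale \<eta> \<epsilon> (t, x))\<bar> \<le> B x) \<and>
      Lp p U1 B \<le> ennreal (C * dl m powr \<gamma>) * N)"
proof -
  obtain C where C: "0 < C" and pw: "\<And>(G :: 'd pt \<Rightarrow> 'd dist) \<gamma> p J U N HS HT t \<epsilon> m x \<eta>.
    germ r G \<Longrightarrow> coherent_with r \<gamma> p G J U N HS HT \<Longrightarrow> 0 < \<epsilon> \<Longrightarrow> \<epsilon> \<le> 1 \<Longrightarrow> dl m \<le> \<epsilon> / 4 \<Longrightarrow>
    {t - 2 * \<epsilon>\<^sup>2..t + \<epsilon>\<^sup>2 - (dl (Suc m))\<^sup>2} \<subseteq> J \<Longrightarrow> sball x 2 \<subseteq> U \<Longrightarrow> \<eta> \<in> Br r \<Longrightarrow>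
    ennreal \<bar>lvl r G (Suc m) (rescale \<eta> \<epsilon> (t, x)) - lvl r G m (rescale \<eta> \<epsilon> (t, x))\<bar> \<le>
    (\<Sum>(i, j)\<in>time_pairs t \<epsilon> m J. \<integral>\<^sup>+y\<in>sball x (2 * \<epsilon>). (\<integral>\<^sup>+w\<in>sball y (4 * dl m).
       ennreal (C * ((1 / \<epsilon>) ^ (CARD('d) + 2) * ((1 / dl m) ^ CARD('d) * (dl m)\<^sup>2))) *
       (HS (2 * dl m) (bt (Suc m) j) y w + HT (2 * dl m) (bt (Suc m) j) (bt m i) y) \<partial>lebesgue) \<partial>lebesgue)"
    using level_diff_pointwise[where 'd='d, of r] by blast
  \<comment> \<open>33 counts the time pairs, \<open>2 * 4 ^ CARD('d)\<close> comes from the moving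
    average, \<open>1 + 4 ^ CARD('d)\<close> from \<open>Lp_increments\<close>, and the powers of 2
    from the comparison scale \<open>2 * dl m\<close>.\<close>
  define C' where "C' = 33 * (2 * 4 ^ CARD('d) * (C * ((1 + 4 ^ CARD('d)) * (2 powr \<gamma> * 2 ^ CARD('d)))))"
  have C': "0 < C'" unfolding C'_def using C by (intro mult_pos_pos add_pos_pos zero_less_power) auto
  show ?thesis
  proof (intro exI[of _ C'] conjI C' allI impI)
    fix G :: "'d pt \<Rightarrow> 'd dist" and J U U1 N t \<epsilon> m
    assume G: "germ r G" and "coherent r \<gamma> p G J U N" and l: "0 < \<epsilon>" "\<epsilon> \<le> 1" "dl m \<le> \<epsilon> / 4"
      and J: "{t - 2 * \<epsilon>\<^sup>2..t + \<epsilon>\<^sup>2 - (dl (Suc m))\<^sup>2} \<subseteq> J" and U [measurable]: "U \<in> sets lebesgue" "U1 \<in> sets lebesgue"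
      and UU: "\<forall>x\<in>U1. sball x 2 \<subseteq> U"
    then obtain HS HT where coh: "coherent_with r \<gamma> p G J U N HS HT" by (auto simp: coherent_def)
    define Q where "Q = C * ((1 / \<epsilon>) ^ (CARD('d) + 2) * ((1 / dl m) ^ CARD('d) * (dl m)\<^sup>2))"
    have Q: "0 \<le> Q" using C l by (simp add: Q_def)
    let ?T = "time_pairs t \<epsilon> m J"
    define h where "h ij y = (\<integral>\<^sup>+w\<in>sball y (4 * dl m). ennreal Q *
       (HS (2 * dl m) (bt (Suc m) (snd ij)) y w + HT (2 * dl m) (bt (Suc m) (snd ij)) (bt m (fst ij)) y) \<partial>lebesgue)" for ij y
    define B where "B x = (\<Sum>ij\<in>?T. \<integral>\<^sup>+y\<in>sball x (2 * \<epsilon>). h ij y \<partial>lebesgue)" for x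
    define a where "a = Q * ((1 + 4 ^ CARD('d)) * ((2 * dl m) powr \<gamma> * (2 * dl m) ^ CARD('d)))"
    have a: "0 \<le> a" using Q by (simp add: a_def)
    have mu: "0 < 2 * dl m" "2 * dl m \<le> 1" using l dl_pos[of m] by linarith+
    have e4: "2 * (2 * dl m) = 4 * dl m" by simp
    have h: "h ij \<in> borel_measurable lebesgue" "Lp p U (h ij) \<le> ennreal a * N" if "ij \<in> ?T" for ij
    proof -
      have "bt (Suc m) (snd ij) \<in> J" "bt m (fst ij) \<in> J" "\<bar>bt (Suc m) (snd ij) - bt m (fst ij)\<bar> \<le> 2 * (2 * dl m)\<^sup>2"
        using that bt_diff_le by (auto simp: time_pairs_def)
      from Lp_increments[OF p coh U(1) mu this Q]
      show "h ij \<in> borel_measurable lebesgue" "Lp p U (h ij) \<le> ennreal a * N"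
        unfolding h_def a_def e4 by blast+
    qed
    have mB: "(\<lambda>x. \<integral>\<^sup>+y\<in>sball x (2 * \<epsilon>). h ij y \<partial>lebesgue) \<in> borel_measurable lebesgue" if "ij \<in> ?T" for ij
      using h(1)[OF that] by (intro measurable_sball_integral measurable_snd_lebesgue)
    have "Lp p U1 B \<le> (\<Sum>ij\<in>?T. Lp p U1 (\<lambda>x. \<integral>\<^sup>+y\<in>sball x (2 * \<epsilon>). h ij y \<partial>lebesgue))"
      unfolding B_def using time_pairs_card(1)[OF l(3)] mB by (intro Lp_sum p) auto
    also have "\<dots> \<le> ennreal (33 * (\<epsilon>\<^sup>2 / (dl m)\<^sup>2) * (2 * (4 * \<epsilon>) ^ CARD('d) * a)) * N"
    proof (rule sum_const_ennreal_le[OF time_pairs_card(1)[OF l(3)] _ _ time_pairs_card(2)[OF l(3)]])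
      fix ij assume ij: "ij \<in> ?T"
      have "Lp p U1 (\<lambda>x. \<integral>\<^sup>+y\<in>sball x (2 * \<epsilon>). h ij y \<partial>lebesgue) \<le> ennreal (2 * (2 * (2 * \<epsilon>)) ^ CARD('d)) * Lp p U (h ij)"
      proof (rule Lp_moving_average[OF p h(1)[OF ij]])
        fix x assume "x \<in> U1"
        moreover have "sball x (2 * \<epsilon>) \<subseteq> sball x 2" using l by (auto simp: sball_def)
        ultimately show "sball x (2 * \<epsilon>) \<subseteq> U" using UU by blast
      qed (use l in auto)
      also have "\<dots> \<le> ennreal (2 * (2 * (2 * \<epsilon>)) ^ CARD('d)) * (ennreal a * N)"
        by (intro mult_left_mono h(2) ij) auto
      also have "\<dots> = ennreal (2 * (4 * \<epsilon>) ^ CARD('d) * a) * N"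
        using a l by (simp add: ennreal_mult mult.assoc)
      finally show "Lp p U1 (\<lambda>x. \<integral>\<^sup>+y\<in>sball x (2 * \<epsilon>). h ij y \<partial>lebesgue) \<le> ennreal (2 * (4 * \<epsilon>) ^ CARD('d) * a) * N" .
    qed (use a l in auto)
    also have "33 * (\<epsilon>\<^sup>2 / (dl m)\<^sup>2) * (2 * (4 * \<epsilon>) ^ CARD('d) * a) = C' * dl m powr \<gamma>"
    proof -
      define e f where "e = \<epsilon> ^ CARD('d)" and "f = dl m ^ CARD('d)"
      have ef: "0 < e" "0 < f" using l by (auto simp: e_def f_def)
      have r: "(4 * \<epsilon>) ^ CARD('d) = 4 ^ CARD('d) * e" "(2 * dl m) ^ CARD('d) = 2 ^ CARD('d) * f"
        "(1 / \<epsilon>) ^ (CARD('d) + 2) = 1 / e * (1 / \<epsilon>\<^sup>2)" "(1 / dl m) ^ CARD('d) = 1 / f"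
        "(2 * dl m) powr \<gamma> = 2 powr \<gamma> * dl m powr \<gamma>"
        by (simp_all add: e_def f_def power_mult_distrib power_add power_one_over power_divide powr_mult power2_eq_square)
      have "33 * (\<epsilon>\<^sup>2 / (dl m)\<^sup>2) * (2 * (4 * \<epsilon>) ^ CARD('d) * a) =
        (\<epsilon>\<^sup>2 * (1 / \<epsilon>\<^sup>2)) * ((dl m)\<^sup>2 / (dl m)\<^sup>2) * (e * (1 / e)) * (f * (1 / f)) * (C' * dl m powr \<gamma>)"
        unfolding a_def Q_def C'_def r by (simp only: divide_inverse mult_1_left mult_ac)
      moreover have "\<epsilon>\<^sup>2 * (1 / \<epsilon>\<^sup>2) = 1" "(dl m)\<^sup>2 / (dl m)\<^sup>2 = 1" "e * (1 / e) = 1" "f * (1 / f) = 1"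
      proof -
        have "\<epsilon>\<^sup>2 \<noteq> 0" "e \<noteq> 0" "f \<noteq> 0" using ef l(1) by auto
        then show "\<epsilon>\<^sup>2 * (1 / \<epsilon>\<^sup>2) = 1" "(dl m)\<^sup>2 / (dl m)\<^sup>2 = 1" "e * (1 / e) = 1" "f * (1 / f) = 1"
          by simp_all
      qed
      ultimately show ?thesis by (simp only: mult_1_left)
    qed
    finally have LB: "Lp p U1 B \<le> ennreal (C' * dl m powr \<gamma>) * N" .
    show "\<exists>B\<in>borel_measurable lebesgue. (\<forall>x\<in>U1. \<forall>\<eta>\<in>Br r.
        ennreal \<bar>lvl r G (Suc m) (rescale \<eta> \<epsilon> (t, x)) - lvl r G m (rescale \<eta> \<epsilon> (t, x))\<bar> \<le> B x) \<and>
      Lp p U1 B \<le> ennreal (C' * dl m powr \<gamma>) * N"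
    proof (intro bexI[of _ B] conjI LB ballI)
      show "B \<in> borel_measurable lebesgue" unfolding B_def using mB by (intro borel_measurable_sum)
      fix x :: "real ^ 'd" and \<eta> :: "'d func" assume x: "x \<in> U1" and \<eta>: "\<eta> \<in> Br r"
      show "ennreal \<bar>lvl r G (Suc m) (rescale \<eta> \<epsilon> (t, x)) - lvl r G m (rescale \<eta> \<epsilon> (t, x))\<bar> \<le> B x"
        using pw[OF G coh l J _ \<eta>, of x] UU x unfolding B_def h_def Q_def case_prod_beta' by blast
    qed
  qed
qed

text \<open>Counterpart of \<open>overlap\<close> for one level and the fixed point (t, x). Here the
  comparison takes place at the scale \<epsilon>, which dominates \<open>2 * dl m\<close>.\<close>

lemma overlap_first:
  fixes k :: "'d::finite idx"
  assumes \<eta>: "\<eta> \<in> Br r" and l: "0 < \<epsilon>" "dl m \<le> \<epsilon> / 4"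
    and J: "{t - 2 * \<epsilon>\<^sup>2..t + \<epsilon>\<^sup>2 - (dl m)\<^sup>2} \<subseteq> J" and y: "y \<in> cell m (snd k)"
    and z: "pu r m k z * rescale \<eta> \<epsilon> (t, x) z \<noteq> 0"
  shows "\<bar>t / (dl m)\<^sup>2 - of_int (fst k)\<bar> \<le> \<epsilon>\<^sup>2 / (dl m)\<^sup>2 + 1" "bt m (fst k) \<in> J" "\<bar>bt m (fst k) - t\<bar> \<le> 2 * \<epsilon>\<^sup>2" "y \<in> sball x (2 * \<epsilon>)"
    "\<bar>fst z - bt m (fst k)\<bar> \<le> \<epsilon>\<^sup>2" "\<bar>fst z - t\<bar> \<le> \<epsilon>\<^sup>2" "infnorm (snd z - y) \<le> \<epsilon>" "infnorm (snd z - x) \<le> \<epsilon>"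
proof -
  define D where "D = (dl m)\<^sup>2"
  have D: "0 < D" by (simp add: D_def)
  have lD: "16 * D \<le> \<epsilon>\<^sup>2" using power_mono[OF l(2), of 2] by (simp add: power_divide D_def)
  have zk: "\<bar>fst z - D * of_int (fst k)\<bar> \<le> D" "infnorm (snd z - corner m (snd k)) \<le> dl m"
    using z pu_support[of r m k z] by (auto simp: D_def)
  have zx: "\<bar>fst z - t\<bar> \<le> \<epsilon>\<^sup>2" "infnorm (snd z - x) \<le> \<epsilon>"
    using z \<eta> l rescale_support[of \<eta> \<epsilon> "(t, x)" z] by (auto simp: Br_def)
  then show "\<bar>fst z - t\<bar> \<le> \<epsilon>\<^sup>2" "infnorm (snd z - x) \<le> \<epsilon>" .
  have yk: "infnorm (y - corner m (snd k)) \<le> dl m" using cell_corner[OF y] .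
  have zy: "infnorm (snd z - y) \<le> 2 * dl m"
    using infnorm_tri[of "snd z" y "corner m (snd k)"] infnorm_sub[of "snd z"] infnorm_sub[of y] yk zk by (smt (verit))
  then show "infnorm (snd z - y) \<le> \<epsilon>" using l by linarith
  have "infnorm (y - x) \<le> 2 * dl m + \<epsilon>" using infnorm_tri[of y x "snd z"] zy zx by linarith
  then show "y \<in> sball x (2 * \<epsilon>)" using l by (simp add: sball_def)
  have bk: "bt m (fst k) = D * of_int (fst k) - 2 * D" by (simp add: bt_def D_def algebra_simps)
  show "\<bar>fst z - bt m (fst k)\<bar> \<le> \<epsilon>\<^sup>2" unfolding bk using zk(1) D lD by linarith
  show "\<bar>bt m (fst k) - t\<bar> \<le> 2 * \<epsilon>\<^sup>2" unfolding bk using zk(1) zx(1) D lD by linarith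
  have "bt m (fst k) \<in> {t - 2 * \<epsilon>\<^sup>2..t + \<epsilon>\<^sup>2 - D}" unfolding bk atLeastAtMost_iff using zk(1) zx(1) lD D by (intro conjI; linarith)
  then show "bt m (fst k) \<in> J" using J by (auto simp: D_def)
  have "\<bar>t - D * of_int (fst k)\<bar> / D \<le> (\<epsilon>\<^sup>2 + D) / D"
    using zk(1) zx(1) D by (intro divide_right_mono) auto
  moreover have "\<bar>t - D * of_int (fst k)\<bar> / D = \<bar>t / D - of_int (fst k)\<bar>"
  proof -
    have "(t - D * of_int (fst k)) / D = t / D - of_int (fst k)" using D by (simp add: diff_divide_distrib)
    then show ?thesis using D by (metis abs_divide abs_of_pos)
  qed
  ultimately show "\<bar>t / (dl m)\<^sup>2 - of_int (fst k)\<bar> \<le> \<epsilon>\<^sup>2 / (dl m)\<^sup>2 + 1"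
    using D unfolding D_def[symmetric] by (simp add: add_divide_distrib)
qed

text \<open>\<open>G (t, x)\<close> is expanded in the partition of the level, and each piece is
  compared with the cell average. As \<open>dl m\<close> is comparable to \<epsilon>, the number of
  times is bounded and the pieces have size \<epsilon>, so that no sum over scales occurs. Here x is
  fixed and only w is integrated.\<close>

lemma first_level:
  assumes p: "1 \<le> p"
  shows "\<exists>C>0. \<forall>(G :: 'd::finite pt \<Rightarrow> 'd dist) J U U1 N t \<epsilon> m.
    germ r G \<longrightarrow> coherent r \<gamma> p G J U N \<longrightarrow> 0 < \<epsilon> \<longrightarrow> \<epsilon> \<le> 1 \<longrightarrow> dl m \<le> \<epsilon> / 4 \<longrightarrow> \<epsilon> / 8 < dl m \<longrightarrow>
    {t - 2 * \<epsilon>\<^sup>2..t + \<epsilon>\<^sup>2 - (dl m)\<^sup>2} \<subseteq> J \<longrightarrow> U \<in> sets lebesgue \<longrightarrow> U1 \<in> sets lebesgue \<longrightarrow> (\<forall>x\<in>U1. sball x 2 \<subseteq> U) \<longrightarrow>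
    (\<exists>B\<in>borel_measurable lebesgue. (\<forall>x\<in>U1. \<forall>\<eta>\<in>Br r.
        ennreal \<bar>lvl r G m (rescale \<eta> \<epsilon> (t, x)) - G (t, x) (rescale \<eta> \<epsilon> (t, x))\<bar> \<le> B x) \<and>
      Lp p U1 B \<le> ennreal (C * \<epsilon> powr \<gamma>) * N)"
proof -
  obtain Cp where Cp: "0 < Cp" "\<And>m (k::'d idx). sized r Cp (dl m) (pu r m k)" using pu_sized by blast
  obtain Cm where Cm: "0 < Cm" "\<And>(f::'d func) g A B \<mu>. 0 \<le> A \<Longrightarrow> 0 \<le> B \<Longrightarrow> 0 < \<mu> \<Longrightarrow> sized r A \<mu> f \<Longrightarrow> sized r B \<mu> g \<Longrightarrow>
     sized r (Cm * A * B) \<mu> (\<lambda>z. f z * g z)" using sized_mult by blast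
  define c1 where "c1 = Cm * (Cp * 8 powr r)"
  have c1: "0 < c1" using Cp(1) Cm(1) by (simp add: c1_def)
  \<comment> \<open>The condition \<open>\<epsilon> / 8 < dl m\<close> gives
    \<open>8 ^ CARD('d)\<close> through the cell normalisation, and at most
    \<open>2 * 65 + 1\<close> time indices, for which 192 is a generous bound.\<close>
  define C' where "C' = 192 * (8 ^ CARD('d) * c1 * (1 + 4 ^ CARD('d)))"
  have C': "0 < C'" unfolding C'_def using c1 by (intro mult_pos_pos add_pos_pos zero_less_power) auto
  show ?thesis
  proof (intro exI[of _ C'] conjI C' allI impI)
    fix G :: "'d pt \<Rightarrow> 'd dist" and J U U1 N t \<epsilon> m
    assume G: "germ r G" and "coherent r \<gamma> p G J U N" and l: "0 < \<epsilon>" "\<epsilon> \<le> 1" "dl m \<le> \<epsilon> / 4" "\<epsilon> / 8 < dl m"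
      and J: "{t - 2 * \<epsilon>\<^sup>2..t + \<epsilon>\<^sup>2 - (dl m)\<^sup>2} \<subseteq> J" and U [measurable]: "U \<in> sets lebesgue" "U1 \<in> sets lebesgue"
      and UU: "\<forall>x\<in>U1. sball x 2 \<subseteq> U"
    then obtain HS HT where coh: "coherent_with r \<gamma> p G J U N HS HT" by (auto simp: coherent_def)
    have lD: "16 * (dl m)\<^sup>2 \<le> \<epsilon>\<^sup>2" using power_mono[OF l(3), of 2] by (simp add: power_divide)
    have tJ: "t \<in> J"
    proof -
      have "t \<in> {t - 2 * \<epsilon>\<^sup>2..t + \<epsilon>\<^sup>2 - (dl m)\<^sup>2}" using lD zero_le_power2[of "dl m"] by (simp add: order_trans[OF _ lD])
      then show ?thesis using J by blast
    qed
    define Q where "Q = (1 / dl m) ^ CARD('d) * c1"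
    have Q: "0 \<le> Q" using c1 by (simp add: Q_def)
    define T where "T = {i::int. \<bar>t / (dl m)\<^sup>2 - of_int i\<bar> \<le> \<epsilon>\<^sup>2 / (dl m)\<^sup>2 + 1 \<and> bt m i \<in> J \<and> \<bar>bt m i - t\<bar> \<le> 2 * \<epsilon>\<^sup>2}"
    have X: "16 \<le> \<epsilon>\<^sup>2 / (dl m)\<^sup>2" "\<epsilon>\<^sup>2 / (dl m)\<^sup>2 \<le> 64"
    proof -
      show "16 \<le> \<epsilon>\<^sup>2 / (dl m)\<^sup>2" using lD by (simp add: le_divide_eq)
      have "\<epsilon>\<^sup>2 \<le> (8 * dl m)\<^sup>2" using l by (intro power_mono) auto
      then show "\<epsilon>\<^sup>2 / (dl m)\<^sup>2 \<le> 64" by (simp add: divide_le_eq power_mult_distrib)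
    qed
    have T_sub: "T \<subseteq> {i::int. \<bar>t / (dl m)\<^sup>2 - of_int i\<bar> \<le> \<epsilon>\<^sup>2 / (dl m)\<^sup>2 + 1}" by (auto simp: T_def)
    have finT: "finite T" using T_sub card_int_interval(1) by (rule finite_subset)
    have cardT: "real (card T) \<le> 192"
    proof -
      have "card T \<le> card {i::int. \<bar>t / (dl m)\<^sup>2 - of_int i\<bar> \<le> \<epsilon>\<^sup>2 / (dl m)\<^sup>2 + 1}"
        using T_sub card_int_interval(1) by (intro card_mono)
      then have "real (card T) \<le> real (card {i::int. \<bar>t / (dl m)\<^sup>2 - of_int i\<bar> \<le> \<epsilon>\<^sup>2 / (dl m)\<^sup>2 + 1})" by simp
      also have "\<dots> \<le> 2 * (\<epsilon>\<^sup>2 / (dl m)\<^sup>2 + 1) + 1" by (rule card_int_interval(2)) (use X in simp)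
      also have "\<dots> \<le> 192" using X by simp
      finally show ?thesis .
    qed
    define h where "h i x = (\<integral>\<^sup>+w\<in>sball x (2 * \<epsilon>). ennreal Q * (HS \<epsilon> (bt m i) x w + HT \<epsilon> (bt m i) t x) \<partial>lebesgue)" for i x
    define B where "B x = (\<Sum>i\<in>T. h i x)" for x
    define a where "a = Q * ((1 + 4 ^ CARD('d)) * (\<epsilon> powr \<gamma> * \<epsilon> ^ CARD('d)))"
    have a: "0 \<le> a" using Q l by (simp add: a_def)
    have h: "h i \<in> borel_measurable lebesgue" "Lp p U (h i) \<le> ennreal a * N" if "i \<in> T" for i
      using Lp_increments[OF p coh U(1) l(1,2) _ tJ _ Q, of "bt m i"] that unfolding h_def a_def T_def by blast+
    have U1U: "U1 \<subseteq> U" using UU by (force simp: sball_def infnorm_0)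
    have "Lp p U1 B \<le> Lp p U B" using p U1U by (intro Lp_mono) auto
    also have "\<dots> \<le> (\<Sum>i\<in>T. Lp p U (h i))" unfolding B_def using finT h by (intro Lp_sum p) auto
    also have "\<dots> \<le> ennreal (192 * a) * N" by (rule sum_const_ennreal_le[OF finT h(2) a cardT])
    also have "\<dots> \<le> ennreal (C' * \<epsilon> powr \<gamma>) * N"
    proof (intro mult_right_mono ennreal_leI)
      have "(1 / dl m) ^ CARD('d) \<le> (8 / \<epsilon>) ^ CARD('d)"
        using l by (intro power_mono) (auto simp: field_simps)
      then have "Q * \<epsilon> ^ CARD('d) \<le> ((8 / \<epsilon>) ^ CARD('d) * c1) * \<epsilon> ^ CARD('d)"
        unfolding Q_def using c1 l by (intro mult_right_mono) auto
      also have "\<dots> = 8 ^ CARD('d) * c1" using l by (simp add: power_divide)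
      finally have "(192 * ((1 + 4 ^ CARD('d)) * \<epsilon> powr \<gamma>)) * (Q * \<epsilon> ^ CARD('d)) \<le> (192 * ((1 + 4 ^ CARD('d)) * \<epsilon> powr \<gamma>)) * (8 ^ CARD('d) * c1)"
        by (intro mult_left_mono) auto
      then show "192 * a \<le> C' * \<epsilon> powr \<gamma>" unfolding a_def C'_def by (simp only: mult_ac)
    qed simp
    finally have LB: "Lp p U1 B \<le> ennreal (C' * \<epsilon> powr \<gamma>) * N" .
    show "\<exists>B\<in>borel_measurable lebesgue. (\<forall>x\<in>U1. \<forall>\<eta>\<in>Br r.
        ennreal \<bar>lvl r G m (rescale \<eta> \<epsilon> (t, x)) - G (t, x) (rescale \<eta> \<epsilon> (t, x))\<bar> \<le> B x) \<and>
      Lp p U1 B \<le> ennreal (C' * \<epsilon> powr \<gamma>) * N"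
    proof (intro bexI[of _ B] conjI LB ballI)
      show "B \<in> borel_measurable lebesgue" unfolding B_def using h(1) by (intro borel_measurable_sum)
      fix x :: "real ^ 'd" and \<eta> :: "'d func" assume x: "x \<in> U1" and \<eta>: "\<eta> \<in> Br r"
      define \<phi> where "\<phi> = rescale \<eta> \<epsilon> (t, x)"
      define A0 where "A0 = (1 / \<epsilon>) ^ (CARD('d) + 2)"
      have A0: "0 < A0" unfolding A0_def by (rule zero_less_power) (use l in simp)
      have A0': "A0 * \<epsilon> ^ (CARD('d) + 2) = 1" using l by (simp add: A0_def power_one_over)
      have \<phi>: "\<phi> \<in> tests r" unfolding \<phi>_def by (rule tests_rescale[OF \<eta> l(1)])
      have s\<phi>: "sized r A0 \<epsilon> \<phi>"
        using sized_rescale[OF Br_sized[OF \<eta>] l(1), of "(t, x)"] by (simp only: \<phi>_def A0_def mult_1_right)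
      define \<psi> where "\<psi> k = (\<lambda>z. pu r m k z * \<phi> z)" for k :: "'d idx"
      have s\<psi>: "sized r (c1 * A0) \<epsilon> (\<psi> k)" for k
      proof -
        have "sized r (Cp * 8 powr r) \<epsilon> (pu r m k)"
          using Cp(1) l by (intro sized_scale_up[OF Cp(2)]) auto
        then have "sized r (Cm * (Cp * 8 powr r) * A0) \<epsilon> (\<psi> k)"
          unfolding \<psi>_def using Cp(1) Cm(1) A0 l s\<phi> by (intro Cm(2)) auto
        then show ?thesis by (simp add: c1_def mult_ac)
      qed
      have t\<psi>: "\<psi> k \<in> tests r" for k unfolding \<psi>_def by (intro pu_tests \<phi>)
      define IA KA where "IA = fst ` supp_idx r m \<phi>" and "KA = snd ` supp_idx r m \<phi>"
      have fin: "finite IA" "finite KA" unfolding IA_def KA_def using finite_supp_idx[OF \<phi>] by auto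
      have sub: "supp_idx r m \<phi> \<subseteq> IA \<times> KA" unfolding IA_def KA_def by force
      have fin2: "finite (IA \<times> KA)" using fin by auto
      define H where "H i w = HS \<epsilon> (bt m i) x w + HT \<epsilon> (bt m i) t x" for i w
      have mH [measurable]: "H i \<in> borel_measurable lebesgue" for i
        unfolding H_def using measurable_Pair2[OF coherent_withD(1)[OF coh, of \<epsilon> "bt m i"], of x] by simp
      define P where "P i w = ennreal Q * H i w * indicator (sball x (2 * \<epsilon>)) w" for i w
      have mP: "P i \<in> borel_measurable lebesgue" for i unfolding P_def by measurable
      have kbound: "ennreal \<bar>cavg m (snd k) (\<lambda>y. G (bt m (fst k), y) (\<psi> k)) - G (t, x) (\<psi> k)\<bar> \<le>
        (if fst k \<in> T then \<integral>\<^sup>+w\<in>cell m (snd k). P (fst k) w \<partial>lebesgue else 0)" for k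
      proof (cases "\<exists>z. \<psi> k z \<noteq> 0")
        case False
        then have "\<psi> k = (\<lambda>z. 0)" by auto
        then show ?thesis using distribution_0[OF germ_dist[OF G]] by (simp add: cavg_const)
      next
        case True
        then obtain z0 where z0: "\<psi> k z0 \<noteq> 0" by blast
        note ov = overlap_first[OF \<eta> l(1,3) J _ z0[unfolded \<psi>_def \<phi>_def]]
        have "\<exists>y. y \<in> cell m (snd k)"
          by (rule exI[of _ "corner m (snd k)"]) (auto simp: cell_bounds corner_def)
        then have kT: "fst k \<in> T" "bt m (fst k) \<in> J" "\<bar>bt m (fst k) - t\<bar> \<le> 2 * \<epsilon>\<^sup>2"
          unfolding T_def using ov(1,2,3) by blast+
        have pt: "ennreal \<bar>G (bt m (fst k), w) (\<psi> k) - G (t, x) (\<psi> k)\<bar> \<le> ennreal c1 * H (fst k) w"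
          and in_ball: "w \<in> sball x (2 * \<epsilon>)" if w: "w \<in> cell m (snd k)" for w
        proof -
          show "w \<in> sball x (2 * \<epsilon>)" using ov[OF w] by blast
          moreover have "sball x (2 * \<epsilon>) \<subseteq> sball x 2" using l by (auto simp: sball_def)
          ultimately have "w \<in> U" "x \<in> U" using UU x U1U by blast+
          then have "ennreal \<bar>G (bt m (fst k), w) (\<psi> k) - G (t, x) (\<psi> k)\<bar> \<le> ennreal (c1 * A0 * \<epsilon> ^ (CARD('d) + 2)) * H (fst k) w"
            unfolding H_def using c1 A0 l kT tJ
          proof (intro coherent_pointwise[OF coh G s\<psi>])
            fix z assume "\<psi> k z \<noteq> 0"
            from overlap_first[OF \<eta> l(1,3) J w this[unfolded \<psi>_def \<phi>_def]]
            show "\<bar>fst z - bt m (fst k)\<bar> \<le> \<epsilon>\<^sup>2 \<and> \<bar>fst z - t\<bar> \<le> \<epsilon>\<^sup>2 \<and> infnorm (snd z - w) \<le> \<epsilon> \<and> infnorm (snd z - x) \<le> \<epsilon>"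
              by blast
          qed auto
          then show "ennreal \<bar>G (bt m (fst k), w) (\<psi> k) - G (t, x) (\<psi> k)\<bar> \<le> ennreal c1 * H (fst k) w"
            by (simp only: mult.assoc A0' mult_1_right)
        qed
        have "ennreal \<bar>cavg m (snd k) (\<lambda>y. G (bt m (fst k), y) (\<psi> k)) - G (t, x) (\<psi> k)\<bar> \<le>
          ennreal ((1 / dl m) ^ CARD('d)) * (\<integral>\<^sup>+w\<in>cell m (snd k). ennreal \<bar>G (bt m (fst k), w) (\<psi> k) - G (t, x) (\<psi> k)\<bar> \<partial>lebesgue)"
          by (intro cavg_diff_const germ_integrable_cell[OF G] t\<psi>)
        also have "\<dots> \<le> ennreal ((1 / dl m) ^ CARD('d)) * (\<integral>\<^sup>+w. ennreal c1 * H (fst k) w * indicator (cell m (snd k)) w * indicator (sball x (2 * \<epsilon>)) w \<partial>lebesgue)"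
          using pt in_ball by (intro mult_left_mono nn_integral_mono) (auto simp: indicator_def)
        also have "\<dots> = (\<integral>\<^sup>+w\<in>cell m (snd k). P (fst k) w \<partial>lebesgue)"
          using c1 by (subst nn_integral_cmult[symmetric]) (auto simp: P_def Q_def ennreal_mult mult_ac intro!: nn_integral_cong)
        finally show ?thesis using kT by simp
      qed
      have "lvl r G m \<phi> = (\<Sum>k\<in>IA \<times> KA. cavg m (snd k) (\<lambda>y. G (bt m (fst k), y) (\<psi> k)))"
        unfolding \<psi>_def by (rule lvl_eq[OF G fin2 sub])
      moreover have "G (t, x) \<phi> = (\<Sum>k\<in>IA \<times> KA. G (t, x) (\<psi> k))"
      proof -
        have "\<phi> = (\<lambda>z. \<Sum>k\<in>IA \<times> KA. \<psi> k z)" using pu_decompose[OF fin2 sub] by (simp only: \<psi>_def)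
        then show ?thesis
          using distribution_sum[OF germ_dist[OF G, of "(t, x)"], where I = "IA \<times> KA" and f = \<psi>] t\<psi> by simp
      qed
      ultimately have "ennreal \<bar>lvl r G m \<phi> - G (t, x) \<phi>\<bar> = ennreal \<bar>\<Sum>k\<in>IA \<times> KA. cavg m (snd k) (\<lambda>y. G (bt m (fst k), y) (\<psi> k)) - G (t, x) (\<psi> k)\<bar>"
        by (simp only: sum_subtractf)
      also have "\<dots> \<le> ennreal (\<Sum>k\<in>IA \<times> KA. \<bar>cavg m (snd k) (\<lambda>y. G (bt m (fst k), y) (\<psi> k)) - G (t, x) (\<psi> k)\<bar>)"
        by (intro ennreal_leI sum_abs)
      also have "\<dots> = (\<Sum>k\<in>IA \<times> KA. ennreal \<bar>cavg m (snd k) (\<lambda>y. G (bt m (fst k), y) (\<psi> k)) - G (t, x) (\<psi> k)\<bar>)"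
        by (intro sum_ennreal[symmetric]) auto
      also have "\<dots> \<le> (\<Sum>k\<in>IA \<times> KA. (if fst k \<in> T then \<integral>\<^sup>+w\<in>cell m (snd k). P (fst k) w \<partial>lebesgue else 0))"
        by (intro sum_mono kbound)
      also have "\<dots> = (\<Sum>i\<in>IA. \<Sum>\<kappa>\<in>KA. (if i \<in> T then \<integral>\<^sup>+w\<in>cell m \<kappa>. P i w \<partial>lebesgue else 0))"
        by (simp only: sum.cartesian_product case_prod_beta')
      also have "\<dots> \<le> (\<Sum>i\<in>IA. (if i \<in> T then \<integral>\<^sup>+w. P i w \<partial>lebesgue else 0))"
        by (intro sum_mono) (use sum_cells_le[OF fin(2) mP] in auto)
      also have "\<dots> = (\<Sum>i\<in>IA \<inter> T. \<integral>\<^sup>+w. P i w \<partial>lebesgue)"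
        using fin by (simp add: sum.inter_restrict)
      also have "\<dots> \<le> (\<Sum>i\<in>T. \<integral>\<^sup>+w. P i w \<partial>lebesgue)"
        using finT by (intro sum_mono2) auto
      also have "\<dots> = B x" unfolding B_def h_def P_def H_def ..
      finally show "ennreal \<bar>lvl r G m (rescale \<eta> \<epsilon> (t, x)) - G (t, x) (rescale \<eta> \<epsilon> (t, x))\<bar> \<le> B x"
        unfolding \<phi>_def .
    qed
  qed
qed


section \<open>Summation over dyadic scales\<close>

lemma ex_dl:
  assumes "0 < a" "a \<le> 1"
  shows "\<exists>m. a / 2 < dl m \<and> dl m \<le> a"
proof -
  obtain n where n: "(1 / 2 :: real) ^ n < a" using real_arch_pow_inv[of a "1/2"] assms by auto
  define m where "m = (LEAST m. dl m \<le> a)"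
  have "dl n \<le> a" using n by (simp add: dl_def)
  then have 1: "dl m \<le> a" unfolding m_def by (rule LeastI)
  have "a / 2 < dl m"
  proof (cases m)
    case 0
    then show ?thesis using assms by (simp add: dl_def)
  next
    case (Suc m')
    then have "\<not> dl m' \<le> a" using not_less_Least[of m' "\<lambda>m. dl m \<le> a"] by (simp add: m_def)
    then show ?thesis by (simp add: Suc dl_Suc)
  qed
  with 1 show ?thesis by blast
qed

lemma suminf_shift_le:
  fixes f :: "nat \<Rightarrow> ennreal"
  shows "(\<Sum>i. f (k + i)) \<le> (\<Sum>i. f i)"
proof (rule suminf_le_const)
  fix n
  have "(\<Sum>i<n. f (k + i)) = sum f ((\<lambda>i. k + i) ` {..<n})" by (subst sum.reindex) auto
  also have "\<dots> \<le> (\<Sum>i. f i)" by (rule sum_le_suminf) auto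
  finally show "(\<Sum>i<n. f (k + i)) \<le> (\<Sum>i. f i)" .
qed simp

text \<open>From the first scale below \<epsilon> on, the ratios are dominated by powers of 1/2, and
  the geometric series of ratio \<open>(1 / 2) powr e\<close> bounds the sum uniformly in
  \<epsilon>.\<close>

lemma geometric_scales:
  assumes "0 < e" "0 < \<epsilon>"
  shows "(\<Sum>n. if dl n \<le> \<epsilon> then ennreal ((dl n / \<epsilon>) powr e) else 0) \<le> ennreal (1 / (1 - (1 / 2) powr e))"
proof -
  define q where "q = (1 / 2 :: real) powr e"
  have q: "0 \<le> q" "q < 1" using assms powr_less_mono2[of e "1 / 2" 1] by (auto simp: q_def)
  define n0 where "n0 = (LEAST n. dl n \<le> \<epsilon>)"
  obtain n where "(1 / 2 :: real) ^ n < \<epsilon>" using real_arch_pow_inv[of \<epsilon> "1/2"] assms by auto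
  then have "dl n \<le> \<epsilon>" by (simp add: dl_def)
  then have n0: "dl n0 \<le> \<epsilon>" unfolding n0_def by (rule LeastI)
  define f where "f n = (if dl n \<le> \<epsilon> then ennreal ((dl n / \<epsilon>) powr e) else 0)" for n
  have f: "f n \<le> (if n0 \<le> n then ennreal (q ^ (n - n0)) else 0)" for n
  proof (cases "n0 \<le> n")
    case True
    then obtain i where i: "n = n0 + i" using le_Suc_ex by blast
    have "dl n / \<epsilon> = (dl n0 / \<epsilon>) * (1 / 2) ^ i" by (simp add: i dl_def power_add)
    also have "\<dots> \<le> 1 * (1 / 2) ^ i" using n0 assms by (intro mult_right_mono) auto
    finally have "(dl n / \<epsilon>) powr e \<le> ((1 / 2) ^ i) powr e" using assms by (intro powr_mono2) auto
    also have "((1 / 2 :: real) ^ i) powr e = q ^ i"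
      by (simp add: q_def powr_power flip: powr_realpow) (simp add: powr_powr mult.commute)
    finally show ?thesis using True i q by (auto simp: f_def intro!: ennreal_leI)
  next
    case False
    then have "\<not> dl n \<le> \<epsilon>" using not_less_Least[of n "\<lambda>n. dl n \<le> \<epsilon>"] by (simp add: n0_def)
    then show ?thesis by (simp add: f_def)
  qed
  have sq: "(\<lambda>i. q ^ i) sums (1 / (1 - q))" using q by (intro geometric_sums) auto
  have "(\<Sum>n. f n) \<le> ennreal (1 / (1 - q))"
  proof (rule suminf_le_const)
    fix N
    have "(\<Sum>n<N. f n) \<le> (\<Sum>n<N. if n0 \<le> n then ennreal (q ^ (n - n0)) else 0)" by (intro sum_mono f)
    also have "\<dots> = (\<Sum>n\<in>{n0..<N}. ennreal (q ^ (n - n0)))"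
      by (simp add: sum.If_cases) (intro sum.cong, auto)
    also have "\<dots> \<le> (\<Sum>i<N. ennreal (q ^ i))"
      by (rule sum_le_included[where i="\<lambda>i. i + n0"]) (auto intro!: bexI[of _ "_ - n0"])
    also have "\<dots> = ennreal (\<Sum>i<N. q ^ i)" using q by (intro sum_ennreal) auto
    also have "\<dots> \<le> ennreal (1 / (1 - q))"
      using sum_le_suminf[OF sums_summable[OF sq], of "{..<N}"] q sums_unique[OF sq] by (intro ennreal_leI) auto
    finally show "(\<Sum>n<N. f n) \<le> ennreal (1 / (1 - q))" .
  qed simp
  then show ?thesis by (simp add: f_def q_def)
qed

text \<open>Telescoping from the first level. A single majorant B controls the distance of all later
  levels from the germ and also the total variation of the sequence of levels; the latter yields
  convergence wherever B is finite. The coherence constant depends on n because finer levels reach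
  further into the future.\<close>

lemma reconstruct_estimate:
  assumes p: "1 \<le> p" and e: "0 \<le> e" "e \<le> \<gamma>"
  shows "\<exists>C>0. \<forall>(G :: 'd::finite pt \<Rightarrow> 'd dist) U U1 Nf t \<epsilon>.
    germ r G \<longrightarrow> 0 < \<epsilon> \<longrightarrow> \<epsilon> \<le> 1 \<longrightarrow> U \<in> sets lebesgue \<longrightarrow> U1 \<in> sets lebesgue \<longrightarrow> (\<forall>x\<in>U1. sball x 2 \<subseteq> U) \<longrightarrow>
    (\<forall>n. dl n \<le> \<epsilon> \<longrightarrow> coherent r \<gamma> p G {t - 2 * \<epsilon>\<^sup>2..t + \<epsilon>\<^sup>2 - (dl n)\<^sup>2} U (Nf n)) \<longrightarrow>
    (\<exists>B\<in>borel_measurable lebesgue. \<exists>m. (\<forall>x\<in>U1. \<forall>\<eta>\<in>Br r.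
        (\<forall>M\<ge>m. ennreal \<bar>lvl r G M (rescale \<eta> \<epsilon> (t, x)) - G (t, x) (rescale \<eta> \<epsilon> (t, x))\<bar> \<le> B x) \<and>
        (\<Sum>i. ennreal \<bar>lvl r G (Suc (m + i)) (rescale \<eta> \<epsilon> (t, x)) - lvl r G (m + i) (rescale \<eta> \<epsilon> (t, x))\<bar>) \<le> B x) \<and>
      Lp p U1 B \<le> ennreal (C * \<epsilon> powr \<gamma>) * (\<Sum>n. if dl n \<le> \<epsilon> then ennreal ((dl n / \<epsilon>) powr e) * Nf n else 0))"
proof -
  obtain C1 where C1: "0 < C1" and first: "\<And>(G :: 'd pt \<Rightarrow> 'd dist) J U U1 N t \<epsilon> m.
    germ r G \<Longrightarrow> coherent r \<gamma> p G J U N \<Longrightarrow> 0 < \<epsilon> \<Longrightarrow> \<epsilon> \<le> 1 \<Longrightarrow> dl m \<le> \<epsilon> / 4 \<Longrightarrow> \<epsilon> / 8 < dl m \<Longrightarrow>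
    {t - 2 * \<epsilon>\<^sup>2..t + \<epsilon>\<^sup>2 - (dl m)\<^sup>2} \<subseteq> J \<Longrightarrow> U \<in> sets lebesgue \<Longrightarrow> U1 \<in> sets lebesgue \<Longrightarrow> (\<forall>x\<in>U1. sball x 2 \<subseteq> U) \<Longrightarrow>
    (\<exists>B\<in>borel_measurable lebesgue. (\<forall>x\<in>U1. \<forall>\<eta>\<in>Br r.
        ennreal \<bar>lvl r G m (rescale \<eta> \<epsilon> (t, x)) - G (t, x) (rescale \<eta> \<epsilon> (t, x))\<bar> \<le> B x) \<and>
      Lp p U1 B \<le> ennreal (C1 * \<epsilon> powr \<gamma>) * N)"
    using first_level[OF p, where 'd='d, of r \<gamma>] by blast
  obtain C2 where C2: "0 < C2" and diff: "\<And>(G :: 'd pt \<Rightarrow> 'd dist) J U U1 N t \<epsilon> m.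
    germ r G \<Longrightarrow> coherent r \<gamma> p G J U N \<Longrightarrow> 0 < \<epsilon> \<Longrightarrow> \<epsilon> \<le> 1 \<Longrightarrow> dl m \<le> \<epsilon> / 4 \<Longrightarrow>
    {t - 2 * \<epsilon>\<^sup>2..t + \<epsilon>\<^sup>2 - (dl (Suc m))\<^sup>2} \<subseteq> J \<Longrightarrow> U \<in> sets lebesgue \<Longrightarrow> U1 \<in> sets lebesgue \<Longrightarrow> (\<forall>x\<in>U1. sball x 2 \<subseteq> U) \<Longrightarrow>
    (\<exists>B\<in>borel_measurable lebesgue. (\<forall>x\<in>U1. \<forall>\<eta>\<in>Br r.
        ennreal \<bar>lvl r G (Suc m) (rescale \<eta> \<epsilon> (t, x)) - lvl r G m (rescale \<eta> \<epsilon> (t, x))\<bar> \<le> B x) \<and>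
      Lp p U1 B \<le> ennreal (C2 * dl m powr \<gamma>) * N)"
    using level_diff[OF p, where 'd='d, of r \<gamma>] by blast
  define C where "C = C1 * 8 powr e + C2 * 2 powr e"
  have C: "0 < C" using C1 C2 by (simp add: C_def add_pos_pos)
  show ?thesis
  proof (intro exI[of _ C] conjI C allI impI)
    fix G :: "'d pt \<Rightarrow> 'd dist" and U U1 Nf t \<epsilon>
    assume G: "germ r G" and l: "0 < \<epsilon>" "\<epsilon> \<le> 1" and U: "U \<in> sets lebesgue" "U1 \<in> sets lebesgue" "\<forall>x\<in>U1. sball x 2 \<subseteq> U"
      and coh: "\<forall>n. dl n \<le> \<epsilon> \<longrightarrow> coherent r \<gamma> p G {t - 2 * \<epsilon>\<^sup>2..t + \<epsilon>\<^sup>2 - (dl n)\<^sup>2} U (Nf n)"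
    \<comment> \<open>The summand for the scale n is the one in the asserted constant; m below is
      the first level treated, with \<open>dl m\<close> between \<open>\<epsilon> / 8\<close> and
      \<open>\<epsilon> / 4\<close>.\<close>
    define S where "S = (\<lambda>n. if dl n \<le> \<epsilon> then ennreal ((dl n / \<epsilon>) powr e) * Nf n else 0)"
    obtain m where m: "\<epsilon> / 8 < dl m" "dl m \<le> \<epsilon> / 4" using ex_dl[of "\<epsilon> / 4"] l by auto
    have le4: "dl (m + i) \<le> \<epsilon> / 4" for i
    proof -
      have "dl (m + i) \<le> dl m" by (simp add: dl_def power_add power_le_one mult_left_le)
      then show ?thesis using m by linarith
    qed
    have le1: "dl (m + i) \<le> \<epsilon>" "dl (Suc (m + i)) \<le> \<epsilon>" for i
      using le4[of i] le4[of "Suc i"] l by auto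
    obtain B0 where B0: "B0 \<in> borel_measurable lebesgue" "\<And>x \<eta>. x \<in> U1 \<Longrightarrow> \<eta> \<in> Br r \<Longrightarrow>
        ennreal \<bar>lvl r G m (rescale \<eta> \<epsilon> (t, x)) - G (t, x) (rescale \<eta> \<epsilon> (t, x))\<bar> \<le> B0 x"
      "Lp p U1 B0 \<le> ennreal (C1 * \<epsilon> powr \<gamma>) * Nf m"
      using first[OF G coh[rule_format, of m] l m(2,1) order_refl U] le1(1)[of 0] by auto
    have "\<exists>B\<in>borel_measurable lebesgue. (\<forall>x\<in>U1. \<forall>\<eta>\<in>Br r.
        ennreal \<bar>lvl r G (Suc (m + i)) (rescale \<eta> \<epsilon> (t, x)) - lvl r G (m + i) (rescale \<eta> \<epsilon> (t, x))\<bar> \<le> B x) \<and>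
      Lp p U1 B \<le> ennreal (C2 * dl (m + i) powr \<gamma>) * Nf (Suc (m + i))" for i
      using diff[OF G coh[rule_format, of "Suc (m + i)"] l le4 order_refl U] le1(2) by blast
    then obtain Bd where Bd: "\<And>i. Bd i \<in> borel_measurable lebesgue" "\<And>i x \<eta>. x \<in> U1 \<Longrightarrow> \<eta> \<in> Br r \<Longrightarrow>
        ennreal \<bar>lvl r G (Suc (m + i)) (rescale \<eta> \<epsilon> (t, x)) - lvl r G (m + i) (rescale \<eta> \<epsilon> (t, x))\<bar> \<le> Bd i x"
      "\<And>i. Lp p U1 (Bd i) \<le> ennreal (C2 * dl (m + i) powr \<gamma>) * Nf (Suc (m + i))"
      by metis
    define B where "B x = B0 x + (\<Sum>i. Bd i x)" for x
    have [measurable]: "B0 \<in> borel_measurable lebesgue" "Bd i \<in> borel_measurable lebesgue" for i by fact+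
    have mB: "B \<in> borel_measurable lebesgue" unfolding B_def by measurable
    \<comment> \<open>The first level contributes to the single scale \<open>n = m\<close>, whose
      ratio \<open>dl m / \<epsilon>\<close> exceeds 1/8.\<close>
    have scale: "\<epsilon> powr \<gamma> \<le> \<epsilon> powr \<gamma> * (8 powr e * (dl m / \<epsilon>) powr e)"
    proof -
      have "1 powr e \<le> (8 * (dl m / \<epsilon>)) powr e" using e m l by (intro powr_mono2) (auto simp: field_simps)
      then have "1 \<le> 8 powr e * (dl m / \<epsilon>) powr e" unfolding powr_mult[of 8 "dl m / \<epsilon>" e] by simp
      then show ?thesis using mult_left_mono[of 1 _ "\<epsilon> powr \<gamma>"] by auto
    qed
    \<comment> \<open>Level differences carry the full power \<gamma> of a ratio that is at most 1,
      so the exponent may be lowered to e. The factor \<open>2 powr e\<close> passes from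
      \<open>dl (m + i)\<close> to the finer scale, whose time interval is the one in use.\<close>
    have scale2: "dl (m + i) powr \<gamma> \<le> \<epsilon> powr \<gamma> * (2 powr e * (dl (Suc (m + i)) / \<epsilon>) powr e)" for i
    proof -
      have "dl (m + i) powr \<gamma> = \<epsilon> powr \<gamma> * (dl (m + i) / \<epsilon>) powr \<gamma>" using l by (simp add: powr_divide)
      also have "(dl (m + i) / \<epsilon>) powr \<gamma> \<le> (dl (m + i) / \<epsilon>) powr e"
        using e le1 l by (intro powr_mono') auto
      also have "(dl (m + i) / \<epsilon>) powr e = 2 powr e * (dl (Suc (m + i)) / \<epsilon>) powr e"
        using l by (simp add: dl_Suc flip: powr_mult)
      finally show ?thesis by (simp add: mult_left_mono)
    qed
    have "Lp p U1 B \<le> Lp p U1 B0 + Lp p U1 (\<lambda>x. \<Sum>i. Bd i x)"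
      unfolding B_def by (intro Lp_add p) (use U in auto)
    also have "Lp p U1 (\<lambda>x. \<Sum>i. Bd i x) \<le> (\<Sum>i. Lp p U1 (Bd i))"
      by (intro Lp_suminf p) (use U in auto)
    also have "(\<Sum>i. Lp p U1 (Bd i)) \<le> (\<Sum>i. ennreal (\<epsilon> powr \<gamma> * (C2 * 2 powr e)) * S (Suc m + i))"
    proof (intro suminf_le)
      fix i
      have "Lp p U1 (Bd i) \<le> ennreal (C2 * dl (m + i) powr \<gamma>) * Nf (Suc (m + i))" by (rule Bd)
      also have "\<dots> \<le> ennreal (C2 * (\<epsilon> powr \<gamma> * (2 powr e * (dl (Suc (m + i)) / \<epsilon>) powr e))) * Nf (Suc (m + i))"
        using scale2[of i] C2 by (intro mult_right_mono ennreal_leI mult_left_mono) auto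
      also have "C2 * (\<epsilon> powr \<gamma> * (2 powr e * (dl (Suc (m + i)) / \<epsilon>) powr e)) = (\<epsilon> powr \<gamma> * (C2 * 2 powr e)) * (dl (Suc (m + i)) / \<epsilon>) powr e"
        by (simp only: mult_ac)
      also have "ennreal \<dots> * Nf (Suc (m + i)) = ennreal (\<epsilon> powr \<gamma> * (C2 * 2 powr e)) * S (Suc m + i)"
        using C2 le1(2)[of i] by (simp add: S_def ennreal_mult mult.assoc)
      finally show "Lp p U1 (Bd i) \<le> ennreal (\<epsilon> powr \<gamma> * (C2 * 2 powr e)) * S (Suc m + i)" .
    qed auto
    also have "\<dots> = ennreal (\<epsilon> powr \<gamma> * (C2 * 2 powr e)) * (\<Sum>i. S (Suc m + i))" by simp
    also have "\<dots> \<le> ennreal (\<epsilon> powr \<gamma> * (C2 * 2 powr e)) * (\<Sum>n. S n)"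
      by (intro mult_left_mono suminf_shift_le) auto
    also have "Lp p U1 B0 \<le> ennreal (\<epsilon> powr \<gamma> * (C1 * 8 powr e)) * (\<Sum>n. S n)"
    proof -
      have "Lp p U1 B0 \<le> ennreal (C1 * \<epsilon> powr \<gamma>) * Nf m" by (rule B0)
      also have "\<dots> \<le> ennreal (C1 * (\<epsilon> powr \<gamma> * (8 powr e * (dl m / \<epsilon>) powr e))) * Nf m"
        using scale C1 by (intro mult_right_mono ennreal_leI mult_left_mono) auto
      also have "C1 * (\<epsilon> powr \<gamma> * (8 powr e * (dl m / \<epsilon>) powr e)) = (\<epsilon> powr \<gamma> * (C1 * 8 powr e)) * (dl m / \<epsilon>) powr e"
        by (simp only: mult_ac)
      also have "ennreal \<dots> * Nf m = ennreal (\<epsilon> powr \<gamma> * (C1 * 8 powr e)) * S m"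
        using C1 le1(1)[of 0] by (simp add: S_def ennreal_mult mult.assoc)
      also have "\<dots> \<le> ennreal (\<epsilon> powr \<gamma> * (C1 * 8 powr e)) * (\<Sum>n. S n)"
        using sum_le_suminf[of S "{m}"] by (intro mult_left_mono) auto
      finally show ?thesis .
    qed
    finally have "Lp p U1 B \<le> ennreal (\<epsilon> powr \<gamma> * (C1 * 8 powr e)) * (\<Sum>n. S n) + ennreal (\<epsilon> powr \<gamma> * (C2 * 2 powr e)) * (\<Sum>n. S n)"
      by (simp add: add_mono)
    also have "\<dots> = ennreal (C * \<epsilon> powr \<gamma>) * (\<Sum>n. S n)"
      using C1 C2 by (simp add: C_def flip: distrib_right ennreal_plus) (simp add: algebra_simps)
    finally have LB: "Lp p U1 B \<le> ennreal (C * \<epsilon> powr \<gamma>) * (\<Sum>n. S n)" .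
    show "\<exists>B\<in>borel_measurable lebesgue. \<exists>m. (\<forall>x\<in>U1. \<forall>\<eta>\<in>Br r.
        (\<forall>M\<ge>m. ennreal \<bar>lvl r G M (rescale \<eta> \<epsilon> (t, x)) - G (t, x) (rescale \<eta> \<epsilon> (t, x))\<bar> \<le> B x) \<and>
        (\<Sum>i. ennreal \<bar>lvl r G (Suc (m + i)) (rescale \<eta> \<epsilon> (t, x)) - lvl r G (m + i) (rescale \<eta> \<epsilon> (t, x))\<bar>) \<le> B x) \<and>
      Lp p U1 B \<le> ennreal (C * \<epsilon> powr \<gamma>) * (\<Sum>n. if dl n \<le> \<epsilon> then ennreal ((dl n / \<epsilon>) powr e) * Nf n else 0)"
    proof (intro bexI[OF _ mB] exI[of _ m] conjI ballI allI impI)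
      show "Lp p U1 B \<le> ennreal (C * \<epsilon> powr \<gamma>) * (\<Sum>n. if dl n \<le> \<epsilon> then ennreal ((dl n / \<epsilon>) powr e) * Nf n else 0)"
        using LB by (simp add: S_def)
      fix x :: "real ^ 'd" and \<eta> :: "'d func" assume x: "x \<in> U1" "\<eta> \<in> Br r"
      let ?l = "\<lambda>m. lvl r G m (rescale \<eta> \<epsilon> (t, x))" and ?g = "G (t, x) (rescale \<eta> \<epsilon> (t, x))"
      have "(\<Sum>i. ennreal \<bar>?l (Suc (m + i)) - ?l (m + i)\<bar>) \<le> (\<Sum>i. Bd i x)"
        by (intro suminf_le Bd x) auto
      also have "\<dots> \<le> B x" by (simp add: B_def)
      finally show "(\<Sum>i. ennreal \<bar>?l (Suc (m + i)) - ?l (m + i)\<bar>) \<le> B x" .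
      fix M assume "m \<le> M"
      then obtain n where M: "M = m + n" using le_Suc_ex by blast
      have "ennreal \<bar>?l (m + n) - ?g\<bar> \<le> B0 x + (\<Sum>i<n. Bd i x)"
      proof (induction n)
        case (Suc n)
        have "ennreal \<bar>?l (m + Suc n) - ?g\<bar> \<le> ennreal (\<bar>?l (m + n) - ?g\<bar> + \<bar>?l (Suc (m + n)) - ?l (m + n)\<bar>)"
          by (intro ennreal_leI) simp
        also have "\<dots> \<le> B0 x + (\<Sum>i<n. Bd i x) + Bd n x"
          using add_mono[OF Suc Bd(2)[OF x, of n]] by simp
        finally show ?case by (simp add: add.assoc)
      qed (use B0(2)[OF x] in simp)
      also have "\<dots> \<le> B x" unfolding B_def by (intro add_left_mono sum_le_suminf) auto
      finally show "ennreal \<bar>?l M - ?g\<bar> \<le> B x" by (simp add: M)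
    qed
  qed
qed

section \<open>Existence of the limit as a distribution\<close>

definition locally_coherent :: "real \<Rightarrow> real \<Rightarrow> real \<Rightarrow> ('d::finite pt \<Rightarrow> 'd dist) \<Rightarrow> bool" where
  "locally_coherent r \<gamma> p G \<longleftrightarrow> (\<forall>\<rho>. \<exists>N<top. coherent r \<gamma> p G {-\<rho>..\<rho>} (sball 0 \<rho>) N)"

definition recon :: "real \<Rightarrow> ('d::finite pt \<Rightarrow> 'd dist) \<Rightarrow> 'd dist" where
  "recon r G \<phi> = (if \<phi> \<in> tests r then lim (\<lambda>m. lvl r G m \<phi>) else 0)"

lemma distribution_rescale_bound:
  assumes "\<xi> \<in> distributions r"
  shows "\<exists>K\<ge>0. \<forall>\<eta>\<in>Br r. \<bar>\<xi> (rescale \<eta> 1 z)\<bar> \<le> K"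
proof -
  define \<rho> where "\<rho> = sqrt (1\<^sup>2 + \<bar>fst z\<bar>) + 1 + infnorm (snd z)"
  obtain K where K: "\<And>\<phi>. \<phi> \<in> tests r \<Longrightarrow> vanishes_off \<rho> \<phi> \<Longrightarrow> ennreal \<bar>\<xi> \<phi>\<bar> \<le> ennreal K * Cr_norm r \<phi>"
    using distribution_bound[OF assms, of \<rho>] by blast
  have "\<bar>\<xi> (rescale \<eta> 1 z)\<bar> \<le> max 0 K" if \<eta>: "\<eta> \<in> Br r" for \<eta>
  proof -
    have v: "vanishes_off \<rho> (rescale \<eta> 1 z)" unfolding \<rho>_def
      by (rule bounded_support_vanishes) (use \<eta> rescale_support[of \<eta> 1 z] in \<open>auto simp: Br_def\<close>)
    have "sized r 1 1 (rescale \<eta> 1 z)" using sized_rescale[OF Br_sized[OF \<eta>], of 1 z] by simp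
    then obtain D where "derivs r (rescale \<eta> 1 z) D" "\<And>k z. mdeg k \<le> r \<Longrightarrow> \<bar>D k z\<bar> \<le> 1" by (auto simp: sized_def)
    then have "Cr_norm r (rescale \<eta> 1 z) \<le> ennreal 1" by (subst Cr_norm_le_iff) auto
    then have "ennreal K * Cr_norm r (rescale \<eta> 1 z) \<le> ennreal (max 0 K) * ennreal 1"
      by (intro mult_mono ennreal_leI) auto
    from order_trans[OF K[OF tests_rescale[OF \<eta> zero_less_one] v] this]
    have "ennreal \<bar>\<xi> (rescale \<eta> 1 z)\<bar> \<le> ennreal (max 0 K)" by simp
    then show ?thesis by (subst (asm) ennreal_le_iff) auto
  qed
  then show ?thesis by (intro exI[of _ "max 0 K"]) auto
qed

text \<open>The majorant B at scale 1 has finite norm on a ball of positive volume, so it is finite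
  at some x there. The functions considered are supported within 1/2 of x0, hence within 1 of x, and
  are all multiples of test functions rescaled about (t, x). This one point therefore gives
  convergence, and a bound by K, for all of them.\<close>

lemma lvl_local:
  fixes G :: "'d::finite pt \<Rightarrow> 'd dist"
  assumes p: "1 \<le> p" and \<gamma>: "0 < \<gamma>" and G: "germ r G" and lc: "locally_coherent r \<gamma> p G"
  shows "\<exists>K\<ge>0. \<forall>A \<psi>. 0 < A \<longrightarrow> sized r A 1 \<psi> \<longrightarrow> (\<forall>z. \<psi> z \<noteq> 0 \<longrightarrow> \<bar>fst z - t\<bar> \<le> 1 \<and> infnorm (snd z - x0) \<le> 1 / 2) \<longrightarrow>
    convergent (\<lambda>m. lvl r G m \<psi>) \<and> \<bar>lim (\<lambda>m. lvl r G m \<psi>)\<bar> \<le> K * A"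
proof -
  define \<rho> where "\<rho> = \<bar>t\<bar> + infnorm x0 + 4"
  obtain N where N: "N < top" and coh: "coherent r \<gamma> p G {-\<rho>..\<rho>} (sball 0 \<rho>) N" using lc by (auto simp: locally_coherent_def)
  have coh': "coherent r \<gamma> p G {t - 2 * 1\<^sup>2..t + 1\<^sup>2 - (dl n)\<^sup>2} (sball 0 \<rho>) N" for n
  proof (rule coherent_mono[OF coh])
    show "{t - 2 * 1\<^sup>2..t + 1\<^sup>2 - (dl n)\<^sup>2} \<subseteq> {-\<rho>..\<rho>}"
    proof
      fix s assume "s \<in> {t - 2 * 1\<^sup>2..t + 1\<^sup>2 - (dl n)\<^sup>2}"
      then have "t - 2 \<le> s" "s \<le> t + 1 - (dl n)\<^sup>2" by simp_all
      then show "s \<in> {-\<rho>..\<rho>}"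
        using infnorm_pos_le[of x0] zero_le_power2[of "dl n"] unfolding \<rho>_def atLeastAtMost_iff by linarith
    qed
  qed
  have sub: "sball x 2 \<subseteq> sball 0 \<rho>" if "x \<in> sball x0 (1/2)" for x
  proof
    fix y assume "y \<in> sball x 2"
    then have "infnorm (y - x) < 2" "infnorm (x - x0) < 1/2" using that by (auto simp: sball_def)
    then have "infnorm (y - x0) < 3" using infnorm_tri[of y x0 x] infnorm_sub[of y x] by auto
    then have "infnorm y < 3 + infnorm x0" using infnorm_triangle[of "y - x0" x0] by auto
    then show "y \<in> sball 0 \<rho>" by (simp add: sball_def \<rho>_def)
  qed
  obtain C where C: "0 < C" "\<And>(G :: 'd pt \<Rightarrow> 'd dist) U U1 Nf t \<epsilon>.
    germ r G \<Longrightarrow> 0 < \<epsilon> \<Longrightarrow> \<epsilon> \<le> 1 \<Longrightarrow> U \<in> sets lebesgue \<Longrightarrow> U1 \<in> sets lebesgue \<Longrightarrow> (\<forall>x\<in>U1. sball x 2 \<subseteq> U) \<Longrightarrow>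
    (\<forall>n. dl n \<le> \<epsilon> \<longrightarrow> coherent r \<gamma> p G {t - 2 * \<epsilon>\<^sup>2..t + \<epsilon>\<^sup>2 - (dl n)\<^sup>2} U (Nf n)) \<Longrightarrow>
    (\<exists>B\<in>borel_measurable lebesgue. \<exists>m. (\<forall>x\<in>U1. \<forall>\<eta>\<in>Br r.
        (\<forall>M\<ge>m. ennreal \<bar>lvl r G M (rescale \<eta> \<epsilon> (t, x)) - G (t, x) (rescale \<eta> \<epsilon> (t, x))\<bar> \<le> B x) \<and>
        (\<Sum>i. ennreal \<bar>lvl r G (Suc (m + i)) (rescale \<eta> \<epsilon> (t, x)) - lvl r G (m + i) (rescale \<eta> \<epsilon> (t, x))\<bar>) \<le> B x) \<and>
      Lp p U1 B \<le> ennreal (C * \<epsilon> powr \<gamma>) * (\<Sum>n. if dl n \<le> \<epsilon> then ennreal ((dl n / \<epsilon>) powr \<gamma>) * Nf n else 0))"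
    using reconstruct_estimate[OF p less_imp_le[OF \<gamma>] order_refl, where 'd='d, of r] by blast
  have sub': "\<forall>x\<in>sball x0 (1/2). sball x 2 \<subseteq> sball 0 \<rho>" using sub by blast
  have coh'': "\<forall>n. dl n \<le> 1 \<longrightarrow> coherent r \<gamma> p G {t - 2 * 1\<^sup>2..t + 1\<^sup>2 - (dl n)\<^sup>2} (sball 0 \<rho>) ((\<lambda>_. N) n)"
    using coh' by blast
  obtain B m where B: "B \<in> borel_measurable lebesgue" and bnd: "\<forall>x\<in>sball x0 (1/2). \<forall>\<eta>\<in>Br r.
        (\<forall>M\<ge>m. ennreal \<bar>lvl r G M (rescale \<eta> 1 (t, x)) - G (t, x) (rescale \<eta> 1 (t, x))\<bar> \<le> B x) \<and>
        (\<Sum>i. ennreal \<bar>lvl r G (Suc (m + i)) (rescale \<eta> 1 (t, x)) - lvl r G (m + i) (rescale \<eta> 1 (t, x))\<bar>) \<le> B x"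
     and LB: "Lp p (sball x0 (1/2)) B \<le> ennreal (C * 1 powr \<gamma>) * (\<Sum>n. if dl n \<le> 1 then ennreal ((dl n / 1) powr \<gamma>) * N else 0)"
    using C(2)[OF G zero_less_one order_refl sets_sball(1) sets_sball(1) sub' coh'']
    by (elim bexE exE conjE) (rule that)
  have bnd: "(\<forall>M\<ge>m. ennreal \<bar>lvl r G M (rescale \<eta> 1 (t, x)) - G (t, x) (rescale \<eta> 1 (t, x))\<bar> \<le> B x) \<and>
        (\<Sum>i. ennreal \<bar>lvl r G (Suc (m + i)) (rescale \<eta> 1 (t, x)) - lvl r G (m + i) (rescale \<eta> 1 (t, x))\<bar>) \<le> B x"
    if "x \<in> sball x0 (1/2)" "\<eta> \<in> Br r" for x \<eta>
    by (rule bspec[OF bspec[OF bnd that(1)] that(2)])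
  have "(\<Sum>n. if dl n \<le> 1 then ennreal ((dl n / 1) powr \<gamma>) * N else 0) = (\<Sum>n. (if dl n \<le> 1 then ennreal ((dl n / 1) powr \<gamma>) else 0) * N)"
    by (intro suminf_cong) auto
  also have "\<dots> = (\<Sum>n. if dl n \<le> 1 then ennreal ((dl n / 1) powr \<gamma>) else 0) * N"
    by (rule ennreal_suminf_multc)
  also have "\<dots> \<le> ennreal (1 / (1 - (1 / 2) powr \<gamma>)) * N"
    by (rule mult_right_mono[OF geometric_scales[OF \<gamma> zero_less_one]]) simp
  also have "\<dots> < top" using N by (simp only: ennreal_mult_less_top) simp
  finally have fin: "Lp p (sball x0 (1/2)) B < top"
    by (intro le_less_trans[OF LB]) (simp only: ennreal_mult_less_top ennreal_less_top simp_thms)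
  \<comment> \<open>Otherwise the integral over a ball of positive volume would be infinite.\<close>
  have "\<exists>x\<in>sball x0 (1/2). B x < top"
  proof (rule ccontr)
    assume "\<not> ?thesis"
    then have "\<And>x. x \<in> sball x0 (1/2) \<Longrightarrow> B x = top" by (auto simp: not_less top_unique)
    then have "(\<integral>\<^sup>+x\<in>sball x0 (1/2). epowr (B x) p \<partial>lebesgue) = (\<integral>\<^sup>+x. top * indicator (sball x0 (1/2)) x \<partial>lebesgue)"
      by (intro nn_integral_cong) (auto simp: indicator_def)
    also have "\<dots> = top" using emeasure_sball[of "1/2" x0] by (subst nn_integral_cmult_indicator) auto
    finally show False using fin by (simp add: Lp_def)
  qed
  then obtain x where x: "x \<in> sball x0 (1/2)" "B x < top" by blast
  obtain K0 where K0: "0 \<le> K0" "\<And>\<eta>. \<eta> \<in> Br r \<Longrightarrow> \<bar>G (t, x) (rescale \<eta> 1 (t, x))\<bar> \<le> K0"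
    using distribution_rescale_bound[OF germ_dist[OF G]] by blast
  define K where "K = enn2real (B x) + K0"
  have Bx: "B x = ennreal (enn2real (B x))" using x(2) by simp
  show ?thesis
  proof (intro exI[of _ K] conjI allI impI)
    show "0 \<le> K" using K0 by (simp add: K_def)
    fix A \<psi> assume A: "0 < A" "sized r A 1 \<psi>" and supp: "\<forall>z. \<psi> z \<noteq> 0 \<longrightarrow> \<bar>fst z - t\<bar> \<le> 1 \<and> infnorm (snd z - x0) \<le> 1 / 2"
    have "\<And>w. \<psi> w \<noteq> 0 \<Longrightarrow> \<bar>fst w - fst (t, x)\<bar> \<le> 1\<^sup>2 \<and> infnorm (snd w - snd (t, x)) \<le> 1"
    proof -
      fix w assume "\<psi> w \<noteq> 0"
      with supp have s: "\<bar>fst w - t\<bar> \<le> 1" "infnorm (snd w - x0) \<le> 1 / 2" by blast+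
      have "infnorm (x - x0) < 1 / 2" using x(1) by (simp add: sball_def)
      with s show "\<bar>fst w - fst (t, x)\<bar> \<le> 1\<^sup>2 \<and> infnorm (snd w - snd (t, x)) \<le> 1"
        using infnorm_tri[of "snd w" x x0] infnorm_sub[of x0] by auto
    qed
    then obtain \<eta> where \<eta>: "\<eta> \<in> Br r" "\<psi> = (\<lambda>w. (A * 1 ^ (CARD('d) + 2)) * rescale \<eta> 1 (t, x) w)"
      using sized_imp_rescale[OF A(2,1) zero_less_one, of "(t, x)"] by blast
    let ?\<phi> = "rescale \<eta> 1 (t, x)"
    have \<phi>: "?\<phi> \<in> tests r" by (rule tests_rescale[OF \<eta>(1)]) simp
    have lv: "lvl r G m \<psi> = A * lvl r G m ?\<phi>" for m
      using lvl_cmult_test[OF G \<phi>, of m A] \<eta>(2) by simp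
    have "summable (\<lambda>i. \<bar>lvl r G (Suc (m + i)) ?\<phi> - lvl r G (m + i) ?\<phi>\<bar>)"
    proof (rule summable_suminf_not_top)
      have "(\<Sum>i. ennreal \<bar>lvl r G (Suc (m + i)) ?\<phi> - lvl r G (m + i) ?\<phi>\<bar>) \<le> B x"
        using bnd[OF x(1) \<eta>(1)] by blast
      then show "(\<Sum>i. ennreal \<bar>lvl r G (Suc (m + i)) ?\<phi> - lvl r G (m + i) ?\<phi>\<bar>) \<noteq> top"
        using x(2) by (auto simp: top_unique)
    qed simp
    then have "summable (\<lambda>i. lvl r G (Suc (m + i)) ?\<phi> - lvl r G (m + i) ?\<phi>)"
      by (rule summable_rabs_cancel)
    then have "convergent (\<lambda>n. \<Sum>i<n. lvl r G (m + Suc i) ?\<phi> - lvl r G (m + i) ?\<phi>)"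
      by (simp add: summable_iff_convergent)
    then have "convergent (\<lambda>n. lvl r G (m + n) ?\<phi> - lvl r G m ?\<phi>)"
      using sum_lessThan_telescope[of "\<lambda>i. lvl r G (m + i) ?\<phi>"] by simp
    then have "convergent (\<lambda>n. (lvl r G (m + n) ?\<phi> - lvl r G m ?\<phi>) + lvl r G m ?\<phi>)"
      by (intro convergent_add convergent_const)
    then have "convergent (\<lambda>n. lvl r G (n + m) ?\<phi>)" by (simp add: add.commute)
    then have cv: "convergent (\<lambda>n. lvl r G n ?\<phi>)" by (subst (asm) convergent_ignore_initial_segment)
    then show cvA: "convergent (\<lambda>n. lvl r G n \<psi>)" unfolding lv by (intro convergent_mult convergent_const)
    have "\<bar>lvl r G M \<psi>\<bar> \<le> K * A" if M: "m \<le> M" for M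
    proof -
      have "ennreal \<bar>lvl r G M ?\<phi> - G (t, x) ?\<phi>\<bar> \<le> ennreal (enn2real (B x))"
        using bnd[OF x(1) \<eta>(1)] M unfolding Bx[symmetric] by blast
      then have "\<bar>lvl r G M ?\<phi> - G (t, x) ?\<phi>\<bar> \<le> enn2real (B x)" by simp
      then have "\<bar>lvl r G M ?\<phi>\<bar> \<le> K" using K0(2)[OF \<eta>(1)] unfolding K_def by linarith
      then have "A * \<bar>lvl r G M ?\<phi>\<bar> \<le> A * K" using A by (intro mult_left_mono) auto
      then show ?thesis using A unfolding lv by (simp add: abs_mult mult.commute)
    qed
    then show "\<bar>lim (\<lambda>n. lvl r G n \<psi>)\<bar> \<le> K * A"
      using tendsto_rabs[OF cvA[unfolded convergent_LIMSEQ_iff]] by (intro LIMSEQ_le_const2) auto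
  qed
qed

lemma lvl_sum_test:
  assumes G: "germ r G" and "\<And>i. i \<in> I \<Longrightarrow> f i \<in> tests r"
  shows "lvl r G m (\<lambda>z. \<Sum>i\<in>I. f i z) = (\<Sum>i\<in>I. lvl r G m (f i))"
proof -
  have z: "lvl r G m (\<lambda>z. 0) = 0" using lvl_cmult_test[OF G tests_0, of m 0] by simp
  show ?thesis using assms(2)
  proof (induction I rule: infinite_finite_induct)
    case (insert x F)
    then have "lvl r G m (\<lambda>z. f x z + (\<Sum>i\<in>F. f i z)) = lvl r G m (f x) + lvl r G m (\<lambda>z. \<Sum>i\<in>F. f i z)"
      by (intro lvl_add_test G tests_sum) auto
    then show ?case using insert by simp
  qed (auto simp: z)
qed

lemma pieces_sized:
  "\<exists>C>0. \<forall>(\<phi> :: 'd::finite func) A k. 0 \<le> A \<longrightarrow> sized r A 1 \<phi> \<longrightarrow> sized r (C * A) 1 (\<lambda>z. pu r m k z * \<phi> z)"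
proof -
  obtain Cp where Cp: "0 < Cp" "\<And>m (k::'d idx). sized r Cp (dl m) (pu r m k)" using pu_sized by blast
  obtain Cm where Cm: "0 < Cm" "\<And>(f::'d func) g A B \<mu>. 0 \<le> A \<Longrightarrow> 0 \<le> B \<Longrightarrow> 0 < \<mu> \<Longrightarrow> sized r A \<mu> f \<Longrightarrow> sized r B \<mu> g \<Longrightarrow>
     sized r (Cm * A * B) \<mu> (\<lambda>z. f z * g z)" using sized_mult by blast
  have "sized r (Cm * (Cp * (1 / dl m) powr r) * A) 1 (\<lambda>z. pu r m k z * \<phi> z)" if "0 \<le> A" "sized r A 1 \<phi>" for \<phi> :: "'d func" and A k
    using that Cp(1) by (intro Cm(2) sized_scale_up[OF Cp(2)]) auto
  then show ?thesis using Cm(1) Cp(1) by (intro exI[of _ "Cm * (Cp * (1 / dl m) powr r)"]) auto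
qed

lemma piece_support:
  assumes "pu r 1 k z * \<phi> z \<noteq> 0"
  shows "\<bar>fst z - of_int (fst k) / 4\<bar> \<le> 1 \<and> infnorm (snd z - corner 1 (snd k)) \<le> 1 / 2"
  using pu_support[of r 1 k z] assms by (auto simp: dl_def power2_eq_square)

text \<open>The partition of level 1 cuts a test function into pieces supported within 1/2 in space
  and 1 in time of a centre, to which \<open>lvl_local\<close> applies. For a given support radius
  only finitely many centres matter, so the sum of their constants bounds the order of the
  limit.\<close>

lemma
  fixes G :: "'d::finite pt \<Rightarrow> 'd dist"
  assumes p: "1 \<le> p" and \<gamma>: "0 < \<gamma>" and G: "germ r G" and lc: "locally_coherent r \<gamma> p G"
  shows recon_LIMSEQ: "\<phi> \<in> tests r \<Longrightarrow> (\<lambda>m. lvl r G m \<phi>) \<longlonglongrightarrow> recon r G \<phi>"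
    and recon_distribution: "recon r G \<in> distributions r"
proof -
  obtain C where C: "0 < C" "\<And>(\<phi> :: 'd func) A k. 0 \<le> A \<Longrightarrow> sized r A 1 \<phi> \<Longrightarrow> sized r (C * A) 1 (\<lambda>z. pu r 1 k z * \<phi> z)"
    using pieces_sized[where 'd='d] by blast
  have "\<exists>K\<ge>0. \<forall>A \<psi>. 0 < A \<longrightarrow> sized r A 1 \<psi> \<longrightarrow> (\<forall>z. \<psi> z \<noteq> 0 \<longrightarrow> \<bar>fst z - of_int (fst k) / 4\<bar> \<le> 1 \<and> infnorm (snd z - corner 1 (snd k)) \<le> 1 / 2) \<longrightarrow>
    convergent (\<lambda>m. lvl r G m \<psi>) \<and> \<bar>lim (\<lambda>m. lvl r G m \<psi>)\<bar> \<le> K * A" for k :: "'d idx"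
    by (rule lvl_local[OF p \<gamma> G lc])
  then obtain K where K: "\<And>k. 0 \<le> K k" "\<And>(k :: 'd idx) A \<psi>. 0 < A \<Longrightarrow> sized r A 1 \<psi> \<Longrightarrow> (\<And>z. \<psi> z \<noteq> 0 \<Longrightarrow> \<bar>fst z - of_int (fst k) / 4\<bar> \<le> 1 \<and> infnorm (snd z - corner 1 (snd k)) \<le> 1 / 2) \<Longrightarrow>
    convergent (\<lambda>m. lvl r G m \<psi>) \<and> \<bar>lim (\<lambda>m. lvl r G m \<psi>)\<bar> \<le> K k * A"
    by metis
  have piece: "convergent (\<lambda>m. lvl r G m (\<lambda>z. pu r 1 k z * \<phi> z))"
    "\<bar>lim (\<lambda>m. lvl r G m (\<lambda>z. pu r 1 k z * \<phi> z))\<bar> \<le> K k * (C * (A + e))"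
    if "sized r A 1 \<phi>" "0 \<le> A" "0 < e" for \<phi> A e k
  proof -
    \<comment> \<open>\<open>lvl_local\<close> requires a positive amplitude, while A is 0 for the
      zero function; e tends to 0 in the final bound.\<close>
    have "sized r (A + e) 1 \<phi>" using that(1) by (rule sized_mono) (use that in simp)
    then have s: "sized r (C * (A + e)) 1 (\<lambda>z. pu r 1 k z * \<phi> z)" using that by (intro C(2)) auto
    show "convergent (\<lambda>m. lvl r G m (\<lambda>z. pu r 1 k z * \<phi> z))"
      "\<bar>lim (\<lambda>m. lvl r G m (\<lambda>z. pu r 1 k z * \<phi> z))\<bar> \<le> K k * (C * (A + e))"
      using K(2)[OF _ s, of k] piece_support[of r k _ \<phi>] C(1) that by auto
  qed
  have lim: "(\<lambda>m. lvl r G m \<phi>) \<longlonglongrightarrow> (\<Sum>k\<in>I. lim (\<lambda>m. lvl r G m (\<lambda>z. pu r 1 k z * \<phi> z)))"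
    if \<phi>: "\<phi> \<in> tests r" and I: "finite I" "supp_idx r 1 \<phi> \<subseteq> I" for \<phi> I
  proof -
    have "lvl r G m \<phi> = (\<Sum>k\<in>I. lvl r G m (\<lambda>z. pu r 1 k z * \<phi> z))" for m
      using arg_cong[OF pu_decompose[OF I], of "lvl r G m"] pu_tests[OF \<phi>]
        lvl_sum_test[OF G, where I = I and f = "\<lambda>k z. pu r 1 k z * \<phi> z" and m = m] by simp
    moreover have "(\<lambda>m. \<Sum>k\<in>I. lvl r G m (\<lambda>z. pu r 1 k z * \<phi> z)) \<longlonglongrightarrow> (\<Sum>k\<in>I. lim (\<lambda>m. lvl r G m (\<lambda>z. pu r 1 k z * \<phi> z)))"
      using piece(1)[OF testsD(2)[OF \<phi>], of 1] by (intro tendsto_sum) (simp add: convergent_LIMSEQ_iff)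
    ultimately show ?thesis by simp
  qed
  show L: "(\<lambda>m. lvl r G m \<phi>) \<longlonglongrightarrow> recon r G \<phi>" if "\<phi> \<in> tests r" for \<phi>
    using lim[OF that finite_supp_idx[OF that] order_refl] that by (simp add: recon_def limI)
  show "recon r G \<in> distributions r"
    unfolding distributions_def mem_Collect_eq
  proof (intro conjI ballI allI impI)
    fix \<phi> \<psi> :: "'d func" assume a: "\<phi> \<in> tests r" "\<psi> \<in> tests r"
    show "recon r G (\<lambda>z. \<phi> z + \<psi> z) = recon r G \<phi> + recon r G \<psi>"
      using L[OF tests_add[OF a]] tendsto_add[OF L[OF a(1)] L[OF a(2)]] unfolding lvl_add_test[OF G a] by (rule LIMSEQ_unique)
  next
    fix c and \<phi> :: "'d func" assume a: "\<phi> \<in> tests r"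
    show "recon r G (\<lambda>z. c * \<phi> z) = c * recon r G \<phi>"
      using L[OF tests_cmult[OF a]] tendsto_mult_left[OF L[OF a]] unfolding lvl_cmult_test[OF G a] by (rule LIMSEQ_unique)
  next
    fix \<phi> :: "'d func" assume "\<phi> \<notin> tests r"
    then show "recon r G \<phi> = 0" by (simp add: recon_def)
  next
    fix \<rho>
    \<comment> \<open>Depends on the radius alone and not on the test function, as a bound uniform
      over all of them demands.\<close>
    define I where "I = {k :: 'd idx. \<exists>z. pnorm z \<le> max 0 \<rho> \<and> pu r 1 k z \<noteq> 0}"
    have I: "finite I" unfolding I_def by (rule finite_near_idx) simp
    define Kt where "Kt = (\<Sum>k\<in>I. K k * C)"
    have Kt: "0 \<le> Kt" unfolding Kt_def using K(1) C(1) by (intro sum_nonneg) auto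
    show "\<exists>K. \<forall>\<phi>\<in>tests r. vanishes_off \<rho> \<phi> \<longrightarrow> ennreal \<bar>recon r G \<phi>\<bar> \<le> ennreal K * Cr_norm r \<phi>"
    proof (intro exI[of _ Kt] ballI impI)
      fix \<phi> :: "'d func" assume \<phi>: "\<phi> \<in> tests r" "vanishes_off \<rho> \<phi>"
      define A where "A = enn2real (Cr_norm r \<phi>)"
      have A: "0 \<le> A" "sized r A 1 \<phi>" "Cr_norm r \<phi> = ennreal A" using testsD[OF \<phi>(1)] by (auto simp: A_def)
      have "recon r G \<phi> = (\<Sum>k\<in>I. lim (\<lambda>m. lvl r G m (\<lambda>z. pu r 1 k z * \<phi> z)))"
        using L[OF \<phi>(1)] lim[OF \<phi>(1) I] supp_idx_near[OF \<phi>(2), of r 1] unfolding I_def by (blast intro: LIMSEQ_unique)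
      then have "\<bar>recon r G \<phi>\<bar> \<le> (\<Sum>k\<in>I. K k * (C * (A + e)))" if "0 < e" for e
        using piece(2)[OF A(2,1) that] by (auto intro!: order_trans[OF sum_abs] sum_mono)
      then have *: "\<bar>recon r G \<phi>\<bar> \<le> Kt * (A + e)" if "0 < e" for e
        using that by (simp add: Kt_def sum_distrib_right mult.assoc)
      have "\<bar>recon r G \<phi>\<bar> \<le> Kt * A"
      proof (rule field_le_epsilon)
        fix e :: real assume e: "0 < e"
        have "Kt * (A + e / (Kt + 1)) \<le> Kt * A + e"
          using e Kt by (simp add: distrib_left field_simps)
        then show "\<bar>recon r G \<phi>\<bar> \<le> Kt * A + e" using *[of "e / (Kt + 1)"] e Kt by auto
      qed
      then show "ennreal \<bar>recon r G \<phi>\<bar> \<le> ennreal Kt * Cr_norm r \<phi>"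
        unfolding A(3) using A(1) Kt by (simp flip: ennreal_mult add: ennreal_leI)
    qed
  qed
qed

text \<open>B bounds the distance from the germ for all large levels at once, so the bound persists
  in the pointwise limit.\<close>

lemma recon_estimate:
  assumes p: "1 \<le> p" and \<gamma>: "0 < \<gamma>" and e: "0 \<le> e" "e \<le> \<gamma>"
  shows "\<exists>C>0. \<forall>(G :: 'd::finite pt \<Rightarrow> 'd dist) U U1 Nf t \<epsilon>.
    germ r G \<longrightarrow> locally_coherent r \<gamma> p G \<longrightarrow> 0 < \<epsilon> \<longrightarrow> \<epsilon> \<le> 1 \<longrightarrow> U \<in> sets lebesgue \<longrightarrow> U1 \<in> sets lebesgue \<longrightarrow> (\<forall>x\<in>U1. sball x 2 \<subseteq> U) \<longrightarrow>
    (\<forall>n. dl n \<le> \<epsilon> \<longrightarrow> coherent r \<gamma> p G {t - 2 * \<epsilon>\<^sup>2..t + \<epsilon>\<^sup>2 - (dl n)\<^sup>2} U (Nf n)) \<longrightarrow>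
    (\<exists>B\<in>borel_measurable lebesgue. (\<forall>x\<in>U1. \<forall>\<eta>\<in>Br r.
        ennreal \<bar>recon r G (rescale \<eta> \<epsilon> (t, x)) - G (t, x) (rescale \<eta> \<epsilon> (t, x))\<bar> \<le> B x) \<and>
      Lp p U1 B \<le> ennreal (C * \<epsilon> powr \<gamma>) * (\<Sum>n. if dl n \<le> \<epsilon> then ennreal ((dl n / \<epsilon>) powr e) * Nf n else 0))"
proof -
  obtain C where C: "0 < C" "\<And>(G :: 'd pt \<Rightarrow> 'd dist) U U1 Nf t \<epsilon>.
    germ r G \<Longrightarrow> 0 < \<epsilon> \<Longrightarrow> \<epsilon> \<le> 1 \<Longrightarrow> U \<in> sets lebesgue \<Longrightarrow> U1 \<in> sets lebesgue \<Longrightarrow> (\<forall>x\<in>U1. sball x 2 \<subseteq> U) \<Longrightarrow>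
    (\<forall>n. dl n \<le> \<epsilon> \<longrightarrow> coherent r \<gamma> p G {t - 2 * \<epsilon>\<^sup>2..t + \<epsilon>\<^sup>2 - (dl n)\<^sup>2} U (Nf n)) \<Longrightarrow>
    (\<exists>B\<in>borel_measurable lebesgue. \<exists>m. (\<forall>x\<in>U1. \<forall>\<eta>\<in>Br r.
        (\<forall>M\<ge>m. ennreal \<bar>lvl r G M (rescale \<eta> \<epsilon> (t, x)) - G (t, x) (rescale \<eta> \<epsilon> (t, x))\<bar> \<le> B x) \<and>
        (\<Sum>i. ennreal \<bar>lvl r G (Suc (m + i)) (rescale \<eta> \<epsilon> (t, x)) - lvl r G (m + i) (rescale \<eta> \<epsilon> (t, x))\<bar>) \<le> B x) \<and>
      Lp p U1 B \<le> ennreal (C * \<epsilon> powr \<gamma>) * (\<Sum>n. if dl n \<le> \<epsilon> then ennreal ((dl n / \<epsilon>) powr e) * Nf n else 0))"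
    using reconstruct_estimate[OF p e, where 'd='d, of r] by blast
  show ?thesis
  proof (intro exI[of _ C] conjI C(1) allI impI)
    fix G :: "'d pt \<Rightarrow> 'd dist" and U U1 Nf t \<epsilon>
    assume G: "germ r G" and lc: "locally_coherent r \<gamma> p G" and l: "0 < \<epsilon>" "\<epsilon> \<le> 1"
      and U: "U \<in> sets lebesgue" "U1 \<in> sets lebesgue" "\<forall>x\<in>U1. sball x 2 \<subseteq> U"
      and coh: "\<forall>n. dl n \<le> \<epsilon> \<longrightarrow> coherent r \<gamma> p G {t - 2 * \<epsilon>\<^sup>2..t + \<epsilon>\<^sup>2 - (dl n)\<^sup>2} U (Nf n)"
    obtain B m where B: "B \<in> borel_measurable lebesgue" and bnd: "\<And>x \<eta> M. x \<in> U1 \<Longrightarrow> \<eta> \<in> Br r \<Longrightarrow>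
        m \<le> M \<Longrightarrow> ennreal \<bar>lvl r G M (rescale \<eta> \<epsilon> (t, x)) - G (t, x) (rescale \<eta> \<epsilon> (t, x))\<bar> \<le> B x"
      and LB: "Lp p U1 B \<le> ennreal (C * \<epsilon> powr \<gamma>) * (\<Sum>n. if dl n \<le> \<epsilon> then ennreal ((dl n / \<epsilon>) powr e) * Nf n else 0)"
      using C(2)[OF G l U coh] by blast
    show "\<exists>B\<in>borel_measurable lebesgue. (\<forall>x\<in>U1. \<forall>\<eta>\<in>Br r.
        ennreal \<bar>recon r G (rescale \<eta> \<epsilon> (t, x)) - G (t, x) (rescale \<eta> \<epsilon> (t, x))\<bar> \<le> B x) \<and>
      Lp p U1 B \<le> ennreal (C * \<epsilon> powr \<gamma>) * (\<Sum>n. if dl n \<le> \<epsilon> then ennreal ((dl n / \<epsilon>) powr e) * Nf n else 0)"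
    proof (intro bexI[OF _ B] conjI LB ballI)
      fix x :: "real ^ 'd" and \<eta> :: "'d func" assume x: "x \<in> U1" "\<eta> \<in> Br r"
      let ?\<phi> = "rescale \<eta> \<epsilon> (t, x)"
      have "(\<lambda>M. \<bar>lvl r G M ?\<phi> - G (t, x) ?\<phi>\<bar>) \<longlonglongrightarrow> \<bar>recon r G ?\<phi> - G (t, x) ?\<phi>\<bar>"
        by (intro tendsto_intros recon_LIMSEQ[OF p \<gamma> G lc] tests_rescale x l)
      then have "(\<lambda>M. ennreal \<bar>lvl r G M ?\<phi> - G (t, x) ?\<phi>\<bar>) \<longlonglongrightarrow> ennreal \<bar>recon r G ?\<phi> - G (t, x) ?\<phi>\<bar>"
        by (rule tendsto_ennrealI)
      then show "ennreal \<bar>recon r G ?\<phi> - G (t, x) ?\<phi>\<bar> \<le> B x"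
        by (rule LIMSEQ_le_const2) (use bnd[OF x] in blast)
    qed
  qed
qed

section \<open>Linearity and uniqueness of the limit\<close>

lemma lvl_lincomb:
  assumes G: "germ r G" and G': "germ r G'" and GG: "germ r (\<lambda>z \<phi>. a * G z \<phi> + b * G' z \<phi>)" and \<phi>: "\<phi> \<in> tests r"
  shows "lvl r (\<lambda>z \<phi>. a * G z \<phi> + b * G' z \<phi>) m \<phi> = a * lvl r G m \<phi> + b * lvl r G' m \<phi>"
proof -
  have "cavg m \<kappa> (\<lambda>y. a * G (s, y) \<psi> + b * G' (s, y) \<psi>) = a * cavg m \<kappa> (\<lambda>y. G (s, y) \<psi>) + b * cavg m \<kappa> (\<lambda>y. G' (s, y) \<psi>)"
    if "\<psi> \<in> tests r" for \<kappa> s \<psi>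
  proof -
    have i: "set_integrable lebesgue (cell m \<kappa>) (\<lambda>y. a * G (s, y) \<psi>)" "set_integrable lebesgue (cell m \<kappa>) (\<lambda>y. b * G' (s, y) \<psi>)"
      by (rule set_integrable_mult_right, rule germ_integrable_cell[OF G that],
          rule set_integrable_mult_right, rule germ_integrable_cell[OF G' that])
    show ?thesis unfolding cavg_def set_integral_add(2)[OF i] by (simp add: algebra_simps)
  qed
  from this[OF pu_tests[OF \<phi>]] show ?thesis
    unfolding lvl_def by (simp add: sum.distrib sum_distrib_left)
qed


lemma recon_lincomb:
  assumes p: "1 \<le> p" and \<gamma>: "0 < \<gamma>" and G: "germ r G" "locally_coherent r \<gamma> p G" and G': "germ r G'" "locally_coherent r \<gamma> p G'"
    and GG: "germ r (\<lambda>z \<phi>. a * G z \<phi> + b * G' z \<phi>)"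
  shows "recon r (\<lambda>z \<phi>. a * G z \<phi> + b * G' z \<phi>) = (\<lambda>\<phi>. a * recon r G \<phi> + b * recon r G' \<phi>)"
proof
  fix \<phi>
  show "recon r (\<lambda>z \<phi>. a * G z \<phi> + b * G' z \<phi>) \<phi> = a * recon r G \<phi> + b * recon r G' \<phi>"
  proof (cases "\<phi> \<in> tests r")
    case True
    have "(\<lambda>m. a * lvl r G m \<phi> + b * lvl r G' m \<phi>) \<longlonglongrightarrow> a * recon r G \<phi> + b * recon r G' \<phi>"
      by (intro tendsto_intros recon_LIMSEQ[OF p \<gamma>] G G' True)
    then have "(\<lambda>m. lvl r (\<lambda>z \<phi>. a * G z \<phi> + b * G' z \<phi>) m \<phi>) \<longlonglongrightarrow> a * recon r G \<phi> + b * recon r G' \<phi>"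
      by (simp only: lvl_lincomb[OF G(1) G'(1) GG True])
    then show ?thesis using True by (simp add: recon_def limI)
  qed (simp add: recon_def)
qed

text \<open>On each piece of level m, R is compared with the germ at the points w of the cell, at
  the scale \<open>\<mu> = 2 * dl m\<close>. Summed over cells this is an integral over a unit ball,
  which the assumed bound controls by \<open>\<mu> powr \<gamma>\<close>. The roughly
  \<open>(dl m) powr - 2\<close> base times and the cell normalisation cancel the parabolic volume
  of the pieces, and the error is of order \<open>dl m powr \<gamma>\<close>.\<close>

lemma level_converges:
  fixes G :: "'d::finite pt \<Rightarrow> 'd dist"
  assumes p: "1 \<le> p" and \<gamma>: "0 < \<gamma>" and G: "germ r G" and R: "R \<in> distributions r"
    and bnd: "\<And>\<rho>. \<exists>K. \<forall>t\<in>{-\<rho>..\<rho>}. \<forall>x0. infnorm x0 \<le> \<rho> \<longrightarrow> (\<forall>\<epsilon>\<in>{0<..1}.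
      Lp p (sball x0 1) (\<lambda>x. SUP \<eta>\<in>Br r. ennreal \<bar>R (rescale \<eta> \<epsilon> (t, x)) - G (t, x) (rescale \<eta> \<epsilon> (t, x))\<bar>) \<le> ennreal (K * \<epsilon> powr \<gamma>))"
    and \<phi>: "\<phi> \<in> tests r" "sized r A 1 \<phi>" "0 < A"
    and supp: "\<And>z. \<phi> z \<noteq> 0 \<Longrightarrow> \<bar>fst z - t0\<bar> \<le> 1 \<and> infnorm (snd z - x0) \<le> 1 / 2"
  shows "(\<lambda>m. lvl r G m \<phi>) \<longlonglongrightarrow> R \<phi>"
proof -
  have p0: "0 < p" using p by simp
  define \<rho> where "\<rho> = \<bar>t0\<bar> + infnorm x0 + 2"
  obtain K' where K': "\<forall>t\<in>{-\<rho>..\<rho>}. \<forall>x0. infnorm x0 \<le> \<rho> \<longrightarrow> (\<forall>\<epsilon>\<in>{0<..1}.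
      Lp p (sball x0 1) (\<lambda>x. SUP \<eta>\<in>Br r. ennreal \<bar>R (rescale \<eta> \<epsilon> (t, x)) - G (t, x) (rescale \<eta> \<epsilon> (t, x))\<bar>) \<le> ennreal (K' * \<epsilon> powr \<gamma>))"
    using bnd[of \<rho>] by blast
  define S where "S \<epsilon> t x = (SUP \<eta>\<in>Br r. ennreal \<bar>R (rescale \<eta> \<epsilon> (t, x)) - G (t, x) (rescale \<eta> \<epsilon> (t, x))\<bar>)" for \<epsilon> t x
  define K where "K = max 0 K'"
  have K: "Lp p (sball x0 1) (S \<epsilon> t) \<le> ennreal (K * \<epsilon> powr \<gamma>)" if "t \<in> {-\<rho>..\<rho>}" "0 < \<epsilon>" "\<epsilon> \<le> 1" for t \<epsilon>
  proof -
    have "infnorm x0 \<le> \<rho>" by (simp add: \<rho>_def)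
    then have "Lp p (sball x0 1) (S \<epsilon> t) \<le> ennreal (K' * \<epsilon> powr \<gamma>)" using K' that unfolding S_def by auto
    also have "\<dots> \<le> ennreal (K * \<epsilon> powr \<gamma>)" by (intro ennreal_leI mult_right_mono) (auto simp: K_def)
    finally show ?thesis .
  qed
  obtain Cp where Cp: "0 < Cp" "\<And>m (k::'d idx). sized r Cp (dl m) (pu r m k)" using pu_sized by blast
  obtain Cm where Cm: "0 < Cm" "\<And>(f::'d func) g A B \<mu>. 0 \<le> A \<Longrightarrow> 0 \<le> B \<Longrightarrow> 0 < \<mu> \<Longrightarrow> sized r A \<mu> f \<Longrightarrow> sized r B \<mu> g \<Longrightarrow>
     sized r (Cm * A * B) \<mu> (\<lambda>z. f z * g z)" using sized_mult by blast
  define c where "c = Cm * (Cp * 2 powr r) * A"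
  have c: "0 < c" using Cp Cm \<phi>(3) by (simp add: c_def)
  define v where "v = 2 * ((2 * 1) ^ CARD('d)) powr (1 - 1 / p)"
  have v: "0 \<le> v" by (simp add: v_def)
  define C where "C = 5 * (v * (c * 2 ^ (CARD('d) + 2) * (K * 2 powr \<gamma>)))"
  \<comment> \<open>From \<open>m \<ge> 3\<close> on, \<mu> is at most 1/4, so the cells that matter
    lie within 3/4 of x0, inside the unit ball about x0 on which the bound is assumed.\<close>
  have main: "\<bar>lvl r G m \<phi> - R \<phi>\<bar> \<le> C * dl m powr \<gamma>" if m: "3 \<le> m" for m
  proof -
    have d8: "dl m \<le> 1 / 8"
    proof -
      have "dl m \<le> dl 3" unfolding dl_def using m by (intro power_decreasing) auto
      then show ?thesis by (simp add: dl_def power3_eq_cube)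
    qed
    define \<mu> where "\<mu> = 2 * dl m"
    have \<mu>: "0 < \<mu>" "\<mu> \<le> 1" using d8 by (auto simp: \<mu>_def)
    have d2: "(dl m)\<^sup>2 \<le> 1 / 64" using power_mono[OF d8, of 2] by (simp add: power2_eq_square)
    define \<psi> where "\<psi> k = (\<lambda>z. pu r m k z * \<phi> z)" for k :: "'d idx"
    have s\<psi>: "sized r c \<mu> (\<psi> k)" for k
    proof -
      have "sized r (Cp * 2 powr r) \<mu> (pu r m k)" using Cp(1) by (intro sized_scale_up[OF Cp(2)]) (auto simp: \<mu>_def)
      moreover have "sized r A \<mu> \<phi>" using \<phi>(2,3) \<mu> by (intro sized_scale_down[OF \<phi>(2)]) auto
      ultimately show ?thesis unfolding \<psi>_def c_def using Cp(1) Cm(1) \<phi>(3) \<mu> by (intro Cm(2)) auto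
    qed
    have t\<psi>: "\<psi> k \<in> tests r" for k unfolding \<psi>_def by (intro pu_tests \<phi>)
    define IA KA where "IA = fst ` supp_idx r m \<phi>" and "KA = snd ` supp_idx r m \<phi>"
    have fin: "finite IA" "finite KA" unfolding IA_def KA_def using finite_supp_idx[OF \<phi>(1)] by auto
    have sub: "supp_idx r m \<phi> \<subseteq> IA \<times> KA" unfolding IA_def KA_def by force
    have fin2: "finite (IA \<times> KA)" using fin by auto
    have near: "\<bar>fst z - bt m (fst k)\<bar> \<le> \<mu>\<^sup>2 \<and> \<bar>bt m (fst k) - t0\<bar> \<le> 2 \<and> \<bar>t0 / (dl m)\<^sup>2 - of_int (fst k)\<bar> \<le> 1 / (dl m)\<^sup>2 + 1"
      if "\<psi> k z \<noteq> 0" for k z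
    proof -
      define D where "D = (dl m)\<^sup>2"
      have D: "0 < D" "D \<le> 1 / 64" using d2 by (auto simp: D_def)
      have zk: "\<bar>fst z - D * of_int (fst k)\<bar> \<le> D" using that pu_support[of r m k z] by (auto simp: D_def \<psi>_def)
      have zt: "\<bar>fst z - t0\<bar> \<le> 1" using that supp[of z] by (auto simp: \<psi>_def)
      have bk: "bt m (fst k) = D * of_int (fst k) - 2 * D" by (simp add: bt_def D_def algebra_simps)
      have \<mu>D: "\<mu>\<^sup>2 = 4 * D" by (simp add: \<mu>_def power_mult_distrib D_def)
      have "\<bar>t0 - D * of_int (fst k)\<bar> / D \<le> (1 + D) / D"
        using zk zt D by (intro divide_right_mono) auto
      moreover have "\<bar>t0 - D * of_int (fst k)\<bar> / D = \<bar>t0 / D - of_int (fst k)\<bar>"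
      proof -
        have "(t0 - D * of_int (fst k)) / D = t0 / D - of_int (fst k)" using D by (simp add: diff_divide_distrib)
        then show ?thesis using D by (metis abs_divide abs_of_pos)
      qed
      ultimately have "\<bar>t0 / D - of_int (fst k)\<bar> \<le> 1 / D + 1" using D by (simp add: add_divide_distrib)
      moreover have "\<bar>fst z - bt m (fst k)\<bar> \<le> \<mu>\<^sup>2" unfolding bk \<mu>D using zk D by linarith
      moreover have "\<bar>bt m (fst k) - t0\<bar> \<le> 2" unfolding bk using zk zt D by linarith
      ultimately show ?thesis unfolding D_def by blast
    qed
    have IA: "i \<in> {j. \<bar>t0 / (dl m)\<^sup>2 - of_int j\<bar> \<le> 1 / (dl m)\<^sup>2 + 1} \<and> bt m i \<in> {-\<rho>..\<rho>}" if "i \<in> IA" for i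
    proof -
      obtain k z where k: "fst k = i" "\<psi> k z \<noteq> 0" using \<open>i \<in> IA\<close> unfolding IA_def supp_idx_def \<psi>_def by auto
      have "\<bar>bt m i - t0\<bar> \<le> 2" using near[OF k(2)] k(1) by blast
      then have "bt m i \<in> {-\<rho>..\<rho>}" using infnorm_pos_le[of x0] unfolding \<rho>_def atLeastAtMost_iff by linarith
      then show ?thesis using near[OF k(2)] k(1) by blast
    qed
    have cardIA: "real (card IA) \<le> 5 / (dl m)\<^sup>2"
    proof -
      have "card IA \<le> card {j::int. \<bar>t0 / (dl m)\<^sup>2 - of_int j\<bar> \<le> 1 / (dl m)\<^sup>2 + 1}"
        using IA by (intro card_mono card_int_interval(1)) blast
      then have "real (card IA) \<le> real (card {j::int. \<bar>t0 / (dl m)\<^sup>2 - of_int j\<bar> \<le> 1 / (dl m)\<^sup>2 + 1})" by simp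
      also have "\<dots> \<le> 2 * (1 / (dl m)\<^sup>2 + 1) + 1" by (rule card_int_interval(2)) simp
      also have "\<dots> \<le> 5 / (dl m)\<^sup>2"
      proof -
        have "1 \<le> 1 / (dl m)\<^sup>2" using d2 by (simp add: le_divide_eq)
        moreover have "5 / (dl m)\<^sup>2 = 5 * (1 / (dl m)\<^sup>2)" by simp
        ultimately show ?thesis by (smt (verit))
      qed
      finally show ?thesis .
    qed
    define q where "q = c * \<mu> ^ (CARD('d) + 2)"
    have q: "0 < q" unfolding q_def by (intro mult_pos_pos zero_less_power c \<mu>)
    define f where "f i \<kappa> w = ennreal \<bar>G (bt m i, w) (\<psi> (i, \<kappa>)) - R (\<psi> (i, \<kappa>))\<bar> * indicator (cell m \<kappa>) w" for i \<kappa> w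
    have mf [measurable]: "f i \<kappa> \<in> borel_measurable lebesgue" for i \<kappa>
    proof -
      have "integrable lebesgue (\<lambda>w. indicator (cell m \<kappa>) w *\<^sub>R G (bt m i, w) (\<psi> (i, \<kappa>)))"
        using germ_integrable_cell[OF G t\<psi>] unfolding set_integrable_def .
      then have [measurable]: "(\<lambda>w. indicator (cell m \<kappa>) w *\<^sub>R G (bt m i, w) (\<psi> (i, \<kappa>))) \<in> borel_measurable lebesgue"
        by (rule borel_measurable_integrable)
      have "(\<lambda>w. ennreal \<bar>indicator (cell m \<kappa>) w *\<^sub>R G (bt m i, w) (\<psi> (i, \<kappa>)) - indicator (cell m \<kappa>) w * R (\<psi> (i, \<kappa>))\<bar>) \<in> borel_measurable lebesgue"
        by measurable
      then show ?thesis by (rule measurable_cong[THEN iffD1, rotated]) (auto simp: f_def indicator_def)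
    qed
    have f_le: "f i \<kappa> w \<le> ennreal q * S \<mu> (bt m i) w" "f i \<kappa> w \<noteq> 0 \<Longrightarrow> w \<in> sball x0 1" for i \<kappa> w
    proof -
      have "f i \<kappa> w \<le> ennreal q * S \<mu> (bt m i) w \<and> (f i \<kappa> w \<noteq> 0 \<longrightarrow> w \<in> sball x0 1)"
      proof (cases "w \<in> cell m \<kappa> \<and> (\<exists>z. \<psi> (i, \<kappa>) z \<noteq> 0)")
        case True
        then obtain z0 where w: "w \<in> cell m \<kappa>" and z0: "\<psi> (i, \<kappa>) z0 \<noteq> 0" by blast
        have zw: "infnorm (snd z - w) \<le> \<mu>" if "\<psi> (i, \<kappa>) z \<noteq> 0" for z
        proof -
          have "infnorm (snd z - corner m \<kappa>) \<le> dl m" using that pu_support[of r m "(i, \<kappa>)" z] by (auto simp: \<psi>_def)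
          then show ?thesis using infnorm_tri[of "snd z" w "corner m \<kappa>"] infnorm_sub[of "snd z"] infnorm_sub[of w] cell_corner[OF w]
            unfolding \<mu>_def by (smt (verit))
        qed
        have "infnorm (snd z0 - x0) \<le> 1 / 2" using supp[of z0] z0 by (auto simp: \<psi>_def)
        then have "infnorm (w - x0) \<le> \<mu> + 1 / 2" using infnorm_tri[of w x0 "snd z0"] zw[OF z0] by linarith
        then have wx: "w \<in> sball x0 1" using d8 unfolding sball_def \<mu>_def by simp
        obtain \<eta> where \<eta>: "\<eta> \<in> Br r" "\<psi> (i, \<kappa>) = (\<lambda>z. q * rescale \<eta> \<mu> (bt m i, w) z)"
          unfolding q_def
        proof (rule sized_imp_rescale[OF s\<psi> c \<mu>(1), of "(i, \<kappa>)" "(bt m i, w)"])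
          fix z assume "\<psi> (i, \<kappa>) z \<noteq> 0"
          then show "\<bar>fst z - fst (bt m i, w)\<bar> \<le> \<mu>\<^sup>2 \<and> infnorm (snd z - snd (bt m i, w)) \<le> \<mu>"
            using near[of "(i, \<kappa>)" z] zw by auto
        qed
        have "G (bt m i, w) (\<psi> (i, \<kappa>)) = q * G (bt m i, w) (rescale \<eta> \<mu> (bt m i, w))" "R (\<psi> (i, \<kappa>)) = q * R (rescale \<eta> \<mu> (bt m i, w))"
          unfolding \<eta>(2) by (intro distribution_cmult[OF germ_dist[OF G]] distribution_cmult[OF R] tests_rescale \<eta> \<mu>)+
        then have "ennreal \<bar>G (bt m i, w) (\<psi> (i, \<kappa>)) - R (\<psi> (i, \<kappa>))\<bar> = ennreal q * ennreal \<bar>R (rescale \<eta> \<mu> (bt m i, w)) - G (bt m i, w) (rescale \<eta> \<mu> (bt m i, w))\<bar>"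
          using q by (simp only: ennreal_abs_scale[OF less_imp_le[OF q]] abs_minus_commute)
        also have "\<dots> \<le> ennreal q * S \<mu> (bt m i) w"
          unfolding S_def by (intro mult_left_mono SUP_upper \<eta>) auto
        finally show ?thesis using wx by (auto simp: f_def indicator_def)
      next
        case False
        then have "f i \<kappa> w = 0"
        proof (cases "w \<in> cell m \<kappa>")
          case True
          with False have "\<psi> (i, \<kappa>) = (\<lambda>z. 0)" by auto
          then show ?thesis using distribution_0[OF germ_dist[OF G]] distribution_0[OF R] by (simp add: f_def)
        qed (simp add: f_def)
        then show ?thesis by simp
      qed
      then show "f i \<kappa> w \<le> ennreal q * S \<mu> (bt m i) w" "f i \<kappa> w \<noteq> 0 \<Longrightarrow> w \<in> sball x0 1" by auto
    qed
    \<comment> \<open>A measurable minorant of a multiple of S. The supremum S itself need not be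
      measurable, but for a fixed test function the germ is integrable on each cell, and by
      disjointness at most one summand is nonzero at w.\<close>
    define F where "F i w = (\<Sum>\<kappa>\<in>KA. f i \<kappa> w)" for i w
    have mF [measurable]: "F i \<in> borel_measurable lebesgue" for i unfolding F_def by measurable
    have F_le: "F i w \<le> ennreal q * S \<mu> (bt m i) w" for i w
    proof (cases "\<exists>\<kappa>\<in>KA. w \<in> cell m \<kappa>")
      case True
      then obtain \<kappa> where k: "\<kappa> \<in> KA" "w \<in> cell m \<kappa>" by blast
      have "F i w = (\<Sum>\<kappa>'\<in>{\<kappa>}. f i \<kappa>' w)"
        unfolding F_def
      proof (intro sum.mono_neutral_right ballI)
        fix \<kappa>' assume "\<kappa>' \<in> KA - {\<kappa>}"
        then have "w \<notin> cell m \<kappa>'" using cell_unique[OF k(2)] by blast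
        then show "f i \<kappa>' w = 0" by (simp add: f_def)
      qed (use k fin in auto)
      then show ?thesis using f_le(1) by simp
    next
      case False
      then have "F i w = 0" unfolding F_def by (intro sum.neutral) (auto simp: f_def)
      then show ?thesis by simp
    qed
    have F_off: "F i w * indicator (sball x0 1) w = F i w" for i w
    proof (cases "w \<in> sball x0 1")
      case False
      then have "f i \<kappa> w = 0" for \<kappa> using f_le(2) by blast
      then show ?thesis by (simp add: F_def)
    qed simp
    have F_int: "(\<integral>\<^sup>+w. F i w \<partial>lebesgue) \<le> ennreal (v * (q * (K * \<mu> powr \<gamma>)))" if i: "i \<in> IA" for i
    proof -
      have "(\<integral>\<^sup>+w. F i w \<partial>lebesgue) = (\<integral>\<^sup>+w\<in>sball x0 1. F i w \<partial>lebesgue)" by (simp only: F_off)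
      also have "\<dots> \<le> ennreal v * Lp p (sball x0 1) (F i)"
        unfolding v_def by (rule nn_integral_le_Lp[OF p]) (use emeasure_sball[of 1 x0] in auto)
      \<comment> \<open>The factor q is pulled out of the norm of the measurable F, and S is brought
        in afterwards by monotonicity: a constant may be extracted only from a measurable
        function.\<close>
      also have "Lp p (sball x0 1) (F i) = Lp p (sball x0 1) (\<lambda>w. ennreal q * (ennreal (1 / q) * F i w))"
      proof -
        have "ennreal q * (ennreal (1 / q) * a) = a" for a
          using q by (simp flip: mult.assoc ennreal_mult)
        then show ?thesis by simp
      qed
      also have "\<dots> = ennreal q * Lp p (sball x0 1) (\<lambda>w. ennreal (1 / q) * F i w)" by (intro Lp_cmult p0) auto
      also have "Lp p (sball x0 1) (\<lambda>w. ennreal (1 / q) * F i w) \<le> Lp p (sball x0 1) (S \<mu> (bt m i))"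
      proof (intro Lp_mono p0 order_refl)
        fix w
        have "ennreal (1 / q) * F i w \<le> ennreal (1 / q) * (ennreal q * S \<mu> (bt m i) w)" by (intro mult_left_mono F_le) auto
        also have "\<dots> = S \<mu> (bt m i) w" using q by (simp flip: mult.assoc ennreal_mult)
        finally show "ennreal (1 / q) * F i w \<le> S \<mu> (bt m i) w" .
      qed
      also have "\<dots> \<le> ennreal (K * \<mu> powr \<gamma>)" using IA[OF i] \<mu> by (intro K) auto
      finally show ?thesis using v q by (simp add: ennreal_mult mult_left_mono K_def)
    qed
    have "lvl r G m \<phi> = (\<Sum>k\<in>IA \<times> KA. cavg m (snd k) (\<lambda>y. G (bt m (fst k), y) (\<psi> k)))"
      unfolding \<psi>_def by (rule lvl_eq[OF G fin2 sub])
    moreover have "R \<phi> = (\<Sum>k\<in>IA \<times> KA. R (\<psi> k))"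
    proof -
      have "\<phi> = (\<lambda>z. \<Sum>k\<in>IA \<times> KA. \<psi> k z)" using pu_decompose[OF fin2 sub] by (simp only: \<psi>_def)
      then show ?thesis using distribution_sum[OF R, where I = "IA \<times> KA" and f = \<psi>] t\<psi> by simp
    qed
    ultimately have "ennreal \<bar>lvl r G m \<phi> - R \<phi>\<bar> = ennreal \<bar>\<Sum>k\<in>IA \<times> KA. cavg m (snd k) (\<lambda>y. G (bt m (fst k), y) (\<psi> k)) - R (\<psi> k)\<bar>"
      by (simp only: sum_subtractf)
    also have "\<dots> \<le> ennreal (\<Sum>k\<in>IA \<times> KA. \<bar>cavg m (snd k) (\<lambda>y. G (bt m (fst k), y) (\<psi> k)) - R (\<psi> k)\<bar>)"
      by (intro ennreal_leI sum_abs)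
    also have "\<dots> = (\<Sum>k\<in>IA \<times> KA. ennreal \<bar>cavg m (snd k) (\<lambda>y. G (bt m (fst k), y) (\<psi> k)) - R (\<psi> k)\<bar>)"
      by (intro sum_ennreal[symmetric]) auto
    also have "\<dots> \<le> (\<Sum>k\<in>IA \<times> KA. ennreal ((1 / dl m) ^ CARD('d)) * (\<integral>\<^sup>+w. f (fst k) (snd k) w \<partial>lebesgue))"
      unfolding f_def prod.collapse by (intro sum_mono cavg_diff_const germ_integrable_cell[OF G] t\<psi>)
    also have "\<dots> = (\<Sum>i\<in>IA. \<Sum>\<kappa>\<in>KA. ennreal ((1 / dl m) ^ CARD('d)) * (\<integral>\<^sup>+w. f i \<kappa> w \<partial>lebesgue))"
      by (simp only: sum.cartesian_product case_prod_beta')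
    also have "\<dots> = (\<Sum>i\<in>IA. ennreal ((1 / dl m) ^ CARD('d)) * (\<integral>\<^sup>+w. F i w \<partial>lebesgue))"
      unfolding F_def by (simp add: nn_integral_sum sum_distrib_left)
    also have "\<dots> \<le> ennreal (5 / (dl m)\<^sup>2 * ((1 / dl m) ^ CARD('d) * (v * (q * (K * \<mu> powr \<gamma>))))) * 1"
    proof (rule sum_const_ennreal_le[OF fin(1) _ _ cardIA])
      fix i assume "i \<in> IA"
      then have "ennreal ((1 / dl m) ^ CARD('d)) * (\<integral>\<^sup>+w. F i w \<partial>lebesgue) \<le> ennreal ((1 / dl m) ^ CARD('d)) * ennreal (v * (q * (K * \<mu> powr \<gamma>)))"
        by (intro mult_left_mono F_int) auto
      then show "ennreal ((1 / dl m) ^ CARD('d)) * (\<integral>\<^sup>+w. F i w \<partial>lebesgue) \<le> ennreal ((1 / dl m) ^ CARD('d) * (v * (q * (K * \<mu> powr \<gamma>)))) * 1"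
        using v q by (simp add: ennreal_mult K_def)
    qed (use v q in \<open>simp add: K_def\<close>)
    also have "5 / (dl m)\<^sup>2 * ((1 / dl m) ^ CARD('d) * (v * (q * (K * \<mu> powr \<gamma>)))) = C * dl m powr \<gamma>"
    proof -
      have "\<mu> ^ (CARD('d) + 2) = 2 ^ (CARD('d) + 2) * (dl m ^ CARD('d) * (dl m)\<^sup>2)" "\<mu> powr \<gamma> = 2 powr \<gamma> * dl m powr \<gamma>"
        by (simp_all add: \<mu>_def power_mult_distrib power_add powr_mult power2_eq_square)
      then have "5 / (dl m)\<^sup>2 * ((1 / dl m) ^ CARD('d) * (v * (q * (K * \<mu> powr \<gamma>)))) =
        ((dl m)\<^sup>2 * inverse ((dl m)\<^sup>2)) * ((1 / dl m) ^ CARD('d) * dl m ^ CARD('d)) * (C * dl m powr \<gamma>)"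
        unfolding q_def C_def by (simp only: divide_inverse mult_1_left mult_ac)
      moreover have "(dl m)\<^sup>2 * inverse ((dl m)\<^sup>2) = 1" "(1 / dl m) ^ CARD('d) * dl m ^ CARD('d) = 1"
        by (simp_all add: power_one_over)
      ultimately show ?thesis by simp
    qed
    finally have "ennreal \<bar>lvl r G m \<phi> - R \<phi>\<bar> \<le> ennreal (C * dl m powr \<gamma>)" by simp
    moreover have "0 \<le> C * dl m powr \<gamma>" using v c by (simp add: C_def K_def)
    ultimately show ?thesis by (subst (asm) ennreal_le_iff)
  qed
  have "(\<lambda>m. C * dl m powr \<gamma>) \<longlonglongrightarrow> C * 0"
  proof (intro tendsto_mult_left)
    have "dl \<longlonglongrightarrow> 0" unfolding dl_def[abs_def] by (rule LIMSEQ_power_zero) simp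
    from tendsto_powr'[OF this tendsto_const[of \<gamma>]] \<gamma> show "(\<lambda>m. dl m powr \<gamma>) \<longlonglongrightarrow> 0" by simp
  qed
  then have lim0: "(\<lambda>m. C * dl m powr \<gamma>) \<longlonglongrightarrow> 0" by simp
  have "(\<lambda>m. lvl r G m \<phi> - R \<phi>) \<longlonglongrightarrow> 0"
    by (rule Lim_null_comparison[OF _ lim0]) (use main in \<open>auto simp: eventually_sequentially\<close>)
  then show ?thesis by (simp add: LIM_zero_iff)
qed

text \<open>Both sides are linear, so it is enough to identify them on the localised pieces of level
  1. The hypothesis may therefore have constants that grow with the region.\<close>

lemma reconstruction_is_limit:
  fixes G :: "'d::finite pt \<Rightarrow> 'd dist"
  assumes p: "1 \<le> p" and \<gamma>: "0 < \<gamma>" and G: "germ r G" and R: "R \<in> distributions r"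
    and bnd: "\<And>\<rho>. \<exists>K. \<forall>t\<in>{-\<rho>..\<rho>}. \<forall>x0. infnorm x0 \<le> \<rho> \<longrightarrow> (\<forall>\<epsilon>\<in>{0<..1}.
      Lp p (sball x0 1) (\<lambda>x. SUP \<eta>\<in>Br r. ennreal \<bar>R (rescale \<eta> \<epsilon> (t, x)) - G (t, x) (rescale \<eta> \<epsilon> (t, x))\<bar>) \<le> ennreal (K * \<epsilon> powr \<gamma>))"
  shows "R = recon r G"
proof
  fix \<phi>
  show "R \<phi> = recon r G \<phi>"
  proof (cases "\<phi> \<in> tests r")
    case True
    obtain C where C: "0 < C" "\<And>(\<phi> :: 'd func) A k. 0 \<le> A \<Longrightarrow> sized r A 1 \<phi> \<Longrightarrow> sized r (C * A) 1 (\<lambda>z. pu r 1 k z * \<phi> z)"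
      using pieces_sized[where 'd='d] by blast
    define A where "A = enn2real (Cr_norm r \<phi>) + 1"
    have A: "0 < A" "sized r A 1 \<phi>" using sized_mono[OF testsD(2)[OF True], of A] by (auto simp: A_def add_nonneg_pos)
    let ?I = "supp_idx r 1 \<phi>"
    have I: "finite ?I" "?I \<subseteq> ?I" using finite_supp_idx[OF True] by auto
    have "(\<lambda>m. lvl r G m (\<lambda>z. pu r 1 k z * \<phi> z)) \<longlonglongrightarrow> R (\<lambda>z. pu r 1 k z * \<phi> z)" for k
    proof (rule level_converges[OF p \<gamma> G R bnd pu_tests[OF True] C(2)[OF less_imp_le[OF A(1)] A(2)]])
      show "0 < C * A" using C(1) A(1) by simp
      fix z assume "pu r 1 k z * \<phi> z \<noteq> 0"
      then show "\<bar>fst z - of_int (fst k) / 4\<bar> \<le> 1 \<and> infnorm (snd z - corner 1 (snd k)) \<le> 1 / 2" by (rule piece_support)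
    qed
    then have "(\<lambda>m. \<Sum>k\<in>?I. lvl r G m (\<lambda>z. pu r 1 k z * \<phi> z)) \<longlonglongrightarrow> (\<Sum>k\<in>?I. R (\<lambda>z. pu r 1 k z * \<phi> z))"
      by (intro tendsto_sum)
    moreover have "lvl r G m \<phi> = (\<Sum>k\<in>?I. lvl r G m (\<lambda>z. pu r 1 k z * \<phi> z))" for m
      using arg_cong[OF pu_decompose[OF I], of "lvl r G m"] pu_tests[OF True]
        lvl_sum_test[OF G, where I = ?I and f = "\<lambda>k z. pu r 1 k z * \<phi> z" and m = m] by simp
    moreover have "R \<phi> = (\<Sum>k\<in>?I. R (\<lambda>z. pu r 1 k z * \<phi> z))"
      using arg_cong[OF pu_decompose[OF I], of R] pu_tests[OF True]
        distribution_sum[OF R, where I = ?I and f = "\<lambda>k z. pu r 1 k z * \<phi> z"] by simp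
    ultimately show ?thesis using True by (simp add: recon_def limI)
  next
    case False
    then show ?thesis using R by (simp add: recon_def distributions_def)
  qed
qed


section \<open>Regularity structures and models\<close>

locale reg_structure =
  fixes S :: "'t::real_vector regstruct"
  assumes RS: "regularity_structure S"
begin

lemma decomposition_proj: "decomposition S \<tau> (\<lambda>\<zeta>. proj S \<zeta> \<tau>)"
proof -
  have "\<exists>!c. decomposition S \<tau> c" using RS by (simp add: regularity_structure_def)
  then have "decomposition S \<tau> (THE c. decomposition S \<tau> c)" by (rule theI')
  then show ?thesis by (simp add: proj_def[abs_def])
qed

lemma proj_eq: "decomposition S \<tau> c \<Longrightarrow> proj S \<zeta> \<tau> = c \<zeta>"
proof -
  assume c: "decomposition S \<tau> c"
  have "\<exists>!c. decomposition S \<tau> c" using RS by (simp add: regularity_structure_def)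
  with c decomposition_proj have "(\<lambda>\<zeta>. proj S \<zeta> \<tau>) = c" by blast
  then show ?thesis by (rule fun_cong)
qed

lemma part_subspace: "subspace (part S \<zeta>)" and part_norm: "norm_on (part S \<zeta>) (cnorm S \<zeta>)"
  using RS by (auto simp: regularity_structure_def)

lemma proj_part: "proj S \<zeta> \<tau> \<in> part S \<zeta>"
  using decomposition_proj by (simp add: decomposition_def)

lemma decompositionI:
  assumes "\<And>\<zeta>. c \<zeta> \<in> part S \<zeta>" "finite F" "\<And>\<zeta>. \<zeta> \<notin> F \<Longrightarrow> c \<zeta> = 0" "\<tau> = (\<Sum>\<zeta>\<in>F. c \<zeta>)"
  shows "decomposition S \<tau> c"
proof -
  have "{\<zeta>. c \<zeta> \<noteq> 0} \<subseteq> F" using assms(3) by blast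
  then show ?thesis using assms unfolding decomposition_def
    by (auto intro: finite_subset sum.mono_neutral_right)
qed

lemma finite_proj: "finite {\<zeta>. proj S \<zeta> \<tau> \<noteq> 0}" and sum_proj: "\<tau> = (\<Sum>\<zeta>\<in>{\<zeta>. proj S \<zeta> \<tau> \<noteq> 0}. proj S \<zeta> \<tau>)"
  using decomposition_proj[of \<tau>] unfolding decomposition_def by blast+

lemma sum_proj_superset: "finite F \<Longrightarrow> {\<zeta>. proj S \<zeta> \<tau> \<noteq> 0} \<subseteq> F \<Longrightarrow> \<tau> = (\<Sum>\<zeta>\<in>F. proj S \<zeta> \<tau>)"
  by (rule trans[OF sum_proj sum.mono_neutral_left]) auto

lemma proj_add: "proj S \<zeta> (a + b) = proj S \<zeta> a + proj S \<zeta> b"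
proof (rule proj_eq, rule decompositionI)
  let ?F = "{\<zeta>. proj S \<zeta> a \<noteq> 0} \<union> {\<zeta>. proj S \<zeta> b \<noteq> 0}"
  show "finite ?F" using finite_proj by blast
  then have "(\<Sum>\<zeta>\<in>?F. proj S \<zeta> a) = a" "(\<Sum>\<zeta>\<in>?F. proj S \<zeta> b) = b"
    by (auto intro!: sum_proj_superset[symmetric])
  then show "a + b = (\<Sum>\<zeta>\<in>?F. proj S \<zeta> a + proj S \<zeta> b)" by (simp only: sum.distrib)
qed (auto intro: subspace_add[OF part_subspace] proj_part)

lemma proj_scaleR: "proj S \<zeta> (c *\<^sub>R a) = c *\<^sub>R proj S \<zeta> a"
proof (rule proj_eq, rule decompositionI)
  show "finite {\<zeta>. proj S \<zeta> a \<noteq> 0}" by (rule finite_proj)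
  show "c *\<^sub>R a = (\<Sum>\<zeta>\<in>{\<zeta>. proj S \<zeta> a \<noteq> 0}. c *\<^sub>R proj S \<zeta> a)"
    by (simp only: scaleR_sum_right[symmetric] sum_proj[symmetric])
qed (auto intro: subspace_scale[OF part_subspace] proj_part)

lemma proj_0: "proj S \<zeta> 0 = 0"
  using proj_scaleR[of \<zeta> 0 0] by simp

lemma proj_diff: "proj S \<zeta> (a - b) = proj S \<zeta> a - proj S \<zeta> b"
  using proj_add[of \<zeta> a "(-1) *\<^sub>R b"] by (simp only: proj_scaleR) simp

lemma proj_sum: "proj S \<zeta> (\<Sum>i\<in>I. f i) = (\<Sum>i\<in>I. proj S \<zeta> (f i))"
  by (induction I rule: infinite_finite_induct) (auto simp: proj_0 proj_add)

lemma proj_of_part: "\<tau> \<in> part S \<zeta> \<Longrightarrow> proj S \<xi> \<tau> = (if \<xi> = \<zeta> then \<tau> else 0)"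
  by (rule proj_eq, rule decompositionI[of _ "{\<zeta>}"]) (auto intro: subspace_0[OF part_subspace])

lemma proj_outside: "\<zeta> \<notin> levels S \<Longrightarrow> proj S \<zeta> \<tau> = 0"
  using proj_part[of \<zeta> \<tau>] RS by (auto simp: regularity_structure_def)

lemma below_iff: "\<tau> \<in> below S \<beta> \<longleftrightarrow> (\<forall>\<zeta>\<ge>\<beta>. proj S \<zeta> \<tau> = 0)"
  by (simp add: below_def)

lemma subspace_below: "subspace (below S \<beta>)"
  by (auto simp: subspace_def below_iff proj_0 proj_add proj_scaleR)

lemma hnorm_nonneg: "0 \<le> hnorm S \<zeta> \<tau>"
  and hnorm_add: "hnorm S \<zeta> (a + b) \<le> hnorm S \<zeta> a + hnorm S \<zeta> b"
  and hnorm_scaleR: "hnorm S \<zeta> (c *\<^sub>R a) = \<bar>c\<bar> * hnorm S \<zeta> a"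
  and hnorm_0: "hnorm S \<zeta> 0 = 0"
proof -
  have N: "norm_on (part S \<zeta>) (cnorm S \<zeta>)" by (rule part_norm)
  show "0 \<le> hnorm S \<zeta> \<tau>" "hnorm S \<zeta> (a + b) \<le> hnorm S \<zeta> a + hnorm S \<zeta> b"
    "hnorm S \<zeta> (c *\<^sub>R a) = \<bar>c\<bar> * hnorm S \<zeta> a" "hnorm S \<zeta> 0 = 0"
    using N proj_part[of \<zeta>] subspace_0[OF part_subspace[of \<zeta>]] unfolding hnorm_def proj_add proj_scaleR proj_0 norm_on_def by auto
qed

lemma hnorm_minus: "hnorm S \<zeta> (- a) = hnorm S \<zeta> a"
  using hnorm_scaleR[of \<zeta> "-1" a] by simp

lemma hnorm_diff: "hnorm S \<zeta> (a - b) \<le> hnorm S \<zeta> a + hnorm S \<zeta> b"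
  using hnorm_add[of \<zeta> a "- b"] by (simp add: hnorm_minus)

lemma hnorm_sum: "hnorm S \<zeta> (\<Sum>i\<in>I. f i) \<le> (\<Sum>i\<in>I. hnorm S \<zeta> (f i))"
proof (induction I rule: infinite_finite_induct)
  case (insert x F)
  then show ?case using hnorm_add[of \<zeta> "f x" "\<Sum>i\<in>F. f i"] by simp
qed (auto simp: hnorm_0)

lemma hnorm_outside: "\<zeta> \<notin> levels S \<Longrightarrow> hnorm S \<zeta> \<tau> = 0"
  using hnorm_0[of \<zeta>] by (simp add: hnorm_def proj_outside proj_0)

lemma hnorm_part: "\<tau> \<in> part S \<zeta> \<Longrightarrow> hnorm S \<zeta> \<tau> = cnorm S \<zeta> \<tau>"
  by (simp add: hnorm_def proj_of_part)

lemma cnorm_nonneg: "\<tau> \<in> part S \<zeta> \<Longrightarrow> 0 \<le> cnorm S \<zeta> \<tau>"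
  and cnorm_eq_0: "\<tau> \<in> part S \<zeta> \<Longrightarrow> cnorm S \<zeta> \<tau> = 0 \<Longrightarrow> \<tau> = 0"
  using part_norm[of \<zeta>] by (auto simp: norm_on_def)

definition lv :: "real \<Rightarrow> real set" where
  "lv \<gamma> = levels S \<inter> {..<\<gamma>}"

text \<open>A norm on \<open>below S \<gamma>\<close>. The sum is finite because the levels are
  locally finite and bounded below.\<close>

definition nsum :: "real \<Rightarrow> 't \<Rightarrow> real" where
  "nsum \<gamma> \<tau> = (\<Sum>\<zeta>\<in>lv \<gamma>. hnorm S \<zeta> \<tau>)"

lemma finite_lv: "finite (lv \<gamma>)"
proof -
  obtain a where "\<And>\<zeta>. \<zeta> \<in> levels S \<Longrightarrow> a \<le> \<zeta>"
    using RS by (auto simp: regularity_structure_def bdd_below_def)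
  then have "lv \<gamma> \<subseteq> levels S \<inter> {a..\<gamma>}" by (auto simp: lv_def)
  moreover have "finite (levels S \<inter> {a..\<gamma>})" using RS by (simp add: regularity_structure_def)
  ultimately show ?thesis by (rule finite_subset)
qed

lemma below_sum: "\<tau> \<in> below S \<gamma> \<Longrightarrow> \<tau> = (\<Sum>\<zeta>\<in>lv \<gamma>. proj S \<zeta> \<tau>)"
  by (rule sum_proj_superset[OF finite_lv]) (use proj_outside in \<open>force simp: below_iff lv_def not_less\<close>)

lemma nsum_nonneg: "0 \<le> nsum \<gamma> \<tau>"
  unfolding nsum_def by (intro sum_nonneg hnorm_nonneg)

lemma nsum_add: "nsum \<gamma> (a + b) \<le> nsum \<gamma> a + nsum \<gamma> b"
  unfolding nsum_def sum.distrib[symmetric] by (intro sum_mono hnorm_add)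

lemma nsum_minus: "nsum \<gamma> (- a) = nsum \<gamma> a"
  by (simp add: nsum_def hnorm_minus)

lemma nsum_diff: "nsum \<gamma> (a - b) \<le> nsum \<gamma> a + nsum \<gamma> b"
  using nsum_add[of \<gamma> a "- b"] by (simp add: nsum_minus)

lemma nsum_0: "nsum \<gamma> 0 = 0"
  by (simp add: nsum_def hnorm_0)

lemma hnorm_le_nsum: "\<zeta> \<in> lv \<gamma> \<Longrightarrow> hnorm S \<zeta> \<tau> \<le> nsum \<gamma> \<tau>"
  unfolding nsum_def by (rule member_le_sum) (auto intro: hnorm_nonneg finite_lv)

lemma grp_linear: "g \<in> grp S \<Longrightarrow> linear g"
  using RS by (simp add: regularity_structure_def)

lemma grp_triangular:
  assumes "g \<in> grp S" "\<tau> \<in> part S \<zeta>" "\<zeta> \<le> \<beta>"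
  shows "proj S \<beta> (g \<tau> - \<tau>) = 0"
proof (cases "\<zeta> \<in> levels S")
  case True
  then show ?thesis using RS assms unfolding regularity_structure_def by (auto simp: below_iff)
next
  case False
  then have "\<tau> = 0" using RS assms(2) by (auto simp: regularity_structure_def)
  then show ?thesis using grp_linear[OF assms(1)] by (simp add: linear_0 proj_0)
qed

lemma grp_below:
  assumes "g \<in> grp S" "\<tau> \<in> below S \<gamma>"
  shows "g \<tau> \<in> below S \<gamma>"
proof -
  have "g (proj S \<zeta> \<tau>) \<in> below S \<gamma>" if "\<zeta> \<in> lv \<gamma>" for \<zeta>
  proof -
    have "proj S \<beta> (g (proj S \<zeta> \<tau>) - proj S \<zeta> \<tau>) = 0" if "\<gamma> \<le> \<beta>" for \<beta>
      using that \<open>\<zeta> \<in> lv \<gamma>\<close> by (intro grp_triangular[OF assms(1) proj_part]) (auto simp: lv_def)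
    moreover have "proj S \<beta> (proj S \<zeta> \<tau>) = 0" if "\<gamma> \<le> \<beta>" for \<beta>
      using that \<open>\<zeta> \<in> lv \<gamma>\<close> by (simp add: proj_of_part[OF proj_part] lv_def)
    ultimately show ?thesis by (simp add: below_iff proj_diff)
  qed
  moreover have "g \<tau> = (\<Sum>\<zeta>\<in>lv \<gamma>. g (proj S \<zeta> \<tau>))"
    using arg_cong[OF below_sum[OF assms(2)], of g] linear_sum[OF grp_linear[OF assms(1)], of "\<lambda>\<zeta>. proj S \<zeta> \<tau>" "lv \<gamma>"] by (rule trans)
  ultimately show ?thesis by (simp add: subspace_sum[OF subspace_below])
qed

text \<open>For \<open>x = 0\<close> the claim rests on the conventions for division by 0: the
  quotient is infinite unless h is 0.\<close>

lemma ennreal_divide_le_imp: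
  assumes "ennreal h / ennreal x \<le> ennreal K" "0 \<le> h" "0 \<le> x" "0 \<le> K"
  shows "h \<le> K * x"
proof (cases "x = 0")
  case True
  then show ?thesis using assms by (cases "h = 0") (auto simp: top_unique)
next
  case False
  then have "ennreal (h / x) \<le> ennreal K" using assms by (simp add: divide_ennreal)
  then have "h / x \<le> K" using assms by simp
  then show ?thesis using False assms by (simp add: divide_le_eq)
qed

section \<open>Bounds and continuity of the maps of a model\<close>

lemma model_grp: "is_model S r Md \<Longrightarrow> mGam Md a b \<in> grp S"
proof -
  assume "is_model S r Md"
  then have "\<forall>z z'. mGam Md z z' \<in> grp S" unfolding is_model_def by (elim conjE)
  then show ?thesis by blast
qed

lemma model_cocycle: "is_model S r Md \<Longrightarrow> mGam Md a b (mGam Md b c \<tau>) = mGam Md a c \<tau>"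
proof -
  assume "is_model S r Md"
  then have "\<forall>z z' z''. mGam Md z z' \<circ> mGam Md z' z'' = mGam Md z z''" unfolding is_model_def by (elim conjE)
  then have "mGam Md a b \<circ> mGam Md b c = mGam Md a c" by (elim allE)
  from fun_cong[OF this, of \<tau>] show ?thesis by simp
qed

lemma model_dist: "is_model S r Md \<Longrightarrow> mPi Md z \<tau> \<in> distributions r"
proof -
  assume "is_model S r Md"
  then have "\<forall>z \<tau>. mPi Md z \<tau> \<in> distributions r" unfolding is_model_def by (elim conjE)
  then show ?thesis by blast
qed

lemma model_Pi_Gam: "is_model S r Md \<Longrightarrow> mPi Md a (mGam Md a b \<tau>) = mPi Md b \<tau>"
proof -
  assume "is_model S r Md"
  then have "\<forall>z z' \<tau>. mPi Md z (mGam Md z z' \<tau>) = mPi Md z' \<tau>" unfolding is_model_def by (elim conjE)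
  then show ?thesis by blast
qed

lemma model_Pi_linear: "is_model S r Md \<Longrightarrow> linear (\<lambda>\<tau>. mPi Md z \<tau> \<phi>)"
proof -
  assume "is_model S r Md"
  then have "\<forall>z \<phi>. linear (\<lambda>\<tau>. mPi Md z \<tau> \<phi>)" unfolding is_model_def by (elim conjE)
  then show ?thesis by blast
qed

lemma Gam_part_bound:
  fixes Md :: "('d::finite, 't) model"
  assumes M: "is_model S r Md" and B: "bounded B"
  shows "\<exists>K\<ge>0. \<forall>a\<in>B. \<forall>b\<in>B. \<forall>\<zeta>. \<forall>\<tau>\<in>part S \<zeta>. \<forall>\<beta>\<le>\<zeta>.
    hnorm S \<beta> (mGam Md a b \<tau>) \<le> K * (cnorm S \<zeta> \<tau> * (if \<zeta> = \<beta> then 1 else pnorm (a - b) powr (\<zeta> - \<beta>)))"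
proof -
  have "Gam_norm S (mGam Md) B < top" using M B by (simp add: is_model_def)
  then obtain K0 where K: "Gam_norm S (mGam Md) B = ennreal K0" "0 \<le> K0" by (cases "Gam_norm S (mGam Md) B") auto
  show ?thesis
  proof (intro exI[of _ K0] conjI ballI allI impI K(2))
  fix a b \<zeta> \<tau> \<beta> assume ab: "a \<in> B" "b \<in> B" and \<tau>: "\<tau> \<in> part S \<zeta>" and \<beta>: "\<beta> \<le> \<zeta>"
  let ?x = "cnorm S \<zeta> \<tau> * (if \<zeta> = \<beta> then 1 else pnorm (a - b) powr (\<zeta> - \<beta>))"
  have x: "0 \<le> ?x" using cnorm_nonneg[OF \<tau>] by simp
  show "hnorm S \<beta> (mGam Md a b \<tau>) \<le> K0 * ?x"
  proof (cases "\<zeta> \<in> levels S \<and> \<beta> \<in> levels S")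
    case True
    have "ennreal (hnorm S \<beta> (mGam Md a b \<tau>)) / ennreal ?x \<le> Gam_norm S (mGam Md) B"
      unfolding Gam_norm_def Gam_norm_at_def
      by (rule SUP_upper2[OF ab(1)], rule SUP_upper2[OF ab(2)], rule SUP_upper2[of \<zeta>], use True in blast,
          rule SUP_upper2[of \<beta>], use True \<beta> in blast, rule SUP_upper2[OF \<tau>], rule order_refl)
    then show ?thesis using x K(2) unfolding K(1) by (rule_tac ennreal_divide_le_imp[OF _ hnorm_nonneg])
  next
    case False
    have "hnorm S \<beta> (mGam Md a b \<tau>) = 0"
    proof (cases "\<beta> \<in> levels S")
      case True
      with False have "\<tau> = 0" using RS \<tau> by (auto simp: regularity_structure_def)
      moreover have "linear (mGam Md a b)" by (rule grp_linear[OF model_grp[OF M]])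
      ultimately show ?thesis by (simp add: linear_0 hnorm_0)
    qed (simp add: hnorm_outside)
    then show ?thesis by (simp only: mult_nonneg_nonneg[OF K(2) x])
  qed
  qed
qed

lemma pnorm_nonneg: "0 \<le> pnorm z"
  by (simp add: pnorm_def le_max_iff_disj infnorm_pos_le)

text \<open>By triangularity, \<open>mGam Md a b - id\<close> strictly lowers the homogeneity. Only
  positive powers of the distance occur, so the map tends to the identity as a and b approach each
  other.\<close>

lemma Gam_near_id:
  fixes Md :: "('d::finite, 't) model"
  assumes M: "is_model S r Md" and B: "bounded B"
  shows "\<exists>K\<ge>0. \<forall>a\<in>B. \<forall>b\<in>B. \<forall>\<tau>\<in>below S \<gamma>.
    nsum \<gamma> (mGam Md a b \<tau> - \<tau>) \<le> K * (\<Sum>\<beta>\<in>lv \<gamma>. \<Sum>\<zeta>\<in>lv \<gamma>. if \<beta> < \<zeta> then pnorm (a - b) powr (\<zeta> - \<beta>) else 0) * nsum \<gamma> \<tau>"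
proof -
  obtain K where K: "0 \<le> K" "\<And>a b \<zeta> \<tau> \<beta>. a \<in> B \<Longrightarrow> b \<in> B \<Longrightarrow> \<tau> \<in> part S \<zeta> \<Longrightarrow> \<beta> \<le> \<zeta> \<Longrightarrow>
    hnorm S \<beta> (mGam Md a b \<tau>) \<le> K * (cnorm S \<zeta> \<tau> * (if \<zeta> = \<beta> then 1 else pnorm (a - b) powr (\<zeta> - \<beta>)))"
    using Gam_part_bound[OF M B] by blast
  show ?thesis
  proof (intro exI[of _ K] conjI K(1) ballI)
    fix a b \<tau> assume ab: "a \<in> B" "b \<in> B" and \<tau>: "\<tau> \<in> below S \<gamma>"
    let ?g = "mGam Md a b"
    have g: "?g \<in> grp S" by (rule model_grp[OF M])
    have "?g \<tau> = (\<Sum>\<zeta>\<in>lv \<gamma>. ?g (proj S \<zeta> \<tau>))"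
      using arg_cong[OF below_sum[OF \<tau>], of ?g] linear_sum[OF grp_linear[OF g], of "\<lambda>\<zeta>. proj S \<zeta> \<tau>" "lv \<gamma>"] by (rule trans)
    then have e: "?g \<tau> - \<tau> = (\<Sum>\<zeta>\<in>lv \<gamma>. ?g (proj S \<zeta> \<tau>) - proj S \<zeta> \<tau>)"
      unfolding sum_subtractf by (rule arg_cong2[OF _ below_sum[OF \<tau>], of _ _ minus])
    have 1: "hnorm S \<beta> (?g (proj S \<zeta> \<tau>) - proj S \<zeta> \<tau>) \<le> K * (if \<beta> < \<zeta> then pnorm (a - b) powr (\<zeta> - \<beta>) else 0) * nsum \<gamma> \<tau>"
      if "\<zeta> \<in> lv \<gamma>" for \<beta> \<zeta>
    proof (cases "\<beta> < \<zeta>")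
      case True
      have "proj S \<beta> (?g (proj S \<zeta> \<tau>) - proj S \<zeta> \<tau>) = proj S \<beta> (?g (proj S \<zeta> \<tau>))"
        using True by (simp add: proj_diff proj_of_part[OF proj_part])
      then have "hnorm S \<beta> (?g (proj S \<zeta> \<tau>) - proj S \<zeta> \<tau>) = hnorm S \<beta> (?g (proj S \<zeta> \<tau>))" by (simp add: hnorm_def)
      also have "\<dots> \<le> K * (cnorm S \<zeta> (proj S \<zeta> \<tau>) * pnorm (a - b) powr (\<zeta> - \<beta>))"
        using K(2)[OF ab proj_part, of \<beta> \<zeta> \<tau>] True by simp
      also have "\<dots> \<le> K * (nsum \<gamma> \<tau> * pnorm (a - b) powr (\<zeta> - \<beta>))"
        using hnorm_le_nsum[OF that, of \<tau>] K(1) by (intro mult_left_mono mult_right_mono) (auto simp: hnorm_def)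
      finally show ?thesis using True by (simp add: mult_ac)
    next
      case False
      then have "proj S \<beta> (?g (proj S \<zeta> \<tau>) - proj S \<zeta> \<tau>) = 0"
        by (intro grp_triangular[OF g proj_part]) simp
      then have "hnorm S \<beta> (?g (proj S \<zeta> \<tau>) - proj S \<zeta> \<tau>) = hnorm S \<beta> 0" by (simp add: hnorm_def proj_0)
      then show ?thesis using False by (simp add: hnorm_0)
    qed
    have "nsum \<gamma> (?g \<tau> - \<tau>) \<le> (\<Sum>\<beta>\<in>lv \<gamma>. \<Sum>\<zeta>\<in>lv \<gamma>. hnorm S \<beta> (?g (proj S \<zeta> \<tau>) - proj S \<zeta> \<tau>))"
      unfolding nsum_def e by (intro sum_mono hnorm_sum)
    also have "\<dots> \<le> (\<Sum>\<beta>\<in>lv \<gamma>. \<Sum>\<zeta>\<in>lv \<gamma>. K * (if \<beta> < \<zeta> then pnorm (a - b) powr (\<zeta> - \<beta>) else 0) * nsum \<gamma> \<tau>)"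
      by (intro sum_mono 1)
    also have "\<dots> = K * (\<Sum>\<beta>\<in>lv \<gamma>. \<Sum>\<zeta>\<in>lv \<gamma>. if \<beta> < \<zeta> then pnorm (a - b) powr (\<zeta> - \<beta>) else 0) * nsum \<gamma> \<tau>"
      by (simp only: sum_distrib_left sum_distrib_right)
    finally show "nsum \<gamma> (?g \<tau> - \<tau>) \<le> K * (\<Sum>\<beta>\<in>lv \<gamma>. \<Sum>\<zeta>\<in>lv \<gamma>. if \<beta> < \<zeta> then pnorm (a - b) powr (\<zeta> - \<beta>) else 0) * nsum \<gamma> \<tau>" .
  qed
qed

lemma pnorm_bounded:
  assumes "bounded (B :: 'd::finite pt set)"
  shows "\<exists>\<rho>>0. \<forall>a\<in>B. \<forall>b\<in>B. pnorm (a - b) \<le> \<rho>"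
proof -
  obtain c where c: "\<And>z. z \<in> B \<Longrightarrow> norm z \<le> c" using assms by (auto simp: bounded_iff)
  define \<rho> where "\<rho> = sqrt (2 * \<bar>c\<bar>) + 2 * \<bar>c\<bar> + 1"
  have r: "0 \<le> sqrt (2 * \<bar>c\<bar>)" by simp
  have "pnorm (a - b) \<le> \<rho>" if "a \<in> B" "b \<in> B" for a b
  proof -
    have n: "norm (a - b) \<le> 2 * \<bar>c\<bar>" using norm_triangle_ineq4[of a b] c[OF that(1)] c[OF that(2)] by linarith
    have "\<bar>fst (a - b)\<bar> \<le> 2 * \<bar>c\<bar>" using norm_fst_le[of "fst (a - b)" "snd (a - b)"] n unfolding prod.collapse by simp
    then have "sqrt \<bar>fst (a - b)\<bar> \<le> sqrt (2 * \<bar>c\<bar>)" by simp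
    moreover have "infnorm (snd (a - b)) \<le> 2 * \<bar>c\<bar>"
      using infnorm_le_norm[of "snd (a - b)"] norm_snd_le[of "snd (a - b)" "fst (a - b)"] n unfolding prod.collapse by linarith
    ultimately show ?thesis using r unfolding pnorm_def \<rho>_def max.bounded_iff by linarith
  qed
  moreover have "0 < \<rho>" using r by (simp add: \<rho>_def add_nonneg_pos)
  ultimately show ?thesis by blast
qed

lemma Gam_bounded:
  fixes Md :: "('d::finite, 't) model"
  assumes M: "is_model S r Md" and B: "bounded B"
  shows "\<exists>K\<ge>0. \<forall>a\<in>B. \<forall>b\<in>B. \<forall>\<tau>\<in>below S \<gamma>. nsum \<gamma> (mGam Md a b \<tau>) \<le> K * nsum \<gamma> \<tau>"
proof -
  obtain K where K: "0 \<le> K" "\<And>a b \<tau>. a \<in> B \<Longrightarrow> b \<in> B \<Longrightarrow> \<tau> \<in> below S \<gamma> \<Longrightarrow>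
    nsum \<gamma> (mGam Md a b \<tau> - \<tau>) \<le> K * (\<Sum>\<beta>\<in>lv \<gamma>. \<Sum>\<zeta>\<in>lv \<gamma>. if \<beta> < \<zeta> then pnorm (a - b) powr (\<zeta> - \<beta>) else 0) * nsum \<gamma> \<tau>"
    using Gam_near_id[OF M B] by blast
  obtain \<rho> where \<rho>: "0 < \<rho>" "\<And>a b. a \<in> B \<Longrightarrow> b \<in> B \<Longrightarrow> pnorm (a - b) \<le> \<rho>" using pnorm_bounded[OF B] by blast
  define W where "W = (\<Sum>\<beta>\<in>lv \<gamma>. \<Sum>\<zeta>\<in>lv \<gamma>. if \<beta> < \<zeta> then \<rho> powr (\<zeta> - \<beta>) else 0)"
  have W: "0 \<le> W" unfolding W_def by (intro sum_nonneg) auto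
  show ?thesis
  proof (intro exI[of _ "K * W + 1"] conjI ballI)
    show "0 \<le> K * W + 1" using K(1) W by simp
    fix a b \<tau> assume ab: "a \<in> B" "b \<in> B" and \<tau>: "\<tau> \<in> below S \<gamma>"
    have "(\<Sum>\<beta>\<in>lv \<gamma>. \<Sum>\<zeta>\<in>lv \<gamma>. if \<beta> < \<zeta> then pnorm (a - b) powr (\<zeta> - \<beta>) else 0) \<le> W"
      unfolding W_def using \<rho>(2)[OF ab] by (intro sum_mono) (auto intro!: powr_mono2 pnorm_nonneg)
    then have "K * (\<Sum>\<beta>\<in>lv \<gamma>. \<Sum>\<zeta>\<in>lv \<gamma>. if \<beta> < \<zeta> then pnorm (a - b) powr (\<zeta> - \<beta>) else 0) * nsum \<gamma> \<tau> \<le> K * W * nsum \<gamma> \<tau>"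
      using K(1) by (intro mult_right_mono mult_left_mono nsum_nonneg) auto
    with K(2)[OF ab \<tau>] have "nsum \<gamma> (mGam Md a b \<tau> - \<tau>) \<le> K * W * nsum \<gamma> \<tau>" by linarith
    moreover have "nsum \<gamma> (mGam Md a b \<tau>) \<le> nsum \<gamma> (mGam Md a b \<tau> - \<tau>) + nsum \<gamma> \<tau>"
      using nsum_add[of \<gamma> "mGam Md a b \<tau> - \<tau>" \<tau>] by simp
    ultimately show "nsum \<gamma> (mGam Md a b \<tau>) \<le> (K * W + 1) * nsum \<gamma> \<tau>" by (simp add: distrib_right)
  qed
qed

text \<open>The type \<open>'t\<close> is merely a vector space, so convergence is expressed by the
  norm on the levels below \<gamma>.\<close>

definition tconv :: "real \<Rightarrow> (nat \<Rightarrow> 't) \<Rightarrow> 't \<Rightarrow> bool" where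
  "tconv \<gamma> v a \<longleftrightarrow> (\<lambda>n. nsum \<gamma> (v n - a)) \<longlonglongrightarrow> 0"

lemma tconv_le:
  assumes "f \<longlonglongrightarrow> 0" "\<And>n. nsum \<gamma> (v n - a) \<le> f n"
  shows "tconv \<gamma> v a"
  unfolding tconv_def by (rule tendsto_sandwich[OF _ _ tendsto_const assms(1)]) (auto simp: nsum_nonneg assms(2))

lemma tconv_const: "tconv \<gamma> (\<lambda>n. a) a"
  by (simp add: tconv_def nsum_0)

lemma tconv_add: "tconv \<gamma> u a \<Longrightarrow> tconv \<gamma> v b \<Longrightarrow> tconv \<gamma> (\<lambda>n. u n + v n) (a + b)"
  by (rule tconv_le[of "\<lambda>n. nsum \<gamma> (u n - a) + nsum \<gamma> (v n - b)"])
    (auto simp: tconv_def add_diff_add intro: tendsto_add_zero nsum_add)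

lemma tconv_diff: "tconv \<gamma> u a \<Longrightarrow> tconv \<gamma> v b \<Longrightarrow> tconv \<gamma> (\<lambda>n. u n - v n) (a - b)"
proof (rule tconv_le[of "\<lambda>n. nsum \<gamma> (u n - a) + nsum \<gamma> (v n - b)"])
  fix n
  have "u n - v n - (a - b) = (u n - a) - (v n - b)" by simp
  then show "nsum \<gamma> (u n - v n - (a - b)) \<le> nsum \<gamma> (u n - a) + nsum \<gamma> (v n - b)" by (simp only: nsum_diff)
qed (auto simp: tconv_def intro: tendsto_add_zero)

lemma tconv_hnorm:
  assumes "tconv \<gamma> v a" "\<zeta> \<in> lv \<gamma>"
  shows "(\<lambda>n. hnorm S \<zeta> (v n)) \<longlonglongrightarrow> hnorm S \<zeta> a"
proof (rule LIM_zero_cancel, rule Lim_null_comparison)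
  show "(\<lambda>n. nsum \<gamma> (v n - a)) \<longlonglongrightarrow> 0" using assms(1) by (simp add: tconv_def)
  have "\<bar>hnorm S \<zeta> (v n) - hnorm S \<zeta> a\<bar> \<le> nsum \<gamma> (v n - a)" for n
    using hnorm_add[of \<zeta> "v n - a" a] hnorm_diff[of \<zeta> "v n" "v n - a"] hnorm_le_nsum[OF assms(2), of "v n - a"] by simp
  then show "\<forall>\<^sub>F n in sequentially. norm (hnorm S \<zeta> (v n) - hnorm S \<zeta> a) \<le> nsum \<gamma> (v n - a)" by simp
qed

lemma tconv_Gam_near:
  fixes Md :: "('d::finite, 't) model"
  assumes M: "is_model S r Md" and ab: "a \<longlonglongrightarrow> z" "b \<longlonglongrightarrow> z" and v: "tconv \<gamma> v c" "\<And>n. v n \<in> below S \<gamma>"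
  shows "tconv \<gamma> (\<lambda>n. mGam Md (a n) (b n) (v n)) c"
proof -
  have B: "bounded (range a \<union> range b)" using ab convergent_imp_bounded by (auto simp: convergent_def)
  obtain K where K: "0 \<le> K" "\<And>n. nsum \<gamma> (mGam Md (a n) (b n) (v n) - v n) \<le>
      K * (\<Sum>\<beta>\<in>lv \<gamma>. \<Sum>\<zeta>\<in>lv \<gamma>. if \<beta> < \<zeta> then pnorm (a n - b n) powr (\<zeta> - \<beta>) else 0) * nsum \<gamma> (v n)"
    using Gam_near_id[OF M B, of \<gamma>] v(2) by blast
  define W where "W n = (\<Sum>\<beta>\<in>lv \<gamma>. \<Sum>\<zeta>\<in>lv \<gamma>. if \<beta> < \<zeta> then pnorm (a n - b n) powr (\<zeta> - \<beta>) else 0)" for n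
  have p0: "(\<lambda>n. pnorm (a n - b n)) \<longlonglongrightarrow> 0"
  proof -
    have "(\<lambda>n. a n - b n) \<longlonglongrightarrow> 0" using tendsto_diff[OF ab] by simp
    moreover have "isCont pnorm (0 :: 'd pt)" using continuous_on_pnorm unfolding continuous_on_eq_continuous_at[OF open_UNIV] by blast
    ultimately have "(\<lambda>n. pnorm (a n - b n)) \<longlonglongrightarrow> pnorm (0 :: 'd pt)" by (rule isCont_tendsto_compose[rotated])
    then show ?thesis by (simp add: pnorm_def infnorm_0)
  qed
  have "(\<lambda>n. if \<beta> < \<zeta> then pnorm (a n - b n) powr (\<zeta> - \<beta>) else 0) \<longlonglongrightarrow> 0" for \<beta> \<zeta>
    using tendsto_powr'[OF p0 tendsto_const[of "\<zeta> - \<beta>"]] by (cases "\<beta> < \<zeta>") (auto simp: pnorm_nonneg)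
  then have W0: "W \<longlonglongrightarrow> 0" unfolding W_def[abs_def] by (intro tendsto_null_sum)
  have nv: "nsum \<gamma> (v n) \<le> nsum \<gamma> (v n - c) + nsum \<gamma> c" for n using nsum_add[of \<gamma> "v n - c" c] by simp
  have W_nonneg: "0 \<le> W n" for n unfolding W_def by (intro sum_nonneg) auto
  show ?thesis
  proof (rule tconv_le)
    have "(\<lambda>n. K * W n * (nsum \<gamma> (v n - c) + nsum \<gamma> c) + nsum \<gamma> (v n - c)) \<longlonglongrightarrow> K * 0 * (0 + nsum \<gamma> c) + 0"
      using v(1) unfolding tconv_def by (intro tendsto_intros W0)
    then show "(\<lambda>n. K * W n * (nsum \<gamma> (v n - c) + nsum \<gamma> c) + nsum \<gamma> (v n - c)) \<longlonglongrightarrow> 0" by simp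
    fix n
    have "K * W n * nsum \<gamma> (v n) \<le> K * W n * (nsum \<gamma> (v n - c) + nsum \<gamma> c)"
      using K(1) W_nonneg by (intro mult_left_mono nv) auto
    then show "nsum \<gamma> (mGam Md (a n) (b n) (v n) - c) \<le> K * W n * (nsum \<gamma> (v n - c) + nsum \<gamma> c) + nsum \<gamma> (v n - c)"
      using nsum_add[of \<gamma> "mGam Md (a n) (b n) (v n) - v n" "v n - c"] K(2)[of n] by (simp add: W_def)
  qed
qed

text \<open>The cocycle identity factors the map from \<open>b n\<close> to \<open>a n\<close>
  through z' and z. The two outer factors tend to the identity by \<open>tconv_Gam_near\<close>, and
  the middle one is fixed and bounded. This joint continuity is the source of all measurability
  below.\<close>

lemma tconv_Gam:
  fixes Md :: "('d::finite, 't) model"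
  assumes M: "is_model S r Md" and ab: "a \<longlonglongrightarrow> z" "b \<longlonglongrightarrow> z'" and v: "tconv \<gamma> v c" "\<And>n. v n \<in> below S \<gamma>" "c \<in> below S \<gamma>"
  shows "tconv \<gamma> (\<lambda>n. mGam Md (a n) (b n) (v n)) (mGam Md z z' c)"
proof -
  have 1: "tconv \<gamma> (\<lambda>n. mGam Md z' (b n) (v n)) c"
    by (rule tconv_Gam_near[OF M tendsto_const ab(2) v(1,2)])
  have b1: "mGam Md z' (b n) (v n) \<in> below S \<gamma>" for n by (rule grp_below[OF model_grp[OF M] v(2)])
  have 2: "tconv \<gamma> (\<lambda>n. mGam Md z z' (mGam Md z' (b n) (v n))) (mGam Md z z' c)"
  proof -
    have "bounded {z, z'}" by (simp add: finite_imp_bounded)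
    from Gam_bounded[OF M this] obtain K where K: "\<And>\<tau>. \<tau> \<in> below S \<gamma> \<Longrightarrow> nsum \<gamma> (mGam Md z z' \<tau>) \<le> K * nsum \<gamma> \<tau>" by blast
    have "(\<lambda>n. K * nsum \<gamma> (mGam Md z' (b n) (v n) - c)) \<longlonglongrightarrow> K * 0"
      using 1 unfolding tconv_def by (intro tendsto_intros)
    then have 0: "(\<lambda>n. K * nsum \<gamma> (mGam Md z' (b n) (v n) - c)) \<longlonglongrightarrow> 0" by simp
    show ?thesis
    proof (rule tconv_le[OF 0])
      fix n
      have "mGam Md z' (b n) (v n) - c \<in> below S \<gamma>"
        using b1 v(3) by (rule subspace_diff[OF subspace_below])
      from K[OF this] show "nsum \<gamma> (mGam Md z z' (mGam Md z' (b n) (v n)) - mGam Md z z' c) \<le> K * nsum \<gamma> (mGam Md z' (b n) (v n) - c)"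
        by (simp only: linear_diff[OF grp_linear[OF model_grp[OF M]]])
    qed
  qed
  have "tconv \<gamma> (\<lambda>n. mGam Md (a n) z (mGam Md z z' (mGam Md z' (b n) (v n)))) (mGam Md z z' c)"
    by (rule tconv_Gam_near[OF M ab(1) tendsto_const 2]) (rule grp_below[OF model_grp[OF M] b1])
  then show ?thesis by (simp add: model_cocycle[OF M])
qed

text \<open>F is any family that is linear in the symbol, so as to cover the difference of two
  models too. Each level is estimated apart; a component of norm 0 vanishes and needs no
  quotient.\<close>

lemma Pi_bound:
  fixes F :: "'d::finite pt \<Rightarrow> 't \<Rightarrow> 'd dist"
  assumes F: "\<And>\<phi>. linear (\<lambda>\<tau>. F z \<tau> \<phi>)" and z: "z \<in> B" and \<eta>: "\<eta> \<in> Br r" and l: "0 < l" "l \<le> 1" and \<tau>: "\<tau> \<in> below S \<gamma>"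
  shows "ennreal \<bar>F z \<tau> (rescale \<eta> l z)\<bar> \<le> Pi_norm S r F B * ennreal (\<Sum>\<zeta>\<in>lv \<gamma>. l powr \<zeta> * hnorm S \<zeta> \<tau>)"
proof -
  let ?\<phi> = "rescale \<eta> l z"
  have 1: "ennreal \<bar>F z (proj S \<zeta> \<tau>) ?\<phi>\<bar> \<le> Pi_norm S r F B * ennreal (l powr \<zeta> * hnorm S \<zeta> \<tau>)" if \<zeta>: "\<zeta> \<in> lv \<gamma>" for \<zeta>
  proof -
    let ?x = "cnorm S \<zeta> (proj S \<zeta> \<tau>) * l powr \<zeta>"
    have x: "0 \<le> ?x" using cnorm_nonneg[OF proj_part] by simp
    show ?thesis
    proof (cases "?x = 0")
      case True
      then have "proj S \<zeta> \<tau> = 0" using l cnorm_eq_0[OF proj_part] by auto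
      then show ?thesis using linear_0[OF F] by simp
    next
      case False
      have lz: "\<zeta> \<in> levels S" using \<zeta> by (simp add: lv_def)
      have "ennreal \<bar>F z (proj S \<zeta> \<tau>) ?\<phi>\<bar> / ennreal ?x \<le> Pi_norm S r F B"
        unfolding Pi_norm_def
        by (rule SUP_upper2[OF z], rule SUP_upper2[OF \<eta>], rule SUP_upper2[of l], use l in simp,
            rule SUP_upper2[OF lz], rule SUP_upper2[OF proj_part[of \<zeta> \<tau>]], rule order_refl)
      then have "ennreal (\<bar>F z (proj S \<zeta> \<tau>) ?\<phi>\<bar> / ?x) \<le> Pi_norm S r F B" using x False by (simp add: divide_ennreal)
      then have "ennreal (\<bar>F z (proj S \<zeta> \<tau>) ?\<phi>\<bar> / ?x) * ennreal ?x \<le> Pi_norm S r F B * ennreal ?x" by (rule mult_right_mono) simp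
      moreover have "ennreal (\<bar>F z (proj S \<zeta> \<tau>) ?\<phi>\<bar> / ?x) * ennreal ?x = ennreal \<bar>F z (proj S \<zeta> \<tau>) ?\<phi>\<bar>"
        using x False by (simp flip: ennreal_mult)
      ultimately show ?thesis by (simp add: hnorm_def mult.commute)
    qed
  qed
  have "F z \<tau> ?\<phi> = (\<Sum>\<zeta>\<in>lv \<gamma>. F z (proj S \<zeta> \<tau>) ?\<phi>)"
    using arg_cong[OF below_sum[OF \<tau>], of "\<lambda>\<tau>. F z \<tau> ?\<phi>"] linear_sum[OF F[of ?\<phi>]] by (rule trans)
  then have "ennreal \<bar>F z \<tau> ?\<phi>\<bar> \<le> ennreal (\<Sum>\<zeta>\<in>lv \<gamma>. \<bar>F z (proj S \<zeta> \<tau>) ?\<phi>\<bar>)" by (simp add: ennreal_leI sum_abs)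
  also have "\<dots> = (\<Sum>\<zeta>\<in>lv \<gamma>. ennreal \<bar>F z (proj S \<zeta> \<tau>) ?\<phi>\<bar>)" by (intro sum_ennreal[symmetric]) auto
  also have "\<dots> \<le> (\<Sum>\<zeta>\<in>lv \<gamma>. Pi_norm S r F B * ennreal (l powr \<zeta> * hnorm S \<zeta> \<tau>))" by (intro sum_mono 1)
  also have "\<dots> = Pi_norm S r F B * (\<Sum>\<zeta>\<in>lv \<gamma>. ennreal (l powr \<zeta> * hnorm S \<zeta> \<tau>))" by (simp only: sum_distrib_left)
  also have "(\<Sum>\<zeta>\<in>lv \<gamma>. ennreal (l powr \<zeta> * hnorm S \<zeta> \<tau>)) = ennreal (\<Sum>\<zeta>\<in>lv \<gamma>. l powr \<zeta> * hnorm S \<zeta> \<tau>)"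
    by (intro sum_ennreal mult_nonneg_nonneg hnorm_nonneg powr_ge_zero)
  finally show ?thesis .
qed

text \<open>The norm of the model speaks only of test functions rescaled about the base point. A
  general one is cut into pieces at scale 1, and for each piece the base point is moved to its
  centre, at the cost of a bounded map of the group.\<close>

lemma Pi_functional_bound:
  fixes Md :: "('d::finite, 't) model"
  assumes M: "is_model S r Md" and \<phi>: "\<phi> \<in> tests r"
  shows "\<exists>K\<ge>0. \<forall>\<tau>\<in>below S \<gamma>. \<bar>mPi Md z0 \<tau> \<phi>\<bar> \<le> K * nsum \<gamma> \<tau>"
proof -
  obtain C where C: "0 < C" "\<And>(\<phi> :: 'd func) A k. 0 \<le> A \<Longrightarrow> sized r A 1 \<phi> \<Longrightarrow> sized r (C * A) 1 (\<lambda>z. pu r 1 k z * \<phi> z)"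
    using pieces_sized[where 'd='d] by blast
  define A where "A = enn2real (Cr_norm r \<phi>) + 1"
  have A: "0 < A" "sized r A 1 \<phi>" using sized_mono[OF testsD(2)[OF \<phi>], of A] by (auto simp: A_def add_nonneg_pos)
  let ?I = "supp_idx r 1 \<phi>"
  define \<psi> where "\<psi> k = (\<lambda>z. pu r 1 k z * \<phi> z)" for k
  have I: "finite ?I" "?I \<subseteq> ?I" using finite_supp_idx[OF \<phi>] by auto
  have "\<exists>K\<ge>0. \<forall>\<tau>\<in>below S \<gamma>. \<bar>mPi Md z0 \<tau> (\<psi> k)\<bar> \<le> K * nsum \<gamma> \<tau>" for k
  proof -
    define zk :: "'d pt" where "zk = (of_int (fst k) / 4, corner 1 (snd k))"
    have Bz: "bounded {zk}" "bounded {zk, z0}" by (simp_all add: finite_imp_bounded)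
    obtain K1 where K1: "0 \<le> K1" "\<And>\<tau>. \<tau> \<in> below S \<gamma> \<Longrightarrow> nsum \<gamma> (mGam Md zk z0 \<tau>) \<le> K1 * nsum \<gamma> \<tau>"
      using Gam_bounded[OF M Bz(2), of \<gamma>] by blast
    define P where "P = enn2real (Pi_norm S r (mPi Md) {zk})"
    have "Pi_norm S r (mPi Md) {zk} < top" using M Bz(1) by (simp add: is_model_def)
    then have P: "Pi_norm S r (mPi Md) {zk} = ennreal P" "0 \<le> P" by (auto simp: P_def)
    have CA: "0 < C * A" using C(1) A(1) by simp
    obtain \<eta> where \<eta>: "\<eta> \<in> Br r" "\<psi> k = (\<lambda>w. (C * A * 1 ^ (CARD('d) + 2)) * rescale \<eta> 1 zk w)"
    proof (rule sized_imp_rescale[OF C(2)[OF less_imp_le[OF A(1)] A(2), of k] CA zero_less_one, of zk])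
      fix w assume "pu r 1 k w * \<phi> w \<noteq> 0"
      from piece_support[of r k w \<phi>, OF this] show "\<bar>fst w - fst zk\<bar> \<le> 1\<^sup>2 \<and> infnorm (snd w - snd zk) \<le> 1" by (auto simp: zk_def)
    qed (auto simp: \<psi>_def)
    have "\<bar>mPi Md z0 \<tau> (\<psi> k)\<bar> \<le> (C * A * P * K1) * nsum \<gamma> \<tau>" if \<tau>: "\<tau> \<in> below S \<gamma>" for \<tau>
    proof -
      let ?\<tau> = "mGam Md zk z0 \<tau>"
      have \<tau>': "?\<tau> \<in> below S \<gamma>" by (rule grp_below[OF model_grp[OF M] \<tau>])
      have d: "mPi Md zk ?\<tau> \<in> distributions r" by (rule model_dist[OF M])
      have "ennreal \<bar>mPi Md zk ?\<tau> (rescale \<eta> 1 zk)\<bar> \<le> ennreal P * ennreal (\<Sum>\<zeta>\<in>lv \<gamma>. 1 powr \<zeta> * hnorm S \<zeta> ?\<tau>)"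
        unfolding P(1)[symmetric] by (intro Pi_bound model_Pi_linear[OF M] \<eta> \<tau>') auto
      also have "\<dots> = ennreal (P * nsum \<gamma> ?\<tau>)" using P(2) by (simp add: nsum_def ennreal_mult sum_nonneg hnorm_nonneg)
      finally have "\<bar>mPi Md zk ?\<tau> (rescale \<eta> 1 zk)\<bar> \<le> P * nsum \<gamma> ?\<tau>" using P(2) nsum_nonneg by (subst (asm) ennreal_le_iff) auto
      also have "\<dots> \<le> P * (K1 * nsum \<gamma> \<tau>)" using P(2) by (intro mult_left_mono K1 \<tau>)
      finally have *: "\<bar>mPi Md zk ?\<tau> (rescale \<eta> 1 zk)\<bar> \<le> P * (K1 * nsum \<gamma> \<tau>)" .
      have "mPi Md z0 \<tau> (\<psi> k) = C * A * mPi Md zk ?\<tau> (rescale \<eta> 1 zk)"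
        unfolding model_Pi_Gam[OF M] \<eta>(2) using distribution_cmult[OF d tests_rescale[OF \<eta>(1) zero_less_one]] by (simp add: model_Pi_Gam[OF M])
      then have "\<bar>mPi Md z0 \<tau> (\<psi> k)\<bar> = C * A * \<bar>mPi Md zk ?\<tau> (rescale \<eta> 1 zk)\<bar>" using CA C(1) A(1) by (simp add: abs_mult)
      also have "\<dots> \<le> C * A * (P * (K1 * nsum \<gamma> \<tau>))" using CA by (intro mult_left_mono *) auto
      finally show ?thesis by (simp add: mult_ac)
    qed
    then show ?thesis using C(1) A(1) P(2) K1(1) by (intro exI[of _ "C * A * P * K1"]) auto
  qed
  then obtain K where K: "\<And>k. 0 \<le> K k" "\<And>k \<tau>. \<tau> \<in> below S \<gamma> \<Longrightarrow> \<bar>mPi Md z0 \<tau> (\<psi> k)\<bar> \<le> K k * nsum \<gamma> \<tau>" by metis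
  have "\<bar>mPi Md z0 \<tau> \<phi>\<bar> \<le> (\<Sum>k\<in>?I. K k) * nsum \<gamma> \<tau>" if \<tau>: "\<tau> \<in> below S \<gamma>" for \<tau>
  proof -
    have d: "mPi Md z0 \<tau> \<in> distributions r" by (rule model_dist[OF M])
    have "mPi Md z0 \<tau> \<phi> = (\<Sum>k\<in>?I. mPi Md z0 \<tau> (\<psi> k))"
      using arg_cong[OF pu_decompose[OF I], of "mPi Md z0 \<tau>"] pu_tests[OF \<phi>]
        distribution_sum[OF d, where I = ?I and f = \<psi>] by (simp add: \<psi>_def)
    also have "\<bar>\<dots>\<bar> \<le> (\<Sum>k\<in>?I. K k * nsum \<gamma> \<tau>)" by (intro order_trans[OF sum_abs] sum_mono K \<tau>)
    finally show ?thesis by (simp add: sum_distrib_right)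
  qed
  then show ?thesis using K(1) by (intro exI[of _ "\<Sum>k\<in>?I. K k"]) (auto intro: sum_nonneg)
qed

end


section \<open>Measurability of modelled distributions and of their increments\<close>

lemma measurable_approx:
  fixes M :: "'a::metric_space measure" and \<Phi> :: "'a \<Rightarrow> 'v \<Rightarrow> real"
  assumes idM: "(\<lambda>x. x) \<in> M \<rightarrow>\<^sub>M borel" and E [measurable]: "E \<in> sets M"
    and s: "\<And>n. simple_function M (s n)" "\<And>n x. s n x \<in> V" and g: "\<And>x. g x \<in> V"
    and conv: "\<And>x. x \<in> E \<Longrightarrow> C (\<lambda>n. s n x) (g x)"
    and joint: "\<And>x a v b. x \<longlonglongrightarrow> a \<Longrightarrow> C v b \<Longrightarrow> (\<And>n. v n \<in> V) \<Longrightarrow> b \<in> V \<Longrightarrow> (\<lambda>n. \<Phi> (x n) (v n)) \<longlonglongrightarrow> \<Phi> a b"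
    and const: "\<And>v. v \<in> V \<Longrightarrow> C (\<lambda>n. v) v"
  shows "(\<lambda>x. \<Phi> x (g x) * indicator E x) \<in> borel_measurable M"
proof (rule borel_measurable_LIMSEQ_real)
  \<comment> \<open>The joint sequential continuity, read along constant sequences in V, makes
    \<Phi> continuous in x.\<close>
  have m: "(\<lambda>x. \<Phi> x v) \<in> borel_measurable M" if "v \<in> V" for v
  proof -
    have "continuous_on UNIV (\<lambda>x. \<Phi> x v)"
      unfolding continuous_on_sequentially o_def using joint[OF _ const[OF that] that that] by blast
    then have "(\<lambda>x. \<Phi> x v) \<in> borel_measurable borel" by (rule borel_measurable_continuous_onI)
    from measurable_compose[OF idM this] show ?thesis .
  qed
  show "(\<lambda>x. \<Phi> x (s n x) * indicator E x) \<in> borel_measurable M" for n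
  proof -
    have fin: "finite (s n ` space M)" using s(1)[of n] by (simp add: simple_function_def)
    \<comment> \<open>A simple function takes finitely many values, so this is a countable patchwork
      of functions \<open>\<Phi> x v\<close> with fixed v; the limit in n then keeps measurability
      on E.\<close>
    have "(\<lambda>x. \<Phi> x (s n x)) \<in> borel_measurable M"
    proof (rule measurable_compose_countable'[where I="s n ` space M"])
      show "s n \<in> M \<rightarrow>\<^sub>M count_space (s n ` space M)"
        unfolding measurable_count_space_eq2[OF fin] using s(1)[of n] by (auto simp: simple_function_def)
      show "countable (s n ` space M)" using fin by (rule countable_finite)
      fix i assume "i \<in> s n ` space M"
      then have "i \<in> V" using s(2) by blast
      then show "(\<lambda>x. \<Phi> x i) \<in> borel_measurable M" by (rule m)
    qed
    then show ?thesis by measurable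
  qed
  fix x assume "x \<in> space M"
  show "(\<lambda>n. \<Phi> x (s n x) * indicator E x) \<longlonglongrightarrow> \<Phi> x (g x) * indicator E x"
  proof (cases "x \<in> E")
    case True
    then show ?thesis using joint[OF tendsto_const[of x] conv[OF True] s(2) g] by simp
  qed simp
qed

text \<open>The constant is extracted from the measurable X. The majorant Y is an expression from
  the norm of a modelled distribution, which need not be measurable, and is used by monotonicity
  only.\<close>

lemma Lp_le_scale:
  assumes p: "1 \<le> p" and [measurable]: "X \<in> borel_measurable lebesgue" "U \<in> sets lebesgue" and c: "0 < c"
    and le: "\<And>x. x \<in> U \<Longrightarrow> ennreal (1 / c) * X x \<le> Y x" and Y: "Lp p U Y \<le> D"
  shows "Lp p U X \<le> ennreal c * D"
proof -
  have "ennreal c * (ennreal (1 / c) * a) = a" for a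
    using c by (simp flip: mult.assoc ennreal_mult)
  then have "Lp p U X = Lp p U (\<lambda>x. ennreal c * (ennreal (1 / c) * X x))" by simp
  also have "\<dots> = ennreal c * Lp p U (\<lambda>x. ennreal (1 / c) * X x)" using p by (intro Lp_cmult) auto
  also have "\<dots> \<le> ennreal c * D"
    by (intro mult_left_mono order_trans[OF Lp_mono Y]) (use p le in auto)
  finally show ?thesis .
qed

lemma D_expr_terms:
  assumes "t \<in> J" "\<zeta> \<in> levels S" "0 < l" "l \<le> 2"
  shows "Lp p U (\<lambda>x. ennreal (hnorm S \<zeta> (v t x))) \<le> D_expr S \<gamma> p v sp tm J U"
    "Lp p U (\<lambda>x. \<integral>\<^sup>+y\<in>sball x l. ennreal (hnorm S \<zeta> (sp t y x) / l powr (\<gamma> - \<zeta>) * (1 / l) ^ CARD('d)) \<partial>lebesgue) \<le> D_expr S \<gamma> p v sp tm J (U :: (real ^ 'd::finite) set)"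
    "t - l\<^sup>2 \<in> J \<Longrightarrow> Lp p U (\<lambda>x. ennreal (hnorm S \<zeta> (tm t (t - l\<^sup>2) x) / l powr (\<gamma> - \<zeta>))) \<le> D_expr S \<gamma> p v sp tm J U"
  unfolding D_expr_def
  by (rule SUP_upper2[OF assms(1)], rule SUP_upper2[OF assms(2)], rule SUP_upper2[of l], use assms in simp,
      auto intro: add_increasing add_increasing2)+

context reg_structure
begin

text \<open>Sums the Bochner approximants of the finitely many levels below \<gamma>; E is the
  complement of a measurable null set off which every level converges.\<close>

lemma approx_simple:
  fixes h :: "real ^ 'd::finite \<Rightarrow> 't"
  assumes sm: "\<And>\<zeta>. \<zeta> \<in> levels S \<Longrightarrow> strongly_measurable S \<zeta> h" and h: "\<And>x. h x \<in> below S \<gamma>"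
  shows "\<exists>s E. (\<forall>n. simple_function lebesgue (s n)) \<and> (\<forall>n x. s n x \<in> below S \<gamma>) \<and> E \<in> sets lebesgue \<and>
    (AE x in lebesgue. x \<in> E) \<and> (\<forall>x\<in>E. tconv \<gamma> (\<lambda>n. s n x) (h x))"
proof -
  have "\<exists>s::nat \<Rightarrow> real ^ 'd \<Rightarrow> 't. \<zeta> \<in> lv \<gamma> \<longrightarrow>
     (\<forall>n. finite (range (s n)) \<and> range (s n) \<subseteq> part S \<zeta> \<and> (\<forall>v. s n -` {v} \<in> sets lebesgue)) \<and>
     (AE x in lebesgue. (\<lambda>n. cnorm S \<zeta> (s n x - proj S \<zeta> (h x))) \<longlonglongrightarrow> 0)" for \<zeta>
    using sm[of \<zeta>] unfolding strongly_measurable_def lv_def by blast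
  then have "\<forall>\<zeta>. \<exists>s::nat \<Rightarrow> real ^ 'd \<Rightarrow> 't. \<zeta> \<in> lv \<gamma> \<longrightarrow>
     (\<forall>n. finite (range (s n)) \<and> range (s n) \<subseteq> part S \<zeta> \<and> (\<forall>v. s n -` {v} \<in> sets lebesgue)) \<and>
     (AE x in lebesgue. (\<lambda>n. cnorm S \<zeta> (s n x - proj S \<zeta> (h x))) \<longlonglongrightarrow> 0)" by (rule allI)
  then obtain \<sigma> :: "real \<Rightarrow> nat \<Rightarrow> real ^ 'd \<Rightarrow> 't" where \<sigma>0: "\<forall>\<zeta>. \<zeta> \<in> lv \<gamma> \<longrightarrow>
     (\<forall>n. finite (range (\<sigma> \<zeta> n)) \<and> range (\<sigma> \<zeta> n) \<subseteq> part S \<zeta> \<and> (\<forall>v. \<sigma> \<zeta> n -` {v} \<in> sets lebesgue)) \<and>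
     (AE x in lebesgue. (\<lambda>n. cnorm S \<zeta> (\<sigma> \<zeta> n x - proj S \<zeta> (h x))) \<longlonglongrightarrow> 0)"
    unfolding choice_iff by (elim exE)
  have \<sigma>: "finite (range (\<sigma> \<zeta> n)) \<and> range (\<sigma> \<zeta> n) \<subseteq> part S \<zeta> \<and> (\<forall>v. \<sigma> \<zeta> n -` {v} \<in> sets lebesgue)"
     "AE x in lebesgue. (\<lambda>n. cnorm S \<zeta> (\<sigma> \<zeta> n x - proj S \<zeta> (h x))) \<longlonglongrightarrow> 0" if "\<zeta> \<in> lv \<gamma>" for \<zeta> n
    using \<sigma>0[rule_format, OF that] by simp_all
  have part: "\<sigma> \<zeta> n x \<in> part S \<zeta>" if "\<zeta> \<in> lv \<gamma>" for \<zeta> n x using \<sigma>(1)[OF that] by blast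
  define s where "s n x = (\<Sum>\<zeta>\<in>lv \<gamma>. \<sigma> \<zeta> n x)" for n x
  have "AE x in lebesgue. \<forall>\<zeta>\<in>lv \<gamma>. (\<lambda>n. cnorm S \<zeta> (\<sigma> \<zeta> n x - proj S \<zeta> (h x))) \<longlonglongrightarrow> 0"
    using \<sigma>(2) finite_lv by (intro AE_finite_allI) auto
  then obtain N where N: "N \<in> null_sets lebesgue" "{x \<in> space lebesgue. \<not> (\<forall>\<zeta>\<in>lv \<gamma>. (\<lambda>n. cnorm S \<zeta> (\<sigma> \<zeta> n x - proj S \<zeta> (h x))) \<longlonglongrightarrow> 0)} \<subseteq> N"
    unfolding eventually_ae_filter by blast
  have "simple_function lebesgue (s n)" for n
    unfolding s_def using \<sigma>(1) by (intro simple_function_sum) (auto simp: simple_function_def)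
  moreover have "s n x \<in> below S \<gamma>" for n x
    unfolding s_def
  proof (rule subspace_sum[OF subspace_below])
    fix \<zeta> assume z: "\<zeta> \<in> lv \<gamma>"
    show "\<sigma> \<zeta> n x \<in> below S \<gamma>" using proj_of_part[OF part[OF z]] z by (auto simp: below_iff lv_def)
  qed
  moreover have "- N \<in> sets lebesgue" using sets.compl_sets[OF null_setsD2[OF N(1)]] by (simp add: Compl_eq_Diff_UNIV)
  moreover have "AE x in lebesgue. x \<in> - N" using AE_not_in[OF N(1)] by simp
  moreover have "tconv \<gamma> (\<lambda>n. s n x) (h x)" if "x \<in> - N" for x
  proof -
    have c: "(\<lambda>n. cnorm S \<zeta> (\<sigma> \<zeta> n x - proj S \<zeta> (h x))) \<longlonglongrightarrow> 0" if "\<zeta> \<in> lv \<gamma>" for \<zeta>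
      using N(2) \<open>x \<in> - N\<close> that by auto
    have "nsum \<gamma> (s n x - h x) = (\<Sum>\<zeta>\<in>lv \<gamma>. cnorm S \<zeta> (\<sigma> \<zeta> n x - proj S \<zeta> (h x)))" for n
      unfolding nsum_def
    proof (intro sum.cong refl)
      fix \<beta> assume b: "\<beta> \<in> lv \<gamma>"
      have "proj S \<beta> (s n x) = (\<Sum>\<zeta>\<in>lv \<gamma>. if \<beta> = \<zeta> then \<sigma> \<zeta> n x else 0)"
        unfolding s_def proj_sum by (intro sum.cong refl proj_of_part part)
      also have "\<dots> = \<sigma> \<beta> n x" using b finite_lv by simp
      finally show "hnorm S \<beta> (s n x - h x) = cnorm S \<beta> (\<sigma> \<beta> n x - proj S \<beta> (h x))" by (simp add: hnorm_def proj_diff)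
    qed
    then show ?thesis unfolding tconv_def using tendsto_null_sum[OF c] by simp
  qed
  ultimately show ?thesis by blast
qed

text \<open>One statement for all increments in use: the joint increment of two modelled
  distributions in space or time is of this form, and the increment or the value of a single one
  results when some of the four functions are 0.\<close>

lemma quad_measurable:
  fixes M :: "'a::metric_space measure" and Md Md' :: "('d::finite, 't) model" and P Q :: "'a \<Rightarrow> 'd pt"
  assumes M: "is_model S r Md" "is_model S r Md'" and idM: "(\<lambda>x. x) \<in> M \<rightarrow>\<^sub>M borel" and E: "E \<in> sets M"
    and PQ: "continuous_on UNIV P" "continuous_on UNIV Q" and \<zeta>: "\<zeta> \<in> lv \<gamma>"
    and s: "\<And>n. simple_function M (s1 n)" "\<And>n. simple_function M (s2 n)" "\<And>n. simple_function M (s3 n)" "\<And>n. simple_function M (s4 n)"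
    and sb: "\<And>n x. s1 n x \<in> below S \<gamma>" "\<And>n x. s2 n x \<in> below S \<gamma>" "\<And>n x. s3 n x \<in> below S \<gamma>" "\<And>n x. s4 n x \<in> below S \<gamma>"
    and hb: "\<And>x. h1 x \<in> below S \<gamma>" "\<And>x. h2 x \<in> below S \<gamma>" "\<And>x. h3 x \<in> below S \<gamma>" "\<And>x. h4 x \<in> below S \<gamma>"
    and conv: "\<And>x. x \<in> E \<Longrightarrow> tconv \<gamma> (\<lambda>n. s1 n x) (h1 x)" "\<And>x. x \<in> E \<Longrightarrow> tconv \<gamma> (\<lambda>n. s2 n x) (h2 x)"
      "\<And>x. x \<in> E \<Longrightarrow> tconv \<gamma> (\<lambda>n. s3 n x) (h3 x)" "\<And>x. x \<in> E \<Longrightarrow> tconv \<gamma> (\<lambda>n. s4 n x) (h4 x)"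
  shows "(\<lambda>x. hnorm S \<zeta> (h1 x - h2 x - mGam Md (P x) (Q x) (h3 x) + mGam Md' (P x) (Q x) (h4 x)) * indicator E x) \<in> borel_measurable M"
proof -
  let ?V = "below S \<gamma> \<times> below S \<gamma> \<times> below S \<gamma> \<times> below S \<gamma>"
  define C where "C v a \<longleftrightarrow> tconv \<gamma> (\<lambda>n. fst (v n)) (fst a) \<and> tconv \<gamma> (\<lambda>n. fst (snd (v n))) (fst (snd a)) \<and>
    tconv \<gamma> (\<lambda>n. fst (snd (snd (v n)))) (fst (snd (snd a))) \<and> tconv \<gamma> (\<lambda>n. snd (snd (snd (v n)))) (snd (snd (snd a)))"
    for v :: "nat \<Rightarrow> 't \<times> 't \<times> 't \<times> 't" and a
  define \<Phi> where "\<Phi> x v = hnorm S \<zeta> (fst v - fst (snd v) - mGam Md (P x) (Q x) (fst (snd (snd v))) + mGam Md' (P x) (Q x) (snd (snd (snd v))))" for x v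
  have "(\<lambda>x. \<Phi> x (h1 x, h2 x, h3 x, h4 x) * indicator E x) \<in> borel_measurable M"
  proof (rule measurable_approx[OF idM E, where V = ?V and C = C and s = "\<lambda>n x. (s1 n x, s2 n x, s3 n x, s4 n x)"])
    fix x :: "nat \<Rightarrow> 'a" and a and v :: "nat \<Rightarrow> 't \<times> 't \<times> 't \<times> 't" and b assume x: "x \<longlonglongrightarrow> a" and v: "C v b" "\<And>n. v n \<in> ?V" "b \<in> ?V"
    have Px: "(\<lambda>n. P (x n)) \<longlonglongrightarrow> P a" "(\<lambda>n. Q (x n)) \<longlonglongrightarrow> Q a"
      using PQ x unfolding continuous_on_sequentially by (auto simp: o_def)
    have vb: "fst (snd (snd (v n))) \<in> below S \<gamma>" "snd (snd (snd (v n))) \<in> below S \<gamma>" for n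
      using v(2)[of n] by auto
    have bb: "fst (snd (snd b)) \<in> below S \<gamma>" "snd (snd (snd b)) \<in> below S \<gamma>" using v(3) by auto
    show "(\<lambda>n. \<Phi> (x n) (v n)) \<longlonglongrightarrow> \<Phi> a b"
      unfolding \<Phi>_def using v(1) unfolding C_def
      by (intro tconv_hnorm[OF _ \<zeta>] tconv_add tconv_diff tconv_Gam[OF M(1) Px] tconv_Gam[OF M(2) Px] vb bb) auto
  qed (use s sb hb conv in \<open>auto simp: C_def tconv_const\<close>)
  then show ?thesis by (simp add: \<Phi>_def)
qed

text \<open>With D1 the joint increment and D2 that of f' alone,
  \<open>D1 = (f z - mGam Md z z' (f z')) - D2\<close>. The germ increment equals \<Pi> applied to
  D1 plus the difference of the two \<Pi> applied to D2. Each distribution is transported by its own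
  \<Gamma>, so the discrepancy of the two \<Gamma> is already contained in D1.\<close>

lemma germ_increment:
  fixes Md Md' :: "('d::finite, 't) model"
  assumes M: "is_model S r Md" "is_model S r Md'" and f: "\<And>z. f z \<in> below S \<gamma>" "\<And>z. f' z \<in> below S \<gamma>"
    and z: "z \<in> B" and \<eta>: "\<eta> \<in> Br r" and l: "0 < l" "l \<le> 1"
  shows "ennreal \<bar>(mPi Md z (f z) (rescale \<eta> l z) - mPi Md' z (f' z) (rescale \<eta> l z)) - (mPi Md z' (f z') (rescale \<eta> l z) - mPi Md' z' (f' z') (rescale \<eta> l z))\<bar>
    \<le> Pi_norm S r (mPi Md) B * ennreal (\<Sum>\<zeta>\<in>lv \<gamma>. l powr \<zeta> * hnorm S \<zeta> (f z - f' z - mGam Md z z' (f z') + mGam Md' z z' (f' z'))) +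
      Pi_norm S r (\<lambda>z \<tau> \<phi>. mPi Md z \<tau> \<phi> - mPi Md' z \<tau> \<phi>) B * ennreal (\<Sum>\<zeta>\<in>lv \<gamma>. l powr \<zeta> * hnorm S \<zeta> (f' z - mGam Md' z z' (f' z')))"
proof -
  let ?\<phi> = "rescale \<eta> l z"
  define D1 where "D1 = f z - f' z - mGam Md z z' (f z') + mGam Md' z z' (f' z')"
  define D2 where "D2 = f' z - mGam Md' z z' (f' z')"
  have g: "mGam Md z z' (f z') \<in> below S \<gamma>" "mGam Md' z z' (f' z') \<in> below S \<gamma>"
    by (rule grp_below[OF model_grp[OF M(1)] f(1)], rule grp_below[OF model_grp[OF M(2)] f(2)])
  have b: "D1 \<in> below S \<gamma>" "D2 \<in> below S \<gamma>"
    unfolding D1_def D2_def by (intro subspace_add[OF subspace_below] subspace_diff[OF subspace_below] f g)+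
  note L = model_Pi_linear[OF M(1), of z ?\<phi>] and L' = model_Pi_linear[OF M(2), of z ?\<phi>]
  have lin: "linear (\<lambda>\<tau>. mPi Md z \<tau> \<phi> - mPi Md' z \<tau> \<phi>)" for z \<phi>
    by (intro linear_compose_sub model_Pi_linear[OF M(1)] model_Pi_linear[OF M(2)])
  have "D1 = (f z - mGam Md z z' (f z')) - D2" by (simp add: D1_def D2_def)
  then have "mPi Md z D1 ?\<phi> = mPi Md z (f z) ?\<phi> - mPi Md z (mGam Md z z' (f z')) ?\<phi> - mPi Md z D2 ?\<phi>"
    by (simp only: linear_diff[OF L])
  moreover have "mPi Md' z D2 ?\<phi> = mPi Md' z (f' z) ?\<phi> - mPi Md' z (mGam Md' z z' (f' z')) ?\<phi>"
    by (simp only: D2_def linear_diff[OF L'])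
  ultimately have "(mPi Md z (f z) ?\<phi> - mPi Md' z (f' z) ?\<phi>) - (mPi Md z' (f z') ?\<phi> - mPi Md' z' (f' z') ?\<phi>) =
    mPi Md z D1 ?\<phi> + (mPi Md z D2 ?\<phi> - mPi Md' z D2 ?\<phi>)"
    by (simp add: model_Pi_Gam[OF M(1)] model_Pi_Gam[OF M(2)])
  then have "ennreal \<bar>(mPi Md z (f z) ?\<phi> - mPi Md' z (f' z) ?\<phi>) - (mPi Md z' (f z') ?\<phi> - mPi Md' z' (f' z') ?\<phi>)\<bar>
    \<le> ennreal (\<bar>mPi Md z D1 ?\<phi>\<bar> + \<bar>mPi Md z D2 ?\<phi> - mPi Md' z D2 ?\<phi>\<bar>)"
    by (simp only: ennreal_leI abs_triangle_ineq)
  also have "\<dots> = ennreal \<bar>mPi Md z D1 ?\<phi>\<bar> + ennreal \<bar>mPi Md z D2 ?\<phi> - mPi Md' z D2 ?\<phi>\<bar>" by simp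
  also have "\<dots> \<le> Pi_norm S r (mPi Md) B * ennreal (\<Sum>\<zeta>\<in>lv \<gamma>. l powr \<zeta> * hnorm S \<zeta> D1) +
      Pi_norm S r (\<lambda>z \<tau> \<phi>. mPi Md z \<tau> \<phi> - mPi Md' z \<tau> \<phi>) B * ennreal (\<Sum>\<zeta>\<in>lv \<gamma>. l powr \<zeta> * hnorm S \<zeta> D2)"
    by (intro add_mono Pi_bound[OF model_Pi_linear[OF M(1)] z \<eta> l b(1)]
        Pi_bound[where F="\<lambda>z \<tau> \<phi>. mPi Md z \<tau> \<phi> - mPi Md' z \<tau> \<phi>", OF lin z \<eta> l b(2)])
  finally show ?thesis unfolding D1_def D2_def .
qed

lemma D_spaceD:
  assumes "f \<in> D_space S \<gamma> p Md"
  shows "f z \<in> below S \<gamma>" "\<zeta> \<in> levels S \<Longrightarrow> strongly_measurable S \<zeta> (\<lambda>x. f (t, x))" "D_norm S \<gamma> p Md UNIV UNIV f < top"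
  using assms unfolding D_space_def by blast+

text \<open>Off a null set of space points the increments of modelled distributions are measurable; on the null
  set the majorants are infinite.\<close>

lemma approximants:
  fixes f :: "'d::finite pt \<Rightarrow> 't"
  assumes "f \<in> D_space S \<gamma> p Md"
  shows "\<exists>s E. \<forall>t. (\<forall>n. simple_function lebesgue (s t n)) \<and> (\<forall>n x. s t n x \<in> below S \<gamma>) \<and> E t \<in> sets lebesgue \<and>
    (AE x in lebesgue. x \<in> E t) \<and> (\<forall>x\<in>E t. tconv \<gamma> (\<lambda>n. s t n x) (f (t, x)))"
proof -
  have "\<forall>t. \<exists>s E. (\<forall>n. simple_function lebesgue (s n)) \<and> (\<forall>n x. s n x \<in> below S \<gamma>) \<and> E \<in> sets lebesgue \<and>
    (AE x in lebesgue. x \<in> E) \<and> (\<forall>x\<in>E. tconv \<gamma> (\<lambda>n. s n x) (f (t, x)))"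
    using D_spaceD[OF assms] by (intro allI approx_simple) auto
  then show ?thesis by (simp only: choice_iff)
qed

text \<open>At each time, E is the set of full measure on which the simple approximants of both
  distributions converge. Space increments involve two points, hence the product of E with itself;
  time increments involve two times, hence an intersection.\<close>

lemma increments_measurable:
  fixes Md Md' :: "('d::finite, 't) model"
  assumes M: "is_model S r Md" "is_model S r Md'" and f: "f \<in> D_space S \<gamma> p Md" and f': "f' \<in> D_space S \<gamma> p Md'"
  shows "\<exists>E. (\<forall>t. E t \<in> sets lebesgue \<and> (AE x in lebesgue. x \<in> E t)) \<and>
    (\<forall>\<zeta>\<in>lv \<gamma>. \<forall>t.
      (\<lambda>z. hnorm S \<zeta> (f (t, snd z) - f' (t, snd z) - mGam Md (t, snd z) (t, fst z) (f (t, fst z)) + mGam Md' (t, snd z) (t, fst z) (f' (t, fst z))) * indicator (E t \<times> E t) z) \<in> borel_measurable (lebesgue \<Otimes>\<^sub>M lebesgue) \<and>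
      (\<lambda>z. hnorm S \<zeta> (f' (t, snd z) - mGam Md' (t, snd z) (t, fst z) (f' (t, fst z))) * indicator (E t \<times> E t) z) \<in> borel_measurable (lebesgue \<Otimes>\<^sub>M lebesgue) \<and>
      (\<lambda>x. hnorm S \<zeta> (f (t, x)) * indicator (E t) x) \<in> borel_measurable lebesgue \<and>
      (\<forall>t'. (\<lambda>x. hnorm S \<zeta> (f (t, x) - f' (t, x) - mGam Md (t, x) (t', x) (f (t', x)) + mGam Md' (t, x) (t', x) (f' (t', x))) * indicator (E t \<inter> E t') x) \<in> borel_measurable lebesgue \<and>
         (\<lambda>x. hnorm S \<zeta> (f' (t, x) - mGam Md' (t, x) (t', x) (f' (t', x))) * indicator (E t \<inter> E t') x) \<in> borel_measurable lebesgue))"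
proof -
  obtain s E1 where s: "\<And>t n. simple_function lebesgue (s t n)" "\<And>t n x. s t n x \<in> below S \<gamma>" and E1: "\<And>t. E1 t \<in> sets lebesgue" "\<And>t. AE x in lebesgue. x \<in> E1 t"
    and sc: "\<And>t x. x \<in> E1 t \<Longrightarrow> tconv \<gamma> (\<lambda>n. s t n x) (f (t, x))"
    using approximants[OF f] by blast
  obtain s' E2 where s': "\<And>t n. simple_function lebesgue (s' t n)" "\<And>t n x. s' t n x \<in> below S \<gamma>" and E2: "\<And>t. E2 t \<in> sets lebesgue" "\<And>t. AE x in lebesgue. x \<in> E2 t"
    and sc': "\<And>t x. x \<in> E2 t \<Longrightarrow> tconv \<gamma> (\<lambda>n. s' t n x) (f' (t, x))"
    using approximants[OF f'] by blast
  define E where "E t = E1 t \<inter> E2 t" for t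
  have E: "E t \<in> sets lebesgue" "AE x in lebesgue. x \<in> E t" for t
    using E1 E2 by (auto simp: E_def)
  have id2: "(\<lambda>z. z) \<in> (lebesgue :: (real^'d) measure) \<Otimes>\<^sub>M (lebesgue :: (real^'d) measure) \<rightarrow>\<^sub>M borel"
    by (rule measurable_lebesgue_pair_borel)
  have id1: "(\<lambda>z::real^'d. z) \<in> lebesgue \<rightarrow>\<^sub>M borel" by (simp add: measurable_def)
  have EE: "E t \<times> E t \<in> sets (lebesgue \<Otimes>\<^sub>M lebesgue)" for t using E by auto
  have E': "E t \<inter> E t' \<in> sets lebesgue" for t t' using E by auto
  have f0: "\<And>z. f z \<in> below S \<gamma>" "\<And>z. f' z \<in> below S \<gamma>" using D_spaceD(1) f f' by blast+
  have z0: "(0::'t) \<in> below S \<gamma>" by (rule subspace_0[OF subspace_below])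
  have g0: "mGam Md z z' 0 = 0" "mGam Md' z z' 0 = 0" for z z'
    using linear_0[OF grp_linear[OF model_grp[OF M(1)]]] linear_0[OF grp_linear[OF model_grp[OF M(2)]]] by auto
  have sp: "simple_function (lebesgue \<Otimes>\<^sub>M lebesgue) (\<lambda>z. u (fst z))" "simple_function (lebesgue \<Otimes>\<^sub>M lebesgue) (\<lambda>z. u (snd z))"
    if "simple_function lebesgue u" for u :: "real^'d \<Rightarrow> 't"
    using simple_function_comp[OF measurable_fst that] simple_function_comp[OF measurable_snd that] by auto
  \<comment> \<open>With f replaced by 0, the joint increment is, up to the sign, the increment of
    f' alone.\<close>
  have neg: "hnorm S \<zeta> (0 - a - 0 + b) = hnorm S \<zeta> (a - b)" for \<zeta> a b
    using hnorm_minus[of \<zeta> "a - b"] by simp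
  have c: "continuous_on UNIV (\<lambda>z::(real^'d) \<times> (real^'d). (t, snd z))" "continuous_on UNIV (\<lambda>z::(real^'d) \<times> (real^'d). (t, fst z))"
    "continuous_on UNIV (\<lambda>x::real^'d. (t, x))" for t :: real
    by (intro continuous_intros)+
  show ?thesis
  proof (intro exI[of _ E] conjI allI ballI E)
    fix \<zeta> t assume \<zeta>: "\<zeta> \<in> lv \<gamma>"
    show "(\<lambda>z. hnorm S \<zeta> (f (t, snd z) - f' (t, snd z) - mGam Md (t, snd z) (t, fst z) (f (t, fst z)) + mGam Md' (t, snd z) (t, fst z) (f' (t, fst z))) * indicator (E t \<times> E t) z) \<in> borel_measurable (lebesgue \<Otimes>\<^sub>M lebesgue)"
      by (rule quad_measurable[OF M id2 EE c(1,2) \<zeta> sp(2)[OF s(1)[of t]] sp(2)[OF s'(1)[of t]] sp(1)[OF s(1)[of t]] sp(1)[OF s'(1)[of t]]])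
        (auto simp: E_def intro: s(2) s'(2) f0 sc sc')
    have "(\<lambda>z. hnorm S \<zeta> (0 - f' (t, snd z) - mGam Md (t, snd z) (t, fst z) 0 + mGam Md' (t, snd z) (t, fst z) (f' (t, fst z))) * indicator (E t \<times> E t) z) \<in> borel_measurable (lebesgue \<Otimes>\<^sub>M lebesgue)"
      by (rule quad_measurable[OF M id2 EE c(1,2) \<zeta> simple_function_const[of _ 0] sp(2)[OF s'(1)[of t]] simple_function_const[of _ 0] sp(1)[OF s'(1)[of t]]])
        (auto simp: E_def intro: s'(2) f0 sc' z0 tconv_const)
    then show "(\<lambda>z. hnorm S \<zeta> (f' (t, snd z) - mGam Md' (t, snd z) (t, fst z) (f' (t, fst z))) * indicator (E t \<times> E t) z) \<in> borel_measurable (lebesgue \<Otimes>\<^sub>M lebesgue)"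
      unfolding g0 neg .
    have "(\<lambda>x. hnorm S \<zeta> (f (t, x) - 0 - mGam Md (t, x) (t, x) 0 + mGam Md' (t, x) (t, x) 0) * indicator (E t) x) \<in> borel_measurable lebesgue"
      by (rule quad_measurable[OF M id1 E(1) c(3,3) \<zeta> s(1)[of t] simple_function_const[of _ 0] simple_function_const[of _ 0] simple_function_const[of _ 0]])
        (auto simp: E_def intro: s(2) f0 sc z0 tconv_const)
    then show "(\<lambda>x. hnorm S \<zeta> (f (t, x)) * indicator (E t) x) \<in> borel_measurable lebesgue"
      unfolding g0 by simp
    fix t'
    show "(\<lambda>x. hnorm S \<zeta> (f (t, x) - f' (t, x) - mGam Md (t, x) (t', x) (f (t', x)) + mGam Md' (t, x) (t', x) (f' (t', x))) * indicator (E t \<inter> E t') x) \<in> borel_measurable lebesgue"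
      by (rule quad_measurable[OF M id1 E' c(3,3) \<zeta> s(1)[of t] s'(1)[of t] s(1)[of t'] s'(1)[of t']])
        (auto simp: E_def intro: s(2) s'(2) f0 sc sc')
    have "(\<lambda>x. hnorm S \<zeta> (0 - f' (t, x) - mGam Md (t, x) (t', x) 0 + mGam Md' (t, x) (t', x) (f' (t', x))) * indicator (E t \<inter> E t') x) \<in> borel_measurable lebesgue"
      by (rule quad_measurable[OF M id1 E' c(3,3) \<zeta> simple_function_const[of _ 0] s'(1)[of t] simple_function_const[of _ 0] s'(1)[of t']])
        (auto simp: E_def intro: s'(2) f0 sc' z0 tconv_const)
    then show "(\<lambda>x. hnorm S \<zeta> (f' (t, x) - mGam Md' (t, x) (t', x) (f' (t', x))) * indicator (E t \<inter> E t') x) \<in> borel_measurable lebesgue"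
      unfolding g0 neg .
  qed
qed

text \<open>P1 and P2 are possibly infinite norms of models, so they stay extended reals throughout.
  The weights \<open>a \<zeta>\<close> and the increment bounds \<open>c \<zeta>\<close> are powers
  of the scale whose product is the same for all levels up to the constant k.\<close>

lemma Lp_levels_sum:
  fixes X1 X2 :: "real \<Rightarrow> real ^ 'd::finite \<Rightarrow> ennreal"
  assumes p: "1 \<le> p" and m: "\<And>\<zeta>. \<zeta> \<in> lv \<gamma> \<Longrightarrow> X1 \<zeta> \<in> borel_measurable lebesgue" "\<And>\<zeta>. \<zeta> \<in> lv \<gamma> \<Longrightarrow> X2 \<zeta> \<in> borel_measurable lebesgue"
    and U [measurable]: "U \<in> sets lebesgue"
    and le: "\<And>\<zeta>. \<zeta> \<in> lv \<gamma> \<Longrightarrow> Lp p U (X1 \<zeta>) \<le> ennreal (c \<zeta>) * D1" "\<And>\<zeta>. \<zeta> \<in> lv \<gamma> \<Longrightarrow> Lp p U (X2 \<zeta>) \<le> ennreal (c \<zeta>) * D2"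
    and a: "\<And>\<zeta>. \<zeta> \<in> lv \<gamma> \<Longrightarrow> 0 \<le> a \<zeta>" and c: "\<And>\<zeta>. \<zeta> \<in> lv \<gamma> \<Longrightarrow> 0 \<le> c \<zeta>" "\<And>\<zeta>. \<zeta> \<in> lv \<gamma> \<Longrightarrow> a \<zeta> * c \<zeta> \<le> k"
  shows "Lp p U (\<lambda>x. P1 * (\<Sum>\<zeta>\<in>lv \<gamma>. ennreal (a \<zeta>) * X1 \<zeta> x) + P2 * (\<Sum>\<zeta>\<in>lv \<gamma>. ennreal (a \<zeta>) * X2 \<zeta> x)) \<le> ennreal (real (card (lv \<gamma>)) * k) * (P1 * D1 + P2 * D2)"
proof -
  have p0: "0 < p" using p by simp
  have ms: "(\<lambda>x. \<Sum>\<zeta>\<in>lv \<gamma>. ennreal (a \<zeta>) * X1 \<zeta> x) \<in> borel_measurable lebesgue" "(\<lambda>x. \<Sum>\<zeta>\<in>lv \<gamma>. ennreal (a \<zeta>) * X2 \<zeta> x) \<in> borel_measurable lebesgue"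
    using m by (intro borel_measurable_sum borel_measurable_times; simp)+
  have one: "Lp p U (\<lambda>x. P * (\<Sum>\<zeta>\<in>lv \<gamma>. ennreal (a \<zeta>) * X \<zeta> x)) \<le> ennreal (real (card (lv \<gamma>)) * k) * (P * D)"
    if mX: "\<And>\<zeta>. \<zeta> \<in> lv \<gamma> \<Longrightarrow> X \<zeta> \<in> borel_measurable lebesgue" and leX: "\<And>\<zeta>. \<zeta> \<in> lv \<gamma> \<Longrightarrow> Lp p U (X \<zeta>) \<le> ennreal (c \<zeta>) * D" for X D P
  proof -
    have "Lp p U (\<lambda>x. P * (\<Sum>\<zeta>\<in>lv \<gamma>. ennreal (a \<zeta>) * X \<zeta> x)) = P * Lp p U (\<lambda>x. \<Sum>\<zeta>\<in>lv \<gamma>. ennreal (a \<zeta>) * X \<zeta> x)"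
      using mX by (intro Lp_cmult p0 U borel_measurable_sum borel_measurable_times) auto
    also have "\<dots> \<le> P * (\<Sum>\<zeta>\<in>lv \<gamma>. Lp p U (\<lambda>x. ennreal (a \<zeta>) * X \<zeta> x))"
      using mX by (intro mult_left_mono Lp_sum p finite_lv U borel_measurable_times) auto
    also have "\<dots> \<le> P * (\<Sum>\<zeta>\<in>lv \<gamma>. ennreal k * D)"
    proof (intro mult_left_mono sum_mono)
      fix \<zeta> assume z: "\<zeta> \<in> lv \<gamma>"
      have "Lp p U (\<lambda>x. ennreal (a \<zeta>) * X \<zeta> x) = ennreal (a \<zeta>) * Lp p U (X \<zeta>)" by (intro Lp_cmult p0 mX z U)
      also have "\<dots> \<le> ennreal (a \<zeta>) * (ennreal (c \<zeta>) * D)" by (intro mult_left_mono leX z) simp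
      also have "\<dots> = ennreal (a \<zeta> * c \<zeta>) * D" using a[OF z] c(1)[OF z] by (simp add: ennreal_mult mult.assoc)
      also have "\<dots> \<le> ennreal k * D" by (intro mult_right_mono ennreal_leI c(2) z) simp
      finally show "Lp p U (\<lambda>x. ennreal (a \<zeta>) * X \<zeta> x) \<le> ennreal k * D" .
    qed simp
    also have "(\<Sum>\<zeta>\<in>lv \<gamma>. ennreal k * D) = ennreal (real (card (lv \<gamma>)) * k) * D"
      by (simp add: ennreal_mult' ennreal_of_nat_eq_real_of_nat mult.assoc)
    finally show ?thesis by (simp add: mult.left_commute)
  qed
  have "Lp p U (\<lambda>x. P1 * (\<Sum>\<zeta>\<in>lv \<gamma>. ennreal (a \<zeta>) * X1 \<zeta> x) + P2 * (\<Sum>\<zeta>\<in>lv \<gamma>. ennreal (a \<zeta>) * X2 \<zeta> x)) \<le>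
    Lp p U (\<lambda>x. P1 * (\<Sum>\<zeta>\<in>lv \<gamma>. ennreal (a \<zeta>) * X1 \<zeta> x)) + Lp p U (\<lambda>x. P2 * (\<Sum>\<zeta>\<in>lv \<gamma>. ennreal (a \<zeta>) * X2 \<zeta> x))"
    using ms by (intro Lp_add p U borel_measurable_times) auto
  also have "\<dots> \<le> ennreal (real (card (lv \<gamma>)) * k) * (P1 * D1) + ennreal (real (card (lv \<gamma>)) * k) * (P2 * D2)"
    by (intro add_mono one m le)
  finally show ?thesis by (simp add: distrib_left)
qed

end


section \<open>Coherence of the germs of modelled distributions\<close>

lemma D_expr_space_increment:
  fixes h :: "(real ^ 'd::finite) \<times> (real ^ 'd) \<Rightarrow> real"
  assumes p: "1 \<le> p" and h: "h \<in> borel_measurable (lebesgue \<Otimes>\<^sub>M lebesgue)" and U: "U \<in> sets lebesgue"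
    and le: "\<And>y w. h (y, w) \<le> hnorm S \<zeta> (sp s w y)" and s: "s \<in> J" "\<zeta> \<in> levels S" and l: "0 < l" "l \<le> 2"
  shows "Lp p U (\<lambda>y. \<integral>\<^sup>+w\<in>sball y l. ennreal (h (y, w)) \<partial>lebesgue) \<le> ennreal (l powr (\<gamma> - \<zeta>) * l ^ CARD('d)) * D_expr S \<gamma> p v sp tm J U"
proof (rule Lp_le_scale[OF p _ U _ _ D_expr_terms(2)[OF s l]])
  have "(\<lambda>(y, w). ennreal (h (y, w))) \<in> borel_measurable (lebesgue \<Otimes>\<^sub>M lebesgue)" using h by simp
  then show "(\<lambda>y. \<integral>\<^sup>+w\<in>sball y l. ennreal (h (y, w)) \<partial>lebesgue) \<in> borel_measurable lebesgue"
    by (rule measurable_sball_integral)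
  show c: "0 < l powr (\<gamma> - \<zeta>) * l ^ CARD('d)" using l by simp
  fix y
  have [measurable]: "(\<lambda>w. h (y, w)) \<in> borel_measurable lebesgue" using measurable_Pair2[OF h, of y] by simp
  have "ennreal (1 / (l powr (\<gamma> - \<zeta>) * l ^ CARD('d))) * (\<integral>\<^sup>+w\<in>sball y l. ennreal (h (y, w)) \<partial>lebesgue) =
    (\<integral>\<^sup>+w. ennreal (1 / (l powr (\<gamma> - \<zeta>) * l ^ CARD('d))) * (ennreal (h (y, w)) * indicator (sball y l) w) \<partial>lebesgue)"
    by (rule nn_integral_cmult[symmetric]) simp
  also have "\<dots> \<le> (\<integral>\<^sup>+w\<in>sball y l. ennreal (hnorm S \<zeta> (sp s w y) / l powr (\<gamma> - \<zeta>) * (1 / l) ^ CARD('d)) \<partial>lebesgue)"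
  proof (rule nn_integral_mono)
    fix w
    have "1 / (l powr (\<gamma> - \<zeta>) * l ^ CARD('d)) * h (y, w) \<le> 1 / (l powr (\<gamma> - \<zeta>) * l ^ CARD('d)) * hnorm S \<zeta> (sp s w y)"
      using c le by (intro mult_left_mono) auto
    also have "\<dots> = hnorm S \<zeta> (sp s w y) / l powr (\<gamma> - \<zeta>) * (1 / l) ^ CARD('d)" by (simp add: power_one_over power_inverse divide_inverse mult_ac)
    finally have "ennreal (1 / (l powr (\<gamma> - \<zeta>) * l ^ CARD('d))) * ennreal (h (y, w)) \<le> ennreal (hnorm S \<zeta> (sp s w y) / l powr (\<gamma> - \<zeta>) * (1 / l) ^ CARD('d))"
      using c by (subst ennreal_mult'[symmetric]) (auto intro: ennreal_leI)
    then show "ennreal (1 / (l powr (\<gamma> - \<zeta>) * l ^ CARD('d))) * (ennreal (h (y, w)) * indicator (sball y l) w) \<le>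
      ennreal (hnorm S \<zeta> (sp s w y) / l powr (\<gamma> - \<zeta>) * (1 / l) ^ CARD('d)) * indicator (sball y l) w"
      by (simp add: indicator_def)
  qed
  finally show "ennreal (1 / (l powr (\<gamma> - \<zeta>) * l ^ CARD('d))) * (\<integral>\<^sup>+w\<in>sball y l. ennreal (h (y, w)) \<partial>lebesgue) \<le>
    (\<integral>\<^sup>+w\<in>sball y l. ennreal (hnorm S \<zeta> (sp s w y) / l powr (\<gamma> - \<zeta>) * (1 / l) ^ CARD('d)) \<partial>lebesgue)" .
qed

lemma D_expr_time_increment:
  fixes g :: "real ^ 'd::finite \<Rightarrow> real"
  assumes p: "1 \<le> p" and g: "g \<in> borel_measurable lebesgue" and U: "U \<in> sets lebesgue"
    and le: "\<And>x. g x \<le> hnorm S \<zeta> (tm b a x)" and s: "b \<in> J" "\<zeta> \<in> levels S" and l: "0 < l" "l \<le> 2" "a \<in> J" "a = b - l\<^sup>2"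
  shows "Lp p U (\<lambda>x. ennreal (g x)) \<le> ennreal (l powr (\<gamma> - \<zeta>)) * D_expr S \<gamma> p v sp tm J U"
proof (rule Lp_le_scale[OF p _ U _ _ D_expr_terms(3)[OF s l(1,2) l(3)[unfolded l(4)]]])
  show "(\<lambda>x. ennreal (g x)) \<in> borel_measurable lebesgue" using g by simp
  show c: "0 < l powr (\<gamma> - \<zeta>)" using l by simp
  fix x
  have "1 / l powr (\<gamma> - \<zeta>) * g x \<le> hnorm S \<zeta> (tm b (b - l\<^sup>2) x) / l powr (\<gamma> - \<zeta>)"
    using c le[of x] by (simp add: l(4) divide_right_mono)
  then show "ennreal (1 / l powr (\<gamma> - \<zeta>)) * ennreal (g x) \<le> ennreal (hnorm S \<zeta> (tm b (b - l\<^sup>2) x) / l powr (\<gamma> - \<zeta>))"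
    using c by (subst ennreal_mult'[symmetric]) (auto intro: ennreal_leI)
qed

context reg_structure
begin

text \<open>On the level \<zeta>, \<Pi> contributes \<open>\<mu> powr \<zeta>\<close> and an
  increment at distance up to \<open>2 * \<mu>\<close> contributes
  \<open>(2 * \<mu>) powr (\<gamma> - \<zeta>)\<close>; the product is at most
  \<open>2 powr (\<gamma> - \<alpha>) * \<mu> powr \<gamma>\<close>. Balls of radius
  \<open>2 * \<mu>\<close> are admissible because the norm of a modelled distribution runs over
  distances up to 2.\<close>

lemma coherent_models:
  fixes Md Md' :: "('d::finite, 't) model"
  assumes M: "is_model S r Md" "is_model S r Md'" and f: "f \<in> D_space S \<gamma> p Md" and f': "f' \<in> D_space S \<gamma> p Md'"
    and p: "1 \<le> p" and U [measurable]: "U \<in> sets lebesgue" and \<alpha>: "\<And>\<zeta>. \<zeta> \<in> levels S \<Longrightarrow> \<alpha> \<le> \<zeta>"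
  shows "coherent r \<gamma> p (\<lambda>z \<phi>. mPi Md z (f z) \<phi> - mPi Md' z (f' z) \<phi>) J U
    (ennreal (real (card (lv \<gamma>)) * (2 powr (\<gamma> - \<alpha>) * 2 ^ CARD('d))) *
      (Pi_norm S r (mPi Md) (J \<times> U) * D_dist S \<gamma> p Md Md' J U f f' +
       Pi_norm S r (\<lambda>z \<tau> \<phi>. mPi Md z \<tau> \<phi> - mPi Md' z \<tau> \<phi>) (J \<times> U) * D_norm S \<gamma> p Md' J U f'))"
proof -
  let ?L = "lebesgue :: (real ^ 'd) measure"
  let ?P1 = "Pi_norm S r (mPi Md) (J \<times> U)"
  let ?P2 = "Pi_norm S r (\<lambda>z \<tau> \<phi>. mPi Md z \<tau> \<phi> - mPi Md' z \<tau> \<phi>) (J \<times> U)"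
  let ?D1 = "D_dist S \<gamma> p Md Md' J U f f'" and ?D2 = "D_norm S \<gamma> p Md' J U f'"
  let ?G = "\<lambda>z \<phi>. mPi Md z (f z) \<phi> - mPi Md' z (f' z) \<phi>"
  define A1 where "A1 \<zeta> z z' = hnorm S \<zeta> (f z - f' z - mGam Md z z' (f z') + mGam Md' z z' (f' z'))" for \<zeta> z z'
  define A2 where "A2 \<zeta> z z' = hnorm S \<zeta> (f' z - mGam Md' z z' (f' z'))" for \<zeta> z z'
  obtain E where E: "\<And>t. E t \<in> sets ?L" "\<And>t. AE x in ?L. x \<in> E t"
    and m: "\<And>\<zeta> t. \<zeta> \<in> lv \<gamma> \<Longrightarrow> (\<lambda>z. A1 \<zeta> (t, snd z) (t, fst z) * indicator (E t \<times> E t) z) \<in> borel_measurable (lebesgue \<Otimes>\<^sub>M lebesgue)"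
      "\<And>\<zeta> t. \<zeta> \<in> lv \<gamma> \<Longrightarrow> (\<lambda>z. A2 \<zeta> (t, snd z) (t, fst z) * indicator (E t \<times> E t) z) \<in> borel_measurable (lebesgue \<Otimes>\<^sub>M lebesgue)"
      "\<And>\<zeta> t t'. \<zeta> \<in> lv \<gamma> \<Longrightarrow> (\<lambda>x. A1 \<zeta> (t, x) (t', x) * indicator (E t \<inter> E t') x) \<in> borel_measurable lebesgue"
      "\<And>\<zeta> t t'. \<zeta> \<in> lv \<gamma> \<Longrightarrow> (\<lambda>x. A2 \<zeta> (t, x) (t', x) * indicator (E t \<inter> E t') x) \<in> borel_measurable lebesgue"
    using increments_measurable[OF M f f'] unfolding A1_def A2_def by blast
  have A: "0 \<le> A1 \<zeta> z z'" "0 \<le> A2 \<zeta> z z'" for \<zeta> z z' unfolding A1_def A2_def by (rule hnorm_nonneg)+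
  define W1 where "W1 \<zeta> s z = A1 \<zeta> (s, snd z) (s, fst z) * indicator (E s \<times> E s) z" for \<zeta> s z
  define W2 where "W2 \<zeta> s z = A2 \<zeta> (s, snd z) (s, fst z) * indicator (E s \<times> E s) z" for \<zeta> s z
  define V1 where "V1 \<zeta> t t' x = A1 \<zeta> (t, x) (t', x) * indicator (E t \<inter> E t') x" for \<zeta> t t' x
  define V2 where "V2 \<zeta> t t' x = A2 \<zeta> (t, x) (t', x) * indicator (E t \<inter> E t') x" for \<zeta> t t' x
  have mW: "W1 \<zeta> s \<in> borel_measurable (lebesgue \<Otimes>\<^sub>M lebesgue)" "W2 \<zeta> s \<in> borel_measurable (lebesgue \<Otimes>\<^sub>M lebesgue)" if "\<zeta> \<in> lv \<gamma>" for \<zeta> s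
    using m(1,2)[OF that, of s] by (simp_all add: W1_def[abs_def] W2_def[abs_def])
  have mV: "V1 \<zeta> s s' \<in> borel_measurable lebesgue" "V2 \<zeta> s s' \<in> borel_measurable lebesgue" if "\<zeta> \<in> lv \<gamma>" for \<zeta> s s'
    using m(3,4)[OF that, of s s'] by (simp_all add: V1_def[abs_def] V2_def[abs_def])
  define HS0 where "HS0 \<mu> s z = ?P1 * (\<Sum>\<zeta>\<in>lv \<gamma>. ennreal (\<mu> powr \<zeta>) * ennreal (W1 \<zeta> s z)) + ?P2 * (\<Sum>\<zeta>\<in>lv \<gamma>. ennreal (\<mu> powr \<zeta>) * ennreal (W2 \<zeta> s z))" for \<mu> s z
  define HT0 where "HT0 \<mu> b a x = ?P1 * (\<Sum>\<zeta>\<in>lv \<gamma>. ennreal (\<mu> powr \<zeta>) * ennreal (V1 \<zeta> b a x)) + ?P2 * (\<Sum>\<zeta>\<in>lv \<gamma>. ennreal (\<mu> powr \<zeta>) * ennreal (V2 \<zeta> b a x))" for \<mu> b a x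
  \<comment> \<open>The value \<open>top\<close> makes the pointwise bound trivial off
    \<open>E s \<times> E s\<close>. For almost every y it affects only a null set of w, so the
    integrals are unchanged.\<close>
  define HS where "HS \<mu> s y w = HS0 \<mu> s (y, w) + top * indicator (- (E s \<times> E s)) (y, w)" for \<mu> s y w
  \<comment> \<open>For equal times the increment is 0, and \<open>D_expr\<close> has no term for
    it, since l is positive there. Otherwise the later value is compared with the transported
    earlier one, in the order of the time increments of \<open>D_expr\<close>.\<close>
  define HT where "HT \<mu> s s' x = (if s = s' then 0 else HT0 \<mu> (max s s') (min s s') x + top * indicator (- (E s \<inter> E s')) x)" for \<mu> s s' x
  have mHS0: "HS0 \<mu> s \<in> borel_measurable (lebesgue \<Otimes>\<^sub>M lebesgue)" for \<mu> s
    unfolding HS0_def[abs_def] by (intro borel_measurable_add borel_measurable_times_ennreal borel_measurable_sum borel_measurable_const measurable_compose[OF _ measurable_ennreal] mW)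
  have mHT0: "HT0 \<mu> b a \<in> borel_measurable lebesgue" for \<mu> b a
    unfolding HT0_def[abs_def] by (intro borel_measurable_add borel_measurable_times_ennreal borel_measurable_sum borel_measurable_const measurable_compose[OF _ measurable_ennreal] mV)
  have EE: "- (E s \<times> E s) \<in> sets (?L \<Otimes>\<^sub>M ?L)" for s
    using sets.compl_sets[OF pair_measureI[OF E(1)[of s] E(1)[of s]]] by (simp add: Compl_eq_Diff_UNIV space_pair_measure)
  have Ec: "- (E s \<inter> E s') \<in> sets ?L" for s s'
    using sets.compl_sets[OF sets.Int[OF E(1)[of s] E(1)[of s']]] by (simp add: Compl_eq_Diff_UNIV)
  have f0: "\<And>z. f z \<in> below S \<gamma>" "\<And>z. f' z \<in> below S \<gamma>" using D_spaceD(1) f f' by blast+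
  have germ: "ennreal \<bar>?G z (rescale \<eta> l z) - ?G z' (rescale \<eta> l z)\<bar>
    \<le> ?P1 * (\<Sum>\<zeta>\<in>lv \<gamma>. ennreal (l powr \<zeta>) * ennreal (A1 \<zeta> z z')) + ?P2 * (\<Sum>\<zeta>\<in>lv \<gamma>. ennreal (l powr \<zeta>) * ennreal (A2 \<zeta> z z'))"
    if "z \<in> J \<times> U" "\<eta> \<in> Br r" "0 < l" "l \<le> 1" for z z' \<eta> l
  proof -
    have e: "ennreal (\<Sum>\<zeta>\<in>lv \<gamma>. l powr \<zeta> * a \<zeta>) = (\<Sum>\<zeta>\<in>lv \<gamma>. ennreal (l powr \<zeta>) * ennreal (a \<zeta>))" if "\<And>\<zeta>. 0 \<le> a \<zeta>" for a :: "real \<Rightarrow> real"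
      using that by (subst sum_ennreal[symmetric]) (auto simp: ennreal_mult)
    show ?thesis
      using germ_increment[where f=f and f'=f' and z'=z', OF M f0 that] unfolding A1_def[symmetric] A2_def[symmetric] e[OF A(1)] e[OF A(2)] .
  qed
  have lvl: "\<zeta> \<in> levels S" "\<zeta> < \<gamma>" "\<alpha> \<le> \<zeta>" if "\<zeta> \<in> lv \<gamma>" for \<zeta> using that \<alpha> by (auto simp: lv_def)
  define K where "K = 2 powr (\<gamma> - \<alpha>) * 2 ^ CARD('d)"
  have pow: "\<mu> powr \<zeta> * (2 * \<mu>) powr (\<gamma> - \<zeta>) \<le> 2 powr (\<gamma> - \<alpha>) * \<mu> powr \<gamma>" if "\<zeta> \<in> lv \<gamma>" "0 < \<mu>" for \<zeta> \<mu>
  proof -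
    have "\<mu> powr \<zeta> * (2 * \<mu>) powr (\<gamma> - \<zeta>) = 2 powr (\<gamma> - \<zeta>) * \<mu> powr \<gamma>"
      using that by (simp add: powr_mult mult.left_commute flip: powr_add)
    also have "\<dots> \<le> 2 powr (\<gamma> - \<alpha>) * \<mu> powr \<gamma>" using lvl(3)[OF that(1)] by (intro mult_right_mono powr_mono) auto
    finally show ?thesis .
  qed
  have "coherent_with r \<gamma> p ?G J U (ennreal (real (card (lv \<gamma>)) * K) * (?P1 * ?D1 + ?P2 * ?D2)) HS HT"
    unfolding coherent_with_def
  proof (intro conjI allI ballI impI)
    fix \<mu> s
    show "(\<lambda>(y, w). HS \<mu> s y w) \<in> borel_measurable (?L \<Otimes>\<^sub>M ?L)"
      using borel_measurable_add[OF mHS0 borel_measurable_times_ennreal[OF borel_measurable_const borel_measurable_indicator[OF EE]], of \<mu> s top s] by (simp add: HS_def case_prod_beta')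
    fix s'
    show "HT \<mu> s s' \<in> borel_measurable ?L"
      using borel_measurable_add[OF mHT0 borel_measurable_times_ennreal[OF borel_measurable_const borel_measurable_indicator[OF Ec]], of \<mu> "max s s'" "min s s'" top s s']
      by (cases "s = s'") (simp_all add: HT_def[abs_def])
  next
    fix \<mu> s :: real and w y :: "real ^ 'd" and \<eta> :: "'d func" assume a: "\<mu> \<in> {0<..1::real}" "s \<in> J" "w \<in> U" "\<eta> \<in> Br r"
    show "ennreal \<bar>?G (s, w) (rescale \<eta> \<mu> (s, w)) - ?G (s, y) (rescale \<eta> \<mu> (s, w))\<bar> \<le> HS \<mu> s y w"
    proof (cases "(y, w) \<in> E s \<times> E s")
      case True
      have "ennreal \<bar>?G (s, w) (rescale \<eta> \<mu> (s, w)) - ?G (s, y) (rescale \<eta> \<mu> (s, w))\<bar> \<le> HS0 \<mu> s (y, w)"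
        using germ[of "(s, w)" \<eta> \<mu> "(s, y)"] a True by (simp add: HS0_def W1_def W2_def)
      then show ?thesis using True by (simp add: HS_def)
    qed (simp add: HS_def)
  next
    fix \<mu> s :: real assume a: "\<mu> \<in> {0<..1::real}" "s \<in> J"
    define X1 where "X1 \<zeta> y = (\<integral>\<^sup>+w\<in>sball y (2 * \<mu>). ennreal (W1 \<zeta> s (y, w)) \<partial>?L)" for \<zeta> y
    define X2 where "X2 \<zeta> y = (\<integral>\<^sup>+w\<in>sball y (2 * \<mu>). ennreal (W2 \<zeta> s (y, w)) \<partial>?L)" for \<zeta> y
    have "(\<integral>\<^sup>+w\<in>sball y (2 * \<mu>). HS \<mu> s y w \<partial>?L) = ?P1 * (\<Sum>\<zeta>\<in>lv \<gamma>. ennreal (\<mu> powr \<zeta>) * X1 \<zeta> y) + ?P2 * (\<Sum>\<zeta>\<in>lv \<gamma>. ennreal (\<mu> powr \<zeta>) * X2 \<zeta> y)"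
      if y: "y \<in> E s" for y
    proof -
      have [measurable]: "(\<lambda>w. W1 \<zeta> s (y, w)) \<in> borel_measurable ?L" "(\<lambda>w. W2 \<zeta> s (y, w)) \<in> borel_measurable ?L" if "\<zeta> \<in> lv \<gamma>" for \<zeta>
        using measurable_Pair2[OF mW(1)[OF that], of y s] measurable_Pair2[OF mW(2)[OF that], of y s] by simp_all
      have one: "(\<integral>\<^sup>+w. P * (\<Sum>\<zeta>\<in>lv \<gamma>. ennreal (\<mu> powr \<zeta>) * (ennreal (W \<zeta> w) * indicator (sball y (2 * \<mu>)) w)) \<partial>?L) =
          P * (\<Sum>\<zeta>\<in>lv \<gamma>. ennreal (\<mu> powr \<zeta>) * (\<integral>\<^sup>+w\<in>sball y (2 * \<mu>). ennreal (W \<zeta> w) \<partial>?L))"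
        if [measurable]: "\<And>\<zeta>. \<zeta> \<in> lv \<gamma> \<Longrightarrow> W \<zeta> \<in> borel_measurable ?L" for P W
        by (subst nn_integral_cmult, simp) (simp add: nn_integral_sum nn_integral_cmult)
      have "(\<integral>\<^sup>+w\<in>sball y (2 * \<mu>). HS \<mu> s y w \<partial>?L) = (\<integral>\<^sup>+w. ?P1 * (\<Sum>\<zeta>\<in>lv \<gamma>. ennreal (\<mu> powr \<zeta>) * (ennreal (W1 \<zeta> s (y, w)) * indicator (sball y (2 * \<mu>)) w)) +
           ?P2 * (\<Sum>\<zeta>\<in>lv \<gamma>. ennreal (\<mu> powr \<zeta>) * (ennreal (W2 \<zeta> s (y, w)) * indicator (sball y (2 * \<mu>)) w)) \<partial>?L)"
        by (rule nn_integral_cong_AE, use E(2)[of s] in eventually_elim)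
          (use y in \<open>auto simp: HS_def HS0_def indicator_def\<close>)
      also have "\<dots> = (\<integral>\<^sup>+w. ?P1 * (\<Sum>\<zeta>\<in>lv \<gamma>. ennreal (\<mu> powr \<zeta>) * (ennreal (W1 \<zeta> s (y, w)) * indicator (sball y (2 * \<mu>)) w)) \<partial>?L) +
           (\<integral>\<^sup>+w. ?P2 * (\<Sum>\<zeta>\<in>lv \<gamma>. ennreal (\<mu> powr \<zeta>) * (ennreal (W2 \<zeta> s (y, w)) * indicator (sball y (2 * \<mu>)) w)) \<partial>?L)"
        by (rule nn_integral_add) simp_all
      finally show ?thesis by (simp add: one X1_def X2_def)
    qed
    then have "AE y in ?L. y \<in> U \<longrightarrow> (\<integral>\<^sup>+w\<in>sball y (2 * \<mu>). HS \<mu> s y w \<partial>?L) = ?P1 * (\<Sum>\<zeta>\<in>lv \<gamma>. ennreal (\<mu> powr \<zeta>) * X1 \<zeta> y) + ?P2 * (\<Sum>\<zeta>\<in>lv \<gamma>. ennreal (\<mu> powr \<zeta>) * X2 \<zeta> y)"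
      using E(2)[of s] by (auto elim: eventually_mono)
    then have "Lp p U (\<lambda>y. \<integral>\<^sup>+w\<in>sball y (2 * \<mu>). HS \<mu> s y w \<partial>?L) = Lp p U (\<lambda>y. ?P1 * (\<Sum>\<zeta>\<in>lv \<gamma>. ennreal (\<mu> powr \<zeta>) * X1 \<zeta> y) + ?P2 * (\<Sum>\<zeta>\<in>lv \<gamma>. ennreal (\<mu> powr \<zeta>) * X2 \<zeta> y))"
      by (rule Lp_cong_AE)
    also have "\<dots> \<le> ennreal (real (card (lv \<gamma>)) * (K * \<mu> powr \<gamma> * \<mu> ^ CARD('d))) * (?P1 * ?D1 + ?P2 * ?D2)"
    proof (rule Lp_levels_sum[where c = "\<lambda>\<zeta>. (2 * \<mu>) powr (\<gamma> - \<zeta>) * (2 * \<mu>) ^ CARD('d)", OF p _ _ U])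
      fix \<zeta> assume z: "\<zeta> \<in> lv \<gamma>"
      have l: "0 < 2 * \<mu>" "2 * \<mu> \<le> 2" using a by auto
      have "(\<lambda>(y, w). ennreal (W1 \<zeta> s (y, w))) \<in> borel_measurable (?L \<Otimes>\<^sub>M ?L)" "(\<lambda>(y, w). ennreal (W2 \<zeta> s (y, w))) \<in> borel_measurable (?L \<Otimes>\<^sub>M ?L)"
        using mW[OF z] by simp_all
      note ms = this
      show "X1 \<zeta> \<in> borel_measurable ?L" unfolding X1_def[abs_def] by (rule measurable_sball_integral[OF ms(1)])
      show "X2 \<zeta> \<in> borel_measurable ?L" unfolding X2_def[abs_def] by (rule measurable_sball_integral[OF ms(2)])
      show "Lp p U (X1 \<zeta>) \<le> ennreal ((2 * \<mu>) powr (\<gamma> - \<zeta>) * (2 * \<mu>) ^ CARD('d)) * ?D1" unfolding X1_def[abs_def] D_dist_def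
        by (rule D_expr_space_increment[OF p mW(1)[OF z] U _ a(2) lvl(1)[OF z] l]) (simp add: W1_def A1_def hnorm_nonneg indicator_def)
      show "Lp p U (X2 \<zeta>) \<le> ennreal ((2 * \<mu>) powr (\<gamma> - \<zeta>) * (2 * \<mu>) ^ CARD('d)) * ?D2" unfolding X2_def[abs_def] D_norm_def
        by (rule D_expr_space_increment[OF p mW(2)[OF z] U _ a(2) lvl(1)[OF z] l]) (simp add: W2_def A2_def hnorm_nonneg indicator_def)
      have "\<mu> powr \<zeta> * (2 * \<mu>) powr (\<gamma> - \<zeta>) * (2 * \<mu>) ^ CARD('d) \<le> 2 powr (\<gamma> - \<alpha>) * \<mu> powr \<gamma> * (2 * \<mu>) ^ CARD('d)"
        using pow[OF z] a by (intro mult_right_mono) auto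
      then show "\<mu> powr \<zeta> * ((2 * \<mu>) powr (\<gamma> - \<zeta>) * (2 * \<mu>) ^ CARD('d)) \<le> K * \<mu> powr \<gamma> * \<mu> ^ CARD('d)"
        by (simp add: K_def power_mult_distrib mult_ac)
    qed (use a in auto)
    also have "\<dots> = ennreal (real (card (lv \<gamma>)) * K) * (?P1 * ?D1 + ?P2 * ?D2) * ennreal (\<mu> powr \<gamma> * \<mu> ^ CARD('d))"
    proof -
      have "ennreal (real (card (lv \<gamma>)) * (K * \<mu> powr \<gamma> * \<mu> ^ CARD('d))) = ennreal (real (card (lv \<gamma>)) * K) * ennreal (\<mu> powr \<gamma> * \<mu> ^ CARD('d))"
        using a by (subst ennreal_mult[symmetric]) (auto simp: K_def mult_ac)
      then show ?thesis by (simp only: mult_ac)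
    qed
    finally show "Lp p U (\<lambda>y. \<integral>\<^sup>+w\<in>sball y (2 * \<mu>). HS \<mu> s y w \<partial>?L) \<le> ennreal (real (card (lv \<gamma>)) * K) * (?P1 * ?D1 + ?P2 * ?D2) * ennreal (\<mu> powr \<gamma> * \<mu> ^ CARD('d))" .
  next
    fix \<mu> s s' :: real and y :: "real ^ 'd" and \<eta> :: "'d func" assume a: "\<mu> \<in> {0<..1::real}" "s \<in> J" "s' \<in> J" "\<bar>s - s'\<bar> \<le> 2 * \<mu>\<^sup>2" "y \<in> U" "\<eta> \<in> Br r"
    let ?b = "max s s'" and ?a = "min s s'"
    show "ennreal \<bar>?G (s, y) (rescale \<eta> \<mu> (?b, y)) - ?G (s', y) (rescale \<eta> \<mu> (?b, y))\<bar> \<le> HT \<mu> s s' y"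
    proof (cases "s \<noteq> s' \<and> y \<in> E s \<inter> E s'")
      case True
      have y: "y \<in> E ?b \<inter> E ?a" using True by (auto simp: max_def min_def)
      have b: "?b \<in> J" using a by (simp add: max_def)
      have "ennreal \<bar>?G (?b, y) (rescale \<eta> \<mu> (?b, y)) - ?G (?a, y) (rescale \<eta> \<mu> (?b, y))\<bar> \<le> HT0 \<mu> ?b ?a y"
        using germ[of "(?b, y)" \<eta> \<mu> "(?a, y)"] a y b by (simp add: HT0_def V1_def V2_def)
      then have "ennreal \<bar>?G (s, y) (rescale \<eta> \<mu> (?b, y)) - ?G (s', y) (rescale \<eta> \<mu> (?b, y))\<bar> \<le> HT0 \<mu> ?b ?a y"
        by (cases "s \<le> s'") (simp_all add: max_def min_def abs_minus_commute)
      then show ?thesis using True by (simp add: HT_def)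
    qed (auto simp: HT_def)
  next
    fix \<mu> s s' :: real assume a: "\<mu> \<in> {0<..1::real}" "s \<in> J" "s' \<in> J" "\<bar>s - s'\<bar> \<le> 2 * \<mu>\<^sup>2"
    show "Lp p U (HT \<mu> s s') \<le> ennreal (real (card (lv \<gamma>)) * K) * (?P1 * ?D1 + ?P2 * ?D2) * ennreal (\<mu> powr \<gamma>)"
    proof (cases "s = s'")
      case False
      define b c where "b = max s s'" and "c = min s s'"
      \<comment> \<open>Writes the time gap as a square, the form in which \<open>D_expr\<close>
        measures it; a gap of at most \<open>2 * \<mu>\<^sup>2\<close> keeps l below
        \<open>2 * \<mu>\<close>.\<close>
      define l where "l = sqrt (b - c)"
      have l: "0 < l" "c = b - l\<^sup>2" "l\<^sup>2 \<le> 2 * \<mu>\<^sup>2" "b \<in> J" "c \<in> J" using False a by (auto simp: l_def b_def c_def max_def min_def)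
      have "(2 * \<mu>)\<^sup>2 = 4 * \<mu>\<^sup>2" by (simp add: power_mult_distrib)
      then have "l\<^sup>2 \<le> (2 * \<mu>)\<^sup>2" using l(3) zero_le_power2[of \<mu>] by linarith
      then have "l \<le> 2 * \<mu>" by (rule power2_le_imp_le) (use a in simp)
      then have l2: "l \<le> 2 * \<mu>" "l \<le> 2" using a by auto
      have "AE y in ?L. y \<in> U \<longrightarrow> HT \<mu> s s' y = HT0 \<mu> b c y"
        using E(2)[of s] E(2)[of s'] by eventually_elim (simp add: HT_def False b_def c_def)
      then have "Lp p U (HT \<mu> s s') = Lp p U (HT0 \<mu> b c)" by (rule Lp_cong_AE)
      also have "\<dots> \<le> ennreal (real (card (lv \<gamma>)) * (K * \<mu> powr \<gamma>)) * (?P1 * ?D1 + ?P2 * ?D2)"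
        unfolding HT0_def[abs_def]
      proof (rule Lp_levels_sum[where c = "\<lambda>\<zeta>. l powr (\<gamma> - \<zeta>)", OF p _ _ U])
        fix \<zeta> assume z: "\<zeta> \<in> lv \<gamma>"
        show "(\<lambda>x. ennreal (V1 \<zeta> b c x)) \<in> borel_measurable ?L" "(\<lambda>x. ennreal (V2 \<zeta> b c x)) \<in> borel_measurable ?L"
          using mV[OF z] by simp_all
        show "Lp p U (\<lambda>x. ennreal (V1 \<zeta> b c x)) \<le> ennreal (l powr (\<gamma> - \<zeta>)) * ?D1" unfolding D_dist_def
          by (rule D_expr_time_increment[OF p mV(1)[OF z] U _ l(4) lvl(1)[OF z] l(1) l2(2) l(5,2)]) (simp add: V1_def A1_def hnorm_nonneg indicator_def)
        show "Lp p U (\<lambda>x. ennreal (V2 \<zeta> b c x)) \<le> ennreal (l powr (\<gamma> - \<zeta>)) * ?D2" unfolding D_norm_def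
          by (rule D_expr_time_increment[OF p mV(2)[OF z] U _ l(4) lvl(1)[OF z] l(1) l2(2) l(5,2)]) (simp add: V2_def A2_def hnorm_nonneg indicator_def)
        have "\<mu> powr \<zeta> * l powr (\<gamma> - \<zeta>) \<le> \<mu> powr \<zeta> * (2 * \<mu>) powr (\<gamma> - \<zeta>)"
          using l2(1) l(1) lvl(2)[OF z] by (intro mult_left_mono powr_mono2) auto
        also have "\<dots> \<le> 2 powr (\<gamma> - \<alpha>) * \<mu> powr \<gamma>" using pow[OF z] a by auto
        also have "\<dots> = 2 powr (\<gamma> - \<alpha>) * 1 * \<mu> powr \<gamma>" by simp
        also have "\<dots> \<le> K * \<mu> powr \<gamma>" unfolding K_def by (intro mult_right_mono mult_left_mono) auto
        finally show "\<mu> powr \<zeta> * l powr (\<gamma> - \<zeta>) \<le> K * \<mu> powr \<gamma>" .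
      qed (use a in auto)
      also have "\<dots> = ennreal (real (card (lv \<gamma>)) * K) * (?P1 * ?D1 + ?P2 * ?D2) * ennreal (\<mu> powr \<gamma>)"
      proof -
        have "ennreal (real (card (lv \<gamma>)) * (K * \<mu> powr \<gamma>)) = ennreal (real (card (lv \<gamma>)) * K) * ennreal (\<mu> powr \<gamma>)"
          using a by (subst ennreal_mult[symmetric]) (auto simp: K_def mult_ac)
        then show ?thesis by (simp only: mult_ac)
      qed
      finally show ?thesis .
    qed (simp add: HT_def[abs_def])
  qed
  then show ?thesis unfolding coherent_def K_def by blast
qed

end


text \<open>Adds the majorants. In this way the difference of two locally coherent germs is locally
  coherent, without a proof that the distance of the two modelled distributions is finite.\<close>

lemma coherent_diff:
  assumes p: "1 \<le> p" and U [measurable]: "U \<in> sets lebesgue"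
    and c: "coherent r \<gamma> p G J U N" "coherent r \<gamma> p (G' :: 'd::finite pt \<Rightarrow> 'd dist) J U N'"
  shows "coherent r \<gamma> p (\<lambda>z \<phi>. G z \<phi> - G' z \<phi>) J U (N + N')"
proof -
  obtain HS HT where c1: "coherent_with r \<gamma> p G J U N HS HT" using c(1) unfolding coherent_def by blast
  obtain HS' HT' where c2: "coherent_with r \<gamma> p G' J U N' HS' HT'" using c(2) unfolding coherent_def by blast
  note mS = coherent_withD(1)[OF c1] coherent_withD(1)[OF c2] and mT = coherent_withD(2)[OF c1] coherent_withD(2)[OF c2]
  have tri: "ennreal \<bar>(a - a') - (b - b')\<bar> \<le> x + y" if "ennreal \<bar>a - b\<bar> \<le> x" "ennreal \<bar>a' - b'\<bar> \<le> y" for a a' b b' x y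
  proof -
    have "ennreal \<bar>(a - a') - (b - b')\<bar> \<le> ennreal (\<bar>a - b\<bar> + \<bar>a' - b'\<bar>)" by (rule ennreal_leI) linarith
    also have "\<dots> \<le> x + y" using add_mono[OF that] by simp
    finally show ?thesis .
  qed
  have "coherent_with r \<gamma> p (\<lambda>z \<phi>. G z \<phi> - G' z \<phi>) J U (N + N') (\<lambda>\<mu> s y w. HS \<mu> s y w + HS' \<mu> s y w) (\<lambda>\<mu> s s' y. HT \<mu> s s' y + HT' \<mu> s s' y)"
    unfolding coherent_with_def
  proof (intro conjI allI ballI impI)
    fix \<mu> s
    show "(\<lambda>(y, w). HS \<mu> s y w + HS' \<mu> s y w) \<in> borel_measurable (lebesgue \<Otimes>\<^sub>M lebesgue)"
      using borel_measurable_add[OF mS(1)[of \<mu> s] mS(2)[of \<mu> s]] by (simp add: case_prod_beta')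
    show "(\<lambda>y. HT \<mu> s s' y + HT' \<mu> s s' y) \<in> borel_measurable lebesgue" for s'
      by (rule borel_measurable_add[OF mT])
  next
    fix \<mu> s :: real and w y :: "real ^ 'd" and \<eta> :: "'d func" assume a: "\<mu> \<in> {0<..1}" "s \<in> J" "w \<in> U" "\<eta> \<in> Br r"
    have "ennreal \<bar>G (s, w) (rescale \<eta> \<mu> (s, w)) - G (s, y) (rescale \<eta> \<mu> (s, w))\<bar> \<le> HS \<mu> s y w"
      using c1 a unfolding coherent_with_def by blast
    moreover have "ennreal \<bar>G' (s, w) (rescale \<eta> \<mu> (s, w)) - G' (s, y) (rescale \<eta> \<mu> (s, w))\<bar> \<le> HS' \<mu> s y w"
      using c2 a unfolding coherent_with_def by blast
    ultimately show "ennreal \<bar>G (s, w) (rescale \<eta> \<mu> (s, w)) - G' (s, w) (rescale \<eta> \<mu> (s, w)) - (G (s, y) (rescale \<eta> \<mu> (s, w)) - G' (s, y) (rescale \<eta> \<mu> (s, w)))\<bar> \<le> HS \<mu> s y w + HS' \<mu> s y w"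
      by (rule tri)
  next
    fix \<mu> s :: real assume a: "\<mu> \<in> {0<..1}" "s \<in> J"
    have e: "(\<integral>\<^sup>+w\<in>sball y (2 * \<mu>). HS \<mu> s y w + HS' \<mu> s y w \<partial>lebesgue) = (\<integral>\<^sup>+w\<in>sball y (2 * \<mu>). HS \<mu> s y w \<partial>lebesgue) + (\<integral>\<^sup>+w\<in>sball y (2 * \<mu>). HS' \<mu> s y w \<partial>lebesgue)" for y
    proof -
      have [measurable]: "(\<lambda>w. HS \<mu> s y w) \<in> borel_measurable lebesgue" "(\<lambda>w. HS' \<mu> s y w) \<in> borel_measurable lebesgue"
        using measurable_Pair2[OF mS(1), of y \<mu> s] measurable_Pair2[OF mS(2), of y \<mu> s] by simp_all
      show ?thesis by (subst nn_integral_add[symmetric]) (simp_all add: distrib_right)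
    qed
    have "Lp p U (\<lambda>y. \<integral>\<^sup>+w\<in>sball y (2 * \<mu>). HS \<mu> s y w + HS' \<mu> s y w \<partial>lebesgue) \<le> Lp p U (\<lambda>y. \<integral>\<^sup>+w\<in>sball y (2 * \<mu>). HS \<mu> s y w \<partial>lebesgue) + Lp p U (\<lambda>y. \<integral>\<^sup>+w\<in>sball y (2 * \<mu>). HS' \<mu> s y w \<partial>lebesgue)"
      unfolding e by (intro Lp_add p U measurable_sball_integral mS)
    also have "\<dots> \<le> N * ennreal (\<mu> powr \<gamma> * \<mu> ^ CARD('d)) + N' * ennreal (\<mu> powr \<gamma> * \<mu> ^ CARD('d))"
      by (intro add_mono coherent_withD(3)[OF c1] coherent_withD(3)[OF c2]) (use a in auto)
    finally show "Lp p U (\<lambda>y. \<integral>\<^sup>+w\<in>sball y (2 * \<mu>). HS \<mu> s y w + HS' \<mu> s y w \<partial>lebesgue) \<le> (N + N') * ennreal (\<mu> powr \<gamma> * \<mu> ^ CARD('d))"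
      by (simp only: distrib_right)
  next
    fix \<mu> s s' :: real and y :: "real ^ 'd" and \<eta> :: "'d func" assume a: "\<mu> \<in> {0<..1}" "s \<in> J" "s' \<in> J" "\<bar>s - s'\<bar> \<le> 2 * \<mu>\<^sup>2" "y \<in> U" "\<eta> \<in> Br r"
    have "ennreal \<bar>G (s, y) (rescale \<eta> \<mu> (max s s', y)) - G (s', y) (rescale \<eta> \<mu> (max s s', y))\<bar> \<le> HT \<mu> s s' y"
      using c1 a unfolding coherent_with_def by blast
    moreover have "ennreal \<bar>G' (s, y) (rescale \<eta> \<mu> (max s s', y)) - G' (s', y) (rescale \<eta> \<mu> (max s s', y))\<bar> \<le> HT' \<mu> s s' y"
      using c2 a unfolding coherent_with_def by blast
    ultimately show "ennreal \<bar>G (s, y) (rescale \<eta> \<mu> (max s s', y)) - G' (s, y) (rescale \<eta> \<mu> (max s s', y)) - (G (s', y) (rescale \<eta> \<mu> (max s s', y)) - G' (s', y) (rescale \<eta> \<mu> (max s s', y)))\<bar> \<le> HT \<mu> s s' y + HT' \<mu> s s' y"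
      by (rule tri)
  next
    fix \<mu> s s' :: real assume a: "\<mu> \<in> {0<..1}" "s \<in> J" "s' \<in> J" "\<bar>s - s'\<bar> \<le> 2 * \<mu>\<^sup>2"
    have "Lp p U (\<lambda>y. HT \<mu> s s' y + HT' \<mu> s s' y) \<le> Lp p U (HT \<mu> s s') + Lp p U (HT' \<mu> s s')" by (intro Lp_add p U mT)
    also have "\<dots> \<le> N * ennreal (\<mu> powr \<gamma>) + N' * ennreal (\<mu> powr \<gamma>)"
      by (intro add_mono coherent_withD(4)[OF c1] coherent_withD(4)[OF c2]) (use a in auto)
    finally show "Lp p U (\<lambda>y. HT \<mu> s s' y + HT' \<mu> s s' y) \<le> (N + N') * ennreal (\<mu> powr \<gamma>)" by (simp only: distrib_right)
  qed
  then show ?thesis unfolding coherent_def by blast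
qed

lemma locally_coherent_diff:
  assumes "1 \<le> p" "locally_coherent r \<gamma> p G" "locally_coherent r \<gamma> p G'"
  shows "locally_coherent r \<gamma> p (\<lambda>z \<phi>. G z \<phi> - G' z \<phi>)"
  unfolding locally_coherent_def
proof
  fix \<rho>
  obtain N N' where "N < top" "N' < top" "coherent r \<gamma> p G {-\<rho>..\<rho>} (sball 0 \<rho>) N" "coherent r \<gamma> p G' {-\<rho>..\<rho>} (sball 0 \<rho>) N'"
    using assms unfolding locally_coherent_def by blast
  then show "\<exists>N<top. coherent r \<gamma> p (\<lambda>z \<phi>. G z \<phi> - G' z \<phi>) {-\<rho>..\<rho>} (sball 0 \<rho>) N"
    using coherent_diff[OF assms(1) sets_sball(1)] by (intro exI[of _ "N + N'"]) simp
qed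

lemma D_expr_mono:
  fixes U :: "(real ^ 'd::finite) set"
  assumes p: "0 < p" and sub: "J' \<subseteq> J" "U' \<subseteq> U"
  shows "D_expr S \<gamma> p v sp tm J' U' \<le> D_expr S \<gamma> p v sp tm J U"
  unfolding D_expr_def
  by (intro SUP_subset_mono sub(1) order_refl add_mono Lp_mono[OF p order_refl sub(2)])
    (use sub(1) in \<open>auto intro!: Lp_mono[OF p order_refl sub(2)]\<close>)

context reg_structure
begin

text \<open>The zero map belongs to the space of every model and turns the distance of two modelled
  distributions into the norm of one.\<close>

lemma zero_D_space:
  fixes Md :: "('d::finite, 't) model"
  assumes M: "is_model S r Md" and "0 < p"
  shows "D_norm S \<gamma> p Md J U (\<lambda>_. 0) = 0" "(\<lambda>_. 0) \<in> D_space S \<gamma> p Md"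
    "D_dist S \<gamma> p Md Md J U f (\<lambda>_. 0) = D_norm S \<gamma> p Md J U f"
proof -
  have g0: "mGam Md z z' 0 = 0" for z z' by (rule linear_0[OF grp_linear[OF model_grp[OF M]]])
  show e: "D_norm S \<gamma> p Md J U (\<lambda>_. 0) = 0" for J U
  proof -
    have "D_norm S \<gamma> p Md J U (\<lambda>_. 0) \<le> 0"
      unfolding D_norm_def D_expr_def g0 by (intro SUP_least) (simp add: hnorm_0)
    then show ?thesis by simp
  qed
  show "D_dist S \<gamma> p Md Md J U f (\<lambda>_. 0) = D_norm S \<gamma> p Md J U f"
    unfolding D_dist_def D_norm_def by (simp only: g0 diff_zero add_0_right)
  have "strongly_measurable S \<zeta> (\<lambda>x::real^'d. 0)" for \<zeta>
  proof -
    have "cnorm S \<zeta> 0 = 0" using hnorm_0[of \<zeta>] by (simp add: hnorm_def proj_0)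
    then show ?thesis unfolding strongly_measurable_def
      by (intro exI[of _ "\<lambda>n x. 0"]) (auto simp: proj_0 subspace_0[OF part_subspace] vimage_const)
  qed
  then show "(\<lambda>_. 0) \<in> D_space S \<gamma> p Md"
    unfolding D_space_def using e subspace_0[OF subspace_below] by simp
qed

lemma coherent_model:
  fixes Md :: "('d::finite, 't) model"
  assumes M: "is_model S r Md" and f: "f \<in> D_space S \<gamma> p Md"
    and p: "1 \<le> p" and U: "U \<in> sets lebesgue" and \<alpha>: "\<And>\<zeta>. \<zeta> \<in> levels S \<Longrightarrow> \<alpha> \<le> \<zeta>"
  shows "coherent r \<gamma> p (\<lambda>z. mPi Md z (f z)) J U
    (ennreal (real (card (lv \<gamma>)) * (2 powr (\<gamma> - \<alpha>) * 2 ^ CARD('d))) * (Pi_norm S r (mPi Md) (J \<times> U) * D_norm S \<gamma> p Md J U f))"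
proof -
  have p0: "0 < p" using p by simp
  have "mPi Md z 0 \<phi> = 0" for z \<phi> by (rule linear_0[OF model_Pi_linear[OF M]])
  then show ?thesis
    using coherent_models[OF M M f zero_D_space(2)[OF M p0] p U \<alpha>, of J] by (simp add: zero_D_space(1,3)[OF M p0])
qed

lemma D_norm_finite: "0 < p \<Longrightarrow> f \<in> D_space S \<gamma> p Md \<Longrightarrow> D_norm S \<gamma> p Md J U f < top"
  using D_expr_mono[of p J UNIV U UNIV] D_spaceD(3)[of f \<gamma> p Md] unfolding D_norm_def by (meson order_le_less_trans subset_UNIV)

lemma bounded_cylinder: "bounded ({a..b} \<times> sball (x :: real ^ 'd::finite) l)" for a b :: real
  unfolding sball_box by (intro bounded_Times bounded_box bounded_closed_interval)

lemma Pi_norm_finite: "is_model S r Md \<Longrightarrow> bounded B \<Longrightarrow> Pi_norm S r (mPi Md) B < top"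
  by (simp add: is_model_def)

lemma locally_coherent_model:
  fixes Md :: "('d::finite, 't) model"
  assumes M: "is_model S r Md" and f: "f \<in> D_space S \<gamma> p Md"
    and p: "1 \<le> p" and \<alpha>: "\<And>\<zeta>. \<zeta> \<in> levels S \<Longrightarrow> \<alpha> \<le> \<zeta>"
  shows "locally_coherent r \<gamma> p (\<lambda>z. mPi Md z (f z))"
  unfolding locally_coherent_def
proof
  fix \<rho>
  have "Pi_norm S r (mPi Md) ({-\<rho>..\<rho>} \<times> sball 0 \<rho>) < top" by (rule Pi_norm_finite[OF M bounded_cylinder])
  moreover have "D_norm S \<gamma> p Md {-\<rho>..\<rho>} (sball 0 \<rho>) f < top" using p by (intro D_norm_finite f) auto
  ultimately have "ennreal (real (card (lv \<gamma>)) * (2 powr (\<gamma> - \<alpha>) * 2 ^ CARD('d))) *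
      (Pi_norm S r (mPi Md) ({-\<rho>..\<rho>} \<times> sball 0 \<rho>) * D_norm S \<gamma> p Md {-\<rho>..\<rho>} (sball 0 \<rho>) f) < top"
    by (simp add: ennreal_mult_less_top)
  then show "\<exists>N<top. coherent r \<gamma> p (\<lambda>z. mPi Md z (f z)) {-\<rho>..\<rho>} (sball 0 \<rho>) N"
    using coherent_model[OF M f p sets_sball(1)[of 0 \<rho>] \<alpha>, where J="{-\<rho>..\<rho>}"] by blast
qed

text \<open>A measurable version of the norm of each component at a fixed time: the component norm,
  set to 0 on a null set, so that its \<open>Lp\<close> norm is dominated by the norm of f.\<close>

lemma level_majorant:
  fixes Md :: "('d::finite, 't) model"
  assumes M: "is_model S r Md" and f: "f \<in> D_space S \<gamma> p Md" and p: "1 \<le> p" and t: "t \<in> J"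
  obtains E h where "E \<in> sets lebesgue" "AE x in lebesgue. x \<in> E" "\<And>\<zeta>. \<zeta> \<in> lv \<gamma> \<Longrightarrow> h \<zeta> \<in> borel_measurable lebesgue"
    "\<And>\<zeta> x. \<zeta> \<in> lv \<gamma> \<Longrightarrow> x \<in> E \<Longrightarrow> h \<zeta> x = hnorm S \<zeta> (f (t, x))"
    "\<And>\<zeta>. \<zeta> \<in> lv \<gamma> \<Longrightarrow> Lp p U (\<lambda>x. ennreal (h \<zeta> x)) \<le> D_norm S \<gamma> p Md J U f"
proof -
  obtain E where E: "E t \<in> sets lebesgue" "AE x in lebesgue. x \<in> E t"
    and m: "\<And>\<zeta>. \<zeta> \<in> lv \<gamma> \<Longrightarrow> (\<lambda>x. hnorm S \<zeta> (f (t, x)) * indicator (E t) x) \<in> borel_measurable lebesgue"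
    using increments_measurable[OF M M f f] by blast
  show thesis
  proof (rule that[OF E m])
    fix \<zeta> assume z: "\<zeta> \<in> lv \<gamma>"
    show "hnorm S \<zeta> (f (t, x)) * indicator (E t) x = hnorm S \<zeta> (f (t, x))" if "x \<in> E t" for x using that by simp
    have "Lp p U (\<lambda>x. ennreal (hnorm S \<zeta> (f (t, x)) * indicator (E t) x)) \<le> Lp p U (\<lambda>x. ennreal (hnorm S \<zeta> (f (t, x))))"
      using p by (intro Lp_mono) (auto simp: indicator_def hnorm_nonneg)
    also have "\<dots> \<le> D_norm S \<gamma> p Md J U f" unfolding D_norm_def
      by (rule D_expr_terms(1)[where l=1, OF t]) (use z in \<open>auto simp: lv_def\<close>)
    finally show "Lp p U (\<lambda>x. ennreal (hnorm S \<zeta> (f (t, x)) * indicator (E t) x)) \<le> D_norm S \<gamma> p Md J U f" .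
  qed assumption+
qed

text \<open>Estimates the germ itself instead of its increments. For \<epsilon> at most 1 the lowest
  level \<alpha> is the worst, which is the regularity \<alpha> of the target space.\<close>

lemma value_majorant:
  fixes Md :: "('d::finite, 't) model"
  assumes M: "is_model S r Md" and f: "f \<in> D_space S \<gamma> p Md" and p: "1 \<le> p" and U: "U \<in> sets lebesgue"
    and \<alpha>: "\<And>\<zeta>. \<zeta> \<in> levels S \<Longrightarrow> \<alpha> \<le> \<zeta>" and t: "t \<in> J" and \<epsilon>: "0 < \<epsilon>" "\<epsilon> \<le> 1"
  shows "\<exists>B\<in>borel_measurable lebesgue. (\<forall>x\<in>U. \<forall>\<eta>\<in>Br r. ennreal \<bar>mPi Md (t, x) (f (t, x)) (rescale \<eta> \<epsilon> (t, x))\<bar> \<le> B x) \<and>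
    Lp p U B \<le> ennreal (real (card (lv \<gamma>)) * \<epsilon> powr \<alpha>) * (Pi_norm S r (mPi Md) (J \<times> U) * D_norm S \<gamma> p Md J U f)"
proof -
  obtain E h where E: "E \<in> sets lebesgue" "AE x in lebesgue. x \<in> E" and h: "\<And>\<zeta>. \<zeta> \<in> lv \<gamma> \<Longrightarrow> h \<zeta> \<in> borel_measurable lebesgue"
    "\<And>\<zeta> x. \<zeta> \<in> lv \<gamma> \<Longrightarrow> x \<in> E \<Longrightarrow> h \<zeta> x = hnorm S \<zeta> (f (t, x))"
    "\<And>\<zeta>. \<zeta> \<in> lv \<gamma> \<Longrightarrow> Lp p U (\<lambda>x. ennreal (h \<zeta> x)) \<le> D_norm S \<gamma> p Md J U f"
    by (rule level_majorant[OF M f p t, where U=U]) (rule that; assumption)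
  let ?P = "Pi_norm S r (mPi Md) (J \<times> U)"
  define B0 where "B0 x = ?P * (\<Sum>\<zeta>\<in>lv \<gamma>. ennreal (\<epsilon> powr \<zeta>) * ennreal (h \<zeta> x))" for x
  define B where "B x = B0 x + top * indicator (- E) x" for x
  have mB0: "B0 \<in> borel_measurable lebesgue"
    unfolding B0_def[abs_def] by (intro borel_measurable_times_ennreal borel_measurable_sum borel_measurable_const measurable_compose[OF _ measurable_ennreal] h(1))
  have Ec: "- E \<in> sets lebesgue" using sets.compl_sets[OF E(1)] by (simp add: Compl_eq_Diff_UNIV)
  show ?thesis
  proof (intro bexI[of _ B] conjI ballI)
    show "B \<in> borel_measurable lebesgue"
      unfolding B_def[abs_def] by (intro borel_measurable_add borel_measurable_times_ennreal mB0 borel_measurable_const borel_measurable_indicator Ec)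
    fix x and \<eta> :: "'d func" assume x: "x \<in> U" and \<eta>: "\<eta> \<in> Br r"
    show "ennreal \<bar>mPi Md (t, x) (f (t, x)) (rescale \<eta> \<epsilon> (t, x))\<bar> \<le> B x"
    proof (cases "x \<in> E")
      case True
      have "ennreal \<bar>mPi Md (t, x) (f (t, x)) (rescale \<eta> \<epsilon> (t, x))\<bar> \<le> ?P * ennreal (\<Sum>\<zeta>\<in>lv \<gamma>. \<epsilon> powr \<zeta> * hnorm S \<zeta> (f (t, x)))"
        using t x by (intro Pi_bound model_Pi_linear[OF M] \<eta> \<epsilon> D_spaceD(1)[OF f]) auto
      also have "ennreal (\<Sum>\<zeta>\<in>lv \<gamma>. \<epsilon> powr \<zeta> * hnorm S \<zeta> (f (t, x))) = (\<Sum>\<zeta>\<in>lv \<gamma>. ennreal (\<epsilon> powr \<zeta>) * ennreal (h \<zeta> x))"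
        by (subst sum_ennreal[symmetric]) (auto simp: ennreal_mult hnorm_nonneg h(2)[OF _ True])
      finally show ?thesis using True by (simp add: B_def B0_def)
    qed (simp add: B_def)
  next
    have "Lp p U B = Lp p U (\<lambda>x. ?P * (\<Sum>\<zeta>\<in>lv \<gamma>. ennreal (\<epsilon> powr \<zeta>) * ennreal (h \<zeta> x)) + 0 * (\<Sum>\<zeta>\<in>lv \<gamma>. ennreal (\<epsilon> powr \<zeta>) * ennreal (h \<zeta> x)))"
      by (rule Lp_cong_AE, use E(2) in eventually_elim) (simp add: B_def B0_def)
    also have "\<dots> \<le> ennreal (real (card (lv \<gamma>)) * \<epsilon> powr \<alpha>) * (?P * D_norm S \<gamma> p Md J U f + 0 * D_norm S \<gamma> p Md J U f)"
    proof (rule Lp_levels_sum[where c = "\<lambda>\<zeta>. 1", OF p _ _ U])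
      fix \<zeta> assume z: "\<zeta> \<in> lv \<gamma>"
      show "\<epsilon> powr \<zeta> * 1 \<le> \<epsilon> powr \<alpha>" using z \<alpha> \<epsilon> by (auto simp: lv_def intro!: powr_mono')
    qed (use h(1,3) in auto)
    finally show "Lp p U B \<le> ennreal (real (card (lv \<gamma>)) * \<epsilon> powr \<alpha>) * (?P * D_norm S \<gamma> p Md J U f)" by simp
  qed
qed

text \<open>All base points (s, y) are moved to the single point (s, 0). The functional is then
  fixed and y enters only through \<Gamma> and f, which gives measurability by
  \<open>measurable_approx\<close>. On a ball the integrand is bounded by a multiple of the
  component norms of f, which are integrable since the ball has finite volume.\<close>

lemma germ_model:
  fixes Md :: "('d::finite, 't) model"
  assumes M: "is_model S r Md" and f: "f \<in> D_space S \<gamma> p Md" and p: "1 \<le> p"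
  shows "germ r (\<lambda>z. mPi Md z (f z))"
  unfolding germ_def
proof (intro conjI allI ballI model_dist[OF M])
  fix s :: real and \<psi> :: "'d func" and \<rho> :: real assume \<psi>: "\<psi> \<in> tests r"
  let ?L = "lebesgue :: (real ^ 'd) measure"
  let ?z = "(s, 0) :: 'd pt"
  \<comment> \<open>A positive upper bound of the volume for every radius, including those that are
    not positive.\<close>
  define v where "v = (2 * max \<rho> 0) ^ CARD('d) + 1"
  have v: "0 < v" by (simp add: v_def add_nonneg_pos)
  have "emeasure ?L (sball 0 \<rho>) \<le> emeasure ?L (sball 0 (max \<rho> 0))"
    by (intro emeasure_mono sets_sball) (auto simp: sball_def)
  also have "\<dots> \<le> ennreal v" by (subst emeasure_sball) (auto simp: v_def intro: ennreal_leI)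
  finally have vol: "emeasure ?L (sball 0 \<rho>) \<le> ennreal v" .
  have "bounded (insert ?z ({s..s} \<times> sball 0 \<rho>))" using bounded_cylinder[of s s 0 \<rho>] by simp
  then obtain K1 where K1: "0 \<le> K1" "\<And>y \<tau>. y \<in> sball 0 \<rho> \<Longrightarrow> \<tau> \<in> below S \<gamma> \<Longrightarrow> nsum \<gamma> (mGam Md ?z (s, y) \<tau>) \<le> K1 * nsum \<gamma> \<tau>"
    using Gam_bounded[OF M, of "insert ?z ({s..s} \<times> sball 0 \<rho>)" \<gamma>] by auto
  obtain K where K: "0 \<le> K" "\<And>\<tau>. \<tau> \<in> below S \<gamma> \<Longrightarrow> \<bar>mPi Md ?z \<tau> \<psi>\<bar> \<le> K * nsum \<gamma> \<tau>"
    using Pi_functional_bound[OF M \<psi>, of \<gamma> ?z] by blast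
  have fb: "f z \<in> below S \<gamma>" for z by (rule D_spaceD(1)[OF f])
  define g where "g y = mPi Md (s, y) (f (s, y)) \<psi>" for y
  have g: "g y = mPi Md ?z (mGam Md ?z (s, y) (f (s, y))) \<psi>" for y by (simp add: g_def model_Pi_Gam[OF M])
  obtain sf E where sf: "\<And>n. simple_function ?L (sf n)" "\<And>n x. sf n x \<in> below S \<gamma>" and E: "E \<in> sets ?L" "AE x in ?L. x \<in> E"
    and sc: "\<And>x. x \<in> E \<Longrightarrow> tconv \<gamma> (\<lambda>n. sf n x) (f (s, x))"
    using approximants[OF f] by blast
  have "(\<lambda>y. g y * indicator E y) \<in> borel_measurable ?L"
    unfolding g
  proof (rule measurable_approx[where V="below S \<gamma>" and C="tconv \<gamma>" and s=sf and M="?L" and E=E and g="\<lambda>y. f (s, y)" and \<Phi>="\<lambda>y \<tau>. mPi Md ?z (mGam Md ?z (s, y) \<tau>) \<psi>"])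
    fix x :: "nat \<Rightarrow> real ^ 'd" and a and u :: "nat \<Rightarrow> 't" and b
    assume x: "x \<longlonglongrightarrow> a" and u: "tconv \<gamma> u b" "\<And>n. u n \<in> below S \<gamma>" "b \<in> below S \<gamma>"
    let ?w = "\<lambda>n. mGam Md ?z (s, x n) (u n)" and ?b = "mGam Md ?z (s, a) b"
    have w: "tconv \<gamma> ?w ?b" by (rule tconv_Gam[OF M tendsto_const tendsto_Pair[OF tendsto_const x] u])
    have wb: "?w n \<in> below S \<gamma>" "?b \<in> below S \<gamma>" for n using grp_below[OF model_grp[OF M] u(2)] grp_below[OF model_grp[OF M] u(3)] by auto
    show "(\<lambda>n. mPi Md ?z (?w n) \<psi>) \<longlonglongrightarrow> mPi Md ?z ?b \<psi>"
    proof (rule LIM_zero_cancel, rule Lim_null_comparison)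
      show "(\<lambda>n. K * nsum \<gamma> (?w n - ?b)) \<longlonglongrightarrow> 0" using w unfolding tconv_def by (rule tendsto_mult_right_zero)
      have "mPi Md ?z (?w n) \<psi> - mPi Md ?z ?b \<psi> = mPi Md ?z (?w n - ?b) \<psi>" for n by (simp only: linear_diff[OF model_Pi_linear[OF M]])
      then show "\<forall>\<^sub>F n in sequentially. norm (mPi Md ?z (?w n) \<psi> - mPi Md ?z ?b \<psi>) \<le> K * nsum \<gamma> (?w n - ?b)"
        using K(2)[OF subspace_diff[OF subspace_below wb]] by simp
    qed
  qed (use E sf sc fb tconv_const in \<open>auto simp: measurable_def\<close>)
  then have mg [measurable]: "g \<in> borel_measurable ?L"
    by (rule borel_measurable_AE) (use E(2) in \<open>auto elim: eventually_mono\<close>)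
  obtain E' h where "E' \<in> sets ?L" and E': "AE x in ?L. x \<in> E'" and h [measurable]: "\<And>\<zeta>. \<zeta> \<in> lv \<gamma> \<Longrightarrow> h \<zeta> \<in> borel_measurable ?L"
    and h2: "\<And>\<zeta> x. \<zeta> \<in> lv \<gamma> \<Longrightarrow> x \<in> E' \<Longrightarrow> h \<zeta> x = hnorm S \<zeta> (f (s, x))"
      "\<And>\<zeta>. \<zeta> \<in> lv \<gamma> \<Longrightarrow> Lp p (sball 0 \<rho>) (\<lambda>x. ennreal (h \<zeta> x)) \<le> D_norm S \<gamma> p Md UNIV (sball 0 \<rho>) f"
    by (rule level_majorant[OF M f p UNIV_I[of s], where U="sball 0 \<rho>"]) (rule that; assumption)
  show "set_integrable ?L (sball 0 \<rho>) (\<lambda>y. mPi Md (s, y) (f (s, y)) \<psi>)"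
    unfolding set_integrable_def g_def[symmetric]
  proof (rule integrableI_bounded)
    show "(\<lambda>y. indicator (sball 0 \<rho>) y *\<^sub>R g y) \<in> borel_measurable ?L" by measurable
    have le: "\<bar>g y\<bar> \<le> K * (K1 * nsum \<gamma> (f (s, y)))" if "y \<in> sball 0 \<rho>" for y
      unfolding g using K(2)[OF grp_below[OF model_grp[OF M] fb]] mult_left_mono[OF K1(2)[OF that fb] K(1)] by (rule order_trans)
    have "(\<integral>\<^sup>+y. ennreal (norm (indicator (sball 0 \<rho>) y *\<^sub>R g y)) \<partial>?L) \<le> (\<integral>\<^sup>+y. ennreal (K * K1) * (\<Sum>\<zeta>\<in>lv \<gamma>. ennreal (h \<zeta> y) * indicator (sball 0 \<rho>) y) \<partial>?L)"
    proof (rule nn_integral_mono_AE, use E' in eventually_elim)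
      fix y assume y: "y \<in> E'"
      show "ennreal (norm (indicator (sball 0 \<rho>) y *\<^sub>R g y)) \<le> ennreal (K * K1) * (\<Sum>\<zeta>\<in>lv \<gamma>. ennreal (h \<zeta> y) * indicator (sball 0 \<rho>) y)"
      proof (cases "y \<in> sball 0 \<rho>")
        case True
        have "ennreal \<bar>g y\<bar> \<le> ennreal (K * K1 * nsum \<gamma> (f (s, y)))" using le[OF True] by (intro ennreal_leI) (simp add: mult.assoc)
        also have "\<dots> = ennreal (K * K1) * (\<Sum>\<zeta>\<in>lv \<gamma>. ennreal (hnorm S \<zeta> (f (s, y))))"
          using K(1) K1(1) by (simp add: ennreal_mult nsum_nonneg sum_ennreal hnorm_nonneg) (simp add: nsum_def)
        also have "(\<Sum>\<zeta>\<in>lv \<gamma>. ennreal (hnorm S \<zeta> (f (s, y)))) = (\<Sum>\<zeta>\<in>lv \<gamma>. ennreal (h \<zeta> y))" by (intro sum.cong refl) (simp add: h2(1)[OF _ y])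
        finally show ?thesis using True by simp
      qed simp
    qed
    also have "\<dots> = ennreal (K * K1) * (\<Sum>\<zeta>\<in>lv \<gamma>. \<integral>\<^sup>+y\<in>sball 0 \<rho>. ennreal (h \<zeta> y) \<partial>?L)"
      by (subst nn_integral_cmult, simp) (simp add: nn_integral_sum)
    also have "\<dots> < top"
    proof -
      have "(\<integral>\<^sup>+y\<in>sball 0 \<rho>. ennreal (h \<zeta> y) \<partial>?L) < top" if z: "\<zeta> \<in> lv \<gamma>" for \<zeta>
      proof -
        have "(\<integral>\<^sup>+y\<in>sball 0 \<rho>. ennreal (h \<zeta> y) \<partial>?L) \<le> ennreal (2 * v powr (1 - 1 / p)) * Lp p (sball 0 \<rho>) (\<lambda>y. ennreal (h \<zeta> y))"
          using h[OF z] by (intro nn_integral_le_Lp p vol v) auto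
        also have "\<dots> \<le> ennreal (2 * v powr (1 - 1 / p)) * D_norm S \<gamma> p Md UNIV (sball 0 \<rho>) f"
          by (intro mult_left_mono h2(2) z) simp
        also have "\<dots> < top" using D_norm_finite[OF _ f] p by (simp add: ennreal_mult_less_top)
        finally show ?thesis .
      qed
      then show ?thesis using finite_lv by (simp add: ennreal_mult_less_top)
    qed
    finally show "(\<integral>\<^sup>+y. ennreal (norm (indicator (sball 0 \<rho>) y *\<^sub>R g y)) \<partial>?L) < \<infinity>" by simp
  qed
qed

end


lemma germ_lincomb:
  assumes "germ r G" "germ r (G' :: 'd::finite pt \<Rightarrow> 'd dist)"
  shows "germ r (\<lambda>z \<phi>. a * G z \<phi> + b * G' z \<phi>)"
  unfolding germ_def
proof (intro conjI allI ballI)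
  show "(\<lambda>\<phi>. a * G z \<phi> + b * G' z \<phi>) \<in> distributions r" for z
    by (rule distribution_lincomb[OF germ_dist[OF assms(1)] germ_dist[OF assms(2)]])
  fix s \<rho> :: real and \<psi> :: "'d func" assume "\<psi> \<in> tests r"
  then have "set_integrable lebesgue (sball 0 \<rho>) (\<lambda>y. G (s, y) \<psi>)" "set_integrable lebesgue (sball 0 \<rho>) (\<lambda>y. G' (s, y) \<psi>)"
    using assms unfolding germ_def by blast+
  then show "set_integrable lebesgue (sball 0 \<rho>) (\<lambda>y. a * G (s, y) \<psi> + b * G' (s, y) \<psi>)"
    by (intro set_integral_add(1) set_integrable_mult_right)
qed

lemma Pi_norm_mono: "B \<subseteq> B' \<Longrightarrow> Pi_norm S r F B \<le> Pi_norm S r F B'"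
  unfolding Pi_norm_def by (rule SUP_subset_mono) auto

lemma Gam_norm_mono: "B \<subseteq> B' \<Longrightarrow> Gam_norm S G B \<le> Gam_norm S G B'"
  unfolding Gam_norm_def by (intro SUP_subset_mono) auto

lemma sball_subset: "infnorm (x - y) \<le> b - a \<Longrightarrow> sball x a \<subseteq> sball y b"
proof
  fix w assume "infnorm (x - y) \<le> b - a" "w \<in> sball x a"
  then show "w \<in> sball y b"
    using infnorm_triangle[of "w - x" "x - y"] by (simp add: sball_def)
qed

lemma scale_sum_le:
  assumes e: "0 < min \<gamma> (r + \<alpha>)" and l: "0 < l"
    and w: "\<And>n. (1 / 2) ^ n \<le> l \<Longrightarrow> w {t - 2 * l\<^sup>2 .. t + l\<^sup>2 - (1 / 2) ^ (2 * n)} (sball x0 3) \<le> W"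
  shows "scale_sum r \<gamma> \<alpha> w t x0 l \<le> ennreal (1 / (1 - (1 / 2) powr (min \<gamma> (r + \<alpha>)))) * W"
proof -
  have "scale_sum r \<gamma> \<alpha> w t x0 l \<le> (\<Sum>n. (if dl n \<le> l then ennreal ((dl n / l) powr min \<gamma> (r + \<alpha>)) else 0) * W)"
    unfolding scale_sum_def by (intro suminf_le) (auto simp: dl_def intro!: mult_left_mono w)
  also have "\<dots> = (\<Sum>n. if dl n \<le> l then ennreal ((dl n / l) powr min \<gamma> (r + \<alpha>)) else 0) * W"
    by (simp add: mult.commute)
  also have "\<dots> \<le> ennreal (1 / (1 - (1 / 2) powr (min \<gamma> (r + \<alpha>)))) * W"
    by (intro mult_right_mono geometric_scales e l) simp
  finally show ?thesis .
qed

context reg_structure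
begin

text \<open>Continuity of the operator concerns differences of modelled distributions, which must
  themselves be modelled distributions.\<close>

lemma strongly_measurable_diff:
  assumes "strongly_measurable S \<zeta> g" "strongly_measurable S \<zeta> (g' :: real ^ 'd::finite \<Rightarrow> 't)"
  shows "strongly_measurable S \<zeta> (\<lambda>x. g x - g' x)"
proof -
  obtain s where s: "\<And>n. finite (range (s n)) \<and> range (s n) \<subseteq> part S \<zeta> \<and> (\<forall>v. s n -` {v} \<in> sets lebesgue)"
     "AE x in lebesgue. (\<lambda>n. cnorm S \<zeta> (s n x - proj S \<zeta> (g x))) \<longlonglongrightarrow> 0"
    using assms(1) unfolding strongly_measurable_def by blast
  obtain s' where s': "\<And>n. finite (range (s' n)) \<and> range (s' n) \<subseteq> part S \<zeta> \<and> (\<forall>v. s' n -` {v} \<in> sets lebesgue)"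
     "AE x in lebesgue. (\<lambda>n. cnorm S \<zeta> (s' n x - proj S \<zeta> (g' x))) \<longlonglongrightarrow> 0"
    using assms(2) unfolding strongly_measurable_def by blast
  have sp: "s n x \<in> part S \<zeta>" "s' n x \<in> part S \<zeta>" for n x using s(1)[of n] s'(1)[of n] by auto
  have sf: "simple_function lebesgue (\<lambda>x. s n x - s' n x)" for n
    using s(1)[of n] s'(1)[of n] by (intro simple_function_diff) (auto simp: simple_function_def)
  have pre: "(\<lambda>x. s n x - s' n x) -` {v} \<in> sets lebesgue" for n v
  proof (cases "v \<in> range (\<lambda>x. s n x - s' n x)")
    case True
    then show ?thesis using sf[of n] by (auto simp: simple_function_def)
  next
    case False
    then have "(\<lambda>x. s n x - s' n x) -` {v} = {}" by auto
    then show ?thesis by simp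
  qed
  have conv: "(\<lambda>n. cnorm S \<zeta> (s n x - s' n x - proj S \<zeta> (g x - g' x))) \<longlonglongrightarrow> 0"
    if "(\<lambda>n. cnorm S \<zeta> (s n x - proj S \<zeta> (g x))) \<longlonglongrightarrow> 0" "(\<lambda>n. cnorm S \<zeta> (s' n x - proj S \<zeta> (g' x))) \<longlonglongrightarrow> 0" for x
  proof (rule Lim_null_comparison)
    show "(\<lambda>n. cnorm S \<zeta> (s n x - proj S \<zeta> (g x)) + cnorm S \<zeta> (s' n x - proj S \<zeta> (g' x))) \<longlonglongrightarrow> 0"
      using tendsto_add[OF that] by simp
    have "norm (cnorm S \<zeta> (s n x - s' n x - proj S \<zeta> (g x - g' x))) \<le> cnorm S \<zeta> (s n x - proj S \<zeta> (g x)) + cnorm S \<zeta> (s' n x - proj S \<zeta> (g' x))" for n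
    proof -
      have a: "s n x - proj S \<zeta> (g x) \<in> part S \<zeta>" "s' n x - proj S \<zeta> (g' x) \<in> part S \<zeta>"
        by (intro subspace_diff[OF part_subspace] sp proj_part)+
      have e: "s n x - s' n x - proj S \<zeta> (g x - g' x) = (s n x - proj S \<zeta> (g x)) - (s' n x - proj S \<zeta> (g' x))"
        by (simp add: proj_diff)
      have b: "(s n x - proj S \<zeta> (g x)) - (s' n x - proj S \<zeta> (g' x)) \<in> part S \<zeta>" by (rule subspace_diff[OF part_subspace a])
      show ?thesis unfolding e
        using hnorm_diff[of \<zeta> "s n x - proj S \<zeta> (g x)" "s' n x - proj S \<zeta> (g' x)"] cnorm_nonneg[OF b]
        by (simp only: hnorm_part[OF a(1)] hnorm_part[OF a(2)] hnorm_part[OF b] real_norm_def abs_of_nonneg)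
    qed
    then show "\<forall>\<^sub>F n in sequentially. norm (cnorm S \<zeta> (s n x - s' n x - proj S \<zeta> (g x - g' x))) \<le> cnorm S \<zeta> (s n x - proj S \<zeta> (g x)) + cnorm S \<zeta> (s' n x - proj S \<zeta> (g' x))"
      by simp
  qed
  have "AE x in lebesgue. (\<lambda>n. cnorm S \<zeta> (s n x - s' n x - proj S \<zeta> (g x - g' x))) \<longlonglongrightarrow> 0"
    using s(2) s'(2) by eventually_elim (rule conv)
  moreover have "finite (range (\<lambda>x. s n x - s' n x))" for n using sf[of n] by (simp add: simple_function_def)
  moreover have "range (\<lambda>x. s n x - s' n x) \<subseteq> part S \<zeta>" for n using subspace_diff[OF part_subspace sp] by blast
  ultimately show ?thesis unfolding strongly_measurable_def using pre
    by (intro exI[of _ "\<lambda>n x. s n x - s' n x"]) blast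
qed

section \<open>The reconstruction operator\<close>

definition rec :: "real \<Rightarrow> ('d::finite, 't) model \<Rightarrow> ('d pt \<Rightarrow> 't) \<Rightarrow> 'd dist" where
  "rec r M f = recon r (\<lambda>z. mPi M z (f z))"

context
  fixes \<gamma> p \<alpha> r :: real
  assumes \<gamma>: "0 < \<gamma>" and p: "1 \<le> p" and \<alpha>: "\<And>\<zeta>. \<zeta> \<in> levels S \<Longrightarrow> \<alpha> \<le> \<zeta>" "\<alpha> < 0" and r: "0 < r + \<alpha>"
begin

text \<open>The two summands may belong to different models. With coefficients 1 and -1 the germ is
  the one that compares two models; with a single model this is linearity.\<close>

lemma rec_lincomb:
  fixes M M' :: "('d::finite, 't) model"
  assumes M: "is_model S r M" "is_model S r M'" and f: "f \<in> D_space S \<gamma> p M" and f': "f' \<in> D_space S \<gamma> p M'"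
  shows "recon r (\<lambda>z \<phi>. a * mPi M z (f z) \<phi> + b * mPi M' z (f' z) \<phi>) = (\<lambda>\<phi>. a * rec r M f \<phi> + b * rec r M' f' \<phi>)"
  unfolding rec_def
  by (rule recon_lincomb[OF p \<gamma> germ_model[OF M(1) f p] locally_coherent_model[OF M(1) f p \<alpha>(1)] germ_model[OF M(2) f' p] locally_coherent_model[OF M(2) f' p \<alpha>(1)]
    germ_lincomb[OF germ_model[OF M(1) f p] germ_model[OF M(2) f' p]]])

lemma rec_zero: "is_model S r M \<Longrightarrow> rec r M (\<lambda>_. 0) = (\<lambda>\<phi> :: 'd::finite func. 0)"
proof -
  assume M: "is_model S r M"
  have "mPi M z 0 = (\<lambda>\<phi>. 0)" for z using linear_0[OF model_Pi_linear[OF M]] by blast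
  then show ?thesis by (auto simp: rec_def recon_def lvl_def cavg_def limI)
qed

lemma rec_dist: "is_model S r M \<Longrightarrow> f \<in> D_space S \<gamma> p M \<Longrightarrow> rec r M f \<in> distributions r"
  unfolding rec_def by (rule recon_distribution[OF p \<gamma> germ_model[OF _ _ p] locally_coherent_model[OF _ _ p \<alpha>(1)]])

text \<open>C is chosen before the models: \<open>recon_estimate\<close> is uniform over germs, and
  \<open>coherent_models\<close> depends on the models only through the norms in its bound.\<close>

lemma rec_diff_bound:
  "\<exists>C. \<forall>(M :: ('d::finite, 't) model) M'. is_model S r M \<longrightarrow> is_model S r M' \<longrightarrow> recon_diff_bound S r \<gamma> p \<alpha> M M' (rec r M) (rec r M') C"
proof -
  define e where "e = min \<gamma> (r + \<alpha>)"
  have e: "0 < e" "0 \<le> e" "e \<le> \<gamma>" using \<gamma> r by (auto simp: e_def)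
  obtain C where C: "0 < C" "\<And>(G :: 'd pt \<Rightarrow> 'd dist) U U1 Nf t \<epsilon>.
    germ r G \<Longrightarrow> locally_coherent r \<gamma> p G \<Longrightarrow> 0 < \<epsilon> \<Longrightarrow> \<epsilon> \<le> 1 \<Longrightarrow> U \<in> sets lebesgue \<Longrightarrow> U1 \<in> sets lebesgue \<Longrightarrow> (\<forall>x\<in>U1. sball x 2 \<subseteq> U) \<Longrightarrow>
    (\<forall>n. dl n \<le> \<epsilon> \<longrightarrow> coherent r \<gamma> p G {t - 2 * \<epsilon>\<^sup>2..t + \<epsilon>\<^sup>2 - (dl n)\<^sup>2} U (Nf n)) \<Longrightarrow>
    (\<exists>B\<in>borel_measurable lebesgue. (\<forall>x\<in>U1. \<forall>\<eta>\<in>Br r.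
        ennreal \<bar>recon r G (rescale \<eta> \<epsilon> (t, x)) - G (t, x) (rescale \<eta> \<epsilon> (t, x))\<bar> \<le> B x) \<and>
      Lp p U1 B \<le> ennreal (C * \<epsilon> powr \<gamma>) * (\<Sum>n. if dl n \<le> \<epsilon> then ennreal ((dl n / \<epsilon>) powr e) * Nf n else 0))"
    using recon_estimate[OF p \<gamma> e(2,3), where r=r and 'd='d] by blast
  define K where "K = real (card (lv \<gamma>)) * (2 powr (\<gamma> - \<alpha>) * 2 ^ CARD('d))"
  have K: "0 \<le> K" by (simp add: K_def)
  have "recon_diff_bound S r \<gamma> p \<alpha> M M' (rec r M) (rec r M') (C * K)"
    if M: "is_model S r M" "is_model S r M'" for M M' :: "('d, 't) model"
    unfolding recon_diff_bound_def
  proof (intro ballI allI)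
    fix f f' l t and x0 :: "real ^ 'd"
    assume f: "f \<in> D_space S \<gamma> p M" and f': "f' \<in> D_space S \<gamma> p M'" and "l \<in> {0<..1::real}"
    then have l: "0 < l" "l \<le> 1" by auto
    define G where "G z \<phi> = mPi M z (f z) \<phi> - mPi M' z (f' z) \<phi>" for z \<phi>
    define w where "w J U = Pi_norm S r (mPi M) (J \<times> U) * (1 + Gam_norm S (mGam M) (J \<times> U)) * D_dist S \<gamma> p M M' J U f f' +
     (Pi_norm S r (\<lambda>z \<tau> \<phi>. mPi M z \<tau> \<phi> - mPi M' z \<tau> \<phi>) (J \<times> U) * (1 + Gam_norm S (mGam M) (J \<times> U)) +
      Pi_norm S r (mPi M') (J \<times> U) * Gam_norm S (\<lambda>z z' \<tau>. mGam M z z' \<tau> - mGam M' z z' \<tau>) (J \<times> U)) *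
     D_norm S \<gamma> p M' J U f'" for J U
    define w0 where "w0 J U = Pi_norm S r (mPi M) (J \<times> U) * D_dist S \<gamma> p M M' J U f f' +
       Pi_norm S r (\<lambda>z \<tau> \<phi>. mPi M z \<tau> \<phi> - mPi M' z \<tau> \<phi>) (J \<times> U) * D_norm S \<gamma> p M' J U f'" for J U
    \<comment> \<open>Passes from the weight that coherence delivers to the larger weight in the
      asserted constant.\<close>
    have w0: "w0 J U \<le> w J U" for J U
    proof -
      have 1: "a \<le> a * (1 + b)" for a b :: ennreal by (simp add: distrib_left)
      have 2: "a \<le> a * (1 + b) + c" for a b c :: ennreal using add_mono[OF 1[of a b], of 0 c] by simp
      show ?thesis unfolding w0_def w_def by (intro add_mono mult_right_mono 1 2) auto
    qed
    define J where "J n = {t - 2 * l\<^sup>2..t + l\<^sup>2 - (dl n)\<^sup>2}" for n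
    define U where "U = sball x0 3"
    have R: "recon r G = (\<lambda>\<phi>. rec r M f \<phi> - rec r M' f' \<phi>)"
      using rec_lincomb[OF M f f', of 1 "-1"] by (simp add: G_def[abs_def])
    have gG: "germ r G" unfolding G_def[abs_def] using germ_lincomb[OF germ_model[OF M(1) f p] germ_model[OF M(2) f' p], of 1 "-1"] by simp
    have lG: "locally_coherent r \<gamma> p G" unfolding G_def[abs_def]
      by (rule locally_coherent_diff[OF p locally_coherent_model[OF M(1) f p \<alpha>(1)] locally_coherent_model[OF M(2) f' p \<alpha>(1)]])
    \<comment> \<open>The base points compared with x lie within \<open>2 * \<epsilon>\<close>,
      hence within 2 of it; together with the unit ball about x0 this is the radius 3.\<close>
    have sub: "\<forall>x\<in>sball x0 1. sball x 2 \<subseteq> U"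
    proof
      fix x assume "x \<in> sball x0 1"
      then show "sball x 2 \<subseteq> U" unfolding U_def by (intro sball_subset) (simp add: sball_def)
    qed
    have co: "\<forall>n. dl n \<le> l \<longrightarrow> coherent r \<gamma> p G {t - 2 * l\<^sup>2..t + l\<^sup>2 - (dl n)\<^sup>2} U (ennreal K * w0 (J n) U)"
      unfolding J_def[symmetric] G_def[abs_def] w0_def K_def U_def
      by (intro allI impI coherent_models[OF M f f' p _ \<alpha>(1)]) auto
    obtain B where B: "\<And>x \<eta>. x \<in> sball x0 1 \<Longrightarrow> \<eta> \<in> Br r \<Longrightarrow> ennreal \<bar>recon r G (rescale \<eta> l (t, x)) - G (t, x) (rescale \<eta> l (t, x))\<bar> \<le> B x"
      "Lp p (sball x0 1) B \<le> ennreal (C * l powr \<gamma>) * (\<Sum>n. if dl n \<le> l then ennreal ((dl n / l) powr e) * (ennreal K * w0 (J n) U) else 0)"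
      using C(2)[OF gG lG l _ _ sub co] by (auto simp: U_def)
    have "Lp p (sball x0 1) (\<lambda>x. SUP \<eta>\<in>Br r. ennreal
          \<bar>rec r M f (rescale \<eta> l (t, x)) - rec r M' f' (rescale \<eta> l (t, x))
            - mPi M (t, x) (f (t, x)) (rescale \<eta> l (t, x))
            + mPi M' (t, x) (f' (t, x)) (rescale \<eta> l (t, x))\<bar>) \<le> Lp p (sball x0 1) B"
    proof (rule Lp_mono)
      fix x assume x: "x \<in> sball x0 1"
      have "\<bar>rec r M f \<phi> - rec r M' f' \<phi> - mPi M (t, x) (f (t, x)) \<phi> + mPi M' (t, x) (f' (t, x)) \<phi>\<bar> = \<bar>recon r G \<phi> - G (t, x) \<phi>\<bar>" for \<phi>
        by (simp add: R G_def)
      then show "(SUP \<eta>\<in>Br r. ennreal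
          \<bar>rec r M f (rescale \<eta> l (t, x)) - rec r M' f' (rescale \<eta> l (t, x))
            - mPi M (t, x) (f (t, x)) (rescale \<eta> l (t, x))
            + mPi M' (t, x) (f' (t, x)) (rescale \<eta> l (t, x))\<bar>) \<le> B x"
        by (simp only:) (intro SUP_least B(1) x)
    qed (use p in auto)
    also have "\<dots> \<le> ennreal (C * l powr \<gamma>) * (\<Sum>n. ennreal K * (if dl n \<le> l then ennreal ((dl n / l) powr e) * w (J n) U else 0))"
      by (rule order_trans[OF B(2)], intro mult_left_mono suminf_le)
        (auto intro!: mult_left_mono w0 simp: mult.left_commute[of "ennreal K"])
    also have "\<dots> = ennreal (C * l powr \<gamma>) * (ennreal K * (\<Sum>n. if dl n \<le> l then ennreal ((dl n / l) powr e) * w (J n) U else 0))"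
      by simp
    also have "\<dots> = ennreal (C * K * l powr \<gamma>) * (\<Sum>n. if dl n \<le> l then ennreal ((dl n / l) powr e) * w (J n) U else 0)"
    proof -
      have "ennreal (C * K * l powr \<gamma>) = ennreal (C * l powr \<gamma>) * ennreal K"
        using C(1) K by (subst ennreal_mult[symmetric]) (auto simp: mult_ac)
      then show ?thesis by (simp only: mult.assoc)
    qed
    also have "(\<Sum>n. if dl n \<le> l then ennreal ((dl n / l) powr e) * w (J n) U else 0) = recon_diff_const S r \<gamma> p \<alpha> M M' f f' t x0 l"
      unfolding recon_diff_const_def scale_sum_def J_def w_def U_def e_def dl_square by (simp only: dl_def)
    finally show "Lp p (sball x0 1) (\<lambda>x. SUP \<eta>\<in>Br r. ennreal
          \<bar>rec r M f (rescale \<eta> l (t, x)) - rec r M' f' (rescale \<eta> l (t, x))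
            - mPi M (t, x) (f (t, x)) (rescale \<eta> l (t, x))
            + mPi M' (t, x) (f' (t, x)) (rescale \<eta> l (t, x))\<bar>)
        \<le> ennreal (C * K * l powr \<gamma>) * recon_diff_const S r \<gamma> p \<alpha> M M' f f' t x0 l" .
  qed
  then show ?thesis by blast
qed

lemma rec_bound: "\<exists>C. \<forall>M :: ('d::finite, 't) model. is_model S r M \<longrightarrow> recon_bound S r \<gamma> p \<alpha> M (rec r M) C"
proof -
  obtain C where C: "\<And>M M' :: ('d, 't) model. is_model S r M \<Longrightarrow> is_model S r M' \<Longrightarrow> recon_diff_bound S r \<gamma> p \<alpha> M M' (rec r M) (rec r M') C"
    using rec_diff_bound by blast
  have p0: "0 < p" using p by simp
  have "recon_bound S r \<gamma> p \<alpha> M (rec r M) C" if M: "is_model S r M" for M :: "('d, 't) model"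
    unfolding recon_bound_def
  proof (intro ballI allI)
    fix f l t and x0 :: "real ^ 'd" assume a: "f \<in> D_space S \<gamma> p M" "l \<in> {0<..1::real}"
    have z: "mPi M z 0 \<phi> = 0" for z \<phi> by (rule linear_0[OF model_Pi_linear[OF M]])
    have "recon_diff_const S r \<gamma> p \<alpha> M M f (\<lambda>_. 0) = recon_const S r \<gamma> p \<alpha> M f"
      unfolding recon_diff_const_def recon_const_def by (simp add: zero_D_space(1,3)[OF M p0])
    then show "Lp p (sball x0 1) (\<lambda>x. SUP \<eta>\<in>Br r. ennreal
          \<bar>rec r M f (rescale \<eta> l (t, x)) - mPi M (t, x) (f (t, x)) (rescale \<eta> l (t, x))\<bar>)
        \<le> ennreal (C * l powr \<gamma>) * recon_const S r \<gamma> p \<alpha> M f t x0 l"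
      using C[OF M M, unfolded recon_diff_bound_def, rule_format, OF a(1) zero_D_space(2)[OF M p0] a(2), of x0 t]
      by (simp add: z rec_zero[OF M])
  qed
  then show ?thesis by blast
qed

text \<open>The pairing is split into its distance from the germ, of order
  \<open>l powr \<gamma>\<close>, and the germ, of order \<open>l powr \<alpha>\<close>. After
  multiplication by \<open>l powr (- \<alpha>)\<close> both are bounded for l at most 1. J contains
  the past 2 and the future 1 of each time, as the base times require at scale 1.\<close>

lemma rec_E_norm:
  "\<exists>C\<ge>0. \<forall>(M :: ('d::finite, 't) model) f J U J1 U1. is_model S r M \<longrightarrow> f \<in> D_space S \<gamma> p M \<longrightarrow> U \<in> sets lebesgue \<longrightarrow> U1 \<in> sets lebesgue \<longrightarrow>
    (\<forall>x\<in>U1. sball x 2 \<subseteq> U) \<longrightarrow> U1 \<subseteq> U \<longrightarrow> (\<forall>t\<in>J1. {t - 2..t + 1} \<subseteq> J) \<longrightarrow>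
    E_norm r \<alpha> p J1 U1 (rec r M f) \<le> ennreal C * (Pi_norm S r (mPi M) (J \<times> U) * D_norm S \<gamma> p M UNIV UNIV f)"
proof -
  define e where "e = min \<gamma> (r + \<alpha>)"
  have e: "0 < e" "0 \<le> e" "e \<le> \<gamma>" using \<gamma> r by (auto simp: e_def)
  have p0: "0 < p" using p by simp
  obtain C where C: "0 < C" "\<And>(G :: 'd pt \<Rightarrow> 'd dist) U U1 Nf t \<epsilon>.
    germ r G \<Longrightarrow> locally_coherent r \<gamma> p G \<Longrightarrow> 0 < \<epsilon> \<Longrightarrow> \<epsilon> \<le> 1 \<Longrightarrow> U \<in> sets lebesgue \<Longrightarrow> U1 \<in> sets lebesgue \<Longrightarrow> (\<forall>x\<in>U1. sball x 2 \<subseteq> U) \<Longrightarrow>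
    (\<forall>n. dl n \<le> \<epsilon> \<longrightarrow> coherent r \<gamma> p G {t - 2 * \<epsilon>\<^sup>2..t + \<epsilon>\<^sup>2 - (dl n)\<^sup>2} U (Nf n)) \<Longrightarrow>
    (\<exists>B\<in>borel_measurable lebesgue. (\<forall>x\<in>U1. \<forall>\<eta>\<in>Br r.
        ennreal \<bar>recon r G (rescale \<eta> \<epsilon> (t, x)) - G (t, x) (rescale \<eta> \<epsilon> (t, x))\<bar> \<le> B x) \<and>
      Lp p U1 B \<le> ennreal (C * \<epsilon> powr \<gamma>) * (\<Sum>n. if dl n \<le> \<epsilon> then ennreal ((dl n / \<epsilon>) powr e) * Nf n else 0))"
    using recon_estimate[OF p \<gamma> e(2,3), where r=r and 'd='d] by blast
  define K where "K = real (card (lv \<gamma>)) * (2 powr (\<gamma> - \<alpha>) * 2 ^ CARD('d))"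
  have K: "0 \<le> K" by (simp add: K_def)
  define g where "g = 1 / (1 - (1 / 2 :: real) powr e)"
  have "(1 / 2 :: real) powr e < 1" using powr_less_mono2[of e "1 / 2 :: real" 1] e by simp
  then have g: "0 \<le> g" by (simp add: g_def)
  define CC where "CC = C * g * K + real (card (lv \<gamma>))"
  show ?thesis
  proof (intro exI[of _ CC] conjI allI impI)
    show "0 \<le> CC" using C(1) g K by (simp add: CC_def)
    fix M :: "('d, 't) model" and f and J J1 :: "real set" and U U1 :: "(real ^ 'd) set"
    assume M: "is_model S r M" and f: "f \<in> D_space S \<gamma> p M" and U: "U \<in> sets lebesgue" "U1 \<in> sets lebesgue"
      and sub: "\<forall>x\<in>U1. sball x 2 \<subseteq> U" "U1 \<subseteq> U" "\<forall>t\<in>J1. {t - 2..t + 1} \<subseteq> J"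
    define W where "W = Pi_norm S r (mPi M) (J \<times> U) * D_norm S \<gamma> p M UNIV UNIV f"
    have Dm: "D_norm S \<gamma> p M J' U' f \<le> D_norm S \<gamma> p M UNIV UNIV f" for J' U'
      unfolding D_norm_def by (rule D_expr_mono[OF p0]) auto
    show "E_norm r \<alpha> p J1 U1 (rec r M f) \<le> ennreal CC * (Pi_norm S r (mPi M) (J \<times> U) * D_norm S \<gamma> p M UNIV UNIV f)"
      unfolding E_norm_def W_def[symmetric]
    proof (intro SUP_least)
      fix l t assume "l \<in> {0<..1::real}" and t: "t \<in> J1"
      then have l: "0 < l" "l \<le> 1" by auto
      have tJ: "t \<in> J" using sub(3) t by force
      have l2: "l\<^sup>2 \<le> 1" using l by (simp add: power_le_one)
      let ?G = "\<lambda>z. mPi M z (f z)"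
      have co: "\<forall>n. dl n \<le> l \<longrightarrow> coherent r \<gamma> p ?G {t - 2 * l\<^sup>2..t + l\<^sup>2 - (dl n)\<^sup>2} U (ennreal K * (Pi_norm S r (mPi M) (J \<times> U) * D_norm S \<gamma> p M J U f))"
      proof (intro allI impI)
        fix n
        have "t - 2 \<le> t - 2 * l\<^sup>2" "t + l\<^sup>2 - (dl n)\<^sup>2 \<le> t + 1" using l2 zero_le_power2[of "dl n"] by linarith+
        then have "{t - 2 * l\<^sup>2..t + l\<^sup>2 - (dl n)\<^sup>2} \<subseteq> {t - 2..t + 1}" by auto
        also have "\<dots> \<subseteq> J" using sub(3) t by blast
        finally show "coherent r \<gamma> p ?G {t - 2 * l\<^sup>2..t + l\<^sup>2 - (dl n)\<^sup>2} U (ennreal K * (Pi_norm S r (mPi M) (J \<times> U) * D_norm S \<gamma> p M J U f))"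
          unfolding K_def by (rule coherent_mono[OF coherent_model[OF M f p U(1) \<alpha>(1)], rotated])
      qed
      obtain B1 where B1: "B1 \<in> borel_measurable lebesgue"
        "\<And>x \<eta>. x \<in> U1 \<Longrightarrow> \<eta> \<in> Br r \<Longrightarrow> ennreal \<bar>rec r M f (rescale \<eta> l (t, x)) - ?G (t, x) (rescale \<eta> l (t, x))\<bar> \<le> B1 x"
        "Lp p U1 B1 \<le> ennreal (C * l powr \<gamma>) * (\<Sum>n. if dl n \<le> l then ennreal ((dl n / l) powr e) * (ennreal K * (Pi_norm S r (mPi M) (J \<times> U) * D_norm S \<gamma> p M J U f)) else 0)"
        using C(2)[OF germ_model[OF M f p] locally_coherent_model[OF M f p \<alpha>(1)] l U sub(1) co] unfolding rec_def by blast
      obtain B2 where B2: "B2 \<in> borel_measurable lebesgue"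
        "\<And>x \<eta>. x \<in> U1 \<Longrightarrow> \<eta> \<in> Br r \<Longrightarrow> ennreal \<bar>?G (t, x) (rescale \<eta> l (t, x))\<bar> \<le> B2 x"
        "Lp p U1 B2 \<le> ennreal (real (card (lv \<gamma>)) * l powr \<alpha>) * (Pi_norm S r (mPi M) (J \<times> U1) * D_norm S \<gamma> p M J U1 f)"
        using value_majorant[OF M f p U(2) \<alpha>(1) tJ l] by blast
      have L1: "Lp p U1 B1 \<le> ennreal (C * l powr \<gamma> * g * K) * W"
      proof -
        let ?N = "ennreal K * W"
        have "Lp p U1 B1 \<le> ennreal (C * l powr \<gamma>) * (\<Sum>n. (if dl n \<le> l then ennreal ((dl n / l) powr e) else 0) * ?N)"
          unfolding W_def by (rule order_trans[OF B1(3)], intro mult_left_mono suminf_le) (auto intro!: mult_left_mono Dm)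
        also have "\<dots> = ennreal (C * l powr \<gamma>) * ((\<Sum>n. if dl n \<le> l then ennreal ((dl n / l) powr e) else 0) * ?N)"
          by (simp only: ennreal_suminf_multc)
        also have "\<dots> \<le> ennreal (C * l powr \<gamma>) * (ennreal g * ?N)"
          unfolding g_def by (intro mult_left_mono mult_right_mono geometric_scales e l) auto
        also have "\<dots> = ennreal (C * l powr \<gamma> * g * K) * W"
          using C(1) g K by (simp add: ennreal_mult mult_ac)
        finally show ?thesis .
      qed
      have L2: "Lp p U1 B2 \<le> ennreal (real (card (lv \<gamma>)) * l powr \<alpha>) * W"
        unfolding W_def using sub(2) by (intro order_trans[OF B2(3)] mult_left_mono mult_mono Dm Pi_norm_mono) auto
      have "Lp p U1 (\<lambda>x. SUP \<eta>\<in>Br r. ennreal (l powr (- \<alpha>) * \<bar>rec r M f (rescale \<eta> l (t, x))\<bar>)) \<le> Lp p U1 (\<lambda>x. ennreal (l powr (- \<alpha>)) * (B1 x + B2 x))"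
      proof (rule Lp_mono[OF p0 SUP_least order_refl])
        fix x and \<eta> :: "'d func" assume x: "x \<in> U1" "\<eta> \<in> Br r"
        let ?a = "rec r M f (rescale \<eta> l (t, x))" and ?b = "?G (t, x) (rescale \<eta> l (t, x))"
        have "ennreal \<bar>?a\<bar> \<le> ennreal (\<bar>?a - ?b\<bar> + \<bar>?b\<bar>)" by (intro ennreal_leI) linarith
        also have "\<dots> = ennreal \<bar>?a - ?b\<bar> + ennreal \<bar>?b\<bar>" by simp
        also have "\<dots> \<le> B1 x + B2 x" by (intro add_mono B1(2) B2(2) x)
        finally show "ennreal (l powr (- \<alpha>) * \<bar>?a\<bar>) \<le> ennreal (l powr (- \<alpha>)) * (B1 x + B2 x)"
          by (subst ennreal_mult) (auto intro: mult_left_mono)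
      qed
      also have "\<dots> = ennreal (l powr (- \<alpha>)) * Lp p U1 (\<lambda>x. B1 x + B2 x)"
        using B1(1) B2(1) by (intro Lp_cmult p0 U) auto
      also have "\<dots> \<le> ennreal (l powr (- \<alpha>)) * (Lp p U1 B1 + Lp p U1 B2)"
        by (intro mult_left_mono Lp_add p B1 B2 U) auto
      also have "\<dots> \<le> ennreal (l powr (- \<alpha>)) * (ennreal (C * l powr \<gamma> * g * K) * W + ennreal (real (card (lv \<gamma>)) * l powr \<alpha>) * W)"
        by (intro mult_left_mono add_mono L1 L2) auto
      also have "\<dots> = ennreal (l powr (- \<alpha>) * (C * l powr \<gamma> * g * K + real (card (lv \<gamma>)) * l powr \<alpha>)) * W"
        using C(1) g K by (simp add: ennreal_mult ennreal_plus distrib_right mult.assoc)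
      also have "\<dots> \<le> ennreal CC * W"
      proof (intro mult_right_mono ennreal_leI)
        have "l powr (- \<alpha>) * l powr \<gamma> \<le> 1" using l \<gamma> \<alpha>(2) by (simp add: powr_add[symmetric] powr_le1)
        then have "l powr (- \<alpha>) * l powr \<gamma> * (C * g * K) \<le> 1 * (C * g * K)" using C(1) g K by (intro mult_right_mono) auto
        moreover have "l powr (- \<alpha>) * l powr \<alpha> = 1" using l by (simp add: powr_add[symmetric])
        moreover have "l powr (- \<alpha>) * (C * l powr \<gamma> * g * K + real (card (lv \<gamma>)) * l powr \<alpha>) =
          l powr (- \<alpha>) * l powr \<gamma> * (C * g * K) + real (card (lv \<gamma>)) * (l powr (- \<alpha>) * l powr \<alpha>)" by (simp add: algebra_simps)
        ultimately show "l powr (- \<alpha>) * (C * l powr \<gamma> * g * K + real (card (lv \<gamma>)) * l powr \<alpha>) \<le> CC" by (simp add: CC_def)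
      qed simp
      finally show "Lp p U1 (\<lambda>x. SUP \<eta>\<in>Br r. ennreal (l powr (- \<alpha>) * \<bar>rec r M f (rescale \<eta> l (t, x))\<bar>)) \<le> ennreal CC * W" .
    qed
  qed
qed

text \<open>For a linear map a bound by a multiple of the norm yields continuity, once the
  difference of two elements is known to lie in the space, where the bound applies to it.\<close>

lemma rec_continuous_linear:
  fixes M :: "('d::finite, 't) model"
  assumes M: "is_model S r M" and K: "0 \<le> K"
    and bnd: "\<And>f. f \<in> D_space S \<gamma> p M \<Longrightarrow> E_norm r \<alpha> p J U (rec r M f) \<le> ennreal K * D_norm S \<gamma> p M UNIV UNIV f"
  shows "continuous_linear_map r (D_space S \<gamma> p M) (D_norm S \<gamma> p M UNIV UNIV) (E_norm r \<alpha> p J U) (rec r M)"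
  unfolding continuous_linear_map_def
proof (intro conjI ballI allI impI)
  have p0: "0 < p" using p by simp
  note L = model_Pi_linear[OF M]
  fix f assume f: "f \<in> D_space S \<gamma> p M"
  show "rec r M f \<in> distributions r" by (rule rec_dist[OF M f])
  show "E_norm r \<alpha> p J U (rec r M f) < top"
    using D_norm_finite[OF p0 f] by (intro order_le_less_trans[OF bnd[OF f]]) (simp add: ennreal_mult_less_top)
  {
    fix g assume g: "g \<in> D_space S \<gamma> p M"
    have "(\<lambda>z. mPi M z (f z + g z)) = (\<lambda>z \<phi>. 1 * mPi M z (f z) \<phi> + 1 * mPi M z (g z) \<phi>)"
      by (intro ext) (simp add: linear_add[OF L])
    then show "rec r M (\<lambda>z. f z + g z) = (\<lambda>\<phi>. rec r M f \<phi> + rec r M g \<phi>)"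
      using rec_lincomb[OF M M f g, of 1 1] by (simp add: rec_def)
  }
  show "rec r M (\<lambda>z. c *\<^sub>R f z) = (\<lambda>\<phi>. c * rec r M f \<phi>)" for c
  proof -
    have "(\<lambda>z. mPi M z (c *\<^sub>R f z)) = (\<lambda>z \<phi>. c * mPi M z (f z) \<phi> + 0 * mPi M z (f z) \<phi>)"
      by (intro ext) (simp add: linear_scale[OF L])
    then show ?thesis using rec_lincomb[OF M M f f, of c 0] by (simp add: rec_def)
  qed
  fix \<epsilon> :: real assume \<epsilon>: "0 < \<epsilon>"
  show "\<exists>\<delta>>0. \<forall>g\<in>D_space S \<gamma> p M. D_norm S \<gamma> p M UNIV UNIV (\<lambda>z. g z - f z) < ennreal \<delta> \<longrightarrow>
        E_norm r \<alpha> p J U (\<lambda>\<phi>. rec r M g \<phi> - rec r M f \<phi>) < ennreal \<epsilon>"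
  \<comment> \<open>K may be 0, and the final inequality is strict, hence
    \<open>K + 1\<close>.\<close>
  proof (intro exI[of _ "\<epsilon> / (K + 1)"] conjI ballI impI)
    show "0 < \<epsilon> / (K + 1)" using \<epsilon> K by simp
    fix g assume g: "g \<in> D_space S \<gamma> p M" and le: "D_norm S \<gamma> p M UNIV UNIV (\<lambda>z. g z - f z) < ennreal (\<epsilon> / (K + 1))"
    have d: "(\<lambda>z. g z - f z) \<in> D_space S \<gamma> p M"
      unfolding D_space_def
    proof (intro CollectI conjI allI ballI)
      show "g z - f z \<in> below S \<gamma>" for z by (intro subspace_diff[OF subspace_below] D_spaceD(1)[OF f] D_spaceD(1)[OF g])
      show "strongly_measurable S \<zeta> (\<lambda>x. g (t, x) - f (t, x))" if "\<zeta> \<in> levels S" for t \<zeta>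
        by (intro strongly_measurable_diff D_spaceD(2)[OF f that] D_spaceD(2)[OF g that])
      show "D_norm S \<gamma> p M UNIV UNIV (\<lambda>z. g z - f z) < top" using le by (rule less_trans) simp
    qed
    have "(\<lambda>z. mPi M z (g z - f z)) = (\<lambda>z \<phi>. 1 * mPi M z (g z) \<phi> + (-1) * mPi M z (f z) \<phi>)"
      by (intro ext) (simp add: linear_diff[OF L])
    then have "rec r M (\<lambda>z. g z - f z) = (\<lambda>\<phi>. rec r M g \<phi> - rec r M f \<phi>)"
      using rec_lincomb[OF M M g f, of 1 "-1"] by (simp add: rec_def)
    then have "E_norm r \<alpha> p J U (\<lambda>\<phi>. rec r M g \<phi> - rec r M f \<phi>) \<le> ennreal K * D_norm S \<gamma> p M UNIV UNIV (\<lambda>z. g z - f z)"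
      using bnd[OF d] by simp
    also have "\<dots> \<le> ennreal K * ennreal (\<epsilon> / (K + 1))" using le by (intro mult_left_mono) auto
    also have "\<dots> = ennreal (K * (\<epsilon> / (K + 1)))" using K \<epsilon> by (intro ennreal_mult[symmetric]) auto
    also have "\<dots> < ennreal \<epsilon>" using K \<epsilon> by (intro ennreal_lessI) (auto simp: divide_simps)
    finally show "E_norm r \<alpha> p J U (\<lambda>\<phi>. rec r M g \<phi> - rec r M f \<phi>) < ennreal \<epsilon>" .
  qed
qed

lemma rec_reconstruction:
  fixes M :: "('d::finite, 't) model"
  assumes M: "is_model S r M"
  shows "reconstruction S r \<gamma> p \<alpha> M (rec r M)"
proof -
  obtain C where C: "0 \<le> C" "\<And>f J J1 U U1. f \<in> D_space S \<gamma> p M \<Longrightarrow> U \<in> sets lebesgue \<Longrightarrow> U1 \<in> sets lebesgue \<Longrightarrow>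
    (\<forall>x\<in>U1. sball x 2 \<subseteq> U) \<Longrightarrow> U1 \<subseteq> U \<Longrightarrow> (\<forall>t\<in>J1. {t - 2..t + 1} \<subseteq> J) \<Longrightarrow>
    E_norm r \<alpha> p J1 U1 (rec r M f) \<le> ennreal C * (Pi_norm S r (mPi M) (J \<times> U) * D_norm S \<gamma> p M UNIV UNIV f)"
    using rec_E_norm[where 'd='d] M by blast
  \<comment> \<open>Serves both target spaces. They differ in the region on which the norm of \<Pi>
    has to be finite: a bounded cylinder for the localised norms, all of space-time for the global
    one.\<close>
  have CL: "continuous_linear_map r (D_space S \<gamma> p M) (D_norm S \<gamma> p M UNIV UNIV) (E_norm r \<alpha> p J1 U1) (rec r M)"
    if "Pi_norm S r (mPi M) (J \<times> U) < top" "U \<in> sets lebesgue" "U1 \<in> sets lebesgue"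
      "\<forall>x\<in>U1. sball x 2 \<subseteq> U" "U1 \<subseteq> U" "\<forall>t\<in>J1. {t - 2..t + 1} \<subseteq> J" for J J1 and U U1 :: "(real ^ 'd) set"
  proof (rule rec_continuous_linear[OF M])
    let ?P = "enn2real (Pi_norm S r (mPi M) (J \<times> U))"
    have P: "Pi_norm S r (mPi M) (J \<times> U) = ennreal ?P" using that(1) by simp
    show "0 \<le> C * ?P" using C(1) by simp
    fix f assume f: "f \<in> D_space S \<gamma> p M"
    have "ennreal (C * ?P) = ennreal C * Pi_norm S r (mPi M) (J \<times> U)"
      by (subst (2) P, rule ennreal_mult) (use C(1) in auto)
    then show "E_norm r \<alpha> p J1 U1 (rec r M f) \<le> ennreal (C * ?P) * D_norm S \<gamma> p M UNIV UNIV f"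
      using C(2)[OF f that(2-6)] by (simp only: mult.assoc)
  qed
  show ?thesis
    unfolding reconstruction_def
  proof (intro conjI allI impI)
    fix \<rho> :: real assume "0 < \<rho>"
    have sb: "sball x 2 \<subseteq> sball 0 (\<rho> + 2)" if "x \<in> sball 0 \<rho>" for x :: "real ^ 'd"
      using that by (intro sball_subset) (simp add: sball_def)
    show "continuous_linear_map r (D_space S \<gamma> p M) (D_norm S \<gamma> p M UNIV UNIV) (E_norm r \<alpha> p {-\<rho>..\<rho>} (sball 0 \<rho>)) (rec r M)"
    proof (rule CL[OF Pi_norm_finite[OF M bounded_cylinder[of "-\<rho> - 2" "\<rho> + 1" 0 "\<rho> + 2"]]])
      show "sball (0 :: real ^ 'd) \<rho> \<subseteq> sball 0 (\<rho> + 2)" by (intro sball_subset) (simp add: infnorm_0)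
      show "\<forall>x\<in>sball 0 \<rho>. sball x 2 \<subseteq> sball (0 :: real ^ 'd) (\<rho> + 2)" using sb by blast
    qed auto
  next
    assume "unif_bounded_model S r M"
    then have "Pi_norm S r (mPi M) (UNIV \<times> UNIV) < top" by (simp add: unif_bounded_model_def)
    then show "continuous_linear_map r (D_space S \<gamma> p M) (D_norm S \<gamma> p M UNIV UNIV) (E_norm r \<alpha> p UNIV UNIV) (rec r M)"
      by (rule CL) auto
  next
    show "\<exists>C. recon_bound S r \<gamma> p \<alpha> M (rec r M) C" using rec_bound[where 'd='d] M by blast
  qed
qed

text \<open>Over bounded sets of base points the constant in the reconstruction bound stays finite,
  by local boundedness of the model and the geometric sum over scales. This is the hypothesis of
  \<open>reconstruction_is_limit\<close>, whose limit involves the germ alone.\<close>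

lemma reconstruction_unique:
  fixes M :: "('d::finite, 't) model"
  assumes M: "is_model S r M" and R: "reconstruction S r \<gamma> p \<alpha> M R" and f: "f \<in> D_space S \<gamma> p M"
  shows "R f = rec r M f"
  unfolding rec_def
proof (rule reconstruction_is_limit[OF p \<gamma> germ_model[OF M f p]])
  have p0: "0 < p" using p by simp
  show "R f \<in> distributions r"
  proof -
    have "continuous_linear_map r (D_space S \<gamma> p M) (D_norm S \<gamma> p M UNIV UNIV) (E_norm r \<alpha> p {-1..1} (sball 0 1)) R"
      using R unfolding reconstruction_def by (meson zero_less_one)
    then show ?thesis using f unfolding continuous_linear_map_def by blast
  qed
  obtain C where C: "recon_bound S r \<gamma> p \<alpha> M R C" using R unfolding reconstruction_def by blast
  have e: "0 < min \<gamma> (r + \<alpha>)" using \<gamma> r by simp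
  define g where "g = 1 / (1 - (1 / 2 :: real) powr (min \<gamma> (r + \<alpha>)))"
  have "(1 / 2 :: real) powr (min \<gamma> (r + \<alpha>)) < 1" using powr_less_mono2[of "min \<gamma> (r + \<alpha>)" "1 / 2 :: real" 1] e by simp
  then have g: "0 \<le> g" by (simp add: g_def)
  fix \<rho> :: real
  \<comment> \<open>Contains all cylinders of the reconstruction bound for times up to \<rho> in
    modulus, centres of norm at most \<rho> and scales at most 1.\<close>
  define BB where "BB = {- \<rho> - 2..\<rho> + 1} \<times> sball (0 :: real ^ 'd) (\<rho> + 3)"
  define W where "W = Pi_norm S r (mPi M) BB * (1 + Gam_norm S (mGam M) BB) * D_norm S \<gamma> p M UNIV UNIV f"
  have bB: "bounded BB" unfolding BB_def by (rule bounded_cylinder)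
  have "Gam_norm S (mGam M) BB < top" using M bB by (simp add: is_model_def)
  then have "W < top" unfolding W_def
    using Pi_norm_finite[OF M bB] D_norm_finite[OF p0 f] by (simp add: ennreal_mult_less_top)
  then have W: "W = ennreal (enn2real W)" by simp
  show "\<exists>K. \<forall>t\<in>{-\<rho>..\<rho>}. \<forall>x0. infnorm x0 \<le> \<rho> \<longrightarrow> (\<forall>\<epsilon>\<in>{0<..1}.
      Lp p (sball x0 1) (\<lambda>x. SUP \<eta>\<in>Br r. ennreal \<bar>R f (rescale \<eta> \<epsilon> (t, x)) - mPi M (t, x) (f (t, x)) (rescale \<eta> \<epsilon> (t, x))\<bar>) \<le> ennreal (K * \<epsilon> powr \<gamma>))"
  \<comment> \<open>The constant C in \<open>recon_bound\<close> is an arbitrary real, possibly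
    negative.\<close>
  proof (intro exI[of _ "max C 0 * g * enn2real W"] ballI allI impI)
    fix t \<epsilon> and x0 :: "real ^ 'd" assume t: "t \<in> {-\<rho>..\<rho>}" and x0: "infnorm x0 \<le> \<rho>" and \<epsilon>: "\<epsilon> \<in> {0<..1::real}"
    have \<epsilon>2: "\<epsilon>\<^sup>2 \<le> 1" using \<epsilon> by (simp add: power_le_one)
    have "Lp p (sball x0 1) (\<lambda>x. SUP \<eta>\<in>Br r. ennreal \<bar>R f (rescale \<eta> \<epsilon> (t, x)) - mPi M (t, x) (f (t, x)) (rescale \<eta> \<epsilon> (t, x))\<bar>) \<le>
      ennreal (C * \<epsilon> powr \<gamma>) * recon_const S r \<gamma> p \<alpha> M f t x0 \<epsilon>"
      using C f \<epsilon> unfolding recon_bound_def by blast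
    also have "\<dots> \<le> ennreal (max C 0 * \<epsilon> powr \<gamma>) * (ennreal g * W)"
      unfolding recon_const_def g_def
    proof (intro mult_mono ennreal_leI scale_sum_le e)
      show "0 < \<epsilon>" using \<epsilon> by simp
      fix n :: nat
      let ?J = "{t - 2 * \<epsilon>\<^sup>2 .. t + \<epsilon>\<^sup>2 - (1 / 2) ^ (2 * n)}"
      have "0 \<le> (1 / 2 :: real) ^ (2 * n)" by simp
      moreover have "t \<le> \<rho>" "- \<rho> \<le> t" using t by auto
      ultimately have "t + \<epsilon>\<^sup>2 - (1 / 2) ^ (2 * n) \<le> \<rho> + 1" "- \<rho> - 2 \<le> t - 2 * \<epsilon>\<^sup>2" using \<epsilon>2 by linarith+
      then have "?J \<subseteq> {- \<rho> - 2..\<rho> + 1}" by auto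
      moreover have "sball x0 3 \<subseteq> sball 0 (\<rho> + 3)" using x0 by (intro sball_subset) simp
      ultimately have s: "?J \<times> sball x0 3 \<subseteq> BB" unfolding BB_def by blast
      have Dm: "D_norm S \<gamma> p M ?J (sball x0 3) f \<le> D_norm S \<gamma> p M UNIV UNIV f"
        unfolding D_norm_def by (rule D_expr_mono[OF p0]) auto
      show "Pi_norm S r (mPi M) (?J \<times> sball x0 3) * (1 + Gam_norm S (mGam M) (?J \<times> sball x0 3)) * D_norm S \<gamma> p M ?J (sball x0 3) f \<le> W"
        unfolding W_def by (intro mult_mono add_mono order_refl Pi_norm_mono Gam_norm_mono s Dm) auto
    qed auto
    also have "\<dots> = ennreal (max C 0 * g * enn2real W * \<epsilon> powr \<gamma>)"
      by (subst W) (use g in \<open>simp add: ennreal_mult[symmetric] mult_ac\<close>)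
    finally show "Lp p (sball x0 1) (\<lambda>x. SUP \<eta>\<in>Br r. ennreal \<bar>R f (rescale \<eta> \<epsilon> (t, x)) - mPi M (t, x) (f (t, x)) (rescale \<eta> \<epsilon> (t, x))\<bar>) \<le> ennreal (max C 0 * g * enn2real W * \<epsilon> powr \<gamma>)" .
  qed
qed

text \<open>Uniqueness turns a bound for \<open>rec\<close> into one for every reconstruction, so a
  constant can be fixed before the operators are given.\<close>

lemma recon_bound_rec:
  fixes M :: "('d::finite, 't) model"
  assumes "is_model S r M" "reconstruction S r \<gamma> p \<alpha> M R"
  shows "recon_bound S r \<gamma> p \<alpha> M R C \<longleftrightarrow> recon_bound S r \<gamma> p \<alpha> M (rec r M) C"
  unfolding recon_bound_def by (intro ball_cong refl) (simp only: reconstruction_unique[OF assms])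

lemma recon_diff_bound_rec:
  fixes M M' :: "('d::finite, 't) model"
  assumes "is_model S r M" "reconstruction S r \<gamma> p \<alpha> M R" "is_model S r M'" "reconstruction S r \<gamma> p \<alpha> M' R'"
  shows "recon_diff_bound S r \<gamma> p \<alpha> M M' R R' C \<longleftrightarrow> recon_diff_bound S r \<gamma> p \<alpha> M M' (rec r M) (rec r M') C"
  unfolding recon_diff_bound_def
  by (intro ball_cong refl) (simp only: reconstruction_unique[OF assms(1,2)] reconstruction_unique[OF assms(3,4)])

end

end

theorem theorem2p10:
  fixes S :: "'t::real_vector regstruct" and Y :: "('d::finite, 't) symbols"
    and \<gamma> p \<alpha> r :: real and P0 Pminus :: "'d func"
  assumes "regularity_structure S" and "symbols_of S Y"
    and "heat_kernel_decomposition r P0 Pminus"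
    and "0 < \<gamma>" and "1 \<le> p"
    and "\<alpha> \<in> levels S" and "\<forall>\<zeta>\<in>levels S. \<alpha> \<le> \<zeta>" and "\<alpha> < 0" and "\<bar>\<alpha>\<bar> < r"
  shows
    "(\<forall>M::('d, 't) model. is_model S r M \<longrightarrow>
        (\<exists>R. reconstruction S r \<gamma> p \<alpha> M R \<and>
          (\<forall>R'. reconstruction S r \<gamma> p \<alpha> M R' \<longrightarrow> (\<forall>f\<in>D_space S \<gamma> p M. R' f = R f)))) \<and>
     (\<exists>C. \<forall>(M::('d, 't) model) R.
        admissible S Y r P0 M \<and> reconstruction S r \<gamma> p \<alpha> M R \<longrightarrow> recon_bound S r \<gamma> p \<alpha> M R C) \<and>
     (\<forall>(M::('d, 't) model) M' R R'.
        is_model S r M \<and> is_model S r M' \<and>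
        reconstruction S r \<gamma> p \<alpha> M R \<and> reconstruction S r \<gamma> p \<alpha> M' R' \<longrightarrow>
        (\<exists>C. recon_diff_bound S r \<gamma> p \<alpha> M M' R R' C)) \<and>
     (\<exists>C. \<forall>(M::('d, 't) model) M' R R'.
        admissible S Y r P0 M \<and> admissible S Y r P0 M' \<and>
        reconstruction S r \<gamma> p \<alpha> M R \<and> reconstruction S r \<gamma> p \<alpha> M' R' \<longrightarrow>
        recon_diff_bound S r \<gamma> p \<alpha> M M' R R' C)"
proof -
  interpret reg_structure S by unfold_locales (rule assms(1))
  have lev: "\<alpha> \<le> \<zeta>" if "\<zeta> \<in> levels S" for \<zeta> using assms(7) that by blast
  have r: "0 < r + \<alpha>" using assms(8,9) by linarith
  note context_assms = assms(4,5) lev assms(8) r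
  obtain C where C: "\<And>M :: ('d, 't) model. is_model S r M \<Longrightarrow> recon_bound S r \<gamma> p \<alpha> M (rec r M) C"
    using rec_bound[OF context_assms, where 'd='d] by blast
  obtain C' where C': "\<And>M M' :: ('d, 't) model. is_model S r M \<Longrightarrow> is_model S r M' \<Longrightarrow> recon_diff_bound S r \<gamma> p \<alpha> M M' (rec r M) (rec r M') C'"
    using rec_diff_bound[OF context_assms, where 'd='d] by blast
  have am: "is_model S r M" if "admissible S Y r P0 M" for M :: "('d, 't) model"
    using that by (simp add: admissible_def)
  show ?thesis
  proof (intro conjI)
    show "\<forall>M::('d, 't) model. is_model S r M \<longrightarrow>
        (\<exists>R. reconstruction S r \<gamma> p \<alpha> M R \<and>
          (\<forall>R'. reconstruction S r \<gamma> p \<alpha> M R' \<longrightarrow> (\<forall>f\<in>D_space S \<gamma> p M. R' f = R f)))"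
      using rec_reconstruction[OF context_assms] reconstruction_unique[OF context_assms] by blast
    show "\<exists>C. \<forall>(M::('d, 't) model) R.
        admissible S Y r P0 M \<and> reconstruction S r \<gamma> p \<alpha> M R \<longrightarrow> recon_bound S r \<gamma> p \<alpha> M R C"
      using C am recon_bound_rec[OF context_assms] by blast
    show "\<forall>(M::('d, 't) model) M' R R'.
        is_model S r M \<and> is_model S r M' \<and>
        reconstruction S r \<gamma> p \<alpha> M R \<and> reconstruction S r \<gamma> p \<alpha> M' R' \<longrightarrow>
        (\<exists>C. recon_diff_bound S r \<gamma> p \<alpha> M M' R R' C)"
      using C' recon_diff_bound_rec[OF context_assms] by blast
    show "\<exists>C. \<forall>(M::('d, 't) model) M' R R'.
        admissible S Y r P0 M \<and> admissible S Y r P0 M' \<and>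
        reconstruction S r \<gamma> p \<alpha> M R \<and> reconstruction S r \<gamma> p \<alpha> M' R' \<longrightarrow>
        recon_diff_bound S r \<gamma> p \<alpha> M M' R R' C"
      using C' am recon_diff_bound_rec[OF context_assms] by blast
  qed
qed

end
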